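(* Let $C_{M,*},C_M^*>0$ be constants, independent of $h$, such that $|M_h(v_h,w_h)|\le C_M^*\|v_h\|_{0,\Omega}\|w_h\|_{0,\Omega}$ and $M_h(v_h,v_h)\ge C_{M,*}\|v_h\|_{0,\Omega}^2$ for all $v_h,w_h\in V_k^h$, and let $\widehat M:=\max\{C_{M,*},(C_M^* )^2C_{M,*}^{-1}\}$. Assume that $$\Delta t<(2L_f)^{-1}\min\{\widehat M,C_{M,*}\},$$ where $L_f$ is the Lipschitz constant of $f$, and that $u_h^j\in V_k^h$, $j=0,1,\dots,n-1$, are given. Then there exists a unique solution $u_h^n\in V_k^h$ of the fully discrete problem $$M_h\Big(\frac{u_h^n-u_h^{n-1}}{\Delta t},v_h\Big)+\alpha_1A_h(u_h^n,v_h)+\alpha_2B_h(u_h^n,v_h)=F_h(u_h^n;v_h)\qquad\forall v_h\in V_k^h .$$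
   Context: **Domain and boundary conditions.** $\Omega\subset\mathbb R^2$ is a polygonal domain (not necessarily convex) with boundary $\Gamma$ and outward unit normal $\boldsymbol n$; $\partial_{\boldsymbol n}v=\nabla v\cdot\boldsymbol n$; $\alpha_1,\alpha_2>0$ are constants; $f:\mathbb R\to\mathbb R$ satisfies $|f(x)-f(y)|\le L_f|x-y|$ for all $x,y$, with $L_f>0$. $(\cdot,\cdot)_D$ is the $L^2(D)$ inner product and $|\cdot|_{s,D},\|\cdot\|_{s,D}$ are the $H^s(D)$ seminorm and norm. One of three types of boundary conditions is fixed: CP (clamped), NC (Navier), CH (Cahn--Hilliard). **Mesh.** $\{\Omega_h\}_h$ are decompositions of $\Omega$ into non-overlapping simple polygons $K$ with diameter $h_K$; $h=\max_K h_K$; $h_e$ is the length of an edge $e$ and $\boldsymbol n_e$ a unit normal to it. $\mathcal E_h^{\rm int}$, $\mathcal E_h^{\rm tot}$ are the sets of interior and of all edges. $\mathbb P_\ell(D)$ denotes polynomials of degree $\le\ell$ on $D$ ($\{0\}$ if $\ell<0$). $H^2(\Omega_h)=\{v\in L^2(\Omega):v|_K\in H^2(K)\ \forall K\}$; $|v|_{\ell,h}^2=\sum_K|v|_{\ell,K}^2$; $[\![v]\!]$ is the jump across an interior edge and the trace on a boundary edge. **Discrete space.** Fix $k\ge2$. $\mathcal H^0(\Omega_h)$ is the set of $v_h\in H^2(\Omega_h)$ continuous at all interior vertices and vanishing at all boundary vertices (CP, NC), or continuous at all vertices (CH). $H_k^{2,\rm nc}(\Omega_h)$ is the set of $v_h\in\mathcal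 H^0(\Omega_h)$ such that $([\![v_h]\!],p)_e=0$ for all $p\in\mathbb P_{k-3}(e)$ and all $e\in\mathcal E_h^{\rm tot}$ (CP, NC) or $e\in\mathcal E_h^{\rm int}$ (CH), and $([\![\partial_{\boldsymbol n_e}v_h]\!],q)_e=0$ for all $q\in\mathbb P_{k-2}(e)$ and all $e\in\mathcal E_h^{\rm tot}$ (CP, CH) or $e\in\mathcal E_h^{\rm int}$ (NC). For each $K$ a finite-dimensional local space $V_k^h(K)\subset H^2(K)$ with $\mathbb P_k(K)\subset V_k^h(K)$ is given, and $V_k^h=\{v_h\in H_k^{2,\rm nc}(\Omega_h):v_h|_K\in V_k^h(K)\ \forall K\}$. The following local degrees of freedom $\mathrm{dof}_i$, $1\le i\le d_k=\dim V_k^h(K)$, are unisolvent on $V_k^h(K)$: vertex values; $h_e^{-1+i}(\partial_{\boldsymbol n_e}^iv_h,p)_e$ for scaled monomials $p$ of degree $\le d_i^e$ on each edge, $i=0,1$; $h_K^{-2}(v_h,p)_K$ for scaled monomials $p$ of degree $\le d_0^K$; here $d_0^e,d_1^e\ge k-3$, $d_0^K\ge k-4$ are fixed integers. **Projections.** $\Pi_K^k:L^2(K)\to\mathbb P_k(K)$ and $\boldsymbol\Pi_K^{k-1}:L^2(K)^2\to\mathbb P_{k-1}(K)^2$ are the $L^2$-projections. $\Pi_K^{k,\nabla}v\in\mathbb P_k(K)$: $(\nabla(v-\Pi_K^{k,\nabla}v),\nabla p)_K=0$ for all $p\in\mathbb P_k(K)$ and $(v-\Pi_K^{k,\nabla}v,1)_{\partial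 K}=0$. $\Pi_K^{k,\nabla^2}v\in\mathbb P_k(K)$: $(\nabla^2(v-\Pi_K^{k,\nabla^2}v),\nabla^2p)_K=0$ for all $p\in\mathbb P_k(K)$, with $v-\Pi_K^{k,\nabla^2}v$ and $\nabla(v-\Pi_K^{k,\nabla^2}v)$ of zero mean on $\partial K$. On $V_k^h(K)$ the polynomials $\Pi_K^kv_h,\boldsymbol\Pi_K^{k-1}\nabla v_h,\Pi_K^{k,\nabla}v_h,\Pi_K^{k,\nabla^2}v_h$ are computable from the degrees of freedom. **Discrete forms.** $M_h=\sum_KM_h^K$, $A_h=\sum_KA_h^K$, $B_h=\sum_KB_h^K$, with $M_h^K(v,w)=(\Pi_K^kv,\Pi_K^kw)_K+S_0^K((I-\Pi_K^k)v,(I-\Pi_K^k)w)$, $A_h^K(v,w)=(\nabla^2\Pi_K^{k,\nabla^2}v,\nabla^2\Pi_K^{k,\nabla^2}w)_K+S_{\nabla^2}^K((I-\Pi_K^{k,\nabla^2})v,(I-\Pi_K^{k,\nabla^2})w)$, $B_h^K(v,w)=(\boldsymbol\Pi_K^{k-1}\nabla v,\boldsymbol\Pi_K^{k-1}\nabla w)_K+S_\nabla^K((I-\Pi_K^{k,\nabla})v,(I-\Pi_K^{k,\nabla})w)$. With $S^K(v,w)=\sum_i\mathrm{dof}_i(v)\mathrm{dof}_i(w)$, one takes $S_0^K=h_K^2S^K$, $S_\nabla^K=S^K$, $S_{\nabla^2}^K=h_K^{-2}S^K$; these are assumed equivalent, uniformly in $K$ and $h$, to $\|v\|_{0,K}^2$,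 $|v|_{1,K}^2$, $|v|_{2,K}^2$ on the kernels in $V_k^h(K)$ of $\Pi_K^k,\Pi_K^{k,\nabla},\Pi_K^{k,\nabla^2}$, respectively. Consequently (assumed) $M_h^K,A_h^K,B_h^K$ coincide with $(\cdot,\cdot)_K$, $(\nabla^2\cdot,\nabla^2\cdot)_K$, $(\nabla\cdot,\nabla\cdot)_K$ when one argument lies in $\mathbb P_k(K)$, and their quadratic forms on $V_k^h(K)$ are equivalent to $\|\cdot\|_{0,K}^2,|\cdot|_{2,K}^2,|\cdot|_{1,K}^2$ uniformly in $K$ and $h$. Finally $F_h(v_h;w_h)=\sum_K(\Pi_K^kf(\Pi_K^kv_h),w_h)_K$. **Time discretization.** $\Delta t=T/N$, $t_n=n\Delta t$, $n=0,\dots,N$; $u_h^0\in V_k^h$ is given. *)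

theory Defs
  imports "HOL-Analysis.Analysis"
begin

type_synonym pt = "real^2"
type_synonym fld = "pt \<Rightarrow> real"
type_synonym edge = "pt \<times> pt"

section \<open>Domain, polygons and meshes\<close>

text \<open>Holes are allowed; the condition \<open>\<Omega> = interior (closure \<Omega>)\<close> excludes slits.\<close>

definition polygonal_domain :: "pt set \<Rightarrow> bool" where
  "polygonal_domain \<Omega> \<longleftrightarrow> open \<Omega> \<and> connected \<Omega> \<and> bounded \<Omega> \<and> \<Omega> \<noteq> {} \<and>
     interior (closure \<Omega>) = \<Omega> \<and>
     (\<exists>S. finite S \<and> frontier \<Omega> = (\<Union>(a, b)\<in>S. closed_segment a b))"

text \<open>A polygon is given by the cyclic list of its vertices. Consecutive edges may be
  collinear, so that hanging nodes are ordinary vertices.\<close>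

type_synonym polygon = "pt list"

fun poly_path :: "pt list \<Rightarrow> real \<Rightarrow> pt" where
  "poly_path [] = linepath 0 0"
| "poly_path [a] = linepath a a"
| "poly_path [a, b] = linepath a b"
| "poly_path (a # b # c # xs) = linepath a b +++ poly_path (b # c # xs)"

definition bdry_path :: "polygon \<Rightarrow> real \<Rightarrow> pt" where
  "bdry_path K = poly_path (K @ [hd K])"

definition simple_polygon :: "polygon \<Rightarrow> bool" where
  "simple_polygon K \<longleftrightarrow> 3 \<le> length K \<and> simple_path (bdry_path K)"

text \<open>The open region enclosed by the polygon.\<close>

definition cell :: "polygon \<Rightarrow> pt set" where
  "cell K = inside (path_image (bdry_path K))"

definition cell_edges :: "polygon \<Rightarrow> edge set" where
  "cell_edges K = {(K ! i, K ! (Suc i mod length K)) | i. i < length K}"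

text \<open>Edges are oriented pairs in \<^const>\<open>cell_edges\<close>; neighbouring cells may list a common
  edge with opposite orientations.\<close>

definition has_edge :: "polygon \<Rightarrow> edge \<Rightarrow> bool" where
  "has_edge K e \<longleftrightarrow> e \<in> cell_edges K \<or> prod.swap e \<in> cell_edges K"

definition seg :: "edge \<Rightarrow> pt set" where
  "seg e = closed_segment (fst e) (snd e)"

definition edge_len :: "edge \<Rightarrow> real" where
  "edge_len e = dist (fst e) (snd e)"

definition edge_normal :: "edge \<Rightarrow> pt" where
  "edge_normal e = (let t = snd e - fst e in (1 / edge_len e) *\<^sub>R vector [t $ 2, - (t $ 1)])"

text \<open>The last condition makes the edges those of the decomposition: two of them
  coincide or meet at most in common end points.\<close>

definition decomposition :: "pt set \<Rightarrow> polygon set \<Rightarrow> bool" where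
  "decomposition \<Omega> T \<longleftrightarrow> finite T \<and> (\<forall>K\<in>T. simple_polygon K) \<and>
     (\<forall>K\<in>T. \<forall>K'\<in>T. K \<noteq> K' \<longrightarrow> cell K \<inter> cell K' = {}) \<and>
     (\<Union>K\<in>T. closure (cell K)) = closure \<Omega> \<and>
     (\<forall>K\<in>T. \<forall>K'\<in>T. \<forall>e\<in>cell_edges K. \<forall>e'\<in>cell_edges K'.
        seg e = seg e' \<or> seg e \<inter> seg e' \<subseteq> {fst e, snd e} \<inter> {fst e', snd e'})"

definition mesh_size :: "polygon set \<Rightarrow> real" where
  "mesh_size T = Max ((\<lambda>K. diameter (cell K)) ` T)"

definition mesh_verts :: "polygon set \<Rightarrow> pt set" where
  "mesh_verts T = (\<Union>K\<in>T. set K)"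

definition all_edges :: "polygon set \<Rightarrow> edge set" where
  "all_edges T = (\<Union>K\<in>T. cell_edges K)"

definition int_edges :: "pt set \<Rightarrow> polygon set \<Rightarrow> edge set" where
  "int_edges \<Omega> T = {e \<in> all_edges T. open_segment (fst e) (snd e) \<subseteq> \<Omega>}"


section \<open>\<open>L\<^sup>2\<close> and Sobolev spaces\<close>

text \<open>Functions on \<open>D\<close> are represented by functions on the plane whose values outside
  \<open>D\<close> are irrelevant, and are identified if they agree almost everywhere on \<open>D\<close>.\<close>

definition L2 :: "pt set \<Rightarrow> fld set" where
  "L2 D = {v \<in> borel_measurable (lebesgue_on D). integrable (lebesgue_on D) (\<lambda>x. (v x)\<^sup>2)}"

text \<open>Also used for vector fields and for matrix fields, where \<open>\<bullet>\<close> is the Frobenius product.\<close>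

definition ip :: "pt set \<Rightarrow> (pt \<Rightarrow> 'a::euclidean_space) \<Rightarrow> (pt \<Rightarrow> 'a) \<Rightarrow> real" where
  "ip D v w = (LINT x|lebesgue_on D. v x \<bullet> w x)"

definition L2norm :: "pt set \<Rightarrow> (pt \<Rightarrow> 'a::euclidean_space) \<Rightarrow> real" where
  "L2norm D v = sqrt (ip D v v)"

definition L2_conv :: "pt set \<Rightarrow> (nat \<Rightarrow> fld) \<Rightarrow> fld \<Rightarrow> bool" where
  "L2_conv D f g \<longleftrightarrow> g \<in> L2 D \<and> (\<forall>n. f n \<in> L2 D) \<and>
     (\<lambda>n. L2norm D (\<lambda>x. f n x - g x)) \<longlonglongrightarrow> 0"

text \<open>\<open>J 0 0\<close> is an infinitely differentiable function on the plane and
  \<open>J i j = \<partial>\<^sub>1\<^sup>i \<partial>\<^sub>2\<^sup>j (J 0 0)\<close>.\<close>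

definition smooth_jet :: "(nat \<Rightarrow> nat \<Rightarrow> fld) \<Rightarrow> bool" where
  "smooth_jet J \<longleftrightarrow> (\<forall>i j x. (J i j has_derivative
     (\<lambda>d. J (Suc i) j x * d $ 1 + J i (Suc j) x * d $ 2)) (at x))"

text \<open>\<open>H\<^sup>m(D)\<close> is the completion of the functions that are smooth up to the boundary, in the
  \<open>H\<^sup>m\<close> norm, realised in \<open>L\<^sup>2(D)\<close>. It is used only for simple polygons \<open>D\<close>; these are Lipschitz
  domains, on which it is the space of functions with weak derivatives up to order
  \<open>m\<close> in \<open>L\<^sup>2(D)\<close>. \<open>W i j\<close> is the derivative \<open>\<partial>\<^sub>1\<^sup>i \<partial>\<^sub>2\<^sup>j v\<close>.\<close>

definition has_sob_derivs :: "nat \<Rightarrow> pt set \<Rightarrow> fld \<Rightarrow> (nat \<Rightarrow> nat \<Rightarrow> fld) \<Rightarrow> bool" where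
  "has_sob_derivs m D v W \<longleftrightarrow> W 0 0 = v \<and>
     (\<exists>J. (\<forall>n. smooth_jet (J n)) \<and>
          (\<forall>i j. i + j \<le> m \<longrightarrow> L2_conv D (\<lambda>n. J n i j) (W i j)))"

definition sobolev :: "nat \<Rightarrow> pt set \<Rightarrow> fld set" where
  "sobolev m D = {v. \<exists>W. has_sob_derivs m D v W}"

text \<open>Determined up to null sets.\<close>

definition pd :: "pt set \<Rightarrow> nat \<Rightarrow> nat \<Rightarrow> fld \<Rightarrow> fld" where
  "pd D i j v = (SOME w. \<exists>W. has_sob_derivs (i + j) D v W \<and> W i j = w)"

definition grad :: "pt set \<Rightarrow> fld \<Rightarrow> pt \<Rightarrow> real^2" where
  "grad D v x = vector [pd D 1 0 v x, pd D 0 1 v x]"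

definition hess :: "pt set \<Rightarrow> fld \<Rightarrow> pt \<Rightarrow> real^2^2" where
  "hess D v x = vector [vector [pd D 2 0 v x, pd D 1 1 v x],
                        vector [pd D 1 1 v x, pd D 0 2 v x]]"

definition sob_conv :: "nat \<Rightarrow> pt set \<Rightarrow> (nat \<Rightarrow> nat \<Rightarrow> nat \<Rightarrow> fld) \<Rightarrow> fld \<Rightarrow> bool" where
  "sob_conv m D J v \<longleftrightarrow> (\<forall>n. smooth_jet (J n)) \<and>
     (\<forall>i j. i + j \<le> m \<longrightarrow> L2_conv D (\<lambda>n. J n i j) (pd D i j v))"


section \<open>Edge integrals and traces\<close>

definition edge_int :: "edge \<Rightarrow> fld \<Rightarrow> real" where
  "edge_int e g = edge_len e * (LINT t|lebesgue_on {0..1}. g (linepath (fst e) (snd e) t))"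

definition L2_edge :: "edge \<Rightarrow> fld set" where
  "L2_edge e = {g. (\<lambda>t. g (linepath (fst e) (snd e) t)) \<in> borel_measurable (lebesgue_on {0..1}) \<and>
     integrable (lebesgue_on {0..1}) (\<lambda>t. (g (linepath (fst e) (snd e) t))\<^sup>2)}"

text \<open>The trace on an edge of \<open>D\<close> is the extension by density to \<open>H\<^sup>1(D)\<close>, with values in
  \<open>L\<^sup>2(e)\<close>, of the restriction of smooth functions.\<close>

definition is_trace :: "pt set \<Rightarrow> edge \<Rightarrow> fld \<Rightarrow> fld \<Rightarrow> bool" where
  "is_trace D e w g \<longleftrightarrow> g \<in> L2_edge e \<and>
     (\<exists>J. sob_conv 1 D J w \<and> (\<lambda>n. edge_int e (\<lambda>x. (J n 0 0 x - g x)\<^sup>2)) \<longlonglongrightarrow> 0)"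

definition edge_trace :: "pt set \<Rightarrow> edge \<Rightarrow> fld \<Rightarrow> fld" where
  "edge_trace D e w = (SOME g. is_trace D e w g)"

text \<open>\<open>\<partial>\<^sub>n v\<close> on \<open>e\<close> for \<open>v \<in> H\<^sup>2(D)\<close>; the normal is that of \<open>e\<close>, not the outward normal of \<open>D\<close>.\<close>

definition ntrace :: "pt set \<Rightarrow> edge \<Rightarrow> fld \<Rightarrow> fld" where
  "ntrace D e v x = edge_normal e $ 1 * edge_trace D e (pd D 1 0 v) x
                  + edge_normal e $ 2 * edge_trace D e (pd D 0 1 v) x"

text \<open>Point values of \<open>v \<in> H\<^sup>2(D)\<close> at points of the closure of \<open>D\<close>: the extension by density
  of the point values of smooth functions, i.e. the value of the continuous representative
  (Sobolev embedding in two dimensions).\<close>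

definition pval :: "pt set \<Rightarrow> pt \<Rightarrow> fld \<Rightarrow> real" where
  "pval D z v = (THE c. \<exists>J. sob_conv 2 D J v \<and> (\<lambda>n. J n 0 0 z) \<longlonglongrightarrow> c)"

definition bdry_int_trace :: "polygon \<Rightarrow> fld \<Rightarrow> real" where
  "bdry_int_trace K w = (\<Sum>e\<in>cell_edges K. edge_int e (edge_trace (cell K) e w))"


section \<open>Polynomials and projections\<close>

text \<open>Polynomials of total degree at most \<open>l\<close>. Restricted to an edge, they are the
  polynomials of degree at most \<open>l\<close> on that edge.\<close>

definition polys :: "int \<Rightarrow> fld set" where
  "polys l = {p. \<exists>c :: nat \<Rightarrow> nat \<Rightarrow> real.
     \<forall>x. p x = (\<Sum>(i, j) | int (i + j) \<le> l. c i j * x $ 1 ^ i * x $ 2 ^ j)}"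

definition vpolys :: "int \<Rightarrow> (pt \<Rightarrow> real^2) set" where
  "vpolys l = {P. \<forall>i. (\<lambda>x. P x $ i) \<in> polys l}"

definition Pi0 :: "polygon \<Rightarrow> nat \<Rightarrow> fld \<Rightarrow> fld" where
  "Pi0 K k v = (THE p. p \<in> polys (int k) \<and>
     (\<forall>q\<in>polys (int k). ip (cell K) (\<lambda>x. v x - p x) q = 0))"

text \<open>The projection onto vector polynomials of degree at most \<open>k - 1\<close>.\<close>

definition Pi0vec :: "polygon \<Rightarrow> nat \<Rightarrow> (pt \<Rightarrow> real^2) \<Rightarrow> pt \<Rightarrow> real^2" where
  "Pi0vec K k F = (THE P. P \<in> vpolys (int k - 1) \<and>
     (\<forall>Q\<in>vpolys (int k - 1). ip (cell K) (\<lambda>x. F x - P x) Q = 0))"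

definition Pi1 :: "polygon \<Rightarrow> nat \<Rightarrow> fld \<Rightarrow> fld" where
  "Pi1 K k v = (THE p. p \<in> polys (int k) \<and>
     (\<forall>q\<in>polys (int k). ip (cell K) (grad (cell K) (\<lambda>x. v x - p x)) (grad (cell K) q) = 0) \<and>
     bdry_int_trace K (\<lambda>x. v x - p x) = 0)"

definition Pi2 :: "polygon \<Rightarrow> nat \<Rightarrow> fld \<Rightarrow> fld" where
  "Pi2 K k v = (THE p. p \<in> polys (int k) \<and>
     (\<forall>q\<in>polys (int k). ip (cell K) (hess (cell K) (\<lambda>x. v x - p x)) (hess (cell K) q) = 0) \<and>
     bdry_int_trace K (\<lambda>x. v x - p x) = 0 \<and>
     bdry_int_trace K (pd (cell K) 1 0 (\<lambda>x. v x - p x)) = 0 \<and>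
     bdry_int_trace K (pd (cell K) 0 1 (\<lambda>x. v x - p x)) = 0)"


section \<open>The nonconforming space\<close>

datatype bc = CP | NC | CH

text \<open>\<open>tr K e\<close> is a one-sided trace on \<open>e\<close> from the cell \<open>K\<close>. The sign of the jump across
  an interior edge depends on an arbitrary but fixed order of the two cells.\<close>

definition jump :: "polygon set \<Rightarrow> (polygon \<Rightarrow> edge \<Rightarrow> fld) \<Rightarrow> edge \<Rightarrow> fld" where
  "jump T tr e =
     (let K = (SOME K. K \<in> T \<and> has_edge K e) in
      if \<exists>K'\<in>T. K' \<noteq> K \<and> has_edge K' e
      then (let K' = (SOME K'. K' \<in> T \<and> K' \<noteq> K \<and> has_edge K' e) in (\<lambda>x. tr K e x - tr K' e x))
      else tr K e)"

definition H0_space :: "pt set \<Rightarrow> polygon set \<Rightarrow> bc \<Rightarrow> fld set" where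
  "H0_space \<Omega> T b = {v \<in> L2 \<Omega>.
     (\<forall>K\<in>T. v \<in> sobolev 2 (cell K)) \<and>
     (\<forall>z\<in>(if b = CH then mesh_verts T else mesh_verts T \<inter> \<Omega>).
        \<forall>K\<in>T. \<forall>K'\<in>T. z \<in> set K \<and> z \<in> set K' \<longrightarrow> pval (cell K) z v = pval (cell K') z v) \<and>
     (b \<noteq> CH \<longrightarrow>
        (\<forall>z\<in>mesh_verts T \<inter> frontier \<Omega>. \<forall>K\<in>T. z \<in> set K \<longrightarrow> pval (cell K) z v = 0))}"

definition H2nc :: "pt set \<Rightarrow> polygon set \<Rightarrow> bc \<Rightarrow> nat \<Rightarrow> fld set" where
  "H2nc \<Omega> T b k = {v \<in> H0_space \<Omega> T b.
     (\<forall>e\<in>(if b = CH then int_edges \<Omega> T else all_edges T). \<forall>p\<in>polys (int k - 3).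
        edge_int e (\<lambda>x. jump T (\<lambda>K e. edge_trace (cell K) e v) e x * p x) = 0) \<and>
     (\<forall>e\<in>(if b = NC then int_edges \<Omega> T else all_edges T). \<forall>q\<in>polys (int k - 2).
        edge_int e (\<lambda>x. jump T (\<lambda>K e. ntrace (cell K) e v) e x * q x) = 0)}"

definition vem_space ::
  "pt set \<Rightarrow> polygon set \<Rightarrow> bc \<Rightarrow> nat \<Rightarrow> (polygon \<Rightarrow> fld set) \<Rightarrow> fld set" where
  "vem_space \<Omega> T b k V = {v \<in> H2nc \<Omega> T b k. \<forall>K\<in>T. v \<in> V K}"


section \<open>Local degrees of freedom and local spaces\<close>

text \<open>The degrees \<open>d\<^sub>0\<^sup>e\<close>, \<open>d\<^sub>1\<^sup>e\<close>, \<open>d\<^sub>0\<^sup>K\<close>, possibly negative.\<close>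

record dof_degrees =
  deg_edge0 :: int
  deg_edge1 :: int
  deg_cell :: int

datatype dof_index = Vertex pt | Edge0 edge nat | Edge1 edge nat | Moment nat nat

definition dof_set :: "dof_degrees \<Rightarrow> polygon \<Rightarrow> dof_index set" where
  "dof_set d K = Vertex ` set K
     \<union> {Edge0 e r | e r. e \<in> cell_edges K \<and> int r \<le> deg_edge0 d}
     \<union> {Edge1 e r | e r. e \<in> cell_edges K \<and> int r \<le> deg_edge1 d}
     \<union> {Moment i j | i j. int (i + j) \<le> deg_cell d}"

definition edge_mono :: "edge \<Rightarrow> nat \<Rightarrow> fld" where
  "edge_mono e r x =
     (((x - midpoint (fst e) (snd e)) \<bullet> ((1 / edge_len e) *\<^sub>R (snd e - fst e))) / edge_len e) ^ r"

definition centroid :: "polygon \<Rightarrow> pt" where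
  "centroid K = (1 / measure lebesgue (cell K)) *\<^sub>R (LINT x|lebesgue_on (cell K). x)"

definition cell_mono :: "polygon \<Rightarrow> nat \<Rightarrow> nat \<Rightarrow> fld" where
  "cell_mono K i j x = ((x - centroid K) $ 1 / diameter (cell K)) ^ i
                     * ((x - centroid K) $ 2 / diameter (cell K)) ^ j"

fun dof :: "polygon \<Rightarrow> dof_index \<Rightarrow> fld \<Rightarrow> real" where
  "dof K (Vertex z) v = pval (cell K) z v"
| "dof K (Edge0 e r) v =
     edge_len e powi (-1) * edge_int e (\<lambda>x. edge_trace (cell K) e v x * edge_mono e r x)"
| "dof K (Edge1 e r) v =
     edge_len e powi (-1 + 1) * edge_int e (\<lambda>x. ntrace (cell K) e v x * edge_mono e r x)"
| "dof K (Moment i j) v = diameter (cell K) powi (-2) * ip (cell K) v (cell_mono K i j)"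

text \<open>Elements of \<open>V\<close> stand for classes of functions on \<open>K\<close>, whence the closure of
  \<open>V\<close> under equality almost everywhere. Unisolvence: the degrees of freedom of
  \<open>v \<in> V\<close> can be prescribed arbitrarily and determine the class of \<open>v\<close>.\<close>

definition local_space :: "nat \<Rightarrow> dof_degrees \<Rightarrow> polygon \<Rightarrow> fld set \<Rightarrow> bool" where
  "local_space k d K V \<longleftrightarrow>
     V \<subseteq> sobolev 2 (cell K) \<and> polys (int k) \<subseteq> V \<and>
     (\<forall>v\<in>V. \<forall>w\<in>V. (\<lambda>x. v x + w x) \<in> V) \<and>
     (\<forall>v\<in>V. \<forall>a. (\<lambda>x. a * v x) \<in> V) \<and>
     (\<forall>v\<in>V. \<forall>w. (AE x in lebesgue_on (cell K). w x = v x) \<longrightarrow> w \<in> V) \<and>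
     (\<exists>B. finite B \<and> B \<subseteq> V \<and>
        (\<forall>v\<in>V. \<exists>c. AE x in lebesgue_on (cell K). v x = (\<Sum>b\<in>B. c b * b x))) \<and>
     (\<forall>y. \<exists>v\<in>V. \<forall>i\<in>dof_set d K. dof K i v = y i) \<and>
     (\<forall>v\<in>V. \<forall>w\<in>V. (\<forall>i\<in>dof_set d K. dof K i v = dof K i w) \<longrightarrow>
        (AE x in lebesgue_on (cell K). v x = w x))"


section \<open>Discrete forms\<close>

definition SK :: "dof_degrees \<Rightarrow> polygon \<Rightarrow> fld \<Rightarrow> fld \<Rightarrow> real" where
  "SK d K v w = (\<Sum>i\<in>dof_set d K. dof K i v * dof K i w)"

definition S0 :: "dof_degrees \<Rightarrow> polygon \<Rightarrow> fld \<Rightarrow> fld \<Rightarrow> real" where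
  "S0 d K v w = (diameter (cell K))\<^sup>2 * SK d K v w"

definition S1 :: "dof_degrees \<Rightarrow> polygon \<Rightarrow> fld \<Rightarrow> fld \<Rightarrow> real" where
  "S1 d K v w = SK d K v w"

definition S2 :: "dof_degrees \<Rightarrow> polygon \<Rightarrow> fld \<Rightarrow> fld \<Rightarrow> real" where
  "S2 d K v w = diameter (cell K) powi (-2) * SK d K v w"

definition MK :: "nat \<Rightarrow> dof_degrees \<Rightarrow> polygon \<Rightarrow> fld \<Rightarrow> fld \<Rightarrow> real" where
  "MK k d K v w = ip (cell K) (Pi0 K k v) (Pi0 K k w)
     + S0 d K (\<lambda>x. v x - Pi0 K k v x) (\<lambda>x. w x - Pi0 K k w x)"

definition AK :: "nat \<Rightarrow> dof_degrees \<Rightarrow> polygon \<Rightarrow> fld \<Rightarrow> fld \<Rightarrow> real" where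
  "AK k d K v w = ip (cell K) (hess (cell K) (Pi2 K k v)) (hess (cell K) (Pi2 K k w))
     + S2 d K (\<lambda>x. v x - Pi2 K k v x) (\<lambda>x. w x - Pi2 K k w x)"

definition BK :: "nat \<Rightarrow> dof_degrees \<Rightarrow> polygon \<Rightarrow> fld \<Rightarrow> fld \<Rightarrow> real" where
  "BK k d K v w =
     ip (cell K) (Pi0vec K k (grad (cell K) v)) (Pi0vec K k (grad (cell K) w))
     + S1 d K (\<lambda>x. v x - Pi1 K k v x) (\<lambda>x. w x - Pi1 K k w x)"

definition Mh :: "nat \<Rightarrow> dof_degrees \<Rightarrow> polygon set \<Rightarrow> fld \<Rightarrow> fld \<Rightarrow> real" where
  "Mh k d T v w = (\<Sum>K\<in>T. MK k d K v w)"

definition Ah :: "nat \<Rightarrow> dof_degrees \<Rightarrow> polygon set \<Rightarrow> fld \<Rightarrow> fld \<Rightarrow> real" where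
  "Ah k d T v w = (\<Sum>K\<in>T. AK k d K v w)"

definition Bh :: "nat \<Rightarrow> dof_degrees \<Rightarrow> polygon set \<Rightarrow> fld \<Rightarrow> fld \<Rightarrow> real" where
  "Bh k d T v w = (\<Sum>K\<in>T. BK k d K v w)"

definition Fh :: "nat \<Rightarrow> (real \<Rightarrow> real) \<Rightarrow> polygon set \<Rightarrow> fld \<Rightarrow> fld \<Rightarrow> real" where
  "Fh k f T v w = (\<Sum>K\<in>T. ip (cell K) (Pi0 K k (\<lambda>x. f (Pi0 K k v x))) w)"

text \<open>\<open>a\<close> and \<open>b\<close> are equivalent on the sets \<open>W h K\<close>, uniformly in \<open>h\<close> and \<open>K\<close>.\<close>

definition unif_equiv ::
  "real set \<Rightarrow> (real \<Rightarrow> polygon set) \<Rightarrow> (real \<Rightarrow> polygon \<Rightarrow> fld set) \<Rightarrow>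
   (polygon \<Rightarrow> fld \<Rightarrow> real) \<Rightarrow> (polygon \<Rightarrow> fld \<Rightarrow> real) \<Rightarrow> bool" where
  "unif_equiv H T W a b \<longleftrightarrow> (\<exists>c>0. \<exists>C>0. \<forall>h\<in>H. \<forall>K\<in>T h. \<forall>v\<in>W h K.
     c * b K v \<le> a K v \<and> a K v \<le> C * b K v)"

definition sqnorm0 :: "polygon \<Rightarrow> fld \<Rightarrow> real" where
  "sqnorm0 K v = (L2norm (cell K) v)\<^sup>2"

definition sqsemi1 :: "polygon \<Rightarrow> fld \<Rightarrow> real" where
  "sqsemi1 K v = (L2norm (cell K) (grad (cell K) v))\<^sup>2"

definition sqsemi2 :: "polygon \<Rightarrow> fld \<Rightarrow> real" where
  "sqsemi2 K v = (L2norm (cell K) (hess (cell K) v))\<^sup>2"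

definition stabilizations_equivalent ::
  "real set \<Rightarrow> (real \<Rightarrow> polygon set) \<Rightarrow> (real \<Rightarrow> polygon \<Rightarrow> fld set) \<Rightarrow>
   nat \<Rightarrow> dof_degrees \<Rightarrow> bool" where
  "stabilizations_equivalent H T V k d \<longleftrightarrow>
     unif_equiv H T (\<lambda>h K. {v \<in> V h K. Pi0 K k v = (\<lambda>x. 0)}) (\<lambda>K v. S0 d K v v) sqnorm0 \<and>
     unif_equiv H T (\<lambda>h K. {v \<in> V h K. Pi1 K k v = (\<lambda>x. 0)}) (\<lambda>K v. S1 d K v v) sqsemi1 \<and>
     unif_equiv H T (\<lambda>h K. {v \<in> V h K. Pi2 K k v = (\<lambda>x. 0)}) (\<lambda>K v. S2 d K v v) sqsemi2"

definition forms_consistent ::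
  "real set \<Rightarrow> (real \<Rightarrow> polygon set) \<Rightarrow> (real \<Rightarrow> polygon \<Rightarrow> fld set) \<Rightarrow>
   nat \<Rightarrow> dof_degrees \<Rightarrow> bool" where
  "forms_consistent H T V k d \<longleftrightarrow>
     (\<forall>h\<in>H. \<forall>K\<in>T h. \<forall>v\<in>V h K. \<forall>p\<in>polys (int k).
        MK k d K v p = ip (cell K) v p \<and> MK k d K p v = ip (cell K) p v \<and>
        AK k d K v p = ip (cell K) (hess (cell K) v) (hess (cell K) p) \<and>
        AK k d K p v = ip (cell K) (hess (cell K) p) (hess (cell K) v) \<and>
        BK k d K v p = ip (cell K) (grad (cell K) v) (grad (cell K) p) \<and>
        BK k d K p v = ip (cell K) (grad (cell K) p) (grad (cell K) v))"

definition forms_stable ::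
  "real set \<Rightarrow> (real \<Rightarrow> polygon set) \<Rightarrow> (real \<Rightarrow> polygon \<Rightarrow> fld set) \<Rightarrow>
   nat \<Rightarrow> dof_degrees \<Rightarrow> bool" where
  "forms_stable H T V k d \<longleftrightarrow>
     unif_equiv H T V (\<lambda>K v. MK k d K v v) sqnorm0 \<and>
     unif_equiv H T V (\<lambda>K v. AK k d K v v) sqsemi2 \<and>
     unif_equiv H T V (\<lambda>K v. BK k d K v v) sqsemi1"

definition solves_step ::
  "nat \<Rightarrow> dof_degrees \<Rightarrow> polygon set \<Rightarrow> fld set \<Rightarrow> real \<Rightarrow> real \<Rightarrow> real \<Rightarrow> (real \<Rightarrow> real) \<Rightarrow>
   fld \<Rightarrow> fld \<Rightarrow> bool" where
  "solves_step k d T Vh \<alpha>1 \<alpha>2 \<Delta>t f u_prev u \<longleftrightarrow>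
     (\<forall>v\<in>Vh. Mh k d T (\<lambda>x. (u x - u_prev x) / \<Delta>t) v + \<alpha>1 * Ah k d T u v + \<alpha>2 * Bh k d T u v
        = Fh k f T u v)"

end

theory Submission
  imports Defs
begin

text \<open>One time step is the equation \<open>a u v = G u v\<close> for the energy form
  \<open>a = M\<^sub>h / \<Delta>t + \<alpha>\<^sub>1 A\<^sub>h + \<alpha>\<^sub>2 B\<^sub>h\<close>, where \<open>G u v = M\<^sub>h up v / \<Delta>t + F\<^sub>h u v\<close>
  with the previous iterate \<open>up\<close>. The form \<open>a\<close> is positive semidefinite with
  \<open>C \<parallel>v\<parallel>\<^sup>2 \<le> \<Delta>t a v v\<close>, its null space consists of the functions vanishing almost everywhere, and
  the space is finite-dimensional modulo that null space. Hence the linear problem with frozen \<open>G w\<close>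
  is solvable, and since the load is Lipschitz, \<open>w \<mapsto> u\<close> is a contraction with factor
  \<open>L \<Delta>t / C < 1\<close> in the energy norm.

  All of this rests on the linearity of the traces, the point values and hence the degrees of
  freedom and projections, which are defined by choice on functions rather than on equivalence
  classes. Traces are well defined by a trace inequality on parallelograms under the halves of an
  edge; point values are handled by unisolvence, without the Sobolev embedding.\<close>

section \<open>Positive semidefinite forms on linear sets of functions\<close>

text \<open>The problem lives in a space of classes of functions, but no quotient is formed: linear
  sets of functions carry a semidefinite form whose null vectors play the part of zero. Finite
  dimension enters as a finite list of linear functionals with joint kernel inside the null space;
  the degrees of freedom are that list, in place of a basis. The critical entries of the list are
  the vertex values: where a limit fails to exist or to be unique, \<open>THE\<close> returns a
  fixed junk value, and a value fixed in this way is not linear in the function. The contraction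
  factor arises because the load is Lipschitz in the L2 norm with constant \<open>L\<close>, and
  each of the two L2 norms in that estimate is at most \<open>sqrt (\<Delta>t / C)\<close> times the
  energy norm.\<close>

definition lin_space :: "('a \<Rightarrow> real) set \<Rightarrow> bool" where
  "lin_space X \<longleftrightarrow> X \<noteq> {} \<and> (\<forall>v\<in>X. \<forall>w\<in>X. \<forall>a b. (\<lambda>x. a * v x + b * w x) \<in> X)"

definition lin_on :: "('a \<Rightarrow> real) set \<Rightarrow> (('a \<Rightarrow> real) \<Rightarrow> real) \<Rightarrow> bool" where
  "lin_on X \<phi> \<longleftrightarrow> (\<forall>v\<in>X. \<forall>w\<in>X. \<forall>a b. \<phi> (\<lambda>x. a * v x + b * w x) = a * \<phi> v + b * \<phi> w)"

text \<open>Symmetry on \<open>X\<close> carries linearity over to the second argument. Definiteness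
  is left out: a function that vanishes almost everywhere can have energy zero without being the
  zero function.\<close>

definition psd_on :: "('a \<Rightarrow> real) set \<Rightarrow> (('a \<Rightarrow> real) \<Rightarrow> ('a \<Rightarrow> real) \<Rightarrow> real) \<Rightarrow> bool" where
  "psd_on X a \<longleftrightarrow> (\<forall>w\<in>X. lin_on X (\<lambda>v. a v w)) \<and> (\<forall>v\<in>X. \<forall>w\<in>X. a v w = a w v) \<and>
     (\<forall>v\<in>X. 0 \<le> a v v)"

lemma lin_spaceD:
  assumes "lin_space X" "v \<in> X" "w \<in> X"
  shows "(\<lambda>x. a * v x + b * w x) \<in> X" "(\<lambda>x. v x + w x) \<in> X" "(\<lambda>x. v x - w x) \<in> X"
    "(\<lambda>x. a * v x) \<in> X"
proof -
  have *: "(\<lambda>x. a * v x + b * w x) \<in> X" for a b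
    using assms unfolding lin_space_def by blast
  show "(\<lambda>x. a * v x + b * w x) \<in> X" "(\<lambda>x. v x + w x) \<in> X" "(\<lambda>x. v x - w x) \<in> X"
    "(\<lambda>x. a * v x) \<in> X"
    using *[of a b] *[of 1 1] *[of 1 "-1"] *[of a 0] by simp_all
qed

lemma lin_space_zero: "lin_space X \<Longrightarrow> (\<lambda>x. 0) \<in> X"
  using lin_spaceD(4)[of X _ _ 0] unfolding lin_space_def by auto

lemma lin_onD:
  assumes "lin_on X \<phi>" "v \<in> X" "w \<in> X"
  shows "\<phi> (\<lambda>x. a * v x + b * w x) = a * \<phi> v + b * \<phi> w" "\<phi> (\<lambda>x. v x + w x) = \<phi> v + \<phi> w"
    "\<phi> (\<lambda>x. v x - w x) = \<phi> v - \<phi> w" "\<phi> (\<lambda>x. a * v x) = a * \<phi> v"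
proof -
  have *: "\<phi> (\<lambda>x. a * v x + b * w x) = a * \<phi> v + b * \<phi> w" for a b
    using assms unfolding lin_on_def by blast
  show "\<phi> (\<lambda>x. a * v x + b * w x) = a * \<phi> v + b * \<phi> w" "\<phi> (\<lambda>x. v x + w x) = \<phi> v + \<phi> w"
    "\<phi> (\<lambda>x. v x - w x) = \<phi> v - \<phi> w" "\<phi> (\<lambda>x. a * v x) = a * \<phi> v"
    using *[of a b] *[of 1 1] *[of 1 "-1"] *[of a 0] by simp_all
qed

lemma lin_on_zero: "lin_on X \<phi> \<Longrightarrow> lin_space X \<Longrightarrow> \<phi> (\<lambda>x. 0) = 0"
  using lin_onD(4)[of X \<phi> "\<lambda>x. 0" "\<lambda>x. 0" 0] lin_space_zero[of X] by simp

lemma lin_on_comb: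
  assumes "lin_on X \<phi>" "lin_on X \<psi>" shows "lin_on X (\<lambda>v. c * \<phi> v + e * \<psi> v)"
  using assms unfolding lin_on_def by (simp add: algebra_simps)

lemma lin_on_sum:
  assumes "\<And>i. i \<in> I \<Longrightarrow> lin_on X (\<phi> i)" shows "lin_on X (\<lambda>v. \<Sum>i\<in>I. \<phi> i v)"
  unfolding lin_on_def
proof (intro ballI allI)
  fix v w a b assume "v \<in> X" "w \<in> X"
  then have "(\<Sum>i\<in>I. \<phi> i (\<lambda>x. a * v x + b * w x)) = (\<Sum>i\<in>I. a * \<phi> i v + b * \<phi> i w)"
    using lin_onD(1)[OF assms] by (intro sum.cong) auto
  then show "(\<Sum>i\<in>I. \<phi> i (\<lambda>x. a * v x + b * w x)) = a * (\<Sum>i\<in>I. \<phi> i v) + b * (\<Sum>i\<in>I. \<phi> i w)"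
    by (simp add: sum.distrib sum_distrib_left)
qed

lemma lin_on_subset: "lin_on X \<phi> \<Longrightarrow> Y \<subseteq> X \<Longrightarrow> lin_on Y \<phi>"
  unfolding lin_on_def by blast

lemma lin_on_cong:
  assumes "lin_space X" "lin_on X \<psi>" "\<And>v. v \<in> X \<Longrightarrow> \<phi> v = \<psi> v" shows "lin_on X \<phi>"
  unfolding lin_on_def
proof (intro ballI allI)
  fix v w a b assume vw: "v \<in> X" "w \<in> X"
  show "\<phi> (\<lambda>x. a * v x + b * w x) = a * \<phi> v + b * \<phi> w"
    unfolding assms(3)[OF lin_spaceD(1)[OF assms(1) vw]] assms(3)[OF vw(1)] assms(3)[OF vw(2)]
    by (rule lin_onD(1)[OF assms(2) vw])
qed

lemma psd_onD:
  assumes "psd_on X a"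
  shows "w \<in> X \<Longrightarrow> lin_on X (\<lambda>v. a v w)" "v \<in> X \<Longrightarrow> w \<in> X \<Longrightarrow> a v w = a w v"
    "v \<in> X \<Longrightarrow> 0 \<le> a v v"
  using assms unfolding psd_on_def by auto

lemma psd_on_linR:
  assumes "psd_on X a" "lin_space X" "v \<in> X" shows "lin_on X (a v)"
  unfolding lin_on_def
proof (intro ballI allI)
  fix y z s t assume yz: "y \<in> X" "z \<in> X"
  show "a v (\<lambda>x. s * y x + t * z x) = s * a v y + t * a v z"
    using lin_onD(1)[OF psd_onD(1)[OF assms(1,3)] yz, of s t] psd_onD(2)[OF assms(1,3)] yz
      lin_spaceD(1)[OF assms(2) yz] by simp
qed

text \<open>Agreement is asked for on \<open>X\<close> only, because the componentwise formulas for
  products of gradients and Hessians are established for Sobolev functions, where the summands are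
  integrable.\<close>

lemma psd_on_cong:
  assumes X: "lin_space X" and b: "psd_on X b" and eq: "\<And>v w. v \<in> X \<Longrightarrow> w \<in> X \<Longrightarrow> a v w = b v w"
  shows "psd_on X a"
  unfolding psd_on_def lin_on_def
proof (intro conjI ballI allI)
  fix v w z s t assume vwz: "w \<in> X" "v \<in> X" "z \<in> X"
  show "a (\<lambda>x. s * v x + t * z x) w = s * a v w + t * a z w"
    unfolding eq[OF lin_spaceD(1)[OF X vwz(2,3)] vwz(1)] eq[OF vwz(2,1)] eq[OF vwz(3,1)]
    by (rule lin_onD(1)[OF psd_onD(1)[OF b vwz(1)] vwz(2,3)])
next
  fix v w assume "v \<in> X" "w \<in> X"
  then show "a v w = a w v" using eq psd_onD(2)[OF b] by metis
next
  fix v assume "v \<in> X"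
  then show "0 \<le> a v v" using eq psd_onD(3)[OF b] by metis
qed

lemma psd_on_subset: "psd_on X a \<Longrightarrow> Y \<subseteq> X \<Longrightarrow> psd_on Y a"
  unfolding psd_on_def using lin_on_subset by blast

lemma psd_on_comb:
  assumes "psd_on X a" "psd_on X b" "0 \<le> c" "0 \<le> e"
  shows "psd_on X (\<lambda>v w. c * a v w + e * b v w)"
  unfolding psd_on_def
  using psd_onD[OF assms(1)] psd_onD[OF assms(2)] assms(3,4) by (simp add: lin_on_comb)

lemma psd_on_sum:
  assumes "\<And>i. i \<in> I \<Longrightarrow> psd_on X (a i)"
  shows "psd_on X (\<lambda>v w. \<Sum>i\<in>I. a i v w)"
  unfolding psd_on_def
  using psd_onD[OF assms] by (auto intro!: lin_on_sum sum_nonneg sum.cong)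

lemma psd_on_prod: "lin_on X \<phi> \<Longrightarrow> psd_on X (\<lambda>v w. \<phi> v * \<phi> w)"
  unfolding psd_on_def lin_on_def by (simp add: algebra_simps)

text \<open>Meant for projections followed by a known form. \<open>P\<close> has to be linear as a
  map into functions, so a derivative, linear only almost everywhere, fits only after a projection
  has been applied to it.\<close>

lemma psd_on_pullback:
  assumes "psd_on Y a"
    and "\<And>v. v \<in> X \<Longrightarrow> P v \<in> Y"
    and "\<And>v w c e. v \<in> X \<Longrightarrow> w \<in> X \<Longrightarrow> P (\<lambda>x. c * v x + e * w x) = (\<lambda>x. c * P v x + e * P w x)"
  shows "psd_on X (\<lambda>v w. a (P v) (P w))"
  unfolding psd_on_def lin_on_def
  using psd_onD(2,3)[OF assms(1)] assms(2,3) lin_onD(1)[OF psd_onD(1)[OF assms(1)]] by simp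

section \<open>The seminorm of a semidefinite form\<close>

lemma psd_expand:
  assumes "psd_on X a" "lin_space X" "v \<in> X" "w \<in> X"
  shows "a (\<lambda>x. s * v x + t * w x) (\<lambda>x. s * v x + t * w x) = s\<^sup>2 * a v v + 2 * s * t * a v w + t\<^sup>2 * a w w"
proof -
  let ?z = "\<lambda>x. s * v x + t * w x"
  have z: "?z \<in> X" using assms lin_spaceD by blast
  have "a ?z ?z = s * a v ?z + t * a w ?z"
    using lin_onD(1)[OF psd_onD(1)[OF assms(1) z] assms(3,4)] by simp
  also have "a v ?z = s * a v v + t * a v w"
    using lin_onD(1)[OF psd_on_linR[OF assms(1,2,3)] assms(3,4)] by simp
  also have "a w ?z = s * a w v + t * a w w"
    using lin_onD(1)[OF psd_on_linR[OF assms(1,2,4)] assms(3,4)] by simp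
  also have "a w v = a v w" using psd_onD(2)[OF assms(1)] assms by simp
  finally show ?thesis by (simp add: algebra_simps power2_eq_square)
qed

lemma psd_Cauchy_Schwarz:
  assumes "psd_on X a" "lin_space X" "v \<in> X" "w \<in> X"
  shows "(a v w)\<^sup>2 \<le> a v v * a w w"
proof -
  let ?A = "a v v" and ?B = "a v w" and ?C = "a w w"
  have q: "0 \<le> s\<^sup>2 * ?A + 2 * s * t * ?B + t\<^sup>2 * ?C" for s t
    using psd_expand[OF assms, of s t] psd_onD(3)[OF assms(1) lin_spaceD(1)[OF assms(2,3,4)], of s t]
    by simp
  have A: "0 \<le> ?A" and C: "0 \<le> ?C" using psd_onD(3)[OF assms(1)] assms by auto
  show ?thesis
  proof (cases "?C = 0")
    case True
    have "0 \<le> ?A - 2 * t * ?B" for t using q[of 1 "-t"] True by simp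
    \<comment> \<open>If \<open>?B\<close> were nonzero, this \<open>t\<close> would give
      \<open>0 \<le> -1\<close>.\<close>
    from this[of "(?A + 1) / (2 * ?B)"] have "?B = 0" by (cases "?B = 0") auto
    then show ?thesis using True by simp
  next
    case False
    then have "0 < ?C" using C by simp
    \<comment> \<open>For \<open>s = ?C\<close> the quadratic expression is smallest at
      \<open>t = - ?B\<close>.\<close>
    have "0 \<le> ?C * (?A * ?C - ?B\<^sup>2)"
      using q[of "?C" "- ?B"] by (simp add: power2_eq_square algebra_simps)
    then show ?thesis using \<open>0 < ?C\<close> by (simp add: zero_le_mult_iff)
  qed
qed

lemma psd_abs_le:
  assumes "psd_on X a" "lin_space X" "v \<in> X" "w \<in> X"
  shows "\<bar>a v w\<bar> \<le> sqrt (a v v) * sqrt (a w w)"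
  using real_sqrt_le_mono[OF psd_Cauchy_Schwarz[OF assms]] by (simp add: real_sqrt_mult)

text \<open>By Cauchy-Schwarz the vectors of energy zero form the radical of the form; they can be
  treated as zero in either argument.\<close>

lemma psd_null:
  assumes "psd_on X a" "lin_space X" "v \<in> X" "w \<in> X" "a v v = 0"
  shows "a v w = 0" "a w v = 0"
  using psd_Cauchy_Schwarz[OF assms(1-4)] psd_onD(2)[OF assms(1,3,4)] assms(5) by simp_all

lemma psd_triangle:
  assumes "psd_on X a" "lin_space X" "v \<in> X" "w \<in> X"
  shows "sqrt (a (\<lambda>x. v x + w x) (\<lambda>x. v x + w x)) \<le> sqrt (a v v) + sqrt (a w w)"
proof -
  have A: "0 \<le> a v v" and C: "0 \<le> a w w" using psd_onD(3)[OF assms(1)] assms by auto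
  have "a (\<lambda>x. v x + w x) (\<lambda>x. v x + w x) = a v v + 2 * a v w + a w w"
    using psd_expand[OF assms, of 1 1] by simp
  also have "\<dots> \<le> a v v + 2 * (sqrt (a v v) * sqrt (a w w)) + a w w"
    using psd_abs_le[OF assms] by simp
  also have "\<dots> = (sqrt (a v v) + sqrt (a w w))\<^sup>2"
    using A C by (simp add: power2_sum)
  finally show ?thesis by (simp add: real_le_lsqrt A C)
qed

lemma psd_triangle_diff:
  assumes "psd_on X a" "lin_space X" "v \<in> X" "w \<in> X"
  shows "sqrt (a (\<lambda>x. v x - w x) (\<lambda>x. v x - w x)) \<le> sqrt (a v v) + sqrt (a w w)"
proof -
  have m: "(\<lambda>x. - w x) \<in> X" using lin_spaceD(4)[OF assms(2,4,4), of "-1"] by simp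
  have "a (\<lambda>x. - w x) (\<lambda>x. - w x) = a w w"
    using psd_expand[OF assms(1,2,4,4), of "-1" 0] by simp
  then show ?thesis using psd_triangle[OF assms(1-3) m] by simp
qed

text \<open>The finitely many functionals \<open>D i\<close> make \<open>X\<close> finite-dimensional modulo the null space of
  \<open>a\<close>. The induction step is a Schur complement: on the kernel of \<open>D i\<close> the claim is known,
  and the remaining direction is made orthogonal to that kernel.\<close>

lemma riesz_finite:
  assumes "finite I" "lin_space X" "psd_on X a" "lin_on X l"
    and "\<And>v. v \<in> X \<Longrightarrow> a v v = 0 \<Longrightarrow> l v = 0"
    and "\<And>i. i \<in> I \<Longrightarrow> lin_on X (D i)"
    and "\<And>v. v \<in> X \<Longrightarrow> (\<And>i. i \<in> I \<Longrightarrow> D i v = 0) \<Longrightarrow> a v v = 0"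
  shows "\<exists>u\<in>X. \<forall>v\<in>X. a u v = l v"
  using assms
proof (induction I arbitrary: X l rule: finite_induct)
  case empty
  have "(\<lambda>x. 0) \<in> X" using lin_space_zero empty.prems by blast
  moreover have "a (\<lambda>x. 0) v = l v" if "v \<in> X" for v
    using psd_null(2)[OF empty.prems(2,1) that calculation] empty.prems(4,6) that by auto
  ultimately show ?case by blast
next
  case (insert i I)
  note X = insert.prems(1) and a = insert.prems(2) and l = insert.prems(3)
    and null = insert.prems(4) and D = insert.prems(5) and det = insert.prems(6)
  have Di: "lin_on X (D i)" using D by simp
  define Y where "Y = {v \<in> X. D i v = 0}"
  have YX: "Y \<subseteq> X" unfolding Y_def by auto
  have Y: "lin_space Y"
    unfolding lin_space_def
  proof (intro conjI ballI allI)
    show "Y \<noteq> {}" unfolding Y_def using lin_space_zero[OF X] lin_on_zero[OF Di X] by auto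
    show "(\<lambda>x. c * v x + e * w x) \<in> Y" if "v \<in> Y" "w \<in> Y" for v w c e
      using that lin_spaceD(1)[OF X] lin_onD(1)[OF Di] unfolding Y_def by auto
  qed
  \<comment> \<open>The induction hypothesis serves two functionals: \<open>l\<close>, and
    \<open>a b\<close>, whose representer in \<open>Y\<close> is an orthogonal projection of
    \<open>b\<close>.\<close>
  have IH: "\<exists>u\<in>Y. \<forall>v\<in>Y. a u v = m v" if "lin_on X m" "\<And>v. v \<in> X \<Longrightarrow> a v v = 0 \<Longrightarrow> m v = 0" for m
  proof (rule insert.IH[OF Y psd_on_subset[OF a YX] lin_on_subset[OF that(1) YX]])
    show "m v = 0" if "v \<in> Y" "a v v = 0" for v using that \<open>\<And>v. v \<in> X \<Longrightarrow> a v v = 0 \<Longrightarrow> m v = 0\<close> YX by auto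
    show "lin_on Y (D j)" if "j \<in> I" for j using D[of j] that lin_on_subset YX by auto
    show "a v v = 0" if "v \<in> Y" "\<And>j. j \<in> I \<Longrightarrow> D j v = 0" for v
      using det[of v] that unfolding Y_def by auto
  qed
  show ?case
  proof (cases "X = Y")
    case True
    then show ?thesis using IH[OF l null] by blast
  next
    case False
    then obtain b where b: "b \<in> X" "D i b \<noteq> 0" unfolding Y_def by auto
    obtain p where p: "p \<in> Y" "\<And>v. v \<in> Y \<Longrightarrow> a p v = a b v"
      using IH[OF psd_on_linR[OF a X b(1)]] psd_null(2)[OF a X _ b(1)] by blast
    obtain u where u: "u \<in> Y" "\<And>v. v \<in> Y \<Longrightarrow> a u v = l v"
      using IH[OF l null] by blast
    define c where "c = (\<lambda>x. b x - p x)"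
    have pX: "p \<in> X" and uX: "u \<in> X" using p(1) u(1) YX by auto
    have c: "c \<in> X" unfolding c_def using lin_spaceD(3)[OF X b(1) pX] .
    have Dc: "D i c = D i b" unfolding c_def using lin_onD(3)[OF Di b(1) pX] p(1) Y_def by simp
    have ac: "a c v = 0" if "v \<in> Y" for v
      using lin_onD(3)[OF psd_onD(1)[OF a] b(1) pX, of v] that p(2) YX unfolding c_def by auto
    \<comment> \<open>If \<open>a c c = 0\<close>, then \<open>l c = 0\<close> as well, and the
      default value of \<open>s\<close> still satisfies \<open>s * a c c = l c\<close>.\<close>
    define s where "s = (if a c c = 0 then 0 else l c / a c c)"
    define z where "z = (\<lambda>x. 1 * u x + s * c x)"
    have z: "z \<in> X" unfolding z_def using lin_spaceD(1)[OF X uX c] .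
    have sc: "s * a c c = l c" unfolding s_def using null[OF c] by auto
    have "a z v = l v" if v: "v \<in> X" for v
    proof -
      \<comment> \<open>\<open>D i c = D i b\<close>, because \<open>p\<close> lies in the kernel of
        \<open>D i\<close>; subtracting \<open>t\<close> times \<open>c\<close> moves
        \<open>v\<close> into \<open>Y\<close>.\<close>
      define t where "t = D i v / D i b"
      define y where "y = (\<lambda>x. 1 * v x + (-t) * c x)"
      have yX: "y \<in> X" unfolding y_def using lin_spaceD(1)[OF X v c] .
      have "D i y = 0" unfolding y_def using lin_onD(1)[OF Di v c, of 1 "-t"] Dc b(2) t_def by simp
      then have y: "y \<in> Y" using yX Y_def by simp
      have az: "a z w = a u w + s * a c w" if "w \<in> X" for w
        unfolding z_def using lin_onD(1)[OF psd_onD(1)[OF a that] uX c, of 1 s] by simp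
      have "a u c = 0" using ac[OF u(1)] psd_onD(2)[OF a uX c] by simp
      then have "a z c = l c" using az[OF c] sc by simp
      moreover have "a z y = l y" using az[OF yX] ac[OF y] u(2)[OF y] by simp
      moreover have veq: "v = (\<lambda>x. 1 * y x + t * c x)" unfolding y_def by auto
      have "a z v = a z y + t * a z c"
        using lin_onD(1)[OF psd_on_linR[OF a X z] yX c, of 1 t] veq by simp
      moreover have "l v = l y + t * l c"
        using lin_onD(1)[OF l yX c, of 1 t] veq by simp
      ultimately show ?thesis by simp
    qed
    then show ?thesis using z by blast
  qed
qed

text \<open>Strong convergence follows from the convergence of the functionals \<open>a (U m)\<close>, whose limit
  is represented by the previous lemma.\<close>

lemma psd_complete:
  assumes "finite I" and X: "lin_space X" and a: "psd_on X a"
    and "\<And>i. i \<in> I \<Longrightarrow> lin_on X (D i)"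
    and "\<And>v. v \<in> X \<Longrightarrow> (\<And>i. i \<in> I \<Longrightarrow> D i v = 0) \<Longrightarrow> a v v = 0"
    and U: "\<And>m. U m \<in> X"
    and Cau: "\<And>e. 0 < e \<Longrightarrow> \<exists>M. \<forall>m\<ge>M. \<forall>p\<ge>M. sqrt (a (\<lambda>x. U m x - U p x) (\<lambda>x. U m x - U p x)) < e"
  shows "\<exists>u\<in>X. (\<lambda>m. sqrt (a (\<lambda>x. U m x - u x) (\<lambda>x. U m x - u x))) \<longlonglongrightarrow> 0"
proof -
  define N where "N v = sqrt (a v v)" for v
  have dX: "(\<lambda>x. U m x - U p x) \<in> X" for m p using lin_spaceD(3)[OF X U U] .
  have "\<exists>L. (\<lambda>m. a (U m) v) \<longlonglongrightarrow> L" if v: "v \<in> X" for v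
  proof -
    have "Cauchy (\<lambda>m. a (U m) v)"
    proof (rule metric_CauchyI)
      fix e :: real assume e: "0 < e"
      \<comment> \<open>The summand one keeps the tolerance \<open>e / (N v + 1)\<close> meaningful
        when \<open>v\<close> has energy zero.\<close>
      have pos: "0 < N v + 1" using psd_onD(3)[OF a v] unfolding N_def by (simp add: add_nonneg_pos)
      then obtain M where M: "\<And>m p. m \<ge> M \<Longrightarrow> p \<ge> M \<Longrightarrow> N (\<lambda>x. U m x - U p x) < e / (N v + 1)"
        using Cau[of "e / (N v + 1)"] e unfolding N_def by auto
      have "dist (a (U m) v) (a (U p) v) < e" if "m \<ge> M" "p \<ge> M" for m p
      proof -
        have "dist (a (U m) v) (a (U p) v) = \<bar>a (\<lambda>x. U m x - U p x) v\<bar>"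
          using lin_onD(3)[OF psd_onD(1)[OF a v] U U] by (simp add: dist_real_def)
        also have "\<dots> \<le> N (\<lambda>x. U m x - U p x) * N v"
          using psd_abs_le[OF a X dX v] unfolding N_def .
        also have "\<dots> \<le> N (\<lambda>x. U m x - U p x) * (N v + 1)"
          using psd_onD(3)[OF a dX] unfolding N_def by (intro mult_left_mono) auto
        also have "\<dots> < e" using M[OF that] pos by (simp add: field_simps)
        finally show ?thesis .
      qed
      then show "\<exists>M. \<forall>m\<ge>M. \<forall>p\<ge>M. dist (a (U m) v) (a (U p) v) < e" by blast
    qed
    then show ?thesis using Cauchy_convergent_iff convergent_def by blast
  qed
  then obtain l where l: "\<And>v. v \<in> X \<Longrightarrow> (\<lambda>m. a (U m) v) \<longlonglongrightarrow> l v"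
    using bchoice[of X "\<lambda>v L. (\<lambda>m. a (U m) v) \<longlonglongrightarrow> L"] by blast
  have "\<exists>u\<in>X. \<forall>v\<in>X. a u v = l v"
  proof (rule riesz_finite[OF assms(1) X a, where D = D])
    show "lin_on X l"
      unfolding lin_on_def
    proof (intro ballI allI)
      fix v w c e assume vw: "v \<in> X" "w \<in> X"
      have "(\<lambda>m. a (U m) (\<lambda>x. c * v x + e * w x)) \<longlonglongrightarrow> c * l v + e * l w"
        unfolding lin_onD(1)[OF psd_on_linR[OF a X U] vw] using l vw by (intro tendsto_intros) auto
      then show "l (\<lambda>x. c * v x + e * w x) = c * l v + e * l w"
        using l[OF lin_spaceD(1)[OF X vw]] LIMSEQ_unique by blast
    qed
    show "l v = 0" if v: "v \<in> X" "a v v = 0" for v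
    proof -
      have "a (U m) v = 0" for m using psd_null(2)[OF a X v(1) U] v(2) by blast
      then have "(\<lambda>m. 0) \<longlonglongrightarrow> l v" using l[OF v(1)] by simp
      then show ?thesis using LIMSEQ_unique[OF tendsto_const] by metis
    qed
    show "lin_on X (D i)" if "i \<in> I" for i using that by (rule assms(4))
    show "a v v = 0" if "v \<in> X" "\<And>i. i \<in> I \<Longrightarrow> D i v = 0" for v using that by (rule assms(5))
  qed
  then obtain u where u: "u \<in> X" "\<And>v. v \<in> X \<Longrightarrow> a u v = l v" by blast
  define d where "d m = (\<lambda>x. U m x - u x)" for m
  have d: "d m \<in> X" for m unfolding d_def using lin_spaceD(3)[OF X U u(1)] .
  have "(\<lambda>m. N (d m)) \<longlonglongrightarrow> 0"
  proof (rule LIMSEQ_I)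
    fix e :: real assume e: "0 < e"
    obtain M where M: "\<And>m p. m \<ge> M \<Longrightarrow> p \<ge> M \<Longrightarrow> N (\<lambda>x. U m x - U p x) < e / 2"
      using Cau[of "e / 2"] e unfolding N_def by auto
    have "norm (N (d m) - 0) < e" if m: "m \<ge> M" for m
    proof -
      \<comment> \<open>The weak limit is tested with \<open>d m\<close> itself while
        \<open>m\<close> stays fixed: letting \<open>p\<close> tend to infinity in
        \<open>a (U m - U p) (d m) \<le> e / 2 * N (d m)\<close> bounds the energy of
        \<open>d m\<close>.\<close>
      have "(\<lambda>p. a (U m) (d m) - a (U p) (d m)) \<longlonglongrightarrow> a (U m) (d m) - a u (d m)"
        unfolding u(2)[OF d] using l[OF d] by (intro tendsto_intros)
      then have lim: "(\<lambda>p. a (\<lambda>x. U m x - U p x) (d m)) \<longlonglongrightarrow> a (d m) (d m)"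
        using lin_onD(3)[OF psd_onD(1)[OF a d] U U] lin_onD(3)[OF psd_onD(1)[OF a d] U u(1)]
        by (simp add: d_def)
      have "a (\<lambda>x. U m x - U p x) (d m) \<le> e / 2 * N (d m)" if "p \<ge> M" for p
      proof -
        have "a (\<lambda>x. U m x - U p x) (d m) \<le> N (\<lambda>x. U m x - U p x) * N (d m)"
          using psd_abs_le[OF a X dX d, of m p m] unfolding N_def by simp
        also have "\<dots> \<le> e / 2 * N (d m)"
          using M[OF m that] psd_onD(3)[OF a d] by (intro mult_right_mono) (auto simp: N_def)
        finally show ?thesis .
      qed
      then have "a (d m) (d m) \<le> e / 2 * N (d m)"
        using lim by (intro LIMSEQ_le_const2[OF lim]) blast
      moreover have "a (d m) (d m) = N (d m) * N (d m)" "0 \<le> N (d m)"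
        using psd_onD(3)[OF a d] unfolding N_def by simp_all
      ultimately have "N (d m) \<le> e / 2" using e by (cases "N (d m) = 0") auto
      then show ?thesis using e \<open>0 \<le> N (d m)\<close> by simp
    qed
    then show "\<exists>no. \<forall>n\<ge>no. norm (N (d n) - 0) < e" by blast
  qed
  then show ?thesis using u(1) unfolding N_def d_def by blast
qed

section \<open>Square integrable functions\<close>

text \<open>Stated over an arbitrary measure, so that it covers both planar domains and the
  parameter interval of an edge.\<close>

definition sqint :: "'a measure \<Rightarrow> ('a \<Rightarrow> real) set" where
  "sqint M = {v \<in> borel_measurable M. integrable M (\<lambda>x. (v x)\<^sup>2)}"

lemma L2_eq_sqint: "L2 D = sqint (lebesgue_on D)"
  unfolding L2_def sqint_def ..

lemma sqint_measurable: "v \<in> sqint M \<Longrightarrow> v \<in> borel_measurable M"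
  unfolding sqint_def by simp

lemma sqint_mult_integrable:
  assumes "v \<in> sqint M" "w \<in> sqint M" shows "integrable M (\<lambda>x. v x * w x)"
proof (rule Bochner_Integration.integrable_bound)
  show "integrable M (\<lambda>x. (v x)\<^sup>2 + (w x)\<^sup>2)" using assms unfolding sqint_def by simp
  show "(\<lambda>x. v x * w x) \<in> borel_measurable M"
    using assms[THEN sqint_measurable] by measurable
  have "\<bar>v x * w x\<bar> \<le> (v x)\<^sup>2 + (w x)\<^sup>2" for x
  proof -
    have "2 * (\<bar>v x\<bar> * \<bar>w x\<bar>) \<le> (v x)\<^sup>2 + (w x)\<^sup>2"
      using zero_le_power2[of "\<bar>v x\<bar> - \<bar>w x\<bar>"] by (simp add: power2_diff)
    moreover have "0 \<le> \<bar>v x\<bar> * \<bar>w x\<bar>" by simp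
    ultimately show ?thesis unfolding abs_mult by linarith
  qed
  then show "AE x in M. norm (v x * w x) \<le> norm ((v x)\<^sup>2 + (w x)\<^sup>2)" by (intro AE_I2) (simp add: order_trans[OF _ abs_ge_self])
qed

lemma lin_space_sqint: "lin_space (sqint M)"
  unfolding lin_space_def
proof (intro conjI ballI allI)
  show "sqint M \<noteq> {}" using exI[of "\<lambda>v. v \<in> sqint M" "\<lambda>x. 0"] unfolding sqint_def by auto
  fix v w a b assume vw: "v \<in> sqint M" "w \<in> sqint M"
  have "(\<lambda>x. (a * v x + b * w x)\<^sup>2) = (\<lambda>x. a\<^sup>2 * (v x)\<^sup>2 + 2 * a * b * (v x * w x) + b\<^sup>2 * (w x)\<^sup>2)"
    by (auto simp: power2_sum power_mult_distrib)
  moreover have "integrable M \<dots>"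
    using vw sqint_mult_integrable[OF vw] unfolding sqint_def by simp
  moreover have "(\<lambda>x. a * v x + b * w x) \<in> borel_measurable M"
    using vw[THEN sqint_measurable] by measurable
  ultimately show "(\<lambda>x. a * v x + b * w x) \<in> sqint M" unfolding sqint_def by simp
qed

lemma sqint_bounded_mult:
  assumes "v \<in> sqint M" "\<phi> \<in> borel_measurable M" "\<And>x. x \<in> space M \<Longrightarrow> \<bar>\<phi> x\<bar> \<le> B"
  shows "(\<lambda>x. \<phi> x * v x) \<in> sqint M"
proof -
  have meas: "(\<lambda>x. \<phi> x * v x) \<in> borel_measurable M"
    using sqint_measurable[OF assms(1)] assms(2) by measurable
  have "integrable M (\<lambda>x. (\<phi> x * v x)\<^sup>2)"
  proof (rule Bochner_Integration.integrable_bound)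
    show "integrable M (\<lambda>x. B\<^sup>2 * (v x)\<^sup>2)" using assms(1) unfolding sqint_def by simp
    show "(\<lambda>x. (\<phi> x * v x)\<^sup>2) \<in> borel_measurable M" using meas by measurable
    have "(\<phi> x)\<^sup>2 \<le> B\<^sup>2" if "x \<in> space M" for x
      using assms(3)[OF that] power_mono[of "\<bar>\<phi> x\<bar>" B 2] by simp
    then show "AE x in M. norm ((\<phi> x * v x)\<^sup>2) \<le> norm (B\<^sup>2 * (v x)\<^sup>2)"
      by (intro AE_I2) (simp add: power_mult_distrib mult_right_mono)
  qed
  then show ?thesis using meas unfolding sqint_def by simp
qed

lemma sqint_bounded:
  assumes "finite_measure M" "\<phi> \<in> borel_measurable M" "\<And>x. x \<in> space M \<Longrightarrow> \<bar>\<phi> x\<bar> \<le> B"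
  shows "\<phi> \<in> sqint M"
proof -
  interpret finite_measure M by fact
  have "(\<lambda>x. 1) \<in> sqint M" unfolding sqint_def by simp
  from sqint_bounded_mult[OF this assms(2,3)] show ?thesis by simp
qed

lemma psd_sqint: "psd_on (sqint M) (\<lambda>v w. LINT x|M. v x * w x)"
  unfolding psd_on_def
proof (intro conjI ballI)
  fix w assume w: "w \<in> sqint M"
  show "lin_on (sqint M) (\<lambda>v. LINT x|M. v x * w x)"
    unfolding lin_on_def
  proof (intro ballI allI)
    fix v z a b assume "v \<in> sqint M" "z \<in> sqint M"
    then have "integrable M (\<lambda>x. v x * w x)" "integrable M (\<lambda>x. z x * w x)"
      using w by (auto intro: sqint_mult_integrable)
    then have "(LINT x|M. a * (v x * w x) + b * (z x * w x)) = a * (LINT x|M. v x * w x) + b * (LINT x|M. z x * w x)"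
      by simp
    then show "(LINT x|M. (a * v x + b * z x) * w x) = a * (LINT x|M. v x * w x) + b * (LINT x|M. z x * w x)"
      by (simp add: algebra_simps)
  qed
qed (auto simp: mult.commute)

lemma sqint_null:
  assumes "v \<in> sqint M" "(LINT x|M. v x * v x) = 0" shows "AE x in M. v x = 0"
proof -
  have "AE x in M. v x * v x = 0"
    using integral_nonneg_eq_0_iff_AE[of M "\<lambda>x. v x * v x"] assms sqint_mult_integrable[OF assms(1,1)]
    by auto
  then show ?thesis by (rule eventually_mono) auto
qed

lemma ip_real: "ip D v (w :: pt \<Rightarrow> real) = (LINT x|lebesgue_on D. v x * w x)"
  unfolding ip_def by simp

lemma psd_ip: "psd_on (L2 D) (ip D)"
proof -
  have "ip D = (\<lambda>v w. LINT x|lebesgue_on D. v x * w x)" by (intro ext) (rule ip_real)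
  then show ?thesis using psd_sqint by (simp add: L2_eq_sqint)
qed

lemma lin_space_L2: "lin_space (L2 D)"
  by (simp add: L2_eq_sqint lin_space_sqint)

lemma L2_measurable: "v \<in> L2 D \<Longrightarrow> v \<in> borel_measurable (lebesgue_on D)"
  by (simp add: L2_eq_sqint sqint_measurable)

lemma ip_cong_AE:
  fixes v v' w w' :: fld
  assumes "v \<in> L2 D" "w \<in> L2 D" "v' \<in> L2 D" "w' \<in> L2 D"
    and "AE x in lebesgue_on D. v x = v' x" "AE x in lebesgue_on D. w x = w' x"
  shows "ip D v w = ip D v' w'"
  unfolding ip_real using assms
  by (intro integral_cong_AE) (auto dest!: L2_measurable elim: eventually_elim2)

lemma L2norm_null:
  fixes v :: fld
  shows "v \<in> L2 D \<Longrightarrow> L2norm D v = 0 \<Longrightarrow> AE x in lebesgue_on D. v x = 0"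
  using sqint_null[of v "lebesgue_on D"] by (simp add: L2norm_def ip_real L2_eq_sqint)

lemma AE_null_L2norm:
  fixes v :: fld
  assumes "v \<in> L2 D" "AE x in lebesgue_on D. v x = 0" shows "L2norm D v = 0"
  using ip_cong_AE[OF assms(1,1) lin_space_zero lin_space_zero assms(2,2)]
  by (simp add: L2norm_def lin_space_L2 ip_real)

subsection \<open>Convergence in mean square\<close>

lemma L2norm_nonneg: "0 \<le> L2norm D v"
  unfolding L2norm_def ip_def by simp

lemma L2_conv_comb:
  assumes "L2_conv D f g" "L2_conv D f' g'"
  shows "L2_conv D (\<lambda>n x. a * f n x + b * f' n x) (\<lambda>x. a * g x + b * g' x)"
  unfolding L2_conv_def
proof (intro conjI allI)
  note m = assms[unfolded L2_conv_def]
  show "(\<lambda>x. a * g x + b * g' x) \<in> L2 D" "(\<lambda>x. a * f n x + b * f' n x) \<in> L2 D" for n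
    using m lin_spaceD(1)[OF lin_space_L2] by auto
  let ?d = "\<lambda>n x. f n x - g x" and ?d' = "\<lambda>n x. f' n x - g' x"
  have d: "?d n \<in> L2 D" "?d' n \<in> L2 D" for n using m lin_spaceD(3)[OF lin_space_L2] by auto
  have sc: "L2norm D (\<lambda>x. c * v x) = \<bar>c\<bar> * L2norm D v" if "v \<in> L2 D" for c and v :: fld
    using psd_expand[OF psd_ip lin_space_L2 that that, of c 0] by (simp add: L2norm_def real_sqrt_mult)
  have "L2norm D (\<lambda>x. a * f n x + b * f' n x - (a * g x + b * g' x))
    \<le> \<bar>a\<bar> * L2norm D (?d n) + \<bar>b\<bar> * L2norm D (?d' n)" for n
  proof -
    have "(\<lambda>x. a * f n x + b * f' n x - (a * g x + b * g' x)) = (\<lambda>x. a * ?d n x + b * ?d' n x)"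
      by (auto simp: algebra_simps)
    then show ?thesis
      using psd_triangle[OF psd_ip lin_space_L2 lin_spaceD(4)[OF lin_space_L2 d(1) d(1)] lin_spaceD(4)[OF lin_space_L2 d(2) d(2)], of a n b n]
        sc[OF d(1)] sc[OF d(2)] by (simp add: L2norm_def)
  qed
  then have le: "\<forall>\<^sub>F n in sequentially. norm (L2norm D (\<lambda>x. a * f n x + b * f' n x - (a * g x + b * g' x)))
      \<le> \<bar>a\<bar> * L2norm D (?d n) + \<bar>b\<bar> * L2norm D (?d' n)"
    by (simp add: L2norm_nonneg)
  have "(\<lambda>n. L2norm D (?d n)) \<longlonglongrightarrow> 0" "(\<lambda>n. L2norm D (?d' n)) \<longlonglongrightarrow> 0" using m by auto
  then have "(\<lambda>n. \<bar>a\<bar> * L2norm D (?d n) + \<bar>b\<bar> * L2norm D (?d' n)) \<longlonglongrightarrow> 0"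
    by (intro tendsto_add_zero tendsto_mult_right_zero)
  from Lim_null_comparison[OF le this]
  show "(\<lambda>n. L2norm D (\<lambda>x. a * f n x + b * f' n x - (a * g x + b * g' x))) \<longlonglongrightarrow> 0" .
qed

lemma L2_conv_AE:
  assumes "L2_conv D f g" "g' \<in> L2 D" "AE x in lebesgue_on D. g x = g' x"
  shows "L2_conv D f g'"
proof -
  note m = assms(1)[unfolded L2_conv_def]
  have "L2norm D (\<lambda>x. f n x - g x) = L2norm D (\<lambda>x. f n x - g' x)" for n
    unfolding L2norm_def
    using m assms(2,3)
    by (intro arg_cong[where f=sqrt] ip_cong_AE lin_spaceD(3)[OF lin_space_L2]) (auto elim: eventually_mono)
  then show ?thesis using m assms(2) unfolding L2_conv_def by simp
qed

lemma L2_conv_weak: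
  assumes "L2_conv D f g" "\<psi> \<in> L2 D" shows "(\<lambda>n. ip D (f n) \<psi>) \<longlonglongrightarrow> ip D g \<psi>"
proof -
  note m = assms(1)[unfolded L2_conv_def]
  have d: "(\<lambda>x. f n x - g x) \<in> L2 D" for n using m lin_spaceD(3)[OF lin_space_L2] by auto
  have "\<bar>ip D (f n) \<psi> - ip D g \<psi>\<bar> \<le> L2norm D (\<lambda>x. f n x - g x) * L2norm D \<psi>" for n
  proof -
    have "f n \<in> L2 D" "g \<in> L2 D" using m by auto
    then have "ip D (f n) \<psi> - ip D g \<psi> = ip D (\<lambda>x. f n x - g x) \<psi>"
      using lin_onD(3)[OF psd_onD(1)[OF psd_ip assms(2)]] by metis
    then show ?thesis using psd_abs_le[OF psd_ip lin_space_L2 d assms(2), of n] unfolding L2norm_def by metis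
  qed
  then have le: "\<forall>\<^sub>F n in sequentially. norm (ip D (f n) \<psi> - ip D g \<psi>) \<le> L2norm D (\<lambda>x. f n x - g x) * L2norm D \<psi>"
    by simp
  have "(\<lambda>n. L2norm D (\<lambda>x. f n x - g x)) \<longlonglongrightarrow> 0" using m by simp
  from tendsto_mult_left_zero[OF this] have "(\<lambda>n. L2norm D (\<lambda>x. f n x - g x) * L2norm D \<psi>) \<longlonglongrightarrow> 0" .
  from Lim_null_comparison[OF le this] have "(\<lambda>n. ip D (f n) \<psi> - ip D g \<psi>) \<longlonglongrightarrow> 0" .
  then show ?thesis by (simp add: LIM_zero_iff)
qed

text \<open>The Riesz-Fischer argument: a subsequence with geometrically small steps converges
  almost everywhere, and Fatou's lemma turns this into mean square convergence of the whole
  sequence.\<close>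

lemma sqint_complete:
  fixes f :: "nat \<Rightarrow> 'a \<Rightarrow> real"
  assumes M: "finite_measure M" and f: "\<And>n. f n \<in> sqint M"
    and Cau: "\<And>e. 0 < e \<Longrightarrow> \<exists>m. \<forall>p\<ge>m. \<forall>q\<ge>m. (LINT x|M. (f p x - f q x)\<^sup>2) < e"
  obtains g where "g \<in> sqint M" "(\<lambda>n. LINT x|M. (f n x - g x)\<^sup>2) \<longlonglongrightarrow> 0"
proof -
  interpret finite_measure M by fact
  have fm[measurable]: "f n \<in> borel_measurable M" for n using sqint_measurable[OF f] .
  have d: "(\<lambda>x. f p x - f q x) \<in> sqint M" for p q by (rule lin_spaceD(3)[OF lin_space_sqint f f])
  have one: "(\<lambda>x. 1) \<in> sqint M" unfolding sqint_def by simp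
  have "\<forall>k. \<exists>m. \<forall>p\<ge>m. \<forall>q\<ge>m. (LINT x|M. (f p x - f q x)\<^sup>2) < (1/4) ^ k"
    by (intro allI Cau) simp
  from choice[OF this] obtain m
    where m: "\<And>k p q. p \<ge> m k \<Longrightarrow> q \<ge> m k \<Longrightarrow> (LINT x|M. (f p x - f q x)\<^sup>2) < (1/4) ^ k"
    by blast
  \<comment> \<open>Partial sums make the indices increase and keep \<open>R k\<close> at or beyond
    the threshold \<open>m k\<close>.\<close>
  define R where "R k = (\<Sum>i\<le>k. m i)" for k
  have R: "m k \<le> R k" "R k \<le> R (Suc k)" for k
    unfolding R_def using member_le_sum[of k "{..k}" m] by auto
  define D where "D k x = f (R (Suc k)) x - f (R k) x" for k x
  have Ds: "D k \<in> sqint M" for k unfolding D_def using d .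
  have Dm[measurable]: "D k \<in> borel_measurable M" for k using sqint_measurable[OF Ds] .
  have absD: "(\<lambda>x. \<bar>D k x\<bar>) \<in> sqint M" for k using Ds[of k] unfolding sqint_def by simp
  have Dint: "integrable M (\<lambda>x. \<bar>D k x\<bar>)" for k
    using sqint_mult_integrable[OF absD one] by simp
  \<comment> \<open>As the measure is finite, Cauchy-Schwarz against the constant one turns the
    bound \<open>(1/4) ^ k\<close> for squares into the summable bound \<open>C * (1/2) ^ k\<close>
    for absolute values.\<close>
  define C where "C = sqrt (measure M (space M))"
  have bound: "(LINT x|M. \<bar>D k x\<bar>) \<le> C * (1/2) ^ k" for k
  proof -
    have CS: "(LINT x|M. \<bar>D k x\<bar> * 1) \<le> sqrt (LINT x|M. \<bar>D k x\<bar> * \<bar>D k x\<bar>) * sqrt (LINT x|M. 1 * 1)"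
      using psd_abs_le[OF psd_sqint lin_space_sqint absD one, of k] by simp
    have "(LINT x|M. \<bar>D k x\<bar> * \<bar>D k x\<bar>) \<le> (1/4) ^ k"
      using m[of k "R (Suc k)" "R k"] R[of k] unfolding D_def by (simp add: power2_eq_square)
    then have "sqrt (LINT x|M. \<bar>D k x\<bar> * \<bar>D k x\<bar>) \<le> sqrt ((1/4) ^ k)" by simp
    moreover have "sqrt ((1/4) ^ k) = (1/2::real) ^ k" by (simp add: real_sqrt_power real_sqrt_divide)
    ultimately have "sqrt (LINT x|M. \<bar>D k x\<bar> * \<bar>D k x\<bar>) * C \<le> (1/2) ^ k * C"
      by (intro mult_right_mono) (simp_all add: C_def)
    moreover have "C = sqrt (LINT x|M. 1 * 1)" unfolding C_def by simp
    ultimately have "(LINT x|M. \<bar>D k x\<bar> * 1) \<le> (1/2) ^ k * C" using CS by simp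
    then show ?thesis by (simp add: mult.commute)
  qed
  have "summable (\<lambda>k. C * (1/2::real) ^ k)" by (intro summable_mult summable_geometric) simp
  then have "summable (\<lambda>k. LINT x|M. \<bar>D k x\<bar>)"
    by (rule summable_comparison_test'[of _ 0]) (use bound in auto)
  then have "(\<Sum>k. ennreal (LINT x|M. \<bar>D k x\<bar>)) \<noteq> top" by (rule ennreal_suminf_neq_top) simp
  moreover have "(\<Sum>k. ennreal (LINT x|M. \<bar>D k x\<bar>)) = (\<integral>\<^sup>+x. (\<Sum>k. ennreal \<bar>D k x\<bar>) \<partial>M)"
    using nn_integral_eq_integral[OF Dint] by (subst nn_integral_suminf) auto
  ultimately have "(\<integral>\<^sup>+x. (\<Sum>k. ennreal \<bar>D k x\<bar>) \<partial>M) \<noteq> \<infinity>" by simp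
  then have "AE x in M. (\<Sum>k. ennreal \<bar>D k x\<bar>) \<noteq> \<infinity>"
    by (rule nn_integral_noteq_infinite[rotated]) measurable
  define g where "g x = lim (\<lambda>k. f (R k) x)" for x
  have gm[measurable]: "g \<in> borel_measurable M" unfolding g_def by measurable
  have conv: "AE x in M. (\<lambda>k. f (R k) x) \<longlonglongrightarrow> g x"
    using \<open>AE x in M. (\<Sum>k. ennreal \<bar>D k x\<bar>) \<noteq> \<infinity>\<close>
  proof (rule eventually_mono)
    fix x assume "(\<Sum>k. ennreal \<bar>D k x\<bar>) \<noteq> \<infinity>"
    then have "summable (\<lambda>k. \<bar>D k x\<bar>)" by (intro summable_suminf_not_top) auto
    then have "summable (\<lambda>k. D k x)" by (rule summable_rabs_cancel)
    then have "convergent (\<lambda>n. \<Sum>k<n. D k x)" by (simp add: summable_iff_convergent)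
    moreover have "(\<Sum>k<n. D k x) = f (R n) x - f (R 0) x" for n
      unfolding D_def using sum_lessThan_telescope[of "\<lambda>k. f (R k) x" n] by simp
    ultimately have "convergent (\<lambda>n. f (R n) x - f (R 0) x)" by simp
    then have "convergent (\<lambda>n. f (R n) x)" by (simp only: convergent_diff_const_right_iff)
    then show "(\<lambda>k. f (R k) x) \<longlonglongrightarrow> g x" unfolding g_def by (simp add: convergent_LIMSEQ_iff)
  qed
  \<comment> \<open>The pointwise limit is taken along the subsequence only, but the bound holds for
    every late \<open>p\<close>, inside the subsequence or not.\<close>
  have fatou: "(\<integral>\<^sup>+x. ennreal ((f p x - g x)\<^sup>2) \<partial>M) \<le> ennreal ((1/4) ^ n)" if p: "p \<ge> m n" for n p
  proof -
    have "(\<integral>\<^sup>+x. ennreal ((f p x - g x)\<^sup>2) \<partial>M) = (\<integral>\<^sup>+x. liminf (\<lambda>k. ennreal ((f p x - f (R k) x)\<^sup>2)) \<partial>M)"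
    proof (rule nn_integral_cong_AE)
      show "AE x in M. ennreal ((f p x - g x)\<^sup>2) = liminf (\<lambda>k. ennreal ((f p x - f (R k) x)\<^sup>2))"
        using conv
      proof (rule eventually_mono)
        fix x assume "(\<lambda>k. f (R k) x) \<longlonglongrightarrow> g x"
        then have "(\<lambda>k. ennreal ((f p x - f (R k) x)\<^sup>2)) \<longlonglongrightarrow> ennreal ((f p x - g x)\<^sup>2)"
          by (intro tendsto_intros)
        then show "ennreal ((f p x - g x)\<^sup>2) = liminf (\<lambda>k. ennreal ((f p x - f (R k) x)\<^sup>2))"
          by (rule lim_imp_Liminf[OF sequentially_bot, symmetric])
      qed
    qed
    also have "\<dots> \<le> liminf (\<lambda>k. \<integral>\<^sup>+x. ennreal ((f p x - f (R k) x)\<^sup>2) \<partial>M)"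
      by (rule nn_integral_liminf) measurable
    also have "\<dots> \<le> ennreal ((1/4) ^ n)"
    proof (rule Liminf_le)
      show "\<forall>\<^sub>F k in sequentially. (\<integral>\<^sup>+x. ennreal ((f p x - f (R k) x)\<^sup>2) \<partial>M) \<le> ennreal ((1/4) ^ n)"
        using eventually_ge_at_top[of n]
      proof (rule eventually_mono)
        fix k assume k: "n \<le> k"
        have "R n \<le> R k" using incseqD[OF incseq_SucI[of R, OF R(2)] k] .
        then have "(LINT x|M. (f p x - f (R k) x)\<^sup>2) \<le> (1/4) ^ n"
          using m[OF p, of "R k"] R(1)[of n] by simp
        moreover have "integrable M (\<lambda>x. (f p x - f (R k) x)\<^sup>2)" using d unfolding sqint_def by simp
        ultimately show "(\<integral>\<^sup>+x. ennreal ((f p x - f (R k) x)\<^sup>2) \<partial>M) \<le> ennreal ((1/4) ^ n)"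
          by (simp add: nn_integral_eq_integral)
      qed
    qed simp
    finally show ?thesis .
  qed
  have int: "integrable M (\<lambda>x. (f p x - g x)\<^sup>2)" if "p \<ge> m n" for n p
  proof (rule integrableI_bounded)
    show "(\<integral>\<^sup>+x. ennreal (norm ((f p x - g x)\<^sup>2)) \<partial>M) < \<infinity>"
      using fatou[OF that] le_less_trans[of _ "ennreal ((1/4) ^ n)" top] by simp
  qed measurable
  have le: "(LINT x|M. (f p x - g x)\<^sup>2) \<le> (1/4) ^ n" if "p \<ge> m n" for n p
    using fatou[OF that] nn_integral_eq_integral[OF int[OF that]] by (simp add: ennreal_le_iff)
  have "(\<lambda>x. f (m 0) x - g x) \<in> sqint M" using int[of 0 "m 0"] unfolding sqint_def by simp
  from lin_spaceD(3)[OF lin_space_sqint f[of "m 0"] this] have "g \<in> sqint M" by simp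
  moreover have "(\<lambda>n. LINT x|M. (f n x - g x)\<^sup>2) \<longlonglongrightarrow> 0"
  proof (rule LIMSEQ_I)
    fix e :: real assume "0 < e"
    then obtain n where n: "(1/4) ^ n < e" using real_arch_pow_inv[of e "1/4"] by auto
    have "norm ((LINT x|M. (f p x - g x)\<^sup>2) - 0) < e" if "p \<ge> m n" for p
      using le[OF that] n by (simp add: order.strict_trans1)
    then show "\<exists>no. \<forall>p\<ge>no. norm ((LINT x|M. (f p x - g x)\<^sup>2) - 0) < e" by blast
  qed
  ultimately show ?thesis using that by blast
qed

section \<open>Uniqueness of weak derivatives\<close>

text \<open>Difference quotients of \<open>F\<close> have integral zero by translation invariance,
  and they converge dominatedly to \<open>G\<close>. This is the integration by parts used below,
  applied to a product.\<close>

lemma integral_directional_derivative: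
  fixes F G :: "'a::euclidean_space \<Rightarrow> real"
  assumes der: "\<And>x t. ((\<lambda>t. F (x + t *\<^sub>R e)) has_real_derivative G (x + t *\<^sub>R e)) (at t)"
    and cF: "continuous_on UNIV F" and cG: "continuous_on UNIV G"
    and supp: "\<And>x. x \<notin> cball c r \<Longrightarrow> F x = 0" "\<And>x. x \<notin> cball c r \<Longrightarrow> G x = 0"
  shows "integral\<^sup>L lborel G = 0"
proof -
  obtain B where B: "\<And>x. \<bar>G x\<bar> \<le> B"
  proof -
    have "compact (G ` cball c r)" using cG by (intro compact_continuous_image) (auto intro: continuous_on_subset)
    then obtain B where "\<And>x. x \<in> cball c r \<Longrightarrow> \<bar>G x\<bar> \<le> B"
      using compact_imp_bounded bounded_iff by (metis image_eqI real_norm_def)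
    then have "\<bar>G x\<bar> \<le> max B 0" for x using supp(2)[of x] by (cases "x \<in> cball c r") fastforce+
    then show ?thesis using that by blast
  qed
  then have B0: "0 \<le> B" using abs_ge_zero order_trans by blast
  have intF: "integrable lborel F"
  proof -
    have "F = (\<lambda>x. indicator (cball c r) x *\<^sub>R F x)"
      using supp(1) unfolding indicator_def by (intro ext) (auto simp del: mem_cball)
    then show ?thesis using borel_integrable_compact[of "cball c r" F] cF continuous_on_subset
      by (metis compact_cball subset_UNIV)
  qed
  define h where "h n = 1 / real (Suc n)" for n
  have h: "0 < h n" "h n \<le> 1" for n unfolding h_def by auto
  define Q where "Q n x = (F (x + h n *\<^sub>R e) - F x) / h n" for n x
  have intFh: "integrable lborel (\<lambda>x. F (x + v))" "integral\<^sup>L lborel (\<lambda>x. F (x + v)) = integral\<^sup>L lborel F" for v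
  proof -
    have *: "distr lborel borel (\<lambda>x. x + v) = lborel"
    proof -
      have "(\<lambda>x. x + v) = (+) v" by (intro ext) (rule add.commute)
      then show ?thesis using lborel_distr_plus[of v] by simp
    qed
    have Fm: "F \<in> borel_measurable borel" using cF borel_measurable_continuous_onI by blast
    have "integrable (distr lborel borel (\<lambda>x. x + v)) F" using intF unfolding * .
    then show "integrable lborel (\<lambda>x. F (x + v))"
      using integrable_distr_eq[of "\<lambda>x. x + v" lborel borel F] Fm by simp
    show "integral\<^sup>L lborel (\<lambda>x. F (x + v)) = integral\<^sup>L lborel F"
      using integral_distr[of "\<lambda>x. x + v" lborel borel F] Fm unfolding * by simp
  qed
  have Q0: "integral\<^sup>L lborel (Q n) = 0" for n
    unfolding Q_def using intF intFh by simp
  \<comment> \<open>The increments have norm at most \<open>norm e\<close>, whence the enlarged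
    ball; inside it the mean value theorem bounds the quotients by \<open>B\<close>.\<close>
  have "(\<lambda>n. integral\<^sup>L lborel (Q n)) \<longlonglongrightarrow> integral\<^sup>L lborel G"
  proof (rule integral_dominated_convergence[where w = "\<lambda>x. B * indicator (cball c (r + norm e)) x"])
    show "G \<in> borel_measurable lborel" using cG borel_measurable_continuous_onI by auto
    show "Q n \<in> borel_measurable lborel" for n
      unfolding Q_def using intFh(1)[of "h n *\<^sub>R e"] intF by (auto dest!: borel_measurable_integrable)
    show "integrable lborel (\<lambda>x. B * indicator (cball c (r + norm e)) x)"
      by (intro integrable_mult_right integrable_real_indicator emeasure_bounded_finite) auto
    have "(\<lambda>n. Q n x) \<longlonglongrightarrow> G x" for x
    proof -
      have "((\<lambda>t. (F (x + t *\<^sub>R e) - F x) / t) \<longlongrightarrow> G x) (at 0)"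
        using der[of x 0] by (simp add: has_field_derivative_iff)
      moreover have "filterlim h (at 0) sequentially"
        unfolding filterlim_at h_def using LIMSEQ_inverse_real_of_nat by (auto simp: inverse_eq_divide)
      ultimately show ?thesis unfolding Q_def using filterlim_compose by blast
    qed
    then show "AE x in lborel. (\<lambda>n. Q n x) \<longlonglongrightarrow> G x" by simp
    have "\<bar>Q n x\<bar> \<le> B * indicator (cball c (r + norm e)) x" for n x
    proof (cases "x \<in> cball c (r + norm e)")
      case True
      obtain z where z: "0 < z" "z < h n" "F (x + h n *\<^sub>R e) - F (x + 0 *\<^sub>R e) = (h n - 0) * G (x + z *\<^sub>R e)"
        using MVT2[of 0 "h n" "\<lambda>t. F (x + t *\<^sub>R e)" "\<lambda>t. G (x + t *\<^sub>R e)"] h(1) der by blast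
      then have "Q n x = G (x + z *\<^sub>R e)" unfolding Q_def using h(1)[of n] by simp
      then show ?thesis using B True by simp
    next
      case False
      have n1: "norm (h n *\<^sub>R e) \<le> norm e" using h[of n] by (simp add: mult_left_le_one_le)
      have "r + norm e < dist c x" using False by simp
      moreover have "dist c x \<le> dist c (x + h n *\<^sub>R e) + norm (h n *\<^sub>R e)"
        using dist_triangle[of c x "x + h n *\<^sub>R e"] by (simp add: dist_norm)
      ultimately have "x + h n *\<^sub>R e \<notin> cball c r" "x \<notin> cball c r" using n1 norm_ge_zero[of e] unfolding mem_cball by linarith+
      then show ?thesis unfolding Q_def using supp(1) False by simp
    qed
    then show "AE x in lborel. norm (Q n x) \<le> B * indicator (cball c (r + norm e)) x" for n by simp
  qed
  then show ?thesis using Q0 by (simp add: LIMSEQ_const_iff)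
qed

section \<open>Explicit test functions on balls\<close>

text \<open>Squaring the positive part makes the function continuously differentiable, which is the
  regularity that one integration by parts consumes.\<close>

definition bump :: "'a::euclidean_space \<Rightarrow> real \<Rightarrow> 'a \<Rightarrow> real" where
  "bump c r x = (max 0 (r\<^sup>2 - (x - c) \<bullet> (x - c)))\<^sup>2"

definition bump_deriv :: "'a::euclidean_space \<Rightarrow> real \<Rightarrow> 'a \<Rightarrow> 'a \<Rightarrow> real" where
  "bump_deriv c r e x = - 4 * max 0 (r\<^sup>2 - (x - c) \<bullet> (x - c)) * ((x - c) \<bullet> e)"

lemma max_square_deriv: "((\<lambda>t. (max 0 t)\<^sup>2) has_real_derivative 2 * max 0 t) (at (t::real))"
proof -
  consider "t < 0" | "t > 0" | "t = 0" by linarith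
  then show ?thesis
  proof cases
    case 1
    have "((\<lambda>t. 0) has_real_derivative 0) (at t)" by simp
    moreover have "\<forall>\<^sub>F x in nhds t. 0 = (max 0 x)\<^sup>2"
      using eventually_nhds_in_open[of "{..<0}" t] 1 by (auto elim!: eventually_mono)
    ultimately show ?thesis using 1 by (subst DERIV_cong_ev[OF refl _ refl, where g = "\<lambda>t. 0"]) (auto elim: eventually_mono)
  next
    case 2
    have "((\<lambda>t. t\<^sup>2) has_real_derivative 2 * t) (at t)" by (auto intro!: derivative_eq_intros)
    moreover have "\<forall>\<^sub>F x in nhds t. (max 0 x)\<^sup>2 = x\<^sup>2"
      using eventually_nhds_in_open[of "{0<..}" t] 2 by (auto elim!: eventually_mono)
    ultimately show ?thesis using 2 by (subst DERIV_cong_ev[OF refl _ refl, where g = "\<lambda>t. t\<^sup>2"]) auto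
  next
    case 3
    have "((\<lambda>h. (max 0 h)\<^sup>2 / h) \<longlongrightarrow> 0) (at (0::real))"
    proof (rule Lim_null_comparison[where g = "\<lambda>h. \<bar>h\<bar>"])
      show "\<forall>\<^sub>F h in at 0. norm ((max 0 h)\<^sup>2 / h) \<le> \<bar>h::real\<bar>"
        by (intro always_eventually allI) (auto simp: max_def power2_eq_square)
      show "((\<lambda>h. \<bar>h::real\<bar>) \<longlongrightarrow> 0) (at 0)" by (intro tendsto_rabs_zero tendsto_ident_at)
    qed
    then show ?thesis using 3 by (simp add: has_field_derivative_iff)
  qed
qed

lemma bump_line_deriv:
  "((\<lambda>t. bump c r (x + t *\<^sub>R e)) has_real_derivative bump_deriv c r e (x + t *\<^sub>R e)) (at t)"
proof -
  let ?q = "\<lambda>t. r\<^sup>2 - (x + t *\<^sub>R e - c) \<bullet> (x + t *\<^sub>R e - c)"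
  have "(?q has_real_derivative - 2 * ((x + t *\<^sub>R e - c) \<bullet> e)) (at t)"
    unfolding has_field_derivative_def
    by (auto intro!: derivative_eq_intros simp: inner_commute algebra_simps)
  from DERIV_chain2[OF max_square_deriv this] show ?thesis
    unfolding bump_def bump_deriv_def by (simp add: algebra_simps)
qed

lemma continuous_bump: "continuous_on A (bump c r)" "continuous_on A (bump_deriv c r e)"
  unfolding bump_def bump_deriv_def by (auto intro!: continuous_intros)

lemma bump_zero:
  assumes "x \<notin> cball c r" "0 < r" shows "bump c r x = 0" "bump_deriv c r e x = 0"
proof -
  have "r < norm (x - c)" using assms unfolding mem_cball dist_norm not_le by (subst norm_minus_commute)
  then have "r\<^sup>2 < (norm (x - c))\<^sup>2" using assms(2) by (intro power_strict_mono) auto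
  then show "bump c r x = 0" "bump_deriv c r e x = 0"
    unfolding bump_def bump_deriv_def by (simp_all add: power2_norm_eq_inner)
qed

lemma bump_pos:
  assumes "x \<in> ball c r" shows "0 < bump c r x"
proof -
  have "norm (x - c) < r" using assms unfolding mem_ball dist_norm by (subst norm_minus_commute)
  then have "(norm (x - c))\<^sup>2 < r\<^sup>2" by (rule power_strict_mono) simp_all
  then show ?thesis unfolding bump_def by (simp add: power2_norm_eq_inner)
qed

lemma compact_support_L2:
  fixes f :: fld
  assumes "continuous_on UNIV f" "\<And>x. x \<notin> cball c r \<Longrightarrow> f x = 0" "D \<in> sets lebesgue"
  shows "f \<in> L2 D"
proof -
  have m: "f \<in> borel_measurable lebesgue"
    by (intro measurable_completion) (simp add: borel_measurable_continuous_onI[OF assms(1)])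
  have "(\<lambda>x. (f x)\<^sup>2) = (\<lambda>x. indicator (cball c r) x *\<^sub>R (f x)\<^sup>2)"
    using assms(2) unfolding indicator_def by (intro ext) (auto simp del: mem_cball)
  moreover have "integrable lborel (\<lambda>x. indicator (cball c r) x *\<^sub>R (f x)\<^sup>2)"
    by (intro borel_integrable_compact continuous_intros continuous_on_subset[OF assms(1)]) auto
  ultimately have "integrable lborel (\<lambda>x. (f x)\<^sup>2)" by simp
  then have "integrable lebesgue (\<lambda>x. (f x)\<^sup>2)"
    using integrable_completion[of "\<lambda>x. (f x)\<^sup>2" lborel] borel_measurable_integrable by blast
  then have "integrable lebesgue (\<lambda>x. indicator D x *\<^sub>R (f x)\<^sup>2)"
    using assms(3) integrable_mult_indicator by blast
  then have "integrable (lebesgue_on D) (\<lambda>x. (f x)\<^sup>2)"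
    using assms(3) by (simp add: integrable_restrict_space)
  moreover have "f \<in> borel_measurable (lebesgue_on D)"
    using m by (rule measurable_restrict_space1)
  ultimately show ?thesis unfolding L2_def by simp
qed

lemma integral_compact_support:
  fixes f :: fld
  assumes "continuous_on UNIV f" "\<And>x. x \<notin> cball c r \<Longrightarrow> f x = 0" "D \<in> sets lebesgue" "cball c r \<subseteq> D"
  shows "(LINT x|lebesgue_on D. f x) = integral\<^sup>L lborel f"
proof -
  have "(LINT x|lebesgue_on D. f x) = (LINT x|lebesgue. indicator D x *\<^sub>R f x)"
    using assms(3) by (simp add: integral_restrict_space)
  also have "(\<lambda>x. indicator D x *\<^sub>R f x) = f"
    using assms(2,4) unfolding indicator_def by (intro ext) (auto simp del: mem_cball)
  also have "integral\<^sup>L lebesgue f = integral\<^sup>L lborel f"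
    by (rule integral_completion) (simp add: borel_measurable_continuous_onI[OF assms(1)])
  finally show ?thesis .
qed

text \<open>Testing the weak derivative \<open>g\<close> of the zero function with \<open>bump * du n\<close>, instead of with all
  test functions, yields \<open>\<integral> bump * g\<^sup>2 = 0\<close> in the limit.\<close>

lemma weak_derivative_unique:
  fixes u du ddu :: "nat \<Rightarrow> fld"
  assumes D: "open D"
    and cont: "\<And>n. continuous_on UNIV (u n)" "\<And>n. continuous_on UNIV (du n)" "\<And>n. continuous_on UNIV (ddu n)"
    and der: "\<And>n x t. ((\<lambda>t. u n (x + t *\<^sub>R e)) has_real_derivative du n (x + t *\<^sub>R e)) (at t)"
      "\<And>n x t. ((\<lambda>t. du n (x + t *\<^sub>R e)) has_real_derivative ddu n (x + t *\<^sub>R e)) (at t)"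
    and conv: "L2_conv D u z" "L2_conv D du g"
    and z: "AE x in lebesgue_on D. z x = 0"
  shows "AE x in lebesgue_on D. g x = 0"
proof -
  have Dm: "D \<in> sets lebesgue" using D by simp
  have zL: "z \<in> L2 D" and gL: "g \<in> L2 D" and duL: "du n \<in> L2 D" and uL: "u n \<in> L2 D" for n
    using conv unfolding L2_conv_def by auto
  have loc: "AE x in lebesgue_on D. x \<in> ball c r \<longrightarrow> g x = 0" if cr: "cball c r \<subseteq> D" "0 < r" for c r
  proof -
    define s where "s = bump c r"
    define s' where "s' = bump_deriv c r e"
    have sc: "continuous_on UNIV s" "continuous_on UNIV s'" unfolding s_def s'_def by (rule continuous_bump)+
    have s0: "s x = 0" "s' x = 0" if "x \<notin> cball c r" for x
      using bump_zero[OF that cr(2)] unfolding s_def s'_def by auto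
    define \<phi> where "\<phi> n x = s x * du n x" for n x
    \<comment> \<open>The derivative of \<open>\<phi> n\<close> along \<open>e\<close>. It contains
      \<open>ddu n\<close>, for which no convergence is assumed, so \<open>n\<close> stays fixed
      while the index \<open>k\<close> of \<open>u k\<close> and \<open>du k\<close> tends to
      infinity.\<close>
    define \<eta> where "\<eta> n x = s' x * du n x + s x * ddu n x" for n x
    have \<phi>L: "\<phi> n \<in> L2 D" and \<eta>L: "\<eta> n \<in> L2 D" for n
    proof -
      show "\<phi> n \<in> L2 D"
        by (rule compact_support_L2[where c = c and r = r, OF _ _ Dm])
          (simp_all add: \<phi>_def s0 sc cont continuous_on_mult del: mem_cball)
      show "\<eta> n \<in> L2 D"
        by (rule compact_support_L2[where c = c and r = r, OF _ _ Dm])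
          (simp_all add: \<eta>_def s0 sc cont continuous_on_mult continuous_on_add del: mem_cball)
    qed
    have ibp: "ip D (du k) (\<phi> n) = - ip D (u k) (\<eta> n)" for k n
    proof -
      let ?F = "\<lambda>x. u k x * \<phi> n x" and ?G = "\<lambda>x. du k x * \<phi> n x + u k x * \<eta> n x"
      have cG: "continuous_on UNIV ?G" and cF: "continuous_on UNIV ?F"
        unfolding \<phi>_def \<eta>_def by (intro continuous_intros sc cont)+
      have G0: "?G x = 0" if "x \<notin> cball c r" for x using s0[OF that] unfolding \<phi>_def \<eta>_def by simp
      have "integral\<^sup>L lborel ?G = 0"
      proof (rule integral_directional_derivative[OF _ cF cG])
        show "((\<lambda>t. ?F (x + t *\<^sub>R e)) has_real_derivative ?G (x + t *\<^sub>R e)) (at t)" for x t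
        proof -
          have "((\<lambda>t. s (x + t *\<^sub>R e)) has_real_derivative s' (x + t *\<^sub>R e)) (at t)"
            unfolding s_def s'_def by (rule bump_line_deriv)
          from DERIV_mult[OF der(1)[of k] DERIV_mult[OF this der(2)[of n]]]
          show ?thesis unfolding \<phi>_def \<eta>_def by (rule DERIV_cong) (simp add: algebra_simps)
        qed
        show "?F x = 0" if "x \<notin> cball c r" for x using s0[OF that] unfolding \<phi>_def by simp
        show "?G x = 0" if "x \<notin> cball c r" for x using G0[OF that] .
      qed
      moreover have "(LINT x|lebesgue_on D. ?G x) = integral\<^sup>L lborel ?G"
        by (rule integral_compact_support[OF cG _ Dm cr(1)]) (rule G0)
      ultimately have "(LINT x|lebesgue_on D. ?G x) = 0" by simp
      moreover have "integrable (lebesgue_on D) (\<lambda>x. du k x * \<phi> n x)" "integrable (lebesgue_on D) (\<lambda>x. u k x * \<eta> n x)"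
        using duL uL \<phi>L \<eta>L by (simp_all add: sqint_mult_integrable L2_eq_sqint)
      ultimately show ?thesis by (simp add: ip_real)
    qed
    have g\<phi>: "ip D g (\<phi> n) = 0" for n
    proof -
      have "(\<lambda>k. ip D (du k) (\<phi> n)) \<longlonglongrightarrow> - ip D z (\<eta> n)"
        unfolding ibp by (intro tendsto_minus L2_conv_weak conv \<eta>L)
      moreover have "ip D z (\<eta> n) = ip D (\<lambda>x. 0) (\<eta> n)"
        by (intro ip_cong_AE zL \<eta>L z lin_space_zero lin_space_L2) simp
      ultimately have "(\<lambda>k. ip D (du k) (\<phi> n)) \<longlonglongrightarrow> 0" by (simp add: ip_real)
      then show ?thesis using LIMSEQ_unique[OF L2_conv_weak[OF conv(2) \<phi>L[of n]]] by simp
    qed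
    have smeas: "s \<in> borel_measurable (lebesgue_on D)"
      using sc(1) by (intro measurable_restrict_space1 measurable_completion) (simp add: borel_measurable_continuous_onI)
    have "\<bar>s x\<bar> \<le> (r\<^sup>2)\<^sup>2" for x
      unfolding s_def bump_def abs_power2 by (intro power_mono) auto
    then have sg: "(\<lambda>x. s x * g x) \<in> L2 D"
      using sqint_bounded_mult[OF _ smeas, of g "(r\<^sup>2)\<^sup>2"] gL by (simp add: L2_eq_sqint)
    \<comment> \<open>Moving the weight from \<open>du n\<close> to \<open>g\<close> leaves a fixed
      test function, so the limit in \<open>n\<close> is again one of weak convergence.\<close>
    have "ip D (du n) (\<lambda>x. s x * g x) = 0" for n
      using g\<phi>[of n] unfolding ip_real \<phi>_def by (simp add: ac_simps)
    then have "ip D g (\<lambda>x. s x * g x) = 0"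
      using L2_conv_weak[OF conv(2) sg] by (simp add: LIMSEQ_const_iff)
    then have "(LINT x|lebesgue_on D. g x * (s x * g x)) = 0" by (simp add: ip_real)
    moreover have "integrable (lebesgue_on D) (\<lambda>x. g x * (s x * g x))"
      using gL sg by (simp add: sqint_mult_integrable L2_eq_sqint)
    moreover have "0 \<le> g x * (s x * g x)" for x
    proof -
      have "0 \<le> s x" unfolding s_def bump_def by (rule zero_le_power2)
      then have "0 \<le> s x * (g x * g x)" by simp
      then show ?thesis by (simp only: mult.left_commute)
    qed
    ultimately have "AE x in lebesgue_on D. g x * (s x * g x) = 0"
      using integral_nonneg_eq_0_iff_AE[of "lebesgue_on D" "\<lambda>x. g x * (s x * g x)"] by blast
    then show ?thesis
    proof (rule eventually_mono, intro impI)
      fix x assume "g x * (s x * g x) = 0" "x \<in> ball c r"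
      moreover from this(2) have "s x \<noteq> 0" unfolding s_def using bump_pos[of x c r] by linarith
      ultimately show "g x = 0" by simp
    qed
  qed
  \<comment> \<open>Passing to a countable subcover allows the exceptional null sets of the balls to
    be united.\<close>
  define \<F> where "\<F> = {ball c r | c r. cball c r \<subseteq> D \<and> 0 < r}"
  obtain \<F>' where F': "\<F>' \<subseteq> \<F>" "countable \<F>'" "\<Union>\<F>' = \<Union>\<F>"
    using Lindelof[of \<F>] unfolding \<F>_def by auto
  have "x \<in> \<Union>\<F>" if x: "x \<in> D" for x
  proof -
    obtain r where "0 < r" "cball x r \<subseteq> D" using D x unfolding open_contains_cball by blast
    then have "ball x r \<in> \<F>" "x \<in> ball x r" unfolding \<F>_def by auto
    then show ?thesis by blast
  qed
  then have cov: "D \<subseteq> \<Union>\<F>'" using F'(3) by blast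
  have "AE x in lebesgue_on D. \<forall>B\<in>\<F>'. x \<in> B \<longrightarrow> g x = 0"
    unfolding AE_ball_countable[OF F'(2)]
  proof
    fix B assume "B \<in> \<F>'"
    then obtain c r where "B = ball c r" "cball c r \<subseteq> D" "0 < r" using F'(1) unfolding \<F>_def by blast
    then show "AE x in lebesgue_on D. x \<in> B \<longrightarrow> g x = 0" using loc[of c r] by simp
  qed
  moreover have "AE x in lebesgue_on D. x \<in> D"
    using AE_space[of "lebesgue_on D"] by (simp add: space_restrict_space)
  ultimately show ?thesis
  proof (rule eventually_elim2)
    show "g x = 0" if "\<forall>B\<in>\<F>'. x \<in> B \<longrightarrow> g x = 0" "x \<in> D" for x using that cov by blast
  qed
qed

section \<open>Sobolev functions\<close>

lemma smooth_jet_comb: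
  assumes "smooth_jet J" "smooth_jet J'" shows "smooth_jet (\<lambda>i j x. a * J i j x + b * J' i j x)"
  unfolding smooth_jet_def
proof (intro allI)
  fix i j x
  have "((\<lambda>x. a * J i j x + b * J' i j x) has_derivative
    (\<lambda>d. a * (J (Suc i) j x * d $ 1 + J i (Suc j) x * d $ 2) + b * (J' (Suc i) j x * d $ 1 + J' i (Suc j) x * d $ 2))) (at x)"
    using assms unfolding smooth_jet_def by (intro has_derivative_add has_derivative_mult_right) blast+
  then show "((\<lambda>x. a * J i j x + b * J' i j x) has_derivative
    (\<lambda>d. (a * J (Suc i) j x + b * J' (Suc i) j x) * d $ 1 + (a * J i (Suc j) x + b * J' i (Suc j) x) * d $ 2)) (at x)"
    by (rule has_derivative_eq_rhs) (auto simp: algebra_simps)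
qed

lemma smooth_jet_shift: "smooth_jet J \<Longrightarrow> smooth_jet (\<lambda>i j. J (i + p) (j + q))"
  unfolding smooth_jet_def by simp

lemma smooth_jet_continuous: "smooth_jet J \<Longrightarrow> continuous_on A (J i j)"
  unfolding smooth_jet_def
  by (intro continuous_at_imp_continuous_on ballI has_derivative_continuous) blast

lemma smooth_jet_line:
  assumes "smooth_jet J"
  shows "((\<lambda>t. J i j (x + t *\<^sub>R e)) has_real_derivative
    J (Suc i) j (x + t *\<^sub>R e) * e $ 1 + J i (Suc j) (x + t *\<^sub>R e) * e $ 2) (at t)"
proof -
  have "((\<lambda>t. x + t *\<^sub>R e) has_derivative (\<lambda>s. s *\<^sub>R e)) (at t)"
    by (auto intro!: derivative_eq_intros)
  moreover have "(J i j has_derivative (\<lambda>d. J (Suc i) j (x + t *\<^sub>R e) * d $ 1 + J i (Suc j) (x + t *\<^sub>R e) * d $ 2))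
      (at (x + t *\<^sub>R e))"
    using assms unfolding smooth_jet_def by blast
  ultimately have "((\<lambda>t. J i j (x + t *\<^sub>R e)) has_derivative
     (\<lambda>s. J (Suc i) j (x + t *\<^sub>R e) * (s *\<^sub>R e) $ 1 + J i (Suc j) (x + t *\<^sub>R e) * (s *\<^sub>R e) $ 2)) (at t)"
    by (rule has_derivative_compose)
  then show ?thesis unfolding has_field_derivative_def
    by (rule has_derivative_eq_rhs) (auto simp: algebra_simps)
qed

lemma has_sob_derivs_L2: "has_sob_derivs m D v W \<Longrightarrow> i + j \<le> m \<Longrightarrow> W i j \<in> L2 D"
  unfolding has_sob_derivs_def L2_conv_def by blast

lemma has_sob_derivs_mono: "has_sob_derivs m D v W \<Longrightarrow> l \<le> m \<Longrightarrow> has_sob_derivs l D v W"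
  unfolding has_sob_derivs_def by (meson le_trans)

lemma sobolev_mono: "l \<le> m \<Longrightarrow> sobolev m D \<subseteq> sobolev l D"
  unfolding sobolev_def using has_sob_derivs_mono by blast

lemma sobolev_L2: "v \<in> sobolev m D \<Longrightarrow> v \<in> L2 D"
  unfolding sobolev_def has_sob_derivs_def L2_conv_def by fastforce

lemma has_sob_derivs_comb:
  assumes "has_sob_derivs m D v W" "has_sob_derivs m D v' W'"
  shows "has_sob_derivs m D (\<lambda>x. a * v x + b * v' x) (\<lambda>i j x. a * W i j x + b * W' i j x)"
proof -
  obtain J J' where J: "\<And>n. smooth_jet (J n)" "\<And>i j. i + j \<le> m \<Longrightarrow> L2_conv D (\<lambda>n. J n i j) (W i j)"
    and J': "\<And>n. smooth_jet (J' n)" "\<And>i j. i + j \<le> m \<Longrightarrow> L2_conv D (\<lambda>n. J' n i j) (W' i j)"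
    using assms unfolding has_sob_derivs_def by metis
  show ?thesis unfolding has_sob_derivs_def
  proof (intro conjI exI allI impI)
    show "(\<lambda>x. a * W 0 0 x + b * W' 0 0 x) = (\<lambda>x. a * v x + b * v' x)"
      using assms unfolding has_sob_derivs_def by simp
    show "smooth_jet (\<lambda>i j x. a * J n i j x + b * J' n i j x)" for n
      by (rule smooth_jet_comb[OF J(1) J'(1)])
    show "L2_conv D (\<lambda>n x. a * J n i j x + b * J' n i j x) (\<lambda>x. a * W i j x + b * W' i j x)" if "i + j \<le> m" for i j
      using L2_conv_comb[OF J(2)[OF that] J'(2)[OF that]] .
  qed
qed

text \<open>The difference of the two families consists of weak derivatives of a null function. They
  are reached from order zero by steps along the first axis, then along the second. The orders
  \<open>m\<close> and \<open>m'\<close> may differ, because \<open>pd\<close> picks a family of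
  order \<open>i + j\<close> only.\<close>

lemma sob_derivs_unique:
  assumes D: "open D" and W: "has_sob_derivs m D v W" and W': "has_sob_derivs m' D v' W'"
    and v: "AE x in lebesgue_on D. v x = v' x" and "i + j \<le> m" "i + j \<le> m'"
  shows "AE x in lebesgue_on D. W i j x = W' i j x"
proof -
  define l where "l = min m m'"
  have ij: "i + j \<le> l" using assms(5,6) unfolding l_def by simp
  define E where "E i j x = 1 * W i j x + (-1) * W' i j x" for i j x
  have "has_sob_derivs l D (\<lambda>x. 1 * v x + (-1) * v' x) E"
    unfolding E_def using has_sob_derivs_comb[OF has_sob_derivs_mono[OF W] has_sob_derivs_mono[OF W'], of l 1 "-1"]
    by (simp add: l_def)
  then obtain J where E0: "E 0 0 = (\<lambda>x. 1 * v x + (-1) * v' x)" and J: "\<And>n. smooth_jet (J n)"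
    and c: "\<And>i j. i + j \<le> l \<Longrightarrow> L2_conv D (\<lambda>n. J n i j) (E i j)"
    unfolding has_sob_derivs_def by blast
  have 00: "AE x in lebesgue_on D. E 0 0 x = 0" unfolding E0 using v by (rule eventually_mono) simp
  have cont: "continuous_on UNIV (J n i j)" for n i j using smooth_jet_continuous[OF J] .
  have 1: "AE x in lebesgue_on D. E (Suc i) j x = 0" if "AE x in lebesgue_on D. E i j x = 0" "Suc i + j \<le> l" for i j
  proof (rule weak_derivative_unique[OF D cont cont cont _ _ _ _ that(1)])
    show "((\<lambda>t. J n i j (x + t *\<^sub>R axis 1 1)) has_real_derivative J n (Suc i) j (x + t *\<^sub>R axis 1 1)) (at t)" for n x t
      using smooth_jet_line[OF J, of n i j x "axis 1 1" t] by (simp add: axis_def)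
    show "((\<lambda>t. J n (Suc i) j (x + t *\<^sub>R axis 1 1)) has_real_derivative J n (Suc (Suc i)) j (x + t *\<^sub>R axis 1 1)) (at t)" for n x t
      using smooth_jet_line[OF J, of n "Suc i" j x "axis 1 1" t] by (simp add: axis_def)
    show "L2_conv D (\<lambda>n. J n i j) (E i j)" "L2_conv D (\<lambda>n. J n (Suc i) j) (E (Suc i) j)"
      using c that(2) by auto
  qed
  have 2: "AE x in lebesgue_on D. E i (Suc j) x = 0" if "AE x in lebesgue_on D. E i j x = 0" "i + Suc j \<le> l" for i j
  proof (rule weak_derivative_unique[OF D cont cont cont _ _ _ _ that(1)])
    show "((\<lambda>t. J n i j (x + t *\<^sub>R axis 2 1)) has_real_derivative J n i (Suc j) (x + t *\<^sub>R axis 2 1)) (at t)" for n x t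
      using smooth_jet_line[OF J, of n i j x "axis 2 1" t] by (simp add: axis_def)
    show "((\<lambda>t. J n i (Suc j) (x + t *\<^sub>R axis 2 1)) has_real_derivative J n i (Suc (Suc j)) (x + t *\<^sub>R axis 2 1)) (at t)" for n x t
      using smooth_jet_line[OF J, of n i "Suc j" x "axis 2 1" t] by (simp add: axis_def)
    show "L2_conv D (\<lambda>n. J n i j) (E i j)" "L2_conv D (\<lambda>n. J n i (Suc j)) (E i (Suc j))"
      using c that(2) by auto
  qed
  have "i \<le> l \<Longrightarrow> AE x in lebesgue_on D. E i 0 x = 0" for i
    by (induction i) (use 00 1[of _ 0] in auto)
  then have "i + j \<le> l \<Longrightarrow> AE x in lebesgue_on D. E i j x = 0" for i j
    by (induction j) (use 2[of i] in auto)
  then have "AE x in lebesgue_on D. E i j x = 0" using ij by blast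
  then show ?thesis unfolding E_def by (rule eventually_mono) simp
qed

section \<open>The chosen derivatives \<open>pd\<close> and their energies\<close>

lemma pd_has_sob_derivs:
  assumes "v \<in> sobolev m D" "i + j \<le> m"
  obtains W where "has_sob_derivs (i + j) D v W" "pd D i j v = W i j"
proof -
  obtain W0 where "has_sob_derivs (i + j) D v W0"
    using assms(1) has_sob_derivs_mono[OF _ assms(2)] unfolding sobolev_def by blast
  then have "\<exists>w. \<exists>W. has_sob_derivs (i + j) D v W \<and> W i j = w" by blast
  then have "\<exists>W. has_sob_derivs (i + j) D v W \<and> W i j = pd D i j v"
    unfolding pd_def by (rule someI_ex)
  then show ?thesis using that by metis
qed

lemma pd_AE:
  assumes "open D" "has_sob_derivs m D v W" "i + j \<le> m"
  shows "AE x in lebesgue_on D. pd D i j v x = W i j x"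
proof -
  obtain W' where "has_sob_derivs (i + j) D v W'" "pd D i j v = W' i j"
    using pd_has_sob_derivs[of v m D i j] assms(2,3) unfolding sobolev_def by blast
  then show ?thesis using sob_derivs_unique[OF assms(1) _ assms(2), of "i + j" v W' i j] assms(3) by simp
qed

lemma pd_L2:
  assumes "v \<in> sobolev m D" "i + j \<le> m" shows "pd D i j v \<in> L2 D"
  using pd_has_sob_derivs[OF assms] has_sob_derivs_L2 by (metis order_refl)

lemma smooth_jet_sobolev:
  assumes "smooth_jet J" "\<And>i j. i + j \<le> m \<Longrightarrow> J i j \<in> L2 D"
  shows "has_sob_derivs m D (J 0 0) J"
  unfolding has_sob_derivs_def L2_conv_def using assms
  by (intro conjI exI[of _ "\<lambda>n. J"]) (auto simp: L2norm_def ip_def)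

lemma lin_space_sobolev: "lin_space (sobolev m D)"
proof -
  have "smooth_jet (\<lambda>i j x. 0)" unfolding smooth_jet_def by simp
  moreover have "(\<lambda>x. 0) \<in> L2 D" using lin_space_zero lin_space_L2 by blast
  ultimately have "has_sob_derivs m D (\<lambda>x. 0) (\<lambda>i j x. 0)" using smooth_jet_sobolev by blast
  then have "sobolev m D \<noteq> {}" unfolding sobolev_def by blast
  moreover have "(\<lambda>x. a * v x + b * w x) \<in> sobolev m D" if vw: "v \<in> sobolev m D" "w \<in> sobolev m D" for v w a b
  proof -
    obtain W W' where "has_sob_derivs m D v W" "has_sob_derivs m D w W'" using vw unfolding sobolev_def by blast
    from has_sob_derivs_comb[OF this, of a b] show ?thesis unfolding sobolev_def by blast
  qed
  ultimately show ?thesis unfolding lin_space_def by simp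
qed

lemma pd_comb:
  assumes "open D" "v \<in> sobolev m D" "w \<in> sobolev m D" "i + j \<le> m"
  shows "AE x in lebesgue_on D. pd D i j (\<lambda>x. a * v x + b * w x) x = a * pd D i j v x + b * pd D i j w x"
proof -
  obtain W W' where W: "has_sob_derivs m D v W" and W': "has_sob_derivs m D w W'"
    using assms unfolding sobolev_def by blast
  show ?thesis
    using pd_AE[OF assms(1) has_sob_derivs_comb[OF W W', of a b] assms(4)] pd_AE[OF assms(1) W assms(4)] pd_AE[OF assms(1) W' assms(4)]
    by eventually_elim simp
qed

lemma psd_pd:
  assumes "open D" "i + j \<le> m" shows "psd_on (sobolev m D) (\<lambda>v w. ip D (pd D i j v) (pd D i j w))"
  unfolding psd_on_def lin_on_def
proof (intro conjI ballI allI)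
  fix v w z a b assume vwz: "w \<in> sobolev m D" "v \<in> sobolev m D" "z \<in> sobolev m D"
  have L: "pd D i j v \<in> L2 D" "pd D i j w \<in> L2 D" "pd D i j z \<in> L2 D" using vwz assms(2) pd_L2 by auto
  have "ip D (pd D i j (\<lambda>x. a * v x + b * z x)) (pd D i j w) = ip D (\<lambda>x. a * pd D i j v x + b * pd D i j z x) (pd D i j w)"
    using vwz assms L pd_comb[OF assms(1) vwz(2,3) assms(2)]
    by (intro ip_cong_AE pd_L2 lin_spaceD(1)[OF lin_space_L2] lin_spaceD(1)[OF lin_space_sobolev]) auto
  also have "\<dots> = a * ip D (pd D i j v) (pd D i j w) + b * ip D (pd D i j z) (pd D i j w)"
    using lin_onD(1)[OF psd_onD(1)[OF psd_ip L(2)] L(1,3)] .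
  finally show "ip D (pd D i j (\<lambda>x. a * v x + b * z x)) (pd D i j w) = \<dots>" .
next
  fix v w assume vwz: "v \<in> sobolev m D" "w \<in> sobolev m D"
  show "ip D (pd D i j v) (pd D i j w) = ip D (pd D i j w) (pd D i j v)"
    by (simp add: ip_real mult.commute)
  show "0 \<le> ip D (pd D i j v) (pd D i j v)"
    by (simp add: ip_real)
qed

lemma pd_AE_cong:
  assumes "open D" "v \<in> sobolev m D" "w \<in> sobolev m D" "AE x in lebesgue_on D. v x = w x" "i + j \<le> m"
  shows "AE x in lebesgue_on D. pd D i j v x = pd D i j w x"
proof -
  obtain W W' where W: "has_sob_derivs m D v W" and W': "has_sob_derivs m D w W'"
    using assms unfolding sobolev_def by blast
  show ?thesis
    using pd_AE[OF assms(1) W assms(5)] pd_AE[OF assms(1) W' assms(5)] sob_derivs_unique[OF assms(1) W W' assms(4,5,5)]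
    by eventually_elim simp
qed

lemma psd_pd_null:
  assumes "open D" "v \<in> sobolev m D" "AE x in lebesgue_on D. v x = 0" "i + j \<le> m"
  shows "ip D (pd D i j v) (pd D i j v) = 0"
proof -
  have 0: "(\<lambda>x. 0) \<in> sobolev m D" using lin_space_sobolev lin_space_zero by blast
  have "ip D (pd D i j v) (pd D i j v) = ip D (pd D i j (\<lambda>x. 0)) (pd D i j (\<lambda>x. 0))"
    using assms 0 pd_AE_cong[OF assms(1,2) 0 assms(3,4)] by (intro ip_cong_AE pd_L2) auto
  also have "\<dots> = 0"
    using lin_on_zero[OF psd_onD(1)[OF psd_pd[OF assms(1,4)] 0] lin_space_sobolev] .
  finally show ?thesis .
qed

lemma ip_grad:
  assumes "v \<in> sobolev 1 D" "w \<in> sobolev 1 D"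
  shows "ip D (grad D v) (grad D w) = 1 * ip D (pd D 1 0 v) (pd D 1 0 w) + 1 * ip D (pd D 0 1 v) (pd D 0 1 w)"
proof -
  have "integrable (lebesgue_on D) (\<lambda>x. pd D 1 0 v x * pd D 1 0 w x)"
    "integrable (lebesgue_on D) (\<lambda>x. pd D 0 1 v x * pd D 0 1 w x)"
    using assms by (auto intro!: sqint_mult_integrable pd_L2[of _ 1 D, unfolded L2_eq_sqint])
  then show ?thesis unfolding ip_def grad_def by (simp add: inner_vec_def sum_2)
qed

lemma psd_grad:
  assumes "open D" shows "psd_on (sobolev 1 D) (\<lambda>v w. ip D (grad D v) (grad D w))"
proof -
  have "psd_on (sobolev 1 D) (\<lambda>v w. 1 * ip D (pd D 1 0 v) (pd D 1 0 w) + 1 * ip D (pd D 0 1 v) (pd D 0 1 w))"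
    using assms by (intro psd_on_comb psd_pd) auto
  from psd_on_cong[OF lin_space_sobolev this ip_grad] show ?thesis .
qed

text \<open>The mixed derivative fills both off-diagonal entries, whence the factor two; the factors
  one give the shape expected by \<open>psd_on_comb\<close>.\<close>

lemma ip_hess:
  assumes "v \<in> sobolev 2 D" "w \<in> sobolev 2 D"
  shows "ip D (hess D v) (hess D w) = 1 * (1 * ip D (pd D 2 0 v) (pd D 2 0 w) + 2 * ip D (pd D 1 1 v) (pd D 1 1 w))
    + 1 * ip D (pd D 0 2 v) (pd D 0 2 w)"
proof -
  have "integrable (lebesgue_on D) (\<lambda>x. pd D 2 0 v x * pd D 2 0 w x)"
    "integrable (lebesgue_on D) (\<lambda>x. pd D 1 1 v x * pd D 1 1 w x)"
    "integrable (lebesgue_on D) (\<lambda>x. pd D 0 2 v x * pd D 0 2 w x)"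
    using assms by (auto intro!: sqint_mult_integrable pd_L2[of _ 2 D, unfolded L2_eq_sqint])
  then show ?thesis unfolding ip_def hess_def by (simp add: inner_vec_def sum_2)
qed

lemma psd_hess:
  assumes "open D" shows "psd_on (sobolev 2 D) (\<lambda>v w. ip D (hess D v) (hess D w))"
proof -
  have "psd_on (sobolev 2 D) (\<lambda>v w. 1 * (1 * ip D (pd D 2 0 v) (pd D 2 0 w) + 2 * ip D (pd D 1 1 v) (pd D 1 1 w))
    + 1 * ip D (pd D 0 2 v) (pd D 0 2 w))"
    using assms by (intro psd_on_comb psd_pd) auto
  from psd_on_cong[OF lin_space_sobolev this ip_hess] show ?thesis .
qed

lemma sob_conv_ex:
  assumes "open D" "v \<in> sobolev m D" obtains J where "sob_conv m D J v"
proof -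
  obtain W where W: "has_sob_derivs m D v W" using assms unfolding sobolev_def by blast
  then obtain J where J: "\<And>n. smooth_jet (J n)" "\<And>i j. i + j \<le> m \<Longrightarrow> L2_conv D (\<lambda>n. J n i j) (W i j)"
    unfolding has_sob_derivs_def by blast
  have "L2_conv D (\<lambda>n. J n i j) (pd D i j v)" if "i + j \<le> m" for i j
    using pd_AE[OF assms(1) W that]
    by (intro L2_conv_AE[OF J(2)[OF that] pd_L2[OF assms(2) that]]) (auto elim: eventually_mono)
  then show ?thesis using that J(1) unfolding sob_conv_def by blast
qed

lemma sob_conv_comb:
  assumes "open D" "v \<in> sobolev m D" "w \<in> sobolev m D" "sob_conv m D J v" "sob_conv m D J' w"
  shows "sob_conv m D (\<lambda>n i j x. a * J n i j x + b * J' n i j x) (\<lambda>x. a * v x + b * w x)"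
  unfolding sob_conv_def
proof (intro conjI allI impI)
  show "smooth_jet (\<lambda>i j x. a * J n i j x + b * J' n i j x)" for n
    using smooth_jet_comb assms(4,5) unfolding sob_conv_def by blast
  show "L2_conv D (\<lambda>n x. a * J n i j x + b * J' n i j x) (pd D i j (\<lambda>x. a * v x + b * w x))" if "i + j \<le> m" for i j
  proof (rule L2_conv_AE)
    show "L2_conv D (\<lambda>n x. a * J n i j x + b * J' n i j x) (\<lambda>x. a * pd D i j v x + b * pd D i j w x)"
      using assms(4,5) that unfolding sob_conv_def by (intro L2_conv_comb) auto
    show "pd D i j (\<lambda>x. a * v x + b * w x) \<in> L2 D"
      using pd_L2[OF lin_spaceD(1)[OF lin_space_sobolev assms(2,3)] that] .
    show "AE x in lebesgue_on D. a * pd D i j v x + b * pd D i j w x = pd D i j (\<lambda>x. a * v x + b * w x) x"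
      using pd_comb[OF assms(1-3) that, of a b] by (rule eventually_mono) simp
  qed
qed

text \<open>Jets that approximate \<open>v\<close> approximate its derivative after an index shift
  by \<open>p\<close> and \<open>q\<close>.\<close>

lemma pd_sobolev:
  assumes D: "open D" and v: "v \<in> sobolev m D" and pq: "m' + p + q \<le> m"
  shows "pd D p q v \<in> sobolev m' D"
proof -
  obtain J where J: "sob_conv m D J v" using sob_conv_ex[OF D v] .
  have "has_sob_derivs m' D (pd D p q v) (\<lambda>i j. pd D (i + p) (j + q) v)"
    unfolding has_sob_derivs_def
  proof (intro conjI exI allI impI)
    show "smooth_jet (\<lambda>i j. J n (i + p) (j + q))" for n
      using J smooth_jet_shift unfolding sob_conv_def by blast
    show "L2_conv D (\<lambda>n. J n (i + p) (j + q)) (pd D (i + p) (j + q) v)" if "i + j \<le> m'" for i j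
      using J that pq unfolding sob_conv_def by auto
  qed simp
  then show ?thesis unfolding sobolev_def by blast
qed

section \<open>A trace inequality\<close>

text \<open>Fubini's theorem, moved from the product type to \<open>real^2\<close> by the coordinate
  map \<open>g\<close> and its inverse \<open>h\<close>, which send boxes to boxes of the same
  content.\<close>

lemma integral_unit_square:
  fixes f :: "real^2 \<Rightarrow> real"
  assumes "continuous_on UNIV f"
  shows "integral {0..1} (\<lambda>t. integral {0..1} (\<lambda>s. f (vector [t, s]))) = integral (cbox 0 1) f"
proof -
  define g where "g y = (y $ 1, y $ 2)" for y :: "real^2"
  define h where "h p = (vector [fst p, snd p] :: real^2)" for p :: "real \<times> real"
  have hg: "h (g x) = x" for x unfolding h_def g_def by (simp add: vec_eq_iff forall_2)
  have gh: "g (h x) = x" for x unfolding h_def g_def by simp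
  have gbox: "g ` cbox u v = cbox (g u) (g v)" for u v
  proof -
    have "g x \<in> cbox (g u) (g v) \<longleftrightarrow> x \<in> cbox u v" for x
      unfolding g_def by (simp add: mem_box_cart forall_2 cbox_Pair_eq)
    then show ?thesis by (auto simp: image_iff) (metis gh)
  qed
  have hbox: "h ` cbox u v = cbox (h u) (h v)" for u v
  proof -
    have "h ` cbox u v = h ` (g ` cbox (h u) (h v))" unfolding gbox gh ..
    then show ?thesis unfolding image_image hg by simp
  qed
  have cont_h: "continuous_on A h" for A
  proof -
    have "h = (\<lambda>p. fst p *\<^sub>R axis 1 1 + snd p *\<^sub>R axis 2 1)"
      unfolding h_def by (intro ext) (simp add: vec_eq_iff forall_2 axis_def)
    then show ?thesis by (auto intro!: continuous_intros)
  qed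
  define F where "F = f \<circ> h"
  have cF: "continuous_on A F" for A
    unfolding F_def by (intro continuous_on_compose cont_h continuous_on_subset[OF assms]) auto
  have "((\<lambda>x. F (g x)) has_integral (1 / 1) *\<^sub>R integral (cbox (0, 0) (1, 1)) F) (h ` cbox (0, 0) (1, 1))"
  proof (rule has_integral_twiddle[OF _ hg gh])
    show "continuous (at x) g" for x unfolding g_def by (intro continuous_intros)
    show "\<exists>w z. g ` cbox u v = cbox w z" "\<exists>w z. h ` cbox u' v' = cbox w z" for u v u' v'
      using gbox hbox by blast+
    show "measure lborel (g ` cbox u v) = 1 * measure lborel (cbox u v)" for u v
    proof (cases "u $ 1 \<le> v $ 1 \<and> u $ 2 \<le> v $ 2")
      case True
      then have "cbox u v \<noteq> {}" by (simp add: interval_ne_empty_cart forall_2)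
      then have "measure lborel (cbox u v) = (v $ 1 - u $ 1) * (v $ 2 - u $ 2)"
        unfolding content_cbox_cart[OF \<open>cbox u v \<noteq> {}\<close>] by (simp add: UNIV_2)
      then show ?thesis using True unfolding gbox unfolding g_def content_Pair by simp
    next
      case False
      then have "\<not> (cbox u v \<noteq> {})" by (simp only: interval_ne_empty_cart forall_2) blast
      then show ?thesis by simp
    qed
    show "(F has_integral integral (cbox (0, 0) (1, 1)) F) (cbox (0, 0) (1, 1))"
      using cF by (intro integrable_integral integrable_continuous)
  qed simp
  moreover have "h ` cbox (0, 0) (1, 1) = cbox 0 1"
  proof -
    have "h (0, 0) = 0" "h (1, 1) = 1" unfolding h_def by (simp_all add: vec_eq_iff forall_2)
    then show ?thesis unfolding hbox by simp
  qed
  moreover have "(\<lambda>x. F (g x)) = f" unfolding F_def by (simp add: hg)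
  ultimately have "integral (cbox 0 1) f = integral (cbox (0, 0) (1, 1)) F" by (simp add: integral_unique)
  also have "\<dots> = integral (cbox 0 1) (\<lambda>t. integral (cbox 0 1) (\<lambda>s. F (t, s)))"
    by (rule integral_prod_continuous[OF cF])
  finally show ?thesis unfolding F_def h_def by (simp add: o_def)
qed

text \<open>Change of variables under an injective affine map whose Jacobian is the determinant of
  \<open>\<tau>\<close> and \<open>d\<close>. The open box is used because the points known to lie
  in the domain later are those with both parameters strictly between zero and one.\<close>

lemma integral_parallelogram:
  fixes G :: "real^2 \<Rightarrow> real" and a \<tau> d :: "real^2"
  assumes G: "continuous_on UNIV G" and det: "\<tau> $ 1 * d $ 2 - \<tau> $ 2 * d $ 1 \<noteq> 0"
  defines "\<phi> \<equiv> \<lambda>y::real^2. a + y $ 1 *\<^sub>R \<tau> + y $ 2 *\<^sub>R d"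
  shows "G absolutely_integrable_on \<phi> ` box 0 1"
    "\<bar>\<tau> $ 1 * d $ 2 - \<tau> $ 2 * d $ 1\<bar> * integral (cbox 0 1) (\<lambda>y. G (\<phi> y)) = integral (\<phi> ` box 0 1) G"
proof -
  define \<phi>' where "\<phi>' = (\<lambda>y::real^2. y $ 1 *\<^sub>R \<tau> + y $ 2 *\<^sub>R d)"
  define \<delta> where "\<delta> = \<tau> $ 1 * d $ 2 - \<tau> $ 2 * d $ 1"
  have detm: "det (matrix \<phi>') = \<delta>"
    unfolding det_2 matrix_def \<phi>'_def \<delta>_def by (simp add: axis_def)
  have der: "(\<phi> has_derivative \<phi>') (at x within S)" for x S
    unfolding \<phi>_def \<phi>'_def
    by (auto intro!: derivative_eq_intros bounded_linear_imp_has_derivative bounded_linear_vec_nth)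
  have inj: "inj_on \<phi> S" for S
  proof (rule inj_onI)
    fix x y assume "\<phi> x = \<phi> y"
    then have "(x $ 1 - y $ 1) * \<tau> $ i + (x $ 2 - y $ 2) * d $ i = 0" for i
      unfolding \<phi>_def by (simp add: vec_eq_iff algebra_simps)
    from this[of 1] this[of 2] have "(x $ 1 - y $ 1) * \<delta> = 0" "(x $ 2 - y $ 2) * \<delta> = 0"
      unfolding \<delta>_def by algebra+
    then show "x = y" using det unfolding \<delta>_def by (simp add: vec_eq_iff forall_2)
  qed
  have c\<phi>: "continuous_on A \<phi>" for A unfolding \<phi>_def by (intro continuous_intros)
  \<comment> \<open>The change of variables theorem speaks of vector-valued functions, so
    \<open>G\<close> is wrapped into \<open>real^1\<close> and unwrapped at the end.\<close>
  define f where "f x = (vec (G x) :: real^1)" for x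
  have cf: "continuous_on A (\<lambda>y. G (\<phi> y))" for A
    by (rule continuous_on_compose2[OF G c\<phi>]) simp
  define b where "b = integral (box 0 1) (\<lambda>x. \<bar>det (matrix \<phi>')\<bar> *\<^sub>R f (\<phi> x))"
  have cvec: "continuous_on A (\<lambda>x. \<bar>det (matrix \<phi>')\<bar> *\<^sub>R f (\<phi> x))" for A
    unfolding f_def vec_def using cf by (intro continuous_intros) auto
  have "(\<lambda>x. \<bar>det (matrix \<phi>')\<bar> *\<^sub>R f (\<phi> x)) absolutely_integrable_on box 0 1"
    using absolutely_integrable_continuous[OF cvec, of 0 1]
    by (rule set_integrable_subset) (auto simp: box_subset_cbox)
  then have *: "f absolutely_integrable_on (\<phi> ` box 0 1) \<and> integral (\<phi> ` box 0 1) f = b"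
    using has_absolute_integral_change_of_variables[of "box 0 1" \<phi> "\<lambda>_. \<phi>'" f b] der inj b_def by auto
  have lin: "bounded_linear (\<lambda>v::real^1. v $ 1)" by (rule bounded_linear_vec_nth)
  have Gf: "G = (\<lambda>v. v $ 1) \<circ> f" unfolding f_def by (simp add: o_def)
  show "G absolutely_integrable_on \<phi> ` box 0 1"
    unfolding Gf using absolutely_integrable_linear[OF conjunct1[OF *] lin] .
  have "integral (\<phi> ` box 0 1) G = b $ 1"
    unfolding Gf using integral_linear[OF _ lin, of f "\<phi> ` box 0 1"] * set_lebesgue_integral_eq_integral(1) by metis
  also have "\<dots> = integral (box 0 1) ((\<lambda>v. v $ 1) \<circ> (\<lambda>x. \<bar>det (matrix \<phi>')\<bar> *\<^sub>R f (\<phi> x)))"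
    unfolding b_def using integrable_continuous[OF cvec, of 0 1]
    by (subst integral_linear[OF _ lin]) (auto simp: integrable_on_open_interval)
  also have "\<dots> = integral (cbox 0 1) (\<lambda>y. \<bar>\<delta>\<bar> * G (\<phi> y))"
    by (simp add: integral_open_interval o_def f_def detm)
  also have "\<dots> = \<bar>\<delta>\<bar> * integral (cbox 0 1) (\<lambda>y. G (\<phi> y))" by simp
  finally show "\<bar>\<tau> $ 1 * d $ 2 - \<tau> $ 2 * d $ 1\<bar> * integral (cbox 0 1) (\<lambda>y. G (\<phi> y)) = integral (\<phi> ` box 0 1) G"
    unfolding \<delta>_def by simp
qed

text \<open>The weight \<open>1 - s\<close> vanishes at the far end, so integrating the derivative
  of \<open>- ((1 - s) * (\<phi> s)\<^sup>2)\<close> leaves the value at zero alone.\<close>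

lemma trace_1d:
  fixes \<phi> \<phi>' :: "real \<Rightarrow> real"
  assumes der: "\<And>s. (\<phi> has_real_derivative \<phi>' s) (at s)" and cont: "continuous_on UNIV \<phi>'"
  shows "(\<phi> 0)\<^sup>2 \<le> integral {0..1} (\<lambda>s. 2 * (\<phi> s)\<^sup>2 + (\<phi>' s)\<^sup>2)"
proof -
  have c: "continuous_on A \<phi>" "continuous_on A \<phi>'" for A
  proof -
    show "continuous_on A \<phi>"
      by (intro continuous_at_imp_continuous_on ballI DERIV_isCont[OF der])
    show "continuous_on A \<phi>'" by (rule continuous_on_subset[OF cont]) simp
  qed
  have "((\<lambda>s. (\<phi> s)\<^sup>2 - (1 - s) * (2 * \<phi> s * \<phi>' s)) has_integral (- ((1 - 1) * (\<phi> 1)\<^sup>2) - - ((1 - 0) * (\<phi> 0)\<^sup>2))) {0..1}"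
  proof (rule fundamental_theorem_of_calculus)
    show "((\<lambda>s. - ((1 - s) * (\<phi> s)\<^sup>2)) has_vector_derivative (\<phi> s)\<^sup>2 - (1 - s) * (2 * \<phi> s * \<phi>' s)) (at s within {0..1})" for s
      unfolding has_real_derivative_iff_has_vector_derivative[symmetric]
      by (auto intro!: derivative_eq_intros DERIV_subset[OF der])
  qed simp
  then have "(\<phi> 0)\<^sup>2 = integral {0..1} (\<lambda>s. (\<phi> s)\<^sup>2 - (1 - s) * (2 * \<phi> s * \<phi>' s))"
    by (simp add: integral_unique)
  also have "\<dots> \<le> integral {0..1} (\<lambda>s. 2 * (\<phi> s)\<^sup>2 + (\<phi>' s)\<^sup>2)"
  proof (rule integral_le)
    fix s :: real assume s: "s \<in> {0..1}"
    \<comment> \<open>This square absorbs the mixed term; the second inequality fills up the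
      coefficients, which otherwise depend on \<open>s\<close>.\<close>
    have "0 \<le> (1 - s) * (\<phi> s + \<phi>' s)\<^sup>2" using s by simp
    moreover have "0 \<le> s * ((\<phi> s)\<^sup>2 + (\<phi>' s)\<^sup>2)" using s by simp
    ultimately show "(\<phi> s)\<^sup>2 - (1 - s) * (2 * \<phi> s * \<phi>' s) \<le> 2 * (\<phi> s)\<^sup>2 + (\<phi>' s)\<^sup>2"
      by (simp add: algebra_simps power2_eq_square)
  qed (auto intro!: integrable_continuous_real continuous_intros c)
  finally show ?thesis .
qed

text \<open>The one-dimensional estimate is applied on each segment that starts on the side
  \<open>\<tau>\<close> and runs in direction \<open>d\<close>, then integrated along the side. The
  segments sweep out the parallelogram, and the determinant converts the parameter integral into an
  area integral.\<close>

lemma parallelogram_trace: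
  fixes a \<tau> d :: pt
  assumes J: "smooth_jet J" and L: "J 0 0 \<in> L2 D" "J 1 0 \<in> L2 D" "J 0 1 \<in> L2 D"
    and D: "D \<in> sets lebesgue" and det: "\<tau> $ 1 * d $ 2 - \<tau> $ 2 * d $ 1 \<noteq> 0"
    and sub: "\<And>t s. 0 < t \<Longrightarrow> t < 1 \<Longrightarrow> 0 < s \<Longrightarrow> s < 1 \<Longrightarrow> a + t *\<^sub>R \<tau> + s *\<^sub>R d \<in> D"
  shows "\<bar>\<tau> $ 1 * d $ 2 - \<tau> $ 2 * d $ 1\<bar> * integral {0..1} (\<lambda>t. (J 0 0 (a + t *\<^sub>R \<tau>))\<^sup>2)
    \<le> (2 + (d $ 1)\<^sup>2 + (d $ 2)\<^sup>2) * (ip D (J 0 0) (J 0 0) + ip D (J 1 0) (J 1 0) + ip D (J 0 1) (J 0 1))"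
proof -
  define \<delta> where "\<delta> = \<bar>\<tau> $ 1 * d $ 2 - \<tau> $ 2 * d $ 1\<bar>"
  \<comment> \<open>The summand two comes from \<open>trace_1d\<close>, the squared length of
    \<open>d\<close> from Cauchy-Schwarz for the derivative in direction \<open>d\<close>.\<close>
  define K where "K = 2 + (d $ 1)\<^sup>2 + (d $ 2)\<^sup>2"
  define G where "G x = 2 * (J 0 0 x)\<^sup>2 + (J 1 0 x * d $ 1 + J 0 1 x * d $ 2)\<^sup>2" for x
  define g where "g x = K * ((J 0 0 x)\<^sup>2 + (J 1 0 x)\<^sup>2 + (J 0 1 x)\<^sup>2)" for x
  define \<phi> where "\<phi> y = a + y $ 1 *\<^sub>R \<tau> + y $ 2 *\<^sub>R d" for y :: "real^2"
  have cJ: "continuous_on A (J i j)" for A i j by (rule smooth_jet_continuous[OF J])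
  have cG: "continuous_on A G" and cg: "continuous_on A g" for A
    unfolding G_def g_def by (intro continuous_intros cJ)+
  have Gg: "G x \<le> g x" for x
  proof -
    have "0 \<le> (J 1 0 x * d $ 2 - J 0 1 x * d $ 1)\<^sup>2" by simp
    then have "(J 1 0 x * d $ 1 + J 0 1 x * d $ 2)\<^sup>2 \<le> ((d $ 1)\<^sup>2 + (d $ 2)\<^sup>2) * ((J 1 0 x)\<^sup>2 + (J 0 1 x)\<^sup>2)"
      by (simp add: power2_eq_square algebra_simps)
    moreover have "0 \<le> 2 * ((J 1 0 x)\<^sup>2 + (J 0 1 x)\<^sup>2)" "0 \<le> ((d $ 1)\<^sup>2 + (d $ 2)\<^sup>2) * (J 0 0 x)\<^sup>2" by simp_all
    moreover have "g x = 2 * (J 0 0 x)\<^sup>2 + ((d $ 1)\<^sup>2 + (d $ 2)\<^sup>2) * ((J 1 0 x)\<^sup>2 + (J 0 1 x)\<^sup>2)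
        + 2 * ((J 1 0 x)\<^sup>2 + (J 0 1 x)\<^sup>2) + ((d $ 1)\<^sup>2 + (d $ 2)\<^sup>2) * (J 0 0 x)\<^sup>2"
      unfolding g_def K_def by (simp add: algebra_simps)
    ultimately show ?thesis unfolding G_def by linarith
  qed
  have intg: "integrable (lebesgue_on D) g" using L unfolding g_def[abs_def] L2_def by simp
  have 1: "(J 0 0 (a + t *\<^sub>R \<tau>))\<^sup>2 \<le> integral {0..1} (\<lambda>s. G (a + t *\<^sub>R \<tau> + s *\<^sub>R d))" for t
  proof -
    let ?z = "a + t *\<^sub>R \<tau>"
    have "continuous_on UNIV (\<lambda>s. J (Suc 0) 0 (?z + s *\<^sub>R d) * d $ 1 + J 0 (Suc 0) (?z + s *\<^sub>R d) * d $ 2)"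
      by (intro continuous_intros continuous_on_compose2[OF cJ, of UNIV]) auto
    from trace_1d[OF smooth_jet_line[OF J, of 0 0 ?z d] this] show ?thesis by (simp add: G_def)
  qed
  have cc: "continuous_on UNIV (\<lambda>(t, s). G (a + t *\<^sub>R \<tau> + s *\<^sub>R d))"
    unfolding split_beta by (intro continuous_on_compose2[OF cG, of UNIV] continuous_intros) auto
  have "continuous_on {0..1} (\<lambda>t. integral (cbox 0 1) (\<lambda>s. G (a + t *\<^sub>R \<tau> + s *\<^sub>R d)))"
    by (intro integral_continuous_on_param continuous_on_subset[OF cc]) simp
  then have c2: "continuous_on {0..1} (\<lambda>t. integral {0..1} (\<lambda>s. G (a + t *\<^sub>R \<tau> + s *\<^sub>R d)))" by simp
  have c1: "continuous_on {0..1} (\<lambda>t. (J 0 0 (a + t *\<^sub>R \<tau>))\<^sup>2)"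
    by (rule continuous_on_power[OF continuous_on_compose2[OF cJ[of UNIV]]]) (auto intro!: continuous_intros)
  have "integral {0..1} (\<lambda>t. (J 0 0 (a + t *\<^sub>R \<tau>))\<^sup>2) \<le> integral {0..1} (\<lambda>t. integral {0..1} (\<lambda>s. G (a + t *\<^sub>R \<tau> + s *\<^sub>R d)))"
    by (intro integral_le integrable_continuous_real c1 c2 1)
  also have "\<dots> = integral (cbox 0 1) (\<lambda>y. G (\<phi> y))"
  proof -
    have "continuous_on UNIV (\<lambda>y. G (\<phi> y))"
      unfolding \<phi>_def by (intro continuous_on_compose2[OF cG, of UNIV] continuous_intros) auto
    from integral_unit_square[OF this] show ?thesis by (simp add: \<phi>_def)
  qed
  finally have "\<delta> * integral {0..1} (\<lambda>t. (J 0 0 (a + t *\<^sub>R \<tau>))\<^sup>2) \<le> \<delta> * integral (cbox 0 1) (\<lambda>y. G (\<phi> y))"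
    by (rule mult_left_mono) (simp add: \<delta>_def)
  also have "\<dots> = integral (\<phi> ` box 0 1) G"
    using integral_parallelogram(2)[OF cG det, of a] unfolding \<delta>_def \<phi>_def by simp
  also have "\<dots> \<le> integral (\<phi> ` box 0 1) g"
    using integral_parallelogram(1)[OF cG det, of a] integral_parallelogram(1)[OF cg det, of a] Gg
    unfolding \<phi>_def by (intro integral_le set_lebesgue_integral_eq_integral(1)) auto
  also have "\<dots> \<le> integral D g"
  proof (rule integral_subset_le)
    show "\<phi> ` box 0 1 \<subseteq> D" using sub unfolding \<phi>_def by (auto simp: mem_box_cart forall_2)
    show "g integrable_on \<phi> ` box 0 1"
      using integral_parallelogram(1)[OF cg det, of a] unfolding \<phi>_def by (rule set_lebesgue_integral_eq_integral(1))
    show "\<forall>x\<in>D. 0 \<le> g x" unfolding g_def K_def by simp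
    show "g integrable_on D" using intg D by (rule integrable_on_lebesgue_on)
  qed
  also have "integral D g = (LINT x|lebesgue_on D. g x)"
    by (rule lebesgue_integral_eq_integral[OF intg D, symmetric])
  also have "\<dots> = K * (ip D (J 0 0) (J 0 0) + ip D (J 1 0) (J 1 0) + ip D (J 0 1) (J 0 1))"
    using L unfolding g_def ip_real L2_def by (simp add: power2_eq_square)
  finally show ?thesis unfolding \<delta>_def K_def .
qed

text \<open>The second half is run through backwards, so that each half starts at its own end point
  of the edge and the two can be treated alike.\<close>

lemma integral_halves:
  fixes \<phi> :: "real \<Rightarrow> real"
  assumes "continuous_on UNIV \<phi>"
  shows "integral {0..1} \<phi> = (integral {0..1} (\<lambda>t. \<phi> (t / 2)) + integral {0..1} (\<lambda>t. \<phi> (1 - t / 2))) / 2"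
proof -
  \<comment> \<open>The larger interval makes every point of \<open>{0..1}\<close> interior, so the
    antiderivative has two-sided derivatives there.\<close>
  obtain \<Phi> where F: "\<And>x. x \<in> {-1..2} \<Longrightarrow> (\<Phi> has_vector_derivative \<phi> x) (at x within {-1..2})"
    using antiderivative_continuous[OF continuous_on_subset[OF assms], of "-1" 2] by auto
  have F': "(\<Phi> has_real_derivative \<phi> x) (at x)" if "x \<in> {0..1}" for x
    using F[of x] that at_within_interior[of x "{-1..2}"]
    by (simp add: has_real_derivative_iff_has_vector_derivative)
  have "(\<phi> has_integral (\<Phi> 1 - \<Phi> 0)) {0..1}"
    by (rule fundamental_theorem_of_calculus)
      (auto simp: has_real_derivative_iff_has_vector_derivative[symmetric] intro: DERIV_subset[OF F'])
  moreover have "((\<lambda>t. \<phi> (t / 2)) has_integral (2 * \<Phi> (1 / 2) - 2 * \<Phi> (0 / 2))) {0..1}"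
    by (rule fundamental_theorem_of_calculus)
      (auto simp: has_real_derivative_iff_has_vector_derivative[symmetric]
        intro!: derivative_eq_intros DERIV_chain2[OF F'])
  moreover have "((\<lambda>t. \<phi> (1 - t / 2)) has_integral (- 2 * \<Phi> (1 - 1 / 2) - - 2 * \<Phi> (1 - 0 / 2))) {0..1}"
    by (rule fundamental_theorem_of_calculus)
      (auto simp: has_real_derivative_iff_has_vector_derivative[symmetric]
        intro!: derivative_eq_intros DERIV_chain2[OF F'])
  ultimately show ?thesis by (simp add: integral_unique)
qed

section \<open>Traces\<close>

text \<open>A single direction \<open>d\<close> that translates the whole edge into \<open>D\<close> need not exist, because the angles of
  a polygon at the two ends of an edge may add up to less than \<open>\<pi>\<close>. Hence the two halves.\<close>

definition accessible :: "pt set \<Rightarrow> edge \<Rightarrow> bool" where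
  "accessible D e \<longleftrightarrow> (\<forall>(a, b)\<in>{e, prod.swap e}. \<exists>d.
     (b - a) $ 1 * d $ 2 - (b - a) $ 2 * d $ 1 \<noteq> 0 \<and>
     (\<forall>t s. 0 < t \<and> t < 1 \<and> 0 < s \<and> s < 1 \<longrightarrow> a + t *\<^sub>R ((1 / 2) *\<^sub>R (b - a)) + s *\<^sub>R d \<in> D))"

lemma edge_len_nonneg: "0 \<le> edge_len e"
  unfolding edge_len_def by simp

lemma accessible_len: "accessible D e \<Longrightarrow> 0 < edge_len e"
  unfolding accessible_def edge_len_def by (cases e) auto

lemma L2_edge_eq: "L2_edge e = {g. (\<lambda>t. g (linepath (fst e) (snd e) t)) \<in> sqint (lebesgue_on {0..1})}"
  unfolding L2_edge_def sqint_def by simp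

lemma lin_space_L2_edge: "lin_space (L2_edge e)"
proof -
  have "(\<lambda>x. 0) \<in> L2_edge e" unfolding L2_edge_eq using lin_space_zero[OF lin_space_sqint] by simp
  then show ?thesis unfolding lin_space_def L2_edge_eq using lin_spaceD(1)[OF lin_space_sqint] by auto
qed

lemma psd_edge: "psd_on (L2_edge e) (\<lambda>f g. edge_int e (\<lambda>x. f x * g x))"
proof -
  let ?b = "\<lambda>f g. LINT t|lebesgue_on {0..1}. f (linepath (fst e) (snd e) t) * g (linepath (fst e) (snd e) t)"
  have "psd_on (L2_edge e) ?b"
    by (rule psd_on_pullback[OF psd_sqint[of "lebesgue_on {0..1}"], where P = "\<lambda>f t. f (linepath (fst e) (snd e) t)"])
      (auto simp: L2_edge_eq)
  from psd_on_comb[OF this this edge_len_nonneg[of e], of 0] show ?thesis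
    unfolding edge_int_def by simp
qed

lemma continuous_edge:
  assumes "continuous_on UNIV g"
  shows "continuous_on A (\<lambda>t. g (linepath a b t))"
  by (rule continuous_on_compose2[OF assms]) (auto simp: linepath_def intro!: continuous_intros)

lemma continuous_measurable_edge:
  assumes "continuous_on UNIV g"
  shows "(\<lambda>t. (g (linepath a b t) :: real)) \<in> borel_measurable (lebesgue_on {0..1})"
  by (intro continuous_imp_measurable_on_sets_lebesgue continuous_edge[OF assms]) simp

lemma continuous_L2_edge:
  assumes "continuous_on UNIV g" shows "g \<in> L2_edge e"
proof -
  have "continuous_on {0..1} (\<lambda>t. (g (linepath (fst e) (snd e) t))\<^sup>2)"
    by (intro continuous_intros continuous_edge[OF assms])
  then have "integrable (lebesgue_on {0..1}) (\<lambda>t. (g (linepath (fst e) (snd e) t))\<^sup>2)"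
    by (rule continuous_imp_integrable_real)
  then show ?thesis using continuous_measurable_edge[OF assms] unfolding L2_edge_def by simp
qed

text \<open>The constant depends on the edge and the domain alone. Uniformity over all jets is what
  makes traces exist and depend only on the class of the function.\<close>

lemma edge_trace_inequality:
  assumes acc: "accessible D e" and D: "D \<in> sets lebesgue"
  shows "\<exists>C\<ge>0. \<forall>J. smooth_jet J \<longrightarrow> J 0 0 \<in> L2 D \<longrightarrow> J 1 0 \<in> L2 D \<longrightarrow> J 0 1 \<in> L2 D \<longrightarrow>
      edge_int e (\<lambda>x. J 0 0 x * J 0 0 x) \<le> C * (ip D (J 0 0) (J 0 0) + ip D (J 1 0) (J 1 0) + ip D (J 0 1) (J 0 1))"
proof -
  have half: "\<exists>C\<ge>0. \<forall>J. smooth_jet J \<longrightarrow> J 0 0 \<in> L2 D \<longrightarrow> J 1 0 \<in> L2 D \<longrightarrow> J 0 1 \<in> L2 D \<longrightarrow>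
      integral {0..1} (\<lambda>t. (J 0 0 (a + t *\<^sub>R ((1 / 2) *\<^sub>R (b - a))))\<^sup>2)
        \<le> C * (ip D (J 0 0) (J 0 0) + ip D (J 1 0) (J 1 0) + ip D (J 0 1) (J 0 1))"
    if ab: "(a, b) \<in> {e, prod.swap e}" for a b
  proof -
    obtain d where d: "(b - a) $ 1 * d $ 2 - (b - a) $ 2 * d $ 1 \<noteq> 0"
      "\<And>t s. 0 < t \<Longrightarrow> t < 1 \<Longrightarrow> 0 < s \<Longrightarrow> s < 1 \<Longrightarrow> a + t *\<^sub>R ((1 / 2) *\<^sub>R (b - a)) + s *\<^sub>R d \<in> D"
      using acc ab unfolding accessible_def by blast
    let ?\<tau> = "(1 / 2) *\<^sub>R (b - a)"
    define \<delta> where "\<delta> = ?\<tau> $ 1 * d $ 2 - ?\<tau> $ 2 * d $ 1"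
    have \<delta>: "\<delta> \<noteq> 0" using d(1) unfolding \<delta>_def by (simp add: algebra_simps)
    define C where "C = (2 + (d $ 1)\<^sup>2 + (d $ 2)\<^sup>2) / \<bar>\<delta>\<bar>"
    have "0 \<le> C" unfolding C_def by simp
    moreover have "integral {0..1} (\<lambda>t. (J 0 0 (a + t *\<^sub>R ?\<tau>))\<^sup>2)
        \<le> C * (ip D (J 0 0) (J 0 0) + ip D (J 1 0) (J 1 0) + ip D (J 0 1) (J 0 1))"
      if "smooth_jet J" "J 0 0 \<in> L2 D" "J 1 0 \<in> L2 D" "J 0 1 \<in> L2 D" for J
      using parallelogram_trace[OF that D \<delta>[unfolded \<delta>_def] d(2)] \<delta>
      unfolding \<delta>_def[symmetric] C_def by (simp add: pos_le_divide_eq mult.commute)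
    ultimately show ?thesis by blast
  qed
  obtain a b where e: "e = (a, b)" by (cases e)
  obtain C1 where C1: "0 \<le> C1" "\<And>J. smooth_jet J \<Longrightarrow> J 0 0 \<in> L2 D \<Longrightarrow> J 1 0 \<in> L2 D \<Longrightarrow> J 0 1 \<in> L2 D \<Longrightarrow>
      integral {0..1} (\<lambda>t. (J 0 0 (a + t *\<^sub>R ((1 / 2) *\<^sub>R (b - a))))\<^sup>2)
        \<le> C1 * (ip D (J 0 0) (J 0 0) + ip D (J 1 0) (J 1 0) + ip D (J 0 1) (J 0 1))"
    using half[of a b] e by auto
  obtain C2 where C2: "0 \<le> C2" "\<And>J. smooth_jet J \<Longrightarrow> J 0 0 \<in> L2 D \<Longrightarrow> J 1 0 \<in> L2 D \<Longrightarrow> J 0 1 \<in> L2 D \<Longrightarrow>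
      integral {0..1} (\<lambda>t. (J 0 0 (b + t *\<^sub>R ((1 / 2) *\<^sub>R (a - b))))\<^sup>2)
        \<le> C2 * (ip D (J 0 0) (J 0 0) + ip D (J 1 0) (J 1 0) + ip D (J 0 1) (J 0 1))"
    using half[of b a] e by auto
  define C where "C = edge_len e * ((C1 + C2) / 2)"
  have "edge_int e (\<lambda>x. J 0 0 x * J 0 0 x) \<le> C * (ip D (J 0 0) (J 0 0) + ip D (J 1 0) (J 1 0) + ip D (J 0 1) (J 0 1))"
    if J: "smooth_jet J" "J 0 0 \<in> L2 D" "J 1 0 \<in> L2 D" "J 0 1 \<in> L2 D" for J
  proof -
    let ?N = "ip D (J 0 0) (J 0 0) + ip D (J 1 0) (J 1 0) + ip D (J 0 1) (J 0 1)"
    let ?p = "\<lambda>t. (J 0 0 (linepath a b t))\<^sup>2"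
    have c: "continuous_on A ?p" for A
      by (intro continuous_intros continuous_edge smooth_jet_continuous[OF J(1)])
    have "(LINT t|lebesgue_on {0..1}. ?p t) = integral {0..1} ?p"
      by (intro lebesgue_integral_eq_integral continuous_imp_integrable_real c) simp
    also have "\<dots> = (integral {0..1} (\<lambda>t. ?p (t / 2)) + integral {0..1} (\<lambda>t. ?p (1 - t / 2))) / 2"
      by (rule integral_halves[OF c])
    also have "(\<lambda>t. ?p (t / 2)) = (\<lambda>t. (J 0 0 (a + t *\<^sub>R ((1 / 2) *\<^sub>R (b - a))))\<^sup>2)"
      by (simp add: linepath_def algebra_simps)
    also have "(\<lambda>t. ?p (1 - t / 2)) = (\<lambda>t. (J 0 0 (b + t *\<^sub>R ((1 / 2) *\<^sub>R (a - b))))\<^sup>2)"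
      by (simp add: linepath_def algebra_simps)
    finally have "(LINT t|lebesgue_on {0..1}. ?p t) \<le> (C1 * ?N + C2 * ?N) / 2"
      using C1(2)[OF J] C2(2)[OF J] by simp
    then have "edge_len e * (LINT t|lebesgue_on {0..1}. ?p t) \<le> edge_len e * ((C1 * ?N + C2 * ?N) / 2)"
      by (rule mult_left_mono[OF _ edge_len_nonneg])
    moreover have "edge_len e * ((C1 * r + C2 * r) / 2) = C * r" for r
      unfolding C_def by (simp add: field_simps)
    ultimately show ?thesis unfolding edge_int_def e by (simp add: power2_eq_square)
  qed
  moreover have "0 \<le> C" using C1(1) C2(1) edge_len_nonneg unfolding C_def by simp
  ultimately show ?thesis by blast
qed

text \<open>With the square root, convergence is that of a seminorm, and the triangle inequality for
  \<open>psd_edge\<close> applies.\<close>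

lemma is_trace_iff:
  "is_trace D e w g \<longleftrightarrow> g \<in> L2_edge e \<and> (\<exists>J. sob_conv 1 D J w \<and>
     (\<lambda>n. sqrt (edge_int e (\<lambda>x. (J n 0 0 x - g x) * (J n 0 0 x - g x)))) \<longlonglongrightarrow> 0)"
proof -
  have "(\<lambda>n. sqrt (X n)) \<longlonglongrightarrow> 0 \<longleftrightarrow> X \<longlonglongrightarrow> 0" if "\<And>n. 0 \<le> X n" for X :: "nat \<Rightarrow> real"
  proof
    assume "(\<lambda>n. sqrt (X n)) \<longlonglongrightarrow> 0"
    from tendsto_power[OF this, of 2] show "X \<longlonglongrightarrow> 0" using that by simp
  next
    assume "X \<longlonglongrightarrow> 0"
    from tendsto_real_sqrt[OF this] show "(\<lambda>n. sqrt (X n)) \<longlonglongrightarrow> 0" by simp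
  qed
  moreover have "0 \<le> edge_int e (\<lambda>x. f x * f x)" for f
    unfolding edge_int_def by (simp add: edge_len_nonneg)
  ultimately show ?thesis unfolding is_trace_def power2_eq_square by simp
qed

lemma sob_conv_L2:
  assumes "sob_conv m D J w" "i + j \<le> m"
  shows "L2_conv D (\<lambda>n. J n i j) (pd D i j w)" "J n i j \<in> L2 D"
  using assms unfolding sob_conv_def L2_conv_def by auto

lemma sob_conv_jet: "sob_conv m D J w \<Longrightarrow> smooth_jet (J n)"
  unfolding sob_conv_def by blast

lemma is_trace_comb:
  assumes D: "open D" and v: "v \<in> sobolev 1 D" and w: "w \<in> sobolev 1 D"
    and g: "is_trace D e v g" and h: "is_trace D e w h"
  shows "is_trace D e (\<lambda>x. a * v x + b * w x) (\<lambda>x. a * g x + b * h x)"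
proof -
  let ?E = "\<lambda>f. sqrt (edge_int e (\<lambda>x. f x * f x))"
  obtain J J' where J: "sob_conv 1 D J v" "(\<lambda>n. ?E (\<lambda>x. J n 0 0 x - g x)) \<longlonglongrightarrow> 0"
    and J': "sob_conv 1 D J' w" "(\<lambda>n. ?E (\<lambda>x. J' n 0 0 x - h x)) \<longlonglongrightarrow> 0"
    using g h unfolding is_trace_iff by blast
  have gh: "g \<in> L2_edge e" "h \<in> L2_edge e" using g h unfolding is_trace_iff by auto
  have JL: "J n 0 0 \<in> L2_edge e" "J' n 0 0 \<in> L2_edge e" for n
    using continuous_L2_edge smooth_jet_continuous sob_conv_jet[OF J(1)] sob_conv_jet[OF J'(1)] by blast+
  let ?d = "\<lambda>n x. J n 0 0 x - g x" and ?d' = "\<lambda>n x. J' n 0 0 x - h x"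
  have d: "?d n \<in> L2_edge e" "?d' n \<in> L2_edge e" for n
    using lin_spaceD(3)[OF lin_space_L2_edge] gh JL by auto
  have sc: "?E (\<lambda>x. c * f x) = \<bar>c\<bar> * ?E f" if "f \<in> L2_edge e" for c f
    using psd_expand[OF psd_edge lin_space_L2_edge that that, of c 0] by (simp add: real_sqrt_mult)
  have "?E (\<lambda>x. a * J n 0 0 x + b * J' n 0 0 x - (a * g x + b * h x)) \<le> \<bar>a\<bar> * ?E (?d n) + \<bar>b\<bar> * ?E (?d' n)" for n
  proof -
    have "(\<lambda>x. a * J n 0 0 x + b * J' n 0 0 x - (a * g x + b * h x)) = (\<lambda>x. a * ?d n x + b * ?d' n x)"
      by (auto simp: algebra_simps)
    then show ?thesis
      using psd_triangle[OF psd_edge lin_space_L2_edge lin_spaceD(4)[OF lin_space_L2_edge d(1) d(1)] lin_spaceD(4)[OF lin_space_L2_edge d(2) d(2)], of a n b n]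
        sc[OF d(1), of a n] sc[OF d(2), of b n] by metis
  qed
  then have le: "\<forall>\<^sub>F n in sequentially. norm (?E (\<lambda>x. a * J n 0 0 x + b * J' n 0 0 x - (a * g x + b * h x)))
      \<le> \<bar>a\<bar> * ?E (?d n) + \<bar>b\<bar> * ?E (?d' n)"
    by (intro always_eventually allI) (simp add: edge_int_def edge_len_nonneg)
  have "(\<lambda>n. \<bar>a\<bar> * ?E (?d n) + \<bar>b\<bar> * ?E (?d' n)) \<longlonglongrightarrow> 0"
    by (intro tendsto_add_zero tendsto_mult_right_zero J(2) J'(2))
  from Lim_null_comparison[OF le this]
  have "(\<lambda>n. ?E (\<lambda>x. a * J n 0 0 x + b * J' n 0 0 x - (a * g x + b * h x))) \<longlonglongrightarrow> 0" .
  moreover have "sob_conv 1 D (\<lambda>n i j x. a * J n i j x + b * J' n i j x) (\<lambda>x. a * v x + b * w x)"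
    by (rule sob_conv_comb[OF D v w J(1) J'(1)])
  moreover have "(\<lambda>x. a * g x + b * h x) \<in> L2_edge e"
    using lin_spaceD(1)[OF lin_space_L2_edge gh] .
  ultimately show ?thesis unfolding is_trace_iff
    by (intro conjI exI[of _ "\<lambda>n i j x. a * J n i j x + b * J' n i j x"]) auto
qed

text \<open>All derivatives up to order one of a null function are null, so the approximating jets
  tend to zero in the first-order norm; by the trace inequality their restrictions to the edge tend
  to zero as well as to \<open>g\<close>.\<close>

lemma is_trace_null:
  assumes acc: "accessible D e" and D: "open D" and w: "w \<in> sobolev 1 D"
    and w0: "AE x in lebesgue_on D. w x = 0" and g: "is_trace D e w g"
  shows "edge_int e (\<lambda>x. g x * g x) = 0"
proof -
  let ?E = "\<lambda>f. sqrt (edge_int e (\<lambda>x. f x * f x))"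
  have Dm: "D \<in> sets lebesgue" using D by simp
  obtain J where J: "sob_conv 1 D J w" "(\<lambda>n. ?E (\<lambda>x. J n 0 0 x - g x)) \<longlonglongrightarrow> 0"
    using g unfolding is_trace_iff by blast
  have gL: "g \<in> L2_edge e" using g unfolding is_trace_iff by blast
  have JL: "J n 0 0 \<in> L2_edge e" for n
    using continuous_L2_edge smooth_jet_continuous sob_conv_jet[OF J(1)] by blast
  obtain C where C0: "0 \<le> C" and CJ: "\<forall>J. smooth_jet J \<longrightarrow> J 0 0 \<in> L2 D \<longrightarrow> J 1 0 \<in> L2 D \<longrightarrow> J 0 1 \<in> L2 D \<longrightarrow>
      edge_int e (\<lambda>x. J 0 0 x * J 0 0 x) \<le> C * (ip D (J 0 0) (J 0 0) + ip D (J 1 0) (J 1 0) + ip D (J 0 1) (J 0 1))"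
    using edge_trace_inequality[OF acc Dm] by blast
  note C = C0 CJ[rule_format]
  have n0: "(\<lambda>n. ip D (J n i j) (J n i j)) \<longlonglongrightarrow> 0" if ij: "i + j \<le> 1" for i j
  proof -
    have le: "L2norm D (J n i j) \<le> L2norm D (\<lambda>x. J n i j x - pd D i j w x)" for n
    proof -
      have pL: "pd D i j w \<in> L2 D" using pd_L2[OF w ij] .
      have "L2norm D (\<lambda>x. (J n i j x - pd D i j w x) + pd D i j w x)
          \<le> L2norm D (\<lambda>x. J n i j x - pd D i j w x) + L2norm D (pd D i j w)"
        unfolding L2norm_def
        by (rule psd_triangle[OF psd_ip lin_space_L2 lin_spaceD(3)[OF lin_space_L2 sob_conv_L2(2)[OF J(1) ij] pL] pL])
      moreover have "L2norm D (pd D i j w) = 0"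
        unfolding L2norm_def using psd_pd_null[OF D w w0 ij] by simp
      ultimately show ?thesis by simp
    qed
    have l0: "(\<lambda>n. L2norm D (\<lambda>x. J n i j x - pd D i j w x)) \<longlonglongrightarrow> 0"
      using sob_conv_L2(1)[OF J(1) ij] unfolding L2_conv_def by blast
    have "\<forall>\<^sub>F n in sequentially. norm (L2norm D (J n i j)) \<le> L2norm D (\<lambda>x. J n i j x - pd D i j w x)"
      using le by (intro always_eventually allI) (simp add: L2norm_nonneg)
    from tendsto_power[OF Lim_null_comparison[OF this l0], of 2]
    show ?thesis unfolding L2norm_def by (simp add: ip_real)
  qed
  let ?S = "\<lambda>n. C * (ip D (J n 0 0) (J n 0 0) + ip D (J n 1 0) (J n 1 0) + ip D (J n 0 1) (J n 0 1))"
  have S0: "?S \<longlonglongrightarrow> 0" by (intro tendsto_mult_right_zero tendsto_add_zero n0) auto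
  have ES: "?E (J n 0 0) \<le> sqrt (?S n)" for n
    using C(2)[of "J n", OF sob_conv_jet[OF J(1)] sob_conv_L2(2)[OF J(1)] sob_conv_L2(2)[OF J(1)] sob_conv_L2(2)[OF J(1)]]
    by simp
  have "?E g \<le> ?E (\<lambda>x. J n 0 0 x - g x) + sqrt (?S n)" for n
  proof -
    have A: "?E (\<lambda>x. J n 0 0 x - (J n 0 0 x - g x)) \<le> ?E (J n 0 0) + ?E (\<lambda>x. J n 0 0 x - g x)"
      by (rule psd_triangle_diff[OF psd_edge lin_space_L2_edge JL lin_spaceD(3)[OF lin_space_L2_edge JL gL]])
    have "?E (\<lambda>x. J n 0 0 x - (J n 0 0 x - g x)) = ?E g" by simp
    from order_trans[OF A[unfolded this] add_right_mono[OF ES[of n]]] show ?thesis by (simp only: add.commute)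
  qed
  moreover have "(\<lambda>n. ?E (\<lambda>x. J n 0 0 x - g x) + sqrt (?S n)) \<longlonglongrightarrow> 0"
    using tendsto_real_sqrt[OF S0] by (intro tendsto_add_zero J(2)) simp
  ultimately have "?E g \<le> 0" by (intro LIMSEQ_le_const) auto
  then show ?thesis using psd_onD(3)[OF psd_edge gL] by simp
qed

text \<open>Applied to differences of approximating jets, the trace inequality makes their
  restrictions a Cauchy sequence in mean square on the parameter interval, which has a limit by
  completeness.\<close>

lemma is_trace_exists:
  assumes acc: "accessible D e" and D: "open D" and w: "w \<in> sobolev 1 D"
  shows "\<exists>g. is_trace D e w g"
proof -
  obtain a b where e: "e = (a, b)" by (cases e)
  have ab: "a \<noteq> b" using accessible_len[OF acc] unfolding e edge_len_def by simp
  have Dm: "D \<in> sets lebesgue" using D by simp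
  obtain J where J: "sob_conv 1 D J w" using sob_conv_ex[OF D w] .
  obtain C where C0: "0 \<le> C" and CJ: "\<forall>J. smooth_jet J \<longrightarrow> J 0 0 \<in> L2 D \<longrightarrow> J 1 0 \<in> L2 D \<longrightarrow> J 0 1 \<in> L2 D \<longrightarrow>
      edge_int e (\<lambda>x. J 0 0 x * J 0 0 x) \<le> C * (ip D (J 0 0) (J 0 0) + ip D (J 1 0) (J 1 0) + ip D (J 0 1) (J 0 1))"
    using edge_trace_inequality[OF acc Dm] by blast
  note C = C0 CJ[rule_format]
  define f where "f n t = J n 0 0 (linepath a b t)" for n t
  have JL: "J n 0 0 \<in> L2_edge e" for n
    using continuous_L2_edge smooth_jet_continuous sob_conv_jet[OF J] by blast
  then have fL: "f n \<in> sqint (lebesgue_on {0..1})" for n unfolding L2_edge_eq e f_def by simp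
  have Jc: "(\<lambda>n. L2norm D (\<lambda>x. J n i j x - pd D i j w x)) \<longlonglongrightarrow> 0" if "i + j \<le> 1" for i j
    using sob_conv_L2(1)[OF J that] unfolding L2_conv_def by blast
  have Cau: "\<exists>m. \<forall>p\<ge>m. \<forall>q\<ge>m. (LINT t|lebesgue_on {0..1}. (f p t - f q t)\<^sup>2) < \<epsilon>" if \<epsilon>: "0 < \<epsilon>" for \<epsilon>
  proof -
    \<comment> \<open>Two errors below \<open>\<eta>\<close> give each of the three energies of the
      difference a bound whose triple, times \<open>C\<close>, is
      \<open>edge_len e * \<epsilon> * (C / (C + 1))\<close>. Using \<open>C + 1\<close> avoids
      division by zero and makes the estimate strict.\<close>
    define \<eta> where "\<eta> = sqrt (edge_len e * \<epsilon> / (3 * (C + 1))) / 2"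
    have \<eta>: "0 < \<eta>" unfolding \<eta>_def using accessible_len[OF acc] C(1) \<epsilon> by simp
    have "\<forall>\<^sub>F n in sequentially. L2norm D (\<lambda>x. J n i j x - pd D i j w x) < \<eta>" if "i + j \<le> 1" for i j
      using order_tendstoD(2)[OF Jc[OF that] \<eta>] .
    from eventually_conj[OF this[of 0 0] eventually_conj[OF this[of 1 0] this[of 0 1]]]
    obtain m where m: "\<And>n. n \<ge> m \<Longrightarrow> L2norm D (\<lambda>x. J n 0 0 x - pd D 0 0 w x) < \<eta> \<and>
        L2norm D (\<lambda>x. J n 1 0 x - pd D 1 0 w x) < \<eta> \<and> L2norm D (\<lambda>x. J n 0 1 x - pd D 0 1 w x) < \<eta>"
      unfolding eventually_sequentially by auto
    have "(LINT t|lebesgue_on {0..1}. (f p t - f q t)\<^sup>2) < \<epsilon>" if p: "p \<ge> m" and q: "q \<ge> m" for p q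
    proof -
      let ?K = "\<lambda>i j x. 1 * J p i j x + (-1) * J q i j x"
      have KL: "?K i j \<in> L2 D" if "i + j \<le> 1" for i j
        by (rule lin_spaceD(1)[OF lin_space_L2 sob_conv_L2(2)[OF J that] sob_conv_L2(2)[OF J that]])
      have K: "ip D (?K i j) (?K i j) < edge_len e * \<epsilon> / (3 * (C + 1))"
        if ij: "i + j \<le> 1" and b: "L2norm D (\<lambda>x. J p i j x - pd D i j w x) < \<eta>" "L2norm D (\<lambda>x. J q i j x - pd D i j w x) < \<eta>" for i j
      proof -
        have pL: "pd D i j w \<in> L2 D" using pd_L2[OF w ij] .
        have dL: "(\<lambda>x. J n i j x - pd D i j w x) \<in> L2 D" for n
          by (rule lin_spaceD(3)[OF lin_space_L2 sob_conv_L2(2)[OF J ij] pL])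
        have "L2norm D (?K i j) = L2norm D (\<lambda>x. (J p i j x - pd D i j w x) - (J q i j x - pd D i j w x))"
          by (simp add: algebra_simps)
        also have "\<dots> \<le> L2norm D (\<lambda>x. J p i j x - pd D i j w x) + L2norm D (\<lambda>x. J q i j x - pd D i j w x)"
          unfolding L2norm_def by (rule psd_triangle_diff[OF psd_ip lin_space_L2 dL dL])
        also have "\<dots> < 2 * \<eta>" using b by simp
        also have "2 * \<eta> = sqrt (edge_len e * \<epsilon> / (3 * (C + 1)))" unfolding \<eta>_def by simp
        finally show ?thesis unfolding L2norm_def by (simp only: real_sqrt_less_iff)
      qed
      have "edge_int e (\<lambda>x. ?K 0 0 x * ?K 0 0 x) \<le> C * (ip D (?K 0 0) (?K 0 0) + ip D (?K 1 0) (?K 1 0) + ip D (?K 0 1) (?K 0 1))"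
        by (rule C(2)[where J = ?K]) (rule smooth_jet_comb[OF sob_conv_jet[OF J] sob_conv_jet[OF J]], (rule KL, simp)+)
      also have "\<dots> \<le> C * (3 * (edge_len e * \<epsilon> / (3 * (C + 1))))"
      proof (rule mult_left_mono[OF _ C(1)])
        have sum3: "x < B \<Longrightarrow> y < B \<Longrightarrow> z < B \<Longrightarrow> x + y + z \<le> 3 * B" for x y z B :: real by linarith
        have "ip D (?K 0 0) (?K 0 0) < edge_len e * \<epsilon> / (3 * (C + 1))" by (rule K) (use m[OF p] m[OF q] in auto)
        moreover have "ip D (?K 1 0) (?K 1 0) < edge_len e * \<epsilon> / (3 * (C + 1))" by (rule K) (use m[OF p] m[OF q] in auto)
        moreover have "ip D (?K 0 1) (?K 0 1) < edge_len e * \<epsilon> / (3 * (C + 1))" by (rule K) (use m[OF p] m[OF q] in auto)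
        ultimately show "ip D (?K 0 0) (?K 0 0) + ip D (?K 1 0) (?K 1 0) + ip D (?K 0 1) (?K 0 1)
            \<le> 3 * (edge_len e * \<epsilon> / (3 * (C + 1)))" by (rule sum3)
      qed
      also have "\<dots> = edge_len e * \<epsilon> * (C / (C + 1))" using C(1) by (simp add: field_simps)
      also have "\<dots> < edge_len e * \<epsilon> * 1"
        using C(1) \<epsilon> accessible_len[OF acc] by (intro mult_strict_left_mono) auto
      finally have "edge_int e (\<lambda>x. ?K 0 0 x * ?K 0 0 x) < edge_len e * \<epsilon>" by simp
      moreover have "edge_int e (\<lambda>x. ?K 0 0 x * ?K 0 0 x) = edge_len e * (LINT t|lebesgue_on {0..1}. (f p t - f q t)\<^sup>2)"
        unfolding edge_int_def f_def e by (simp add: power2_eq_square)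
      ultimately show ?thesis using accessible_len[OF acc] by simp
    qed
    then show ?thesis by blast
  qed
  have "finite_measure (lebesgue_on {0..1::real})"
    by (rule finite_measure_lebesgue_on) simp
  from sqint_complete[OF this fL Cau] obtain h where
    h: "h \<in> sqint (lebesgue_on {0..1})" "(\<lambda>n. LINT t|lebesgue_on {0..1}. (f n t - h t)\<^sup>2) \<longlonglongrightarrow> 0" by blast
  \<comment> \<open>The limit lives on the parameter interval; a function of the plane is obtained
    from it by evaluating \<open>h\<close> at the parameter of the foot point on the line through
    the edge.\<close>
  define g where "g x = h (((x - a) \<bullet> (b - a)) / ((b - a) \<bullet> (b - a)))" for x
  have gh: "g (linepath a b t) = h t" for t
  proof -
    have "linepath a b t - a = t *\<^sub>R (b - a)" unfolding linepath_def by (simp add: algebra_simps)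
    then show ?thesis unfolding g_def using ab by simp
  qed
  have "(\<lambda>n. edge_len e * (LINT t|lebesgue_on {0..1}. (f n t - h t)\<^sup>2)) \<longlonglongrightarrow> 0"
    by (rule tendsto_mult_right_zero[OF h(2)])
  then have "(\<lambda>n. edge_int e (\<lambda>x. (J n 0 0 x - g x)\<^sup>2)) \<longlonglongrightarrow> 0"
    unfolding edge_int_def e by (simp add: gh f_def)
  moreover have "g \<in> L2_edge e" unfolding L2_edge_eq e using h(1) by (simp add: gh)
  ultimately show ?thesis unfolding is_trace_def using J by blast
qed

definition good_edge :: "pt set \<Rightarrow> edge \<Rightarrow> bool" where
  "good_edge D e \<longleftrightarrow> accessible D e \<or> edge_len e = 0"

lemma edge_trace_is_trace:
  assumes "accessible D e" "open D" "w \<in> sobolev 1 D" shows "is_trace D e w (edge_trace D e w)"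
  unfolding edge_trace_def using is_trace_exists[OF assms] by (rule someI_ex)

text \<open>Two traces are compared through their integrals against test functions, since as
  functions on the plane they may differ off the edge and on a null set of it.\<close>

lemma is_trace_unique_weak:
  assumes acc: "accessible D e" and D: "open D" and v: "v \<in> sobolev 1 D" and w: "w \<in> sobolev 1 D"
    and vw: "AE x in lebesgue_on D. v x = w x"
    and g: "is_trace D e v g" and h: "is_trace D e w h" and \<phi>: "\<phi> \<in> L2_edge e"
  shows "edge_int e (\<lambda>x. g x * \<phi> x) = edge_int e (\<lambda>x. h x * \<phi> x)"
proof -
  have gh: "g \<in> L2_edge e" "h \<in> L2_edge e" using g h unfolding is_trace_def by auto
  let ?z = "\<lambda>x. 1 * g x + (-1) * h x"
  have "is_trace D e (\<lambda>x. 1 * v x + (-1) * w x) ?z" by (rule is_trace_comb[OF D v w g h])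
  moreover have "AE x in lebesgue_on D. 1 * v x + (-1) * w x = 0" using vw by (rule eventually_mono) simp
  ultimately have "edge_int e (\<lambda>x. ?z x * ?z x) = 0"
    using is_trace_null[OF acc D lin_spaceD(1)[OF lin_space_sobolev v w, of 1 "-1"], of ?z] by blast
  from psd_null(1)[OF psd_edge lin_space_L2_edge lin_spaceD(1)[OF lin_space_L2_edge gh, of 1 "-1"] \<phi>, OF this]
  have "edge_int e (\<lambda>x. ?z x * \<phi> x) = 0" .
  moreover have "edge_int e (\<lambda>x. ?z x * \<phi> x) = 1 * edge_int e (\<lambda>x. g x * \<phi> x) + (-1) * edge_int e (\<lambda>x. h x * \<phi> x)"
    by (rule lin_onD(1)[OF psd_onD(1)[OF psd_edge \<phi>] gh])
  ultimately show ?thesis by simp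
qed

lemma edge_int_degenerate: "edge_len e = 0 \<Longrightarrow> edge_int e g = 0"
  unfolding edge_int_def by simp

lemma edge_trace_lin:
  assumes e: "good_edge D e" and D: "open D" and \<phi>: "\<phi> \<in> L2_edge e"
  shows "lin_on (sobolev 1 D) (\<lambda>v. edge_int e (\<lambda>x. edge_trace D e v x * \<phi> x))"
  unfolding lin_on_def
proof (intro ballI allI)
  fix v w a b assume vw: "v \<in> sobolev 1 D" "w \<in> sobolev 1 D"
  show "edge_int e (\<lambda>x. edge_trace D e (\<lambda>x. a * v x + b * w x) x * \<phi> x) =
    a * edge_int e (\<lambda>x. edge_trace D e v x * \<phi> x) + b * edge_int e (\<lambda>x. edge_trace D e w x * \<phi> x)"
  proof (cases "edge_len e = 0")
    case True then show ?thesis by (simp add: edge_int_degenerate)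
  next
    case False
    then have acc: "accessible D e" using e unfolding good_edge_def by blast
    let ?c = "\<lambda>x. a * v x + b * w x"
    have c: "?c \<in> sobolev 1 D" by (rule lin_spaceD(1)[OF lin_space_sobolev vw])
    note t = edge_trace_is_trace[OF acc D]
    have L: "edge_trace D e v \<in> L2_edge e" "edge_trace D e w \<in> L2_edge e"
      using t vw unfolding is_trace_def by auto
    have "edge_int e (\<lambda>x. edge_trace D e ?c x * \<phi> x) = edge_int e (\<lambda>x. (a * edge_trace D e v x + b * edge_trace D e w x) * \<phi> x)"
      by (rule is_trace_unique_weak[OF acc D c c _ t[OF c] is_trace_comb[OF D vw t[OF vw(1)] t[OF vw(2)]] \<phi>]) simp
    also have "\<dots> = a * edge_int e (\<lambda>x. edge_trace D e v x * \<phi> x) + b * edge_int e (\<lambda>x. edge_trace D e w x * \<phi> x)"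
      by (rule lin_onD(1)[OF psd_onD(1)[OF psd_edge \<phi>] L])
    finally show ?thesis .
  qed
qed

lemma edge_trace_null:
  assumes e: "good_edge D e" and D: "open D" and v: "v \<in> sobolev 1 D" and w: "w \<in> sobolev 1 D"
    and vw: "AE x in lebesgue_on D. v x = w x" and \<phi>: "\<phi> \<in> L2_edge e"
  shows "edge_int e (\<lambda>x. edge_trace D e v x * \<phi> x) = edge_int e (\<lambda>x. edge_trace D e w x * \<phi> x)"
proof (cases "edge_len e = 0")
  case True then show ?thesis by (simp add: edge_int_degenerate)
next
  case False
  then have acc: "accessible D e" using e unfolding good_edge_def by blast
  note t = edge_trace_is_trace[OF acc D]
  show ?thesis by (rule is_trace_unique_weak[OF acc D v w vw t[OF v] t[OF w] \<phi>])
qed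

text \<open>The constant sequence shows that a smooth function is its own trace. The boundary means
  of affine functions are computed from this.\<close>

lemma edge_trace_smooth:
  assumes e: "good_edge D e" and D: "open D" and J: "smooth_jet J" "\<And>i j. i + j \<le> 1 \<Longrightarrow> J i j \<in> L2 D"
    and \<phi>: "\<phi> \<in> L2_edge e"
  shows "edge_int e (\<lambda>x. edge_trace D e (J 0 0) x * \<phi> x) = edge_int e (\<lambda>x. J 0 0 x * \<phi> x)"
proof (cases "edge_len e = 0")
  case True then show ?thesis by (simp add: edge_int_degenerate)
next
  case False
  then have acc: "accessible D e" using e unfolding good_edge_def by blast
  have s: "has_sob_derivs 1 D (J 0 0) J" by (rule smooth_jet_sobolev[OF J])
  then have v: "J 0 0 \<in> sobolev 1 D" unfolding sobolev_def by blast
  have "is_trace D e (J 0 0) (J 0 0)"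
    unfolding is_trace_def
  proof (intro conjI exI)
    show "J 0 0 \<in> L2_edge e" by (intro continuous_L2_edge smooth_jet_continuous[OF J(1)])
    show "sob_conv 1 D (\<lambda>n. J) (J 0 0)"
      unfolding sob_conv_def
    proof (intro conjI allI impI J(1))
      fix i j :: nat assume ij: "i + j \<le> 1"
      have "L2_conv D (\<lambda>n. J i j) (J i j)"
        using J(2)[OF ij] unfolding L2_conv_def by (simp add: L2norm_def ip_def)
      then show "L2_conv D (\<lambda>n. J i j) (pd D i j (J 0 0))"
        by (rule L2_conv_AE[OF _ pd_L2[OF v ij]]) (use pd_AE[OF D s ij] in \<open>auto elim: eventually_mono\<close>)
    qed
    show "(\<lambda>n. edge_int e (\<lambda>x. (J 0 0 x - J 0 0 x)\<^sup>2)) \<longlonglongrightarrow> 0" by (simp add: edge_int_def)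
  qed
  then show ?thesis
    by (intro is_trace_unique_weak[OF acc D v v _ edge_trace_is_trace[OF acc D v] _ \<phi>]) auto
qed

section \<open>Edges of a simple polygon\<close>

lemma poly_path_ends:
  "xs \<noteq> [] \<Longrightarrow> pathstart (poly_path xs) = hd xs" "xs \<noteq> [] \<Longrightarrow> pathfinish (poly_path xs) = last xs"
  by (induction xs rule: poly_path.induct) auto

lemma path_image_poly_path:
  assumes "2 \<le> length xs"
  shows "path_image (poly_path xs) = (\<Union>i<length xs - 1. closed_segment (xs ! i) (xs ! Suc i))"
  using assms
proof (induction xs rule: poly_path.induct)
  case (4 a b c xs)
  have "{..<length (a # b # c # xs) - 1} = insert 0 (Suc ` {..<length (b # c # xs) - 1})"
    by (simp add: lessThan_Suc_eq_insert_0)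
  then have "(\<Union>i<length (a # b # c # xs) - 1. closed_segment ((a # b # c # xs) ! i) ((a # b # c # xs) ! Suc i))
      = closed_segment a b \<union> (\<Union>i<length (b # c # xs) - 1. closed_segment ((b # c # xs) ! i) ((b # c # xs) ! Suc i))"
    by simp
  moreover have "path_image (poly_path (a # b # c # xs)) = closed_segment a b \<union> path_image (poly_path (b # c # xs))"
    by (simp add: path_image_join poly_path_ends)
  ultimately show ?case using 4 by simp
qed (auto simp: lessThan_Suc)

lemma path_image_bdry_path:
  assumes "K \<noteq> []" shows "path_image (bdry_path K) = (\<Union>e\<in>cell_edges K. seg e)"
proof -
  have "closed_segment ((K @ [hd K]) ! i) ((K @ [hd K]) ! Suc i) = seg (K ! i, K ! (Suc i mod length K))"
    if "i < length K" for i
  proof (cases "Suc i = length K")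
    case True
    then show ?thesis using assms that by (simp add: seg_def nth_append hd_conv_nth)
  next
    case False
    then show ?thesis using that by (simp add: seg_def nth_append)
  qed
  then have "path_image (bdry_path K) = (\<Union>i<length K. seg (K ! i, K ! (Suc i mod length K)))"
    unfolding bdry_path_def using assms by (subst path_image_poly_path) (auto simp: Suc_le_eq)
  then show ?thesis unfolding cell_edges_def by auto
qed

lemma bdry_path_closed: "K \<noteq> [] \<Longrightarrow> pathfinish (bdry_path K) = pathstart (bdry_path K)"
  unfolding bdry_path_def by (simp add: poly_path_ends)

section \<open>The Jordan curve theorem for the boundary of a cell\<close>

text \<open>The image of the curve is a topological circle, so its complement is disconnected and
  each component has the whole curve as its frontier. The outside is connected, hence the inside
  cannot be empty.\<close>

lemma Jordan_inside_plane:
  fixes c :: "real \<Rightarrow> real^2"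
  assumes "simple_path c" "pathfinish c = pathstart c"
  shows "inside (path_image c) \<noteq> {}" "path_image c \<subseteq> closure (inside (path_image c))"
proof -
  let ?P = "path_image c"
  have "?P homeomorphic sphere (0::complex) 1"
    using assms by (intro homeomorphic_simple_path_image_circle) auto
  also have "sphere (0::complex) 1 homeomorphic sphere (0::real^2) 1"
    by (rule homeomorphic_spheres_gen) auto
  finally have hom: "?P homeomorphic sphere (0::real^2) 1" .
  have bP: "bounded ?P" using assms(1) by (simp add: bounded_simple_path_image)
  have "\<not> connected (- ?P)" using Jordan_Brouwer_separation[OF hom] by simp
  moreover have "connected (outside ?P)" using connected_outside[OF bP] by simp
  ultimately show ne: "inside ?P \<noteq> {}" using inside_Un_outside[of ?P] by (metis sup_bot_left)
  obtain x where x: "x \<in> inside ?P" using ne by blast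
  define T where "T = connected_component_set (- ?P) x"
  have "x \<in> - ?P" using x inside_no_overlap by blast
  then have "T \<in> components (- ?P)" unfolding T_def components_def by blast
  then have "frontier T = ?P" using Jordan_Brouwer_frontier[OF hom] by simp
  moreover have "T \<subseteq> inside ?P" unfolding T_def using inside_same_component x by blast
  ultimately show "?P \<subseteq> closure (inside ?P)" using closure_mono unfolding frontier_def by blast
qed

section \<open>Thin triangles along an edge\<close>

definition perp :: "real^2 \<Rightarrow> real^2" where
  "perp t = vector [- (t $ 2), t $ 1]"

lemma perp_simps: "perp t $ 1 = - (t $ 2)" "perp t $ 2 = t $ 1"
  unfolding perp_def by simp_all

lemma perp_coordinates:
  fixes t x :: "real^2"
  assumes "t \<noteq> 0"
  shows "x = ((x \<bullet> t) / (t \<bullet> t)) *\<^sub>R t + ((x \<bullet> perp t) / (t \<bullet> t)) *\<^sub>R perp t"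
proof -
  have "t \<bullet> t = (t $ 1)\<^sup>2 + (t $ 2)\<^sup>2" by (simp add: inner_vec_def sum_2 power2_eq_square)
  moreover have "t \<bullet> t \<noteq> 0" using assms by simp
  ultimately have nz: "(t $ 1)\<^sup>2 + (t $ 2)\<^sup>2 \<noteq> 0" by simp
  have "(t \<bullet> t) *\<^sub>R x = (x \<bullet> t) *\<^sub>R t + (x \<bullet> perp t) *\<^sub>R perp t"
    by (simp add: vec_eq_iff forall_2 inner_vec_def sum_2 perp_simps algebra_simps)
  then have "(1 / (t \<bullet> t)) *\<^sub>R ((t \<bullet> t) *\<^sub>R x) = (1 / (t \<bullet> t)) *\<^sub>R ((x \<bullet> t) *\<^sub>R t + (x \<bullet> perp t) *\<^sub>R perp t)" by simp
  then show ?thesis using \<open>t \<bullet> t \<noteq> 0\<close> by (simp add: scaleR_add_right)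
qed

lemma perp_unique:
  fixes t :: "real^2"
  assumes "t \<noteq> 0" "x *\<^sub>R t + y *\<^sub>R perp t = x' *\<^sub>R t + y' *\<^sub>R perp t"
  shows "x = x'" "y = y'"
proof -
  have p: "t \<bullet> perp t = 0" "perp t \<bullet> t = 0" "perp t \<bullet> perp t = t \<bullet> t"
    by (simp_all add: inner_vec_def sum_2 perp_simps)
  have "(x *\<^sub>R t + y *\<^sub>R perp t) \<bullet> t = (x' *\<^sub>R t + y' *\<^sub>R perp t) \<bullet> t"
    "(x *\<^sub>R t + y *\<^sub>R perp t) \<bullet> perp t = (x' *\<^sub>R t + y' *\<^sub>R perp t) \<bullet> perp t" using assms(2) by simp_all
  then show "x = x'" "y = y'" using assms(1) by (simp_all add: inner_add_left p)
qed

text \<open>A segment that leaves \<open>a\<close> at a nonzero angle to \<open>t\<close> has a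
  fixed slope, and points of smaller slope miss it; a segment on the line itself is missed because
  \<open>y\<close> is nonzero.\<close>

lemma segment_avoids_at_endpoint:
  fixes a t q :: "real^2"
  assumes t: "t \<noteq> 0"
  shows "\<exists>\<epsilon>>0. \<forall>x y. 0 < x \<longrightarrow> 0 < \<bar>y\<bar> \<longrightarrow> \<bar>y\<bar> < \<epsilon> * x \<longrightarrow> a + x *\<^sub>R t + y *\<^sub>R perp t \<notin> closed_segment a q"
proof -
  obtain \<alpha> \<beta> where q: "q - a = \<alpha> *\<^sub>R t + \<beta> *\<^sub>R perp t" using perp_coordinates[OF t, of "q - a"] by blast
  \<comment> \<open>A positive number below the slope
    \<open>\<bar>\<beta>\<bar> / \<bar>\<alpha>\<bar>\<close> that stays defined for
    \<open>\<alpha> = 0\<close>; the default one covers a segment on the line.\<close>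
  define \<epsilon> where "\<epsilon> = (if \<beta> = 0 then 1 else \<bar>\<beta>\<bar> / (\<bar>\<alpha>\<bar> + 1))"
  have "0 < \<epsilon>" unfolding \<epsilon>_def by (simp add: add_nonneg_pos)
  moreover have False if xy: "0 < x" "0 < \<bar>y\<bar>" "\<bar>y\<bar> < \<epsilon> * x" and mem: "a + x *\<^sub>R t + y *\<^sub>R perp t \<in> closed_segment a q" for x y
  proof -
    obtain l where l: "0 \<le> l" "l \<le> 1" "a + x *\<^sub>R t + y *\<^sub>R perp t = (1 - l) *\<^sub>R a + l *\<^sub>R q"
      using mem unfolding closed_segment_def by blast
    then have "x *\<^sub>R t + y *\<^sub>R perp t = l *\<^sub>R (q - a)" by (simp add: algebra_simps)
    then have "x *\<^sub>R t + y *\<^sub>R perp t = (l * \<alpha>) *\<^sub>R t + (l * \<beta>) *\<^sub>R perp t" unfolding q by (simp add: algebra_simps)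
    then have x: "x = l * \<alpha>" and y: "y = l * \<beta>" using perp_unique[OF t] by blast+
    have \<beta>: "\<beta> \<noteq> 0" and "l \<noteq> 0" using y xy(2) by auto
    then have lp: "0 < l" using l(1) by simp
    then have "0 < \<alpha>" using xy(1) x by (simp add: zero_less_mult_iff)
    have "l * \<bar>\<beta>\<bar> < \<bar>\<beta>\<bar> / (\<bar>\<alpha>\<bar> + 1) * (l * \<alpha>)"
      using xy(3) \<beta> lp unfolding x y \<epsilon>_def by (simp add: abs_mult)
    then have "l * \<bar>\<beta>\<bar> * (\<alpha> + 1) < l * \<bar>\<beta>\<bar> * \<alpha>" using \<open>0 < \<alpha>\<close> by (simp add: field_simps)
    then show False using lp \<beta> by (simp add: mult_less_cancel_left)
  qed
  ultimately show ?thesis by blast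
qed

text \<open>Coordinates along and across an edge, scaled so that the edge is the unit interval. The
  set consists of two open triangles, one on each side; tapering at both ends leaves room for
  neighbouring edges that meet the edge at small angles.\<close>

definition thin_triangle :: "real \<Rightarrow> (real \<times> real) set" where
  "thin_triangle \<epsilon> = {(x, y). 0 < x \<and> x < 1 \<and> 0 < \<bar>y\<bar> \<and> \<bar>y\<bar> < \<epsilon> * x \<and> \<bar>y\<bar> < \<epsilon> * (1 - x)}"

lemma thin_triangle_mono:
  assumes "\<epsilon> \<le> \<epsilon>'" "(x, y) \<in> thin_triangle \<epsilon>" shows "(x, y) \<in> thin_triangle \<epsilon>'"
proof -
  have *: "0 < x" "x < 1" "0 < \<bar>y\<bar>" "\<bar>y\<bar> < \<epsilon> * x" "\<bar>y\<bar> < \<epsilon> * (1 - x)"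
    using assms(2) unfolding thin_triangle_def by auto
  have "\<epsilon> * x \<le> \<epsilon>' * x" "\<epsilon> * (1 - x) \<le> \<epsilon>' * (1 - x)"
    using assms(1) *(1,2) by (auto intro!: mult_right_mono)
  then have "\<bar>y\<bar> < \<epsilon>' * x" "\<bar>y\<bar> < \<epsilon>' * (1 - x)" using *(4,5) by linarith+
  then show ?thesis using *(1,2,3) unfolding thin_triangle_def by blast
qed

text \<open>A disjoint segment has positive distance by compactness. A segment that starts at an end
  point, the edge itself included, is avoided by its slope.\<close>

lemma segment_avoids_thin_triangle:
  fixes a b :: "real^2"
  assumes ab: "a \<noteq> b" and pq: "seg (a, b) \<inter> seg e' = {} \<or> {fst e', snd e'} \<inter> {a, b} \<noteq> {}"
  shows "\<exists>\<epsilon>>0. \<forall>(x, y)\<in>thin_triangle \<epsilon>. a + x *\<^sub>R (b - a) + y *\<^sub>R perp (b - a) \<notin> seg e'"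
  using pq
proof
  assume disj: "seg (a, b) \<inter> seg e' = {}"
  have "\<exists>\<delta>>0. \<forall>x\<in>seg (a, b). \<forall>y\<in>seg e'. \<delta> \<le> dist x y"
    using separate_compact_closed[of "seg (a, b)" "seg e'"] disj unfolding seg_def by auto
  then obtain \<delta> where \<delta>: "0 < \<delta>" "\<And>x y. x \<in> seg (a, b) \<Longrightarrow> y \<in> seg e' \<Longrightarrow> \<delta> \<le> dist x y" by blast
  have n: "norm (perp (b - a)) = norm (b - a)" 
    by (simp add: norm_eq_sqrt_inner inner_vec_def sum_2 perp_simps algebra_simps)
  have pos: "0 < norm (b - a)" using ab by simp
  define \<epsilon> where "\<epsilon> = \<delta> / norm (b - a)"
  have "0 < \<epsilon>" unfolding \<epsilon>_def using \<delta> pos by simp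
  moreover have "a + x *\<^sub>R (b - a) + y *\<^sub>R perp (b - a) \<notin> seg e'" if xy: "(x, y) \<in> thin_triangle \<epsilon>" for x y
  proof
    assume m: "a + x *\<^sub>R (b - a) + y *\<^sub>R perp (b - a) \<in> seg e'"
    have x: "0 < x" "x < 1" "\<bar>y\<bar> < \<epsilon> * x" using xy unfolding thin_triangle_def by auto
    have "a + x *\<^sub>R (b - a) \<in> seg (a, b)"
      unfolding seg_def closed_segment_def using x by (auto intro!: exI[of _ x] simp: algebra_simps)
    from \<delta>(2)[OF this m] have "\<delta> \<le> \<bar>y\<bar> * norm (b - a)" by (simp add: dist_norm n)
    also have "\<dots> < \<epsilon> * x * norm (b - a)" using x(3) pos by simp
    also have "\<dots> = \<delta> * x" unfolding \<epsilon>_def using pos by simp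
    also have "\<dots> \<le> \<delta>" using x \<delta>(1) by (simp add: mult_left_le)
    finally show False by simp
  qed
  ultimately show ?thesis by blast
next
  assume "{fst e', snd e'} \<inter> {a, b} \<noteq> {}"
  then obtain q where q: "seg e' = closed_segment a q \<or> seg e' = closed_segment b q"
    unfolding seg_def using closed_segment_commute by blast
  then show ?thesis
  proof
    assume s: "seg e' = closed_segment a q"
    obtain \<epsilon> where "0 < \<epsilon>" "\<And>x y. 0 < x \<Longrightarrow> 0 < \<bar>y\<bar> \<Longrightarrow> \<bar>y\<bar> < \<epsilon> * x \<Longrightarrow> a + x *\<^sub>R (b - a) + y *\<^sub>R perp (b - a) \<notin> closed_segment a q"
      using segment_avoids_at_endpoint[of "b - a" a q] ab by auto
    then show ?thesis unfolding s thin_triangle_def by (intro exI[of _ \<epsilon>]) auto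
  next
    assume s: "seg e' = closed_segment b q"
    obtain \<epsilon> where e: "0 < \<epsilon>" "\<And>x y. 0 < x \<Longrightarrow> 0 < \<bar>y\<bar> \<Longrightarrow> \<bar>y\<bar> < \<epsilon> * x \<Longrightarrow> b + x *\<^sub>R (a - b) + y *\<^sub>R perp (a - b) \<notin> closed_segment b q"
      using segment_avoids_at_endpoint[of "a - b" b q] ab by auto
    \<comment> \<open>Seen from \<open>b\<close>, the coordinate along the edge is
      \<open>1 - x\<close>, and the other changes sign because \<open>perp\<close> is odd.\<close>
    have eq: "a + x *\<^sub>R (b - a) + y *\<^sub>R perp (b - a) = b + (1 - x) *\<^sub>R (a - b) + (- y) *\<^sub>R perp (a - b)" for x y
      by (simp add: vec_eq_iff forall_2 perp_simps algebra_simps)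
    have "a + x *\<^sub>R (b - a) + y *\<^sub>R perp (b - a) \<notin> seg e'" if "(x, y) \<in> thin_triangle \<epsilon>" for x y
      unfolding s eq using that unfolding thin_triangle_def by (intro e(2)) auto
    then show ?thesis using e(1) by (intro exI[of _ \<epsilon>]) auto
  qed
qed

lemma finite_avoids_thin_triangle:
  fixes a b :: "real^2"
  assumes "finite E" "\<And>e'. e' \<in> E \<Longrightarrow> \<exists>\<epsilon>>0. \<forall>(x, y)\<in>thin_triangle \<epsilon>. f x y \<notin> seg e'"
  shows "\<exists>\<epsilon>>0. \<forall>(x, y)\<in>thin_triangle \<epsilon>. f x y \<notin> (\<Union>e'\<in>E. seg e')"
  using assms
proof (induction E rule: finite_induct)
  case empty
  show ?case by (intro exI[of _ 1]) auto
next
  case (insert e' E)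
  obtain \<epsilon> where \<epsilon>: "0 < \<epsilon>" "\<And>x y. (x, y) \<in> thin_triangle \<epsilon> \<Longrightarrow> f x y \<notin> (\<Union>e'\<in>E. seg e')"
    using insert by (metis (no_types, lifting) case_prodD insertI2)
  obtain \<epsilon>' where \<epsilon>': "0 < \<epsilon>'" "\<And>x y. (x, y) \<in> thin_triangle \<epsilon>' \<Longrightarrow> f x y \<notin> seg e'"
    using insert.prems[of e'] by (metis (no_types, lifting) case_prodD insertI1)
  show ?case
    using \<epsilon> \<epsilon>' thin_triangle_mono[of "min \<epsilon> \<epsilon>'" \<epsilon>] thin_triangle_mono[of "min \<epsilon> \<epsilon>'" \<epsilon>']
    by (intro exI[of _ "min \<epsilon> \<epsilon>'"]) auto
qed

lemma cell_open: "open (cell K)"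
proof -
  have "path (poly_path xs)" for xs
    by (induction xs rule: poly_path.induct)
      (simp_all only: poly_path.simps path_linepath path_join_imp poly_path_ends pathfinish_linepath list.sel list.simps not_False_eq_True)
  then have "closed (path_image (bdry_path K))" unfolding bdry_path_def using closed_path_image by blast
  then show ?thesis unfolding cell_def by (rule open_inside)
qed

text \<open>One half of the thin triangle is convex and misses the curve, so it stays in one
  component of the complement; a single inner point decides for the whole half. The factor
  \<open>sgn y0\<close> selects that half.\<close>

lemma thin_triangle_side:
  assumes y0: "y0 \<noteq> 0" and mem: "(x0, y0) \<in> thin_triangle \<epsilon>"
    and avoid: "\<And>x y. (x, y) \<in> thin_triangle \<epsilon> \<Longrightarrow> a + x *\<^sub>R t + y *\<^sub>R n \<notin> P"
    and ins: "a + x0 *\<^sub>R t + y0 *\<^sub>R n \<in> inside (P :: pt set)"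
    and xy: "(x, \<bar>y\<bar>) \<in> thin_triangle \<epsilon>"
  shows "a + x *\<^sub>R t + (sgn y0 * \<bar>y\<bar>) *\<^sub>R n \<in> inside P"
proof -
  define C where "C = {z :: real \<times> real. 0 < fst z \<and> fst z < 1 \<and> 0 < sgn y0 * snd z \<and> sgn y0 * snd z < \<epsilon> * fst z
     \<and> sgn y0 * snd z < \<epsilon> * (1 - fst z)}"
  define F where "F z = a + fst z *\<^sub>R t + snd z *\<^sub>R n" for z :: "real \<times> real"
  have s: "sgn y0 = 1 \<or> sgn y0 = -1" using y0 by (simp add: sgn_if)
  have CT: "z \<in> C \<Longrightarrow> z \<in> thin_triangle \<epsilon>" for z
    using s unfolding C_def thin_triangle_def by (cases z) auto
  have "convex C"
  proof -
    have "C = {z. fst z > 0} \<inter> {z. fst z < 1} \<inter> {z. sgn y0 * snd z > 0} \<inter> {z. sgn y0 * snd z - \<epsilon> * fst z < 0}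
        \<inter> {z. sgn y0 * snd z + \<epsilon> * fst z < \<epsilon>}"
      unfolding C_def by (auto simp: algebra_simps)
    moreover have "{z :: real \<times> real. fst z > 0} = {z. (1, 0) \<bullet> z > 0}" "{z :: real \<times> real. fst z < 1} = {z. (1, 0) \<bullet> z < 1}"
      "{z :: real \<times> real. sgn y0 * snd z > 0} = {z. (0, sgn y0) \<bullet> z > 0}"
      "{z :: real \<times> real. sgn y0 * snd z - \<epsilon> * fst z < 0} = {z. (- \<epsilon>, sgn y0) \<bullet> z < 0}"
      "{z :: real \<times> real. sgn y0 * snd z + \<epsilon> * fst z < \<epsilon>} = {z. (\<epsilon>, sgn y0) \<bullet> z < \<epsilon>}"
      by (auto simp: inner_prod_def)
    ultimately show ?thesis
      by (simp only: convex_Int convex_halfspace_lt convex_halfspace_gt)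
  qed
  then have "connected (F ` C)"
    unfolding F_def by (intro connected_continuous_image continuous_intros convex_connected)
  moreover have "F ` C \<subseteq> - P" using CT avoid unfolding F_def by force
  moreover have "F (x0, y0) \<in> F ` C"
    using mem y0 s unfolding C_def thin_triangle_def by (intro imageI) (auto simp: sgn_if)
  moreover have "F (x, sgn y0 * \<bar>y\<bar>) \<in> F ` C"
    using xy s unfolding C_def thin_triangle_def by (intro imageI) auto
  ultimately have "connected_component (- P) (F (x0, y0)) (F (x, sgn y0 * \<bar>y\<bar>))"
    unfolding connected_component_def by blast
  then have "F (x, sgn y0 * \<bar>y\<bar>) \<in> inside P" using inside_same_component ins unfolding F_def by auto
  then show ?thesis unfolding F_def by simp
qed

text \<open>A half edge translated straight across the edge would leave the triangle near its tip.
  The translation is therefore tilted towards the middle, in opposite directions for the two end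
  points.\<close>

lemma accessible_if_thin_triangle:
  fixes a b :: pt
  assumes ab: "a \<noteq> b" and \<epsilon>: "0 < \<epsilon>" and \<sigma>: "\<sigma> \<noteq> 0"
    and sub: "\<And>x y. 0 < y \<Longrightarrow> (x, y) \<in> thin_triangle \<epsilon> \<Longrightarrow> a + x *\<^sub>R (b - a) + (\<sigma> * y) *\<^sub>R perp (b - a) \<in> D"
  shows "accessible D (a, b)"
proof -
  define t where "t = b - a"
  have sq: "(t $ 1)\<^sup>2 + (t $ 2)\<^sup>2 \<noteq> 0"
    using ab unfolding t_def by (auto simp: vec_eq_iff forall_2 sum_power2_eq_zero_iff)
  have det: "t $ 1 * (r *\<^sub>R t + (\<sigma> * \<epsilon> / 8) *\<^sub>R perp t) $ 2 - t $ 2 * (r *\<^sub>R t + (\<sigma> * \<epsilon> / 8) *\<^sub>R perp t) $ 1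
      = (\<sigma> * \<epsilon> / 8) * ((t $ 1)\<^sup>2 + (t $ 2)\<^sup>2)" for r
    by (simp add: perp_simps power2_eq_square algebra_simps)
  have m: "(x, s * \<epsilon> / 8) \<in> thin_triangle \<epsilon>" if "0 < s" "s < 1" "s / 4 \<le> x" "s / 4 \<le> 1 - x" for x s
  proof -
    have "0 < s * \<epsilon>" using that \<epsilon> by simp
    have "\<epsilon> * (s / 4) \<le> \<epsilon> * x" "\<epsilon> * (s / 4) \<le> \<epsilon> * (1 - x)" using that(3,4) \<epsilon> by (auto intro!: mult_left_mono)
    moreover have "s * \<epsilon> / 8 < \<epsilon> * (s / 4)" using \<open>0 < s * \<epsilon>\<close> by (simp add: mult.commute)
    ultimately have "s * \<epsilon> / 8 < \<epsilon> * x" "s * \<epsilon> / 8 < \<epsilon> * (1 - x)" by linarith+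
    then show ?thesis using that \<epsilon> \<open>0 < s * \<epsilon>\<close> unfolding thin_triangle_def by simp
  qed
  \<comment> \<open>The tilt by a quarter keeps the position along the edge at least
    \<open>s / 4\<close> away from both ends, where the triangle has height at least
    \<open>\<epsilon> * (s / 4)\<close>, twice the height \<open>s * \<epsilon> / 8\<close> that is
    used.\<close>
  define d where "d = (1 / 4) *\<^sub>R t + (\<sigma> * \<epsilon> / 8) *\<^sub>R perp t"
  define d' where "d' = (- 1 / 4) *\<^sub>R t + (\<sigma> * \<epsilon> / 8) *\<^sub>R perp t"
  have d: "a + r *\<^sub>R ((1 / 2) *\<^sub>R (b - a)) + s *\<^sub>R d \<in> D" if "0 < r" "r < 1" "0 < s" "s < 1" for r s
  proof -
    have "a + r *\<^sub>R ((1 / 2) *\<^sub>R (b - a)) + s *\<^sub>R d = a + (r / 2 + s / 4) *\<^sub>R (b - a) + (\<sigma> * (s * \<epsilon> / 8)) *\<^sub>R perp (b - a)"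
      unfolding d_def t_def by (simp add: vec_eq_iff algebra_simps)
    moreover have "(r / 2 + s / 4, s * \<epsilon> / 8) \<in> thin_triangle \<epsilon>" using that by (intro m) auto
    moreover have "0 < s * \<epsilon> / 8" using that \<epsilon> by simp
    ultimately show ?thesis using sub[of "s * \<epsilon> / 8" "r / 2 + s / 4"] by (simp only:)
  qed
  have d': "b + r *\<^sub>R ((1 / 2) *\<^sub>R (a - b)) + s *\<^sub>R d' \<in> D" if "0 < r" "r < 1" "0 < s" "s < 1" for r s
  proof -
    have "b + r *\<^sub>R ((1 / 2) *\<^sub>R (a - b)) + s *\<^sub>R d' = a + (1 - r / 2 - s / 4) *\<^sub>R (b - a) + (\<sigma> * (s * \<epsilon> / 8)) *\<^sub>R perp (b - a)"
      unfolding d'_def t_def by (simp add: vec_eq_iff algebra_simps)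
    moreover have "(1 - r / 2 - s / 4, s * \<epsilon> / 8) \<in> thin_triangle \<epsilon>" using that by (intro m) auto
    moreover have "0 < s * \<epsilon> / 8" using that \<epsilon> by simp
    ultimately show ?thesis using sub[of "s * \<epsilon> / 8" "1 - r / 2 - s / 4"] by (simp only:)
  qed
  have "(b - a) $ 1 * d $ 2 - (b - a) $ 2 * d $ 1 \<noteq> 0"
    unfolding t_def[symmetric] d_def det using sq \<epsilon> \<sigma> by simp
  moreover have "(a - b) $ 1 * d' $ 2 - (a - b) $ 2 * d' $ 1 \<noteq> 0"
  proof -
    have "(a - b) $ 1 * d' $ 2 - (a - b) $ 2 * d' $ 1 = - (t $ 1 * d' $ 2 - t $ 2 * d' $ 1)"
      unfolding t_def by (simp add: algebra_simps)
    then show ?thesis unfolding d'_def det using sq \<epsilon> \<sigma> by simp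
  qed
  ultimately show ?thesis unfolding accessible_def using d d' by auto
qed

text \<open>The midpoint of the edge lies in the closure of the cell, so cell points come
  arbitrarily close to it. Such a point sits in the thin triangle, off the edge, and pulls its side
  of the triangle into the cell.\<close>

lemma edge_accessible:
  assumes K: "simple_polygon K" and e: "e \<in> cell_edges K" and ne: "fst e \<noteq> snd e"
    and sep: "\<forall>e\<in>cell_edges K. \<forall>e'\<in>cell_edges K.
      seg e = seg e' \<or> seg e \<inter> seg e' \<subseteq> {fst e, snd e} \<inter> {fst e', snd e'}"
  shows "accessible (cell K) e"
proof -
  obtain a b where ab: "e = (a, b)" by (cases e)
  have anb: "a \<noteq> b" using ne ab by simp
  have K0: "K \<noteq> []" using K unfolding simple_polygon_def by auto
  let ?P = "path_image (bdry_path K)"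
  have P: "?P = (\<Union>e\<in>cell_edges K. seg e)" by (rule path_image_bdry_path[OF K0])
  have J: "?P \<subseteq> closure (cell K)"
    unfolding cell_def using K bdry_path_closed[OF K0] unfolding simple_polygon_def by (intro Jordan_inside_plane(2)) auto
  have "finite (cell_edges K)" unfolding cell_edges_def by simp
  then have "\<exists>\<epsilon>>0. \<forall>(x, y)\<in>thin_triangle \<epsilon>. a + x *\<^sub>R (b - a) + y *\<^sub>R perp (b - a) \<notin> (\<Union>e'\<in>cell_edges K. seg e')"
  proof (rule finite_avoids_thin_triangle)
    fix e' assume e': "e' \<in> cell_edges K"
    \<comment> \<open>Either the segments coincide and share their end points, or they meet in
      common end points at most; both alternatives give this dichotomy.\<close>
    have "seg (a, b) \<inter> seg e' = {} \<or> {fst e', snd e'} \<inter> {a, b} \<noteq> {}"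
      using sep[rule_format, OF e e'] unfolding ab
    proof
      assume "seg (a, b) = seg e'"
      then have "{a, b} = {fst e', snd e'}" unfolding seg_def by (simp add: closed_segment_eq)
      then show ?thesis by blast
    qed auto
    then show "\<exists>\<epsilon>>0. \<forall>(x, y)\<in>thin_triangle \<epsilon>. a + x *\<^sub>R (b - a) + y *\<^sub>R perp (b - a) \<notin> seg e'"
      by (rule segment_avoids_thin_triangle[OF anb])
  qed
  then obtain \<epsilon> where \<epsilon>: "0 < \<epsilon>" and avoid: "\<And>x y. (x, y) \<in> thin_triangle \<epsilon> \<Longrightarrow> a + x *\<^sub>R (b - a) + y *\<^sub>R perp (b - a) \<notin> ?P"
    unfolding P by blast
  define t where "t = b - a"
  have t: "t \<noteq> 0" using anb unfolding t_def by simp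
  define m where "m = a + (1 / 2) *\<^sub>R t"
  \<comment> \<open>Chosen so that the coordinates satisfy \<open>\<bar>x\<bar> < 1 / 4\<close> and
    \<open>\<bar>y\<bar> < \<epsilon> / 4\<close>; at distance at least \<open>1 / 4\<close> from
    both ends the triangle is that high.\<close>
  define \<rho> where "\<rho> = norm t * min (1 / 4) (\<epsilon> / 4)"
  have "0 < \<rho>" unfolding \<rho>_def using t \<epsilon> by simp
  have "m \<in> seg e" unfolding m_def t_def seg_def closed_segment_def ab by (auto intro!: exI[of _ "1 / 2"] simp: algebra_simps)
  then have "m \<in> closure (cell K)" using J P e by blast
  then obtain z where z: "z \<in> cell K" "dist z m < \<rho>" using \<open>0 < \<rho>\<close> unfolding closure_approachable by blast
  define x where "x = ((z - m) \<bullet> t) / (t \<bullet> t)"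
  define y where "y = ((z - m) \<bullet> perp t) / (t \<bullet> t)"
  have zm: "z = a + (1 / 2 + x) *\<^sub>R t + y *\<^sub>R perp t"
  proof -
    have "z - m = x *\<^sub>R t + y *\<^sub>R perp t" unfolding x_def y_def by (rule perp_coordinates[OF t])
    then have "z = m + (x *\<^sub>R t + y *\<^sub>R perp t)" by (simp add: algebra_simps)
    then show ?thesis unfolding m_def by (simp add: algebra_simps)
  qed
  have np: "norm (perp t) = norm t"
    by (simp add: norm_eq_sqrt_inner inner_vec_def sum_2 perp_simps)
  have tt: "t \<bullet> t = norm t * norm t" by (simp add: dot_square_norm power2_eq_square)
  have bd: "\<bar>((z - m) \<bullet> w) / (t \<bullet> t)\<bar> < min (1 / 4) (\<epsilon> / 4)" if "norm w = norm t" for w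
  proof -
    have "\<bar>(z - m) \<bullet> w\<bar> \<le> norm (z - m) * norm t" using Cauchy_Schwarz_ineq2[of "z - m" w] that by simp
    also have "\<dots> < \<rho> * norm t" using z(2) t by (simp add: dist_norm)
    also have "\<dots> = min (1 / 4) (\<epsilon> / 4) * (t \<bullet> t)" unfolding \<rho>_def tt by simp
    finally have "\<bar>(z - m) \<bullet> w\<bar> < min (1 / 4) (\<epsilon> / 4) * (t \<bullet> t)" .
    moreover have "0 < t \<bullet> t" using t by simp
    ultimately show ?thesis unfolding abs_divide by (simp only: abs_of_pos pos_divide_less_eq)
  qed
  have x: "\<bar>x\<bar> < 1 / 4" and y: "\<bar>y\<bar> < \<epsilon> / 4" using bd[of t] bd[OF np] unfolding x_def y_def by auto
  have y0: "y \<noteq> 0"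
  proof
    assume "y = 0"
    then have "z = a + (1 / 2 + x) *\<^sub>R (b - a)" unfolding zm t_def by simp
    moreover have "a + r *\<^sub>R (b - a) = (1 - r) *\<^sub>R a + r *\<^sub>R b" for r by (simp add: algebra_simps)
    ultimately have "z = (1 - (1 / 2 + x)) *\<^sub>R a + (1 / 2 + x) *\<^sub>R b" by metis
    then have "z \<in> seg e" unfolding seg_def closed_segment_def ab using x by (auto intro!: exI[of _ "1 / 2 + x"])
    then have "z \<in> ?P" using P e by blast
    then show False using z(1) inside_no_overlap unfolding cell_def by blast
  qed
  have "\<epsilon> * (1 / 4) \<le> \<epsilon> * (1 / 2 + x)" "\<epsilon> * (1 / 4) \<le> \<epsilon> * (1 - (1 / 2 + x))"
    using x \<epsilon> by (auto intro!: mult_left_mono)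
  then have zT: "(1 / 2 + x, y) \<in> thin_triangle \<epsilon>" using x y y0 unfolding thin_triangle_def by auto
  have "accessible (cell K) (a, b)"
  proof (rule accessible_if_thin_triangle[OF anb \<epsilon>])
    show "sgn y \<noteq> 0" using y0 by (simp add: sgn_zero_iff)
    fix x' y' :: real assume "0 < y'" "(x', y') \<in> thin_triangle \<epsilon>"
    then show "a + x' *\<^sub>R (b - a) + (sgn y * y') *\<^sub>R perp (b - a) \<in> cell K"
      using thin_triangle_side[OF y0 zT, of a "b - a" "perp (b - a)" ?P x' y'] avoid z(1) zm
      unfolding cell_def t_def by simp
  qed
  then show ?thesis unfolding ab .
qed

section \<open>Cells of a decomposition\<close>

lemma decompositionD:
  assumes "decomposition \<Omega> T"
  shows "finite T" "K \<in> T \<Longrightarrow> simple_polygon K"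
    "K \<in> T \<Longrightarrow> K' \<in> T \<Longrightarrow> K \<noteq> K' \<Longrightarrow> cell K \<inter> cell K' = {}"
    "(\<Union>K\<in>T. closure (cell K)) = closure \<Omega>"
proof -
  note d = assms[unfolded decomposition_def]
  show "finite T" by (rule conjunct1[OF d])
  show "K \<in> T \<Longrightarrow> simple_polygon K" by (rule bspec[OF d[THEN conjunct2, THEN conjunct1]])
  show "K \<in> T \<Longrightarrow> K' \<in> T \<Longrightarrow> K \<noteq> K' \<Longrightarrow> cell K \<inter> cell K' = {}"
    by (rule d[THEN conjunct2, THEN conjunct2, THEN conjunct1, THEN bspec, THEN bspec, THEN mp])
  show "(\<Union>K\<in>T. closure (cell K)) = closure \<Omega>"
    by (rule d[THEN conjunct2, THEN conjunct2, THEN conjunct2, THEN conjunct1])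
qed

text \<open>\<open>has_edge\<close> also accepts the reversed edge; \<open>accessible\<close> treats
  both end points alike, hence is invariant under reversal.\<close>

lemma good_edge_cell:
  assumes T: "decomposition \<Omega> T" and K: "K \<in> T" and e: "has_edge K e"
  shows "good_edge (cell K) e"
proof (cases "fst e = snd e")
  case True
  then show ?thesis unfolding good_edge_def edge_len_def by simp
next
  case False
  have swap: "accessible D (prod.swap e) = accessible D e" for D
    unfolding accessible_def by (simp add: insert_commute)
  have sp: "simple_polygon K" by (rule decompositionD(2)[OF T K])
  note sep0 = T[unfolded decomposition_def, THEN conjunct2, THEN conjunct2, THEN conjunct2, THEN conjunct2]
  have sep: "\<forall>e\<in>cell_edges K. \<forall>e'\<in>cell_edges K.
      seg e = seg e' \<or> seg e \<inter> seg e' \<subseteq> {fst e, snd e} \<inter> {fst e', snd e'}"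
    by (rule bspec[OF bspec[OF sep0 K] K])
  have "accessible (cell K) e"
  proof (cases "e \<in> cell_edges K")
    case True
    show ?thesis by (rule edge_accessible[OF sp True False sep])
  next
    case F: False
    then have e': "prod.swap e \<in> cell_edges K" using e unfolding has_edge_def by blast
    have ne: "fst (prod.swap e) \<noteq> snd (prod.swap e)" using False by simp
    show ?thesis using edge_accessible[OF sp e' ne sep] unfolding swap .
  qed
  then show ?thesis unfolding good_edge_def by simp
qed

lemma cell_nonempty: "simple_polygon K \<Longrightarrow> cell K \<noteq> {}"
  unfolding cell_def simple_polygon_def using bdry_path_closed[of K] Jordan_inside_plane(1)[of "bdry_path K"]
  by (cases "K = []") auto

lemma cell_bounded: "simple_polygon K \<Longrightarrow> bounded (cell K)"
  unfolding cell_def simple_polygon_def by (intro bounded_inside bounded_simple_path_image) auto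

text \<open>Otherwise the boundary would be a finite set, whose complement in the plane is connected
  and encloses nothing. The perimeter is positive for this reason.\<close>

lemma exists_proper_edge:
  assumes K: "simple_polygon K"
  shows "\<exists>e\<in>cell_edges K. 0 < edge_len e"
proof (rule ccontr)
  assume "\<not> ?thesis"
  then have d: "fst e = snd e" if "e \<in> cell_edges K" for e
    using that unfolding edge_len_def by auto
  have K0: "K \<noteq> []" using K unfolding simple_polygon_def by auto
  have "finite (cell_edges K)" unfolding cell_edges_def by simp
  then have "finite (path_image (bdry_path K))"
    unfolding path_image_bdry_path[OF K0] using d by (auto simp: seg_def)
  then have "inside (path_image (bdry_path K)) = {}"
    using connected_open_delete_finite[of UNIV "path_image (bdry_path K)"]
    by (intro inside_bounded_complement_connected_empty finite_imp_bounded) (auto simp: Compl_eq_Diff_UNIV)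
  then show False using cell_nonempty[OF K] unfolding cell_def by simp
qed

section \<open>Polynomials\<close>

lemma finite_degree_set: "finite {(i, j). int (i + j) \<le> l}"
proof (rule finite_subset)
  show "{(i, j). int (i + j) \<le> l} \<subseteq> {..nat l} \<times> {..nat l}" by auto
qed simp

lemma lin_space_polys: "lin_space (polys l)"
  unfolding lin_space_def
proof (intro conjI ballI allI)
  have "(\<lambda>x. 0) \<in> polys l" unfolding polys_def by (auto intro!: exI[of _ "\<lambda>i j. 0"])
  then show "polys l \<noteq> {}" by blast
  fix v w :: fld and a b :: real assume "v \<in> polys l" "w \<in> polys l"
  then obtain c c' where v: "\<And>x. v x = (\<Sum>(i, j) | int (i + j) \<le> l. c i j * x $ 1 ^ i * x $ 2 ^ j)"
    and w: "\<And>x. w x = (\<Sum>(i, j) | int (i + j) \<le> l. c' i j * x $ 1 ^ i * x $ 2 ^ j)"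
    unfolding polys_def by blast
  have "a * v x + b * w x = (\<Sum>(i, j) | int (i + j) \<le> l. (a * c i j + b * c' i j) * x $ 1 ^ i * x $ 2 ^ j)" for x
    unfolding v w sum_distrib_left sum.distrib[symmetric] by (rule sum.cong) (auto simp: algebra_simps)
  then show "(\<lambda>x. a * v x + b * w x) \<in> polys l"
    unfolding polys_def by (intro CollectI exI[of _ "\<lambda>i j. a * c i j + b * c' i j"] allI)
qed

lemma monomial_in_polys:
  assumes "int (a + b) \<le> l" shows "(\<lambda>x. x $ 1 ^ a * x $ 2 ^ b) \<in> polys l"
proof -
  have "(\<Sum>(i, j) | int (i + j) \<le> l. (if (i, j) = (a, b) then 1 else 0) * x $ 1 ^ i * x $ 2 ^ j)
      = x $ 1 ^ a * x $ 2 ^ b" for x :: pt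
  proof -
    have "(\<Sum>(i, j) | int (i + j) \<le> l. (if (i, j) = (a, b) then 1 else 0) * x $ 1 ^ i * x $ 2 ^ j)
      = (\<Sum>z | int (fst z + snd z) \<le> l. if z = (a, b) then x $ 1 ^ a * x $ 2 ^ b else 0)"
      by (rule sum.cong) (auto simp: split_beta)
    also have "\<dots> = x $ 1 ^ a * x $ 2 ^ b"
    proof -
      have "finite {z. int (fst z + snd z) \<le> l}" using finite_degree_set[of l] by (simp add: case_prod_unfold)
      then show ?thesis using assms by (subst sum.delta) simp_all
    qed
    finally show ?thesis .
  qed
  then show ?thesis unfolding polys_def by (intro CollectI exI[of _ "\<lambda>i j. if (i, j) = (a, b) then 1 else 0"]) simp
qed

lemma polys_mono: "l \<le> l' \<Longrightarrow> polys l \<subseteq> polys l'"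
proof
  fix p assume l: "l \<le> l'" and "p \<in> polys l"
  then obtain c where p: "\<And>x. p x = (\<Sum>(i, j) | int (i + j) \<le> l. c i j * x $ 1 ^ i * x $ 2 ^ j)"
    unfolding polys_def by blast
  have "p x = (\<Sum>(i, j) | int (i + j) \<le> l'. (if int (i + j) \<le> l then c i j else 0) * x $ 1 ^ i * x $ 2 ^ j)" for x
    unfolding p using l finite_degree_set[of l'] by (intro sum.mono_neutral_cong_left) (auto split: if_splits)
  then show "p \<in> polys l'"
    unfolding polys_def by (intro CollectI exI[of _ "\<lambda>i j. if int (i + j) \<le> l then c i j else 0"] allI)
qed

text \<open>Products of one-variable derivatives, iterated with \<open>pderiv\<close>, give all
  mixed derivatives of all orders at once.\<close>

lemma polys_smooth_jet:
  assumes "p \<in> polys l" obtains J where "smooth_jet J" "J 0 0 = p"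
proof -
  obtain c where p: "\<And>x. p x = (\<Sum>(i, j) | int (i + j) \<le> l. c i j * x $ 1 ^ i * x $ 2 ^ j)"
    using assms unfolding polys_def by blast
  define D where "D i a t = poly ((pderiv ^^ i) (monom 1 a)) t" for i a :: nat and t :: real
  have D: "((\<lambda>x. D i a (x $ m)) has_derivative (\<lambda>h. D (Suc i) a (x $ m) * h $ m)) (at x)" for i a x and m :: 2
  proof -
    have "(poly ((pderiv ^^ i) (monom 1 a)) has_real_derivative D (Suc i) a (x $ m)) (at (x $ m))"
      unfolding D_def by (simp add: poly_DERIV)
    then have "(D i a has_derivative (\<lambda>h. D (Suc i) a (x $ m) * h)) (at (x $ m))"
      unfolding D_def has_field_derivative_def .
    with bounded_linear_imp_has_derivative[OF bounded_linear_vec_nth]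
    show ?thesis by (rule has_derivative_compose[where f = "\<lambda>x. x $ m" and g = "D i a"])
  qed
  define J where "J i j x = (\<Sum>(a, b) | int (a + b) \<le> l. c a b * (D i a (x $ 1) * D j b (x $ 2)))" for i j and x :: pt
  have "smooth_jet J"
    unfolding smooth_jet_def
  proof (intro allI)
    fix i j :: nat and x :: pt
    have "((\<lambda>x. \<Sum>z | int (fst z + snd z) \<le> l. c (fst z) (snd z) * (D i (fst z) (x $ 1) * D j (snd z) (x $ 2))) has_derivative
      (\<lambda>h. \<Sum>z | int (fst z + snd z) \<le> l. c (fst z) (snd z) *
         (D i (fst z) (x $ 1) * (D (Suc j) (snd z) (x $ 2) * h $ 2) + D (Suc i) (fst z) (x $ 1) * h $ 1 * D j (snd z) (x $ 2)))) (at x)"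
      by (intro has_derivative_sum has_derivative_mult_right has_derivative_mult D)
    then show "(J i j has_derivative (\<lambda>h. J (Suc i) j x * h $ 1 + J i (Suc j) x * h $ 2)) (at x)"
      unfolding J_def[abs_def] split_beta
      by (rule has_derivative_eq_rhs) (simp add: sum_distrib_left sum.distrib algebra_simps)
  qed
  moreover have "J 0 0 = p"
    unfolding J_def D_def p[abs_def] by (intro ext) (auto simp: poly_monom p intro!: sum.cong)
  ultimately show ?thesis using that by blast
qed

lemma polys_continuous: "p \<in> polys l \<Longrightarrow> continuous_on A p"
  using polys_smooth_jet smooth_jet_continuous by metis

lemma continuous_bounded_L2:
  fixes f :: fld
  assumes "continuous_on UNIV f" "bounded D" "open D" shows "f \<in> L2 D"
proof -
  have "compact (f ` closure D)"
    using assms by (intro compact_continuous_image continuous_on_subset[OF assms(1)]) (auto simp: compact_closure)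
  from compact_imp_bounded[OF this] obtain B where B: "\<And>x. x \<in> closure D \<Longrightarrow> \<bar>f x\<bar> \<le> B"
    unfolding bounded_iff by auto
  have D: "D \<in> lmeasurable" using assms(2,3) lmeasurable_open by blast
  have m: "f \<in> borel_measurable (lebesgue_on D)"
    by (intro measurable_restrict_space1 measurable_completion) (simp add: borel_measurable_continuous_onI[OF assms(1)])
  have "\<bar>f x\<bar> \<le> B" if "x \<in> space (lebesgue_on D)" for x
    using that B[of x] closure_subset[of D] by (auto simp: space_restrict_space)
  then show ?thesis unfolding L2_eq_sqint
    by (intro sqint_bounded[OF finite_measure_lebesgue_on[OF D] m])
qed

text \<open>On the line from a point of \<open>U\<close> to an arbitrary \<open>y\<close>, the
  polynomial has one variable and infinitely many roots; the parameter one gives the value at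
  \<open>y\<close>.\<close>

lemma polys_zero_on_open:
  assumes p: "p \<in> polys l" and U: "open U" "U \<noteq> {}" and z: "\<And>x. x \<in> U \<Longrightarrow> p x = 0"
  shows "p = (\<lambda>x. 0)"
proof
  fix y :: pt
  obtain c where p: "\<And>x. p x = (\<Sum>(i, j) | int (i + j) \<le> l. c i j * x $ 1 ^ i * x $ 2 ^ j)"
    using p unfolding polys_def by blast
  obtain x r where x: "0 < r" "ball x r \<subseteq> U" using U open_contains_ball by blast
  define Q where "Q = (\<Sum>(i, j) | int (i + j) \<le> l. smult (c i j) ([:x $ 1, y $ 1 - x $ 1:] ^ i * [:x $ 2, y $ 2 - x $ 2:] ^ j))"
  have Q: "poly Q t = p (x + t *\<^sub>R (y - x))" for t
    unfolding Q_def p poly_sum by (rule sum.cong) (auto simp: poly_power algebra_simps)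
  have "infinite {0..<r / (norm (y - x) + 1)}"
  proof -
    have "0 < r / (norm (y - x) + 1)" using x(1) by (simp add: add_nonneg_pos)
    then show ?thesis by (simp add: infinite_Ico)
  qed
  moreover have "{0..<r / (norm (y - x) + 1)} \<subseteq> {t. poly Q t = 0}"
  proof
    fix t assume "t \<in> {0..<r / (norm (y - x) + 1)}"
    then have t: "0 \<le> t" "t * (norm (y - x) + 1) < r" by (simp_all add: pos_less_divide_eq add_nonneg_pos)
    have "norm (t *\<^sub>R (y - x)) = t * norm (y - x)" using t(1) by simp
    also have "\<dots> \<le> t * (norm (y - x) + 1)" using t(1) by (simp add: distrib_left)
    finally have "norm (t *\<^sub>R (y - x)) \<le> t * (norm (y - x) + 1)" .
    then have "x + t *\<^sub>R (y - x) \<in> ball x r" using t(2) by (simp add: dist_norm)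
    then show "t \<in> {t. poly Q t = 0}" using x(2) z by (auto simp: Q)
  qed
  ultimately have "Q = 0" using poly_roots_finite infinite_super by blast
  then show "p y = 0" using Q[of 1] by simp
qed

lemma continuous_AE_zero:
  fixes f :: fld
  assumes D: "open D" and f: "continuous_on UNIV f" and z: "AE x in lebesgue_on D. f x = 0" and x: "x \<in> D"
  shows "f x = 0"
proof (rule ccontr)
  assume "f x \<noteq> 0"
  define U where "U = D \<inter> f -` (- {0})"
  have U: "open U" unfolding U_def using D open_vimage[OF _ f, of "- {0}"] by (intro open_Int) auto
  have "AE x in lebesgue. x \<in> D \<longrightarrow> f x = 0" using z D by (simp add: AE_restrict_space_iff)
  then have "AE x in lebesgue. x \<notin> U" by (rule eventually_mono) (auto simp: U_def)
  then have "U \<in> null_sets lebesgue" using AE_iff_null_sets[of U lebesgue] U by simp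
  then have "negligible U" by (simp add: negligible_iff_null_sets)
  then show False using open_not_negligible[OF U] x \<open>f x \<noteq> 0\<close> unfolding U_def by auto
qed

lemma polys_zero_AE:
  assumes "p \<in> polys l" "open D" "D \<noteq> {}" "AE x in lebesgue_on D. p x = 0" shows "p = (\<lambda>x. 0)"
  by (rule polys_zero_on_open[OF assms(1,2,3)]) (rule continuous_AE_zero[OF assms(2) polys_continuous[OF assms(1)] assms(4)])

lemma jet_constant_on_ball:
  assumes J: "smooth_jet J" and z: "\<And>x. x \<in> ball y r \<Longrightarrow> J (Suc i) j x = 0" "\<And>x. x \<in> ball y r \<Longrightarrow> J i (Suc j) x = 0"
  obtains c where "\<And>x. x \<in> ball y r \<Longrightarrow> J i j x = c"
proof -
  have "(J i j has_derivative (\<lambda>h. 0)) (at x within ball y r)" if x: "x \<in> ball y r" for x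
  proof -
    have "(J i j has_derivative (\<lambda>h. J (Suc i) j x * h $ 1 + J i (Suc j) x * h $ 2)) (at x)"
      using J unfolding smooth_jet_def by simp
    moreover have "(\<lambda>h :: pt. J (Suc i) j x * h $ 1 + J i (Suc j) x * h $ 2) = (\<lambda>h. 0)"
      using z(1)[OF x] z(2)[OF x] by simp
    ultimately have "(J i j has_derivative (\<lambda>h. 0)) (at x)" by (simp only:)
    then show ?thesis by (rule has_derivative_at_withinI)
  qed
  then have "\<exists>c. \<forall>x\<in>ball y r. J i j x = c"
    using has_derivative_zero_constant[OF convex_ball, of y r "J i j"] by simp
  then show ?thesis using that by auto
qed

section \<open>Linearity of the degrees of freedom\<close>

lemma finite_dof_set: "finite (dof_set d K)"
proof -
  have fin: "finite {r. int r \<le> l}" for l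
    by (rule finite_subset[of _ "{..nat l}"]) auto
  have ce: "finite (cell_edges K)" unfolding cell_edges_def by simp
  have "finite {Edge0 e r | e r. e \<in> cell_edges K \<and> int r \<le> deg_edge0 d}"
    by (rule finite_subset[OF _ finite_imageI[OF finite_cartesian_product[OF ce fin[of "deg_edge0 d"]], of "\<lambda>(e, r). Edge0 e r"]]) force
  moreover have "finite {Edge1 e r | e r. e \<in> cell_edges K \<and> int r \<le> deg_edge1 d}"
    by (rule finite_subset[OF _ finite_imageI[OF finite_cartesian_product[OF ce fin[of "deg_edge1 d"]], of "\<lambda>(e, r). Edge1 e r"]]) force
  moreover have "finite {Moment i j | i j. int (i + j) \<le> deg_cell d}"
    by (rule finite_subset[OF _ finite_imageI[OF finite_degree_set[of "deg_cell d"], of "\<lambda>(i, j). Moment i j"]]) force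
  ultimately show ?thesis unfolding dof_set_def by simp
qed

text \<open>\<open>pd\<close> is linear almost everywhere only; since integrals of traces depend on
  the class alone, the exceptional null set does no harm.\<close>

lemma edge_trace_pd_lin:
  assumes e: "good_edge D e" and D: "open D" and \<phi>: "\<phi> \<in> L2_edge e" and ij: "i + j \<le> 1"
  shows "lin_on (sobolev 2 D) (\<lambda>v. edge_int e (\<lambda>x. edge_trace D e (pd D i j v) x * \<phi> x))"
  unfolding lin_on_def
proof (intro ballI allI)
  fix v w a b assume vw: "v \<in> sobolev 2 D" "w \<in> sobolev 2 D"
  have s: "pd D i j z \<in> sobolev 1 D" if "z \<in> sobolev 2 D" for z
    using pd_sobolev[OF D that, of 1 i j] ij by simp
  have "edge_int e (\<lambda>x. edge_trace D e (pd D i j (\<lambda>x. a * v x + b * w x)) x * \<phi> x)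
      = edge_int e (\<lambda>x. edge_trace D e (\<lambda>x. a * pd D i j v x + b * pd D i j w x) x * \<phi> x)"
    by (rule edge_trace_null[OF e D s[OF lin_spaceD(1)[OF lin_space_sobolev vw]]
          lin_spaceD(1)[OF lin_space_sobolev s[OF vw(1)] s[OF vw(2)]] pd_comb[OF D vw] \<phi>]) (use ij in simp)
  also have "\<dots> = a * edge_int e (\<lambda>x. edge_trace D e (pd D i j v) x * \<phi> x) + b * edge_int e (\<lambda>x. edge_trace D e (pd D i j w) x * \<phi> x)"
    by (rule lin_onD(1)[OF edge_trace_lin[OF e D \<phi>] s[OF vw(1)] s[OF vw(2)]])
  finally show "edge_int e (\<lambda>x. edge_trace D e (pd D i j (\<lambda>x. a * v x + b * w x)) x * \<phi> x)
    = a * edge_int e (\<lambda>x. edge_trace D e (pd D i j v) x * \<phi> x) + b * edge_int e (\<lambda>x. edge_trace D e (pd D i j w) x * \<phi> x)" .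
qed

lemma edge_trace_L2_edge: "accessible D e \<Longrightarrow> open D \<Longrightarrow> w \<in> sobolev 1 D \<Longrightarrow> edge_trace D e w \<in> L2_edge e"
  using edge_trace_is_trace[of D e w] unfolding is_trace_def by simp

lemma ntrace_edge_int:
  assumes e: "good_edge D e" and D: "open D" and \<phi>: "\<phi> \<in> L2_edge e" and v: "v \<in> sobolev 2 D"
  shows "edge_int e (\<lambda>x. ntrace D e v x * \<phi> x) = edge_normal e $ 1 * edge_int e (\<lambda>x. edge_trace D e (pd D 1 0 v) x * \<phi> x)
    + edge_normal e $ 2 * edge_int e (\<lambda>x. edge_trace D e (pd D 0 1 v) x * \<phi> x)"
proof (cases "edge_len e = 0")
  case True then show ?thesis by (simp add: edge_int_degenerate)
next
  case False
  then have acc: "accessible D e" using e unfolding good_edge_def by blast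
  have s: "pd D 1 0 v \<in> sobolev 1 D" "pd D 0 1 v \<in> sobolev 1 D"
    using pd_sobolev[OF D v, of 1 1 0] pd_sobolev[OF D v, of 1 0 1] by simp_all
  show ?thesis unfolding ntrace_def
    by (rule lin_onD(1)[OF psd_onD(1)[OF psd_edge \<phi>] edge_trace_L2_edge[OF acc D s(1)] edge_trace_L2_edge[OF acc D s(2)]])
qed

lemma ntrace_lin:
  assumes e: "good_edge D e" and D: "open D" and \<phi>: "\<phi> \<in> L2_edge e"
  shows "lin_on (sobolev 2 D) (\<lambda>v. edge_int e (\<lambda>x. ntrace D e v x * \<phi> x))"
proof (rule lin_on_cong[OF lin_space_sobolev])
  show "lin_on (sobolev 2 D) (\<lambda>v. edge_normal e $ 1 * edge_int e (\<lambda>x. edge_trace D e (pd D 1 0 v) x * \<phi> x)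
    + edge_normal e $ 2 * edge_int e (\<lambda>x. edge_trace D e (pd D 0 1 v) x * \<phi> x))"
    by (intro lin_on_comb edge_trace_pd_lin[OF e D \<phi>]) simp_all
  show "edge_int e (\<lambda>x. ntrace D e v x * \<phi> x) = edge_normal e $ 1 * edge_int e (\<lambda>x. edge_trace D e (pd D 1 0 v) x * \<phi> x)
    + edge_normal e $ 2 * edge_int e (\<lambda>x. edge_trace D e (pd D 0 1 v) x * \<phi> x)" if "v \<in> sobolev 2 D" for v
    by (rule ntrace_edge_int[OF e D \<phi> that])
qed

lemma trace_lin:
  assumes e: "good_edge D e" and D: "open D" and \<phi>: "\<phi> \<in> L2_edge e"
  shows "lin_on (sobolev 2 D) (\<lambda>v. edge_int e (\<lambda>x. edge_trace D e v x * \<phi> x))"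
  by (rule lin_on_subset[OF edge_trace_lin[OF e D \<phi>] sobolev_mono]) simp

section \<open>Point values at the vertices\<close>

text \<open>A vector space over an infinite field is not a finite union of proper subspaces: the
  line \<open>v + r w\<close> meets every subspace that does not contain \<open>v\<close> in at most
  one point, so some nonzero \<open>r\<close> avoids them all.\<close>

lemma exists_outside_subspaces:
  assumes "finite I" "lin_space V" "\<And>i. i \<in> I \<Longrightarrow> lin_space (S i)" "\<And>i. i \<in> I \<Longrightarrow> \<exists>v\<in>V. v \<notin> S i"
  shows "\<exists>v\<in>V. \<forall>i\<in>I. v \<notin> S i"
  using assms
proof (induction I rule: finite_induct)
  case empty
  then show ?case using lin_space_zero by auto
next
  case (insert i I)
  obtain v where v: "v \<in> V" "\<And>j. j \<in> I \<Longrightarrow> v \<notin> S j" using insert by auto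
  obtain w where w: "w \<in> V" "w \<notin> S i" using insert.prems(3)[of i] by auto
  note V = insert.prems(1) and S = insert.prems(2)
  show ?case
  proof (cases "v \<in> S i")
    case False
    then show ?thesis using v by auto
  next
    case vi: True
    let ?c = "\<lambda>r x. 1 * v x + r * w x"
    have one: "r = r'" if j: "j \<in> I" and r: "?c r \<in> S j" "?c r' \<in> S j" for j r r'
    proof (rule ccontr)
      assume ne: "r \<noteq> r'"
      have Sj: "lin_space (S j)" using S j by simp
      \<comment> \<open>Normalises the combination of the two points of the line in which
        \<open>w\<close> cancels, so that it equals \<open>v\<close>.\<close>
      define A where "A = 1 / (r' - r)"
      have A: "A * (r' - r) = 1" unfolding A_def using ne by simp
      have "(\<lambda>x. (r' * A) * ?c r x + (- r * A) * ?c r' x) \<in> S j"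
        by (rule lin_spaceD(1)[OF Sj r])
      moreover have "(\<lambda>x. (r' * A) * ?c r x + (- r * A) * ?c r' x) = (\<lambda>x. (A * (r' - r)) * v x)"
        by (intro ext) (simp add: algebra_simps)
      then have "(\<lambda>x. (r' * A) * ?c r x + (- r * A) * ?c r' x) = v" unfolding A by simp
      ultimately show False using v(2)[OF j] by simp
    qed
    have "finite {r. ?c r \<in> S j}" if j: "j \<in> I" for j
    proof (cases "\<exists>r. ?c r \<in> S j")
      case True
      then obtain r where "?c r \<in> S j" by blast
      then have "{r. ?c r \<in> S j} \<subseteq> {r}" using one[OF j] by blast
      then show ?thesis using finite_subset by blast
    qed auto
    then have "finite (insert 0 (\<Union>j\<in>I. {r. ?c r \<in> S j}))" using insert.hyps(1) by simp
    then obtain r where r: "r \<notin> insert 0 (\<Union>j\<in>I. {r. ?c r \<in> S j})"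
      using ex_new_if_finite[OF infinite_UNIV_char_0] by blast
    have "?c r \<notin> S i"
    proof
      assume c: "?c r \<in> S i"
      have Si: "lin_space (S i)" using S by simp
      have "(\<lambda>x. (1 / r) * ?c r x + (- (1 / r)) * v x) \<in> S i" by (rule lin_spaceD(1)[OF Si c vi])
      moreover have "(\<lambda>x. (1 / r) * ?c r x + (- (1 / r)) * v x) = w"
        using r by (intro ext) (simp add: field_simps)
      ultimately show False using w(2) by simp
    qed
    moreover have "?c r \<in> V" by (rule lin_spaceD(1)[OF V v(1) w(1)])
    ultimately show ?thesis using r by (intro bexI[of _ "?c r"]) auto
  qed
qed

text \<open>The relation from which \<open>pval\<close> selects. It is linear in the pair of
  function and limit, and this can be used before existence and uniqueness of limits are
  known.\<close>

definition point_limit :: "pt set \<Rightarrow> pt \<Rightarrow> fld \<Rightarrow> real \<Rightarrow> bool" where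
  "point_limit D z v c \<longleftrightarrow> (\<exists>J. sob_conv 2 D J v \<and> (\<lambda>n. J n 0 0 z) \<longlonglongrightarrow> c)"

lemma pval_point_limit: "pval D z v = (THE c. point_limit D z v c)"
  unfolding pval_def point_limit_def ..

lemma point_limit_comb:
  assumes D: "open D" and v: "v \<in> sobolev 2 D" and w: "w \<in> sobolev 2 D"
    and p: "point_limit D z v c" and q: "point_limit D z w c'"
  shows "point_limit D z (\<lambda>x. a * v x + b * w x) (a * c + b * c')"
proof -
  obtain J J' where J: "sob_conv 2 D J v" "(\<lambda>n. J n 0 0 z) \<longlonglongrightarrow> c" and J': "sob_conv 2 D J' w" "(\<lambda>n. J' n 0 0 z) \<longlonglongrightarrow> c'"
    using p q unfolding point_limit_def by blast
  have "(\<lambda>n. a * J n 0 0 z + b * J' n 0 0 z) \<longlonglongrightarrow> a * c + b * c'"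
    by (intro tendsto_intros J(2) J'(2))
  then show ?thesis unfolding point_limit_def
    using sob_conv_comb[OF D v w J(1) J'(1), of a b]
    by (intro exI[of _ "\<lambda>n i j x. a * J n i j x + b * J' n i j x"]) simp
qed

lemma point_limit_null:
  assumes D: "open D" and v: "v \<in> sobolev 2 D" and z: "AE x in lebesgue_on D. v x = 0"
  shows "point_limit D y v 0"
  unfolding point_limit_def
proof (intro exI conjI)
  show "sob_conv 2 D (\<lambda>n i j x. 0) v"
    unfolding sob_conv_def
  proof (intro conjI allI impI)
    show "smooth_jet (\<lambda>i j x. 0)" unfolding smooth_jet_def by simp
    fix i j :: nat assume ij: "i + j \<le> 2"
    have pL: "pd D i j v \<in> L2 D" by (rule pd_L2[OF v ij])
    have "L2norm D (pd D i j v) = 0" unfolding L2norm_def psd_pd_null[OF D v z ij] by simp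
    moreover have "L2norm D (\<lambda>x. 0 - pd D i j v x) = L2norm D (pd D i j v)"
      unfolding L2norm_def ip_real by simp
    ultimately show "L2_conv D (\<lambda>n x. 0) (pd D i j v)"
      unfolding L2_conv_def using pL lin_space_zero[OF lin_space_L2] by simp
  qed
qed simp

section \<open>A single cell with unisolvent degrees of freedom\<close>

text \<open>The mesh enters only through \<open>good_edge\<close>, so the cell can be studied by
  itself. \<open>D\<close> is a parameter equated with \<open>cell K\<close>, which keeps the
  construction of the cell folded away.\<close>

locale vem_cell =
  fixes k :: nat and d :: dof_degrees and K :: polygon and V :: "fld set" and D :: "pt set"
  assumes simple: "simple_polygon K" and good: "\<And>e. has_edge K e \<Longrightarrow> good_edge (cell K) e"
    and V: "local_space k d K V" and k: "2 \<le> k"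
    and D_def: "D = cell K"
begin

lemma D_open: "open D" and D_bounded: "bounded D" and D_nonempty: "D \<noteq> {}"
  unfolding D_def using cell_open cell_bounded[OF simple] cell_nonempty[OF simple] by auto

lemma good_cell_edge: "e \<in> cell_edges K \<Longrightarrow> good_edge D e"
  using good unfolding D_def has_edge_def by simp

lemma V_sobolev: "V \<subseteq> sobolev 2 D"
  unfolding D_def by (rule V[unfolded local_space_def, THEN conjunct1])

lemma polys_V: "polys (int k) \<subseteq> V"
  by (rule V[unfolded local_space_def, THEN conjunct2, THEN conjunct1])

lemma V_lin: "lin_space V"
proof -
  note add = V[unfolded local_space_def, THEN conjunct2, THEN conjunct2, THEN conjunct1]
  note scale = V[unfolded local_space_def, THEN conjunct2, THEN conjunct2, THEN conjunct2, THEN conjunct1]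
  have "V \<noteq> {}" using polys_V lin_space_zero[OF lin_space_polys] by blast
  moreover have "(\<lambda>x. a * v x + b * w x) \<in> V" if "v \<in> V" "w \<in> V" for v w a b
    using add[rule_format, OF scale[rule_format, OF that(1), of a] scale[rule_format, OF that(2), of b]] .
  ultimately show ?thesis unfolding lin_space_def by simp
qed

lemma dof_surj: "\<exists>v\<in>V. \<forall>i\<in>dof_set d K. dof K i v = y i"
  by (rule V[unfolded local_space_def, THEN conjunct2, THEN conjunct2, THEN conjunct2, THEN conjunct2, THEN conjunct2, THEN conjunct2, THEN conjunct1, THEN spec])

lemma dof_inj:
  assumes "v \<in> V" "w \<in> V" "\<And>i. i \<in> dof_set d K \<Longrightarrow> dof K i v = dof K i w"
  shows "AE x in lebesgue_on D. v x = w x"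
proof -
  note inj = V[unfolded local_space_def, THEN conjunct2, THEN conjunct2, THEN conjunct2, THEN conjunct2, THEN conjunct2, THEN conjunct2, THEN conjunct2, THEN bspec, OF assms(1),
      THEN bspec, OF assms(2), THEN mp]
  show ?thesis unfolding D_def by (rule inj) (use assms(3) in blast)
qed

lemma lin_sobolev_V: "lin_on (sobolev 2 D) \<phi> \<Longrightarrow> lin_on V \<phi>"
  using lin_on_subset V_sobolev by blast

lemma lin_on_scale: "lin_on X \<phi> \<Longrightarrow> lin_on X (\<lambda>v. c * \<phi> v)"
  using lin_on_comb[of X \<phi> \<phi> c 0] by simp

lemma edge_mono_L2: "edge_mono e r \<in> L2_edge e"
  by (rule continuous_L2_edge) (auto simp: edge_mono_def[abs_def] divide_inverse intro!: continuous_intros)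

lemma cell_mono_L2: "cell_mono K i j \<in> L2 D"
  by (rule continuous_bounded_L2[OF _ D_bounded D_open]) (auto simp: cell_mono_def[abs_def] divide_inverse intro!: continuous_intros)

lemma dof_lin_nonvertex:
  assumes i: "i \<in> dof_set d K" and nv: "\<And>z. i \<noteq> Vertex z" shows "lin_on V (dof K i)"
proof (cases i)
  case (Vertex z)
  then show ?thesis using nv by blast
next
  case (Edge0 e r)
  then have e: "e \<in> cell_edges K" using i unfolding dof_set_def by auto
  have "lin_on V (\<lambda>v. edge_len e powi (-1) * edge_int e (\<lambda>x. edge_trace D e v x * edge_mono e r x))"
    by (intro lin_on_scale lin_sobolev_V trace_lin good_cell_edge e D_open edge_mono_L2)
  moreover have "dof K (Edge0 e r) = (\<lambda>v. edge_len e powi (-1) * edge_int e (\<lambda>x. edge_trace D e v x * edge_mono e r x))"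
    unfolding D_def by (intro ext) (rule dof.simps)
  ultimately show ?thesis unfolding Edge0 by simp
next
  case (Edge1 e r)
  then have e: "e \<in> cell_edges K" using i unfolding dof_set_def by auto
  have "lin_on V (\<lambda>v. edge_len e powi (-1 + 1) * edge_int e (\<lambda>x. ntrace D e v x * edge_mono e r x))"
    by (intro lin_on_scale lin_sobolev_V ntrace_lin good_cell_edge e D_open edge_mono_L2)
  moreover have "dof K (Edge1 e r) = (\<lambda>v. edge_len e powi (-1 + 1) * edge_int e (\<lambda>x. ntrace D e v x * edge_mono e r x))"
    unfolding D_def by (intro ext) (rule dof.simps)
  ultimately show ?thesis unfolding Edge1 by simp
next
  case (Moment a b)
  have "lin_on (L2 D) (\<lambda>v. diameter (cell K) powi (-2) * ip D v (cell_mono K a b))"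
    by (intro lin_on_scale psd_onD(1)[OF psd_ip cell_mono_L2])
  moreover have "V \<subseteq> L2 D" using V_sobolev sobolev_L2 by blast
  moreover have "dof K (Moment a b) = (\<lambda>v. diameter (cell K) powi (-2) * ip D v (cell_mono K a b))"
    unfolding D_def by (intro ext) (rule dof.simps)
  ultimately show ?thesis unfolding Moment using lin_on_subset by metis
qed

lemma zero_sobolev: "(\<lambda>x. 0) \<in> sobolev 2 D"
  by (rule lin_space_zero[OF lin_space_sobolev])

text \<open>If the point values of the zero function were not unique, the linear relation
  \<open>point_limit D z\<close> would be total or empty in every second argument, so that \<open>pval\<close> would
  attain at most two values on \<open>V\<close>; this contradicts the surjectivity of the degrees of freedom.\<close>

lemma point_limit_zero:
  assumes z: "z \<in> set K" and c: "point_limit D z (\<lambda>x. 0) c" shows "c = 0"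
proof (rule ccontr)
  assume c0: "c \<noteq> 0"
  \<comment> \<open>The two elements are the values of \<open>THE\<close> at the predicates that are
    nowhere and everywhere true: unknown, but independent of \<open>v\<close>.\<close>
  have vals: "pval D z v \<in> {THE c::real. False, THE c::real. True}" if v: "v \<in> V" for v
  proof (cases "\<exists>c'. point_limit D z v c'")
    case True
    then obtain c' where c': "point_limit D z v c'" by blast
    have vs: "v \<in> sobolev 2 D" using V_sobolev v by blast
    \<comment> \<open>Adding multiples of the zero function with its nonzero limit \<open>c\<close>
      shifts the limit of \<open>v\<close> to any \<open>r\<close>.\<close>
    have "point_limit D z v r" for r
      using point_limit_comb[OF D_open vs zero_sobolev c' c, of 1 "(r - c') / c"] c0 by simp
    then have "point_limit D z v = (\<lambda>r. True)" by (intro ext) simp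
    then show ?thesis unfolding pval_point_limit by simp
  next
    case False
    then have "point_limit D z v = (\<lambda>r. False)" by (intro ext) simp
    then show ?thesis unfolding pval_point_limit by simp
  qed
  obtain r :: real where r: "r \<notin> {THE c::real. False, THE c::real. True}"
    using ex_new_if_finite[OF infinite_UNIV_char_0, of "{THE c::real. False, THE c::real. True}"] by auto
  obtain v where v: "v \<in> V" "\<forall>i\<in>dof_set d K. dof K i v = r" using dof_surj[of "\<lambda>_. r"] by blast
  have "Vertex z \<in> dof_set d K" unfolding dof_set_def using z by blast
  then have "dof K (Vertex z) v = r" using v(2) by blast
  then show False using vals[OF v(1)] r unfolding D_def by simp
qed

lemma point_limit_unique:
  assumes z: "z \<in> set K" and v: "v \<in> sobolev 2 D" and c: "point_limit D z v c" "point_limit D z v c'"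
  shows "c = c'"
  using point_limit_zero[OF z, of "c - c'"] point_limit_comb[OF D_open v v c, of 1 "-1"] by simp

lemma pval_eq:
  assumes z: "z \<in> set K" and v: "v \<in> sobolev 2 D" and c: "point_limit D z v c" shows "pval D z v = c"
  unfolding pval_point_limit using c point_limit_unique[OF z v _ c] by (rule the_equality)

text \<open>Instead of the Sobolev embedding, existence of point values also follows from unisolvence. A
  generic \<open>v\<close> without point values and all its nonzero multiples have the junk value as their
  degrees of freedom there. Subtracting \<open>w\<close> with the remaining degrees of freedom of \<open>v\<close> gives a
  function that has the same degrees of freedom as its double.\<close>

lemma point_limit_exists:
  assumes v: "v \<in> V" and z: "z \<in> set K" shows "\<exists>c. point_limit D z v c"
proof (rule ccontr)
  assume no: "\<not> ?thesis"
  define E where "E z = {v \<in> V. \<exists>c. point_limit D z v c}" for z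
  have sob: "v \<in> sobolev 2 D" if "v \<in> V" for v using that V_sobolev by blast
  have E: "lin_space (E z)" for z
    unfolding lin_space_def
  proof (intro conjI ballI allI)
    have "point_limit D z (\<lambda>x. 0) 0" by (rule point_limit_null[OF D_open zero_sobolev]) simp
    then show "E z \<noteq> {}" unfolding E_def using lin_space_zero[OF V_lin] by blast
    fix v w a b assume "v \<in> E z" "w \<in> E z"
    then obtain c c' where "v \<in> V" "w \<in> V" "point_limit D z v c" "point_limit D z w c'" unfolding E_def by blast
    then show "(\<lambda>x. a * v x + b * w x) \<in> E z"
      unfolding E_def using lin_spaceD(1)[OF V_lin, of v w a b] point_limit_comb[OF D_open sob[of v] sob[of w], of z c c' a b] by blast
  qed
  \<comment> \<open>The vertices at which some function of the local space has no limit, that is,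
    where \<open>E z\<close> is a proper subspace.\<close>
  define B where "B = {z \<in> set K. \<exists>v\<in>V. v \<notin> E z}"
  have zB: "z \<in> B" using no v z unfolding B_def E_def by blast
  have "finite B" unfolding B_def by simp
  then have "\<exists>g\<in>V. \<forall>z\<in>B. g \<notin> E z"
    by (rule exists_outside_subspaces[OF _ V_lin E]) (simp add: B_def)
  then obtain g where g: "g \<in> V" "\<And>z. z \<in> B \<Longrightarrow> g \<notin> E z" by blast
  define u0 where "u0 = (THE c::real. False)"
  have junk: "dof K (Vertex z) f = u0" if "f \<in> V" "f \<notin> E z" for f z
    using that unfolding E_def u0_def by (simp add: pval_point_limit D_def)
  \<comment> \<open>At the vertices of \<open>B\<close> the prescribed value only has to differ from
    the junk value \<open>u0\<close>: then \<open>w\<close> must have limits there. All other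
    degrees of freedom are copied from \<open>g\<close>.\<close>
  define y where "y i = (case i of Vertex z \<Rightarrow> if z \<in> B then u0 + 1 else dof K i g | _ \<Rightarrow> dof K i g)" for i
  obtain w where w: "w \<in> V" and wd: "\<And>i. i \<in> dof_set d K \<Longrightarrow> dof K i w = y i" using dof_surj[of y] by blast
  have vd: "Vertex z \<in> dof_set d K" if "z \<in> set K" for z unfolding dof_set_def using that by blast
  have wE: "w \<in> E z" if "z \<in> B" for z
  proof (rule ccontr)
    assume "w \<notin> E z"
    then have "dof K (Vertex z) w = u0" by (rule junk[OF w])
    moreover have "dof K (Vertex z) w = u0 + 1"
      using wd[OF vd, of z] that unfolding y_def B_def by simp
    ultimately show False by simp
  qed
  define h where "h = (\<lambda>x. g x - w x)"
  have hV: "h \<in> V" unfolding h_def by (rule lin_spaceD(3)[OF V_lin g(1) w])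
  have h2V: "(\<lambda>x. 2 * h x) \<in> V" by (rule lin_spaceD(4)[OF V_lin hV hV])
  have hE: "h \<notin> E z" if "z \<in> B" for z
  proof
    assume "h \<in> E z"
    from lin_spaceD(2)[OF E this wE[OF that]] have "g \<in> E z" unfolding h_def by simp
    then show False using g(2)[OF that] by simp
  qed
  have h2E: "(\<lambda>x. 2 * h x) \<notin> E z" if "z \<in> B" for z
  proof
    assume c: "(\<lambda>x. 2 * h x) \<in> E z"
    from lin_spaceD(4)[OF E c c, of "1 / 2"] show False using hE[OF that] by simp
  qed
  have vertex_lin: "lin_on V (dof K (Vertex z))" if z: "z \<in> set K" "z \<notin> B" for z
    unfolding lin_on_def
  proof (intro ballI allI)
    fix v w a b assume vw: "v \<in> V" "w \<in> V"
    then obtain c c' where c: "point_limit D z v c" "point_limit D z w c'"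
      using z unfolding B_def E_def by blast
    have vws: "v \<in> sobolev 2 D" "w \<in> sobolev 2 D" using vw sob by auto
    show "dof K (Vertex z) (\<lambda>x. a * v x + b * w x) = a * dof K (Vertex z) v + b * dof K (Vertex z) w"
      using pval_eq[OF z(1) vws(1) c(1)] pval_eq[OF z(1) vws(2) c(2)]
        pval_eq[OF z(1) lin_spaceD(1)[OF lin_space_sobolev vws] point_limit_comb[OF D_open vws c]]
      by (simp add: D_def)
  qed
  \<comment> \<open>At the vertices of \<open>B\<close> both sides are junk; every other degree of
    freedom is linear and vanishes at \<open>h\<close>, because \<open>g\<close> and
    \<open>w\<close> agree there.\<close>
  have "dof K i (\<lambda>x. 2 * h x) = dof K i h" if i: "i \<in> dof_set d K" for i
  proof (cases "\<exists>z\<in>B. i = Vertex z")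
    case True
    then obtain z where z: "z \<in> B" "i = Vertex z" by blast
    show ?thesis unfolding z(2) junk[OF hV hE[OF z(1)]] junk[OF h2V h2E[OF z(1)]] ..
  next
    case False
    have lin: "lin_on V (dof K i)"
    proof (cases "\<exists>z. i = Vertex z")
      case True
      then obtain z where z: "i = Vertex z" by blast
      then have "z \<in> set K" using i unfolding dof_set_def by auto
      then show ?thesis unfolding z using vertex_lin False z by blast
    next
      case nv: False
      show ?thesis by (rule dof_lin_nonvertex[OF i]) (use nv in blast)
    qed
    have "y i = dof K i g" using False unfolding y_def by (auto split: dof_index.split)
    then have "dof K i h = 0" unfolding h_def lin_onD(3)[OF lin g(1) w] wd[OF i] by simp
    then show ?thesis using lin_onD(4)[OF lin hV hV, of 2] by simp
  qed
  from dof_inj[OF h2V hV this] have "AE x in lebesgue_on D. 2 * h x = h x" by simp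
  then have "AE x in lebesgue_on D. h x = 0" by (rule eventually_mono) simp
  from point_limit_null[OF D_open sob[OF hV] this, of z] have "h \<in> E z" unfolding E_def using hV by blast
  then show False using hE[OF zB] by simp
qed

lemma dof_lin:
  assumes i: "i \<in> dof_set d K" shows "lin_on V (dof K i)"
proof (cases "\<exists>z. i = Vertex z")
  case True
  then obtain z where z: "i = Vertex z" by blast
  then have zK: "z \<in> set K" using i unfolding dof_set_def by auto
  show ?thesis unfolding lin_on_def z
  proof (intro ballI allI)
    fix v w a b assume vw: "v \<in> V" "w \<in> V"
    then obtain c c' where c: "point_limit D z v c" "point_limit D z w c'"
      using point_limit_exists[OF _ zK] by blast
    have vws: "v \<in> sobolev 2 D" "w \<in> sobolev 2 D" using vw V_sobolev by auto
    show "dof K (Vertex z) (\<lambda>x. a * v x + b * w x) = a * dof K (Vertex z) v + b * dof K (Vertex z) w"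
      using pval_eq[OF zK vws(1) c(1)] pval_eq[OF zK vws(2) c(2)]
        pval_eq[OF zK lin_spaceD(1)[OF lin_space_sobolev vws] point_limit_comb[OF D_open vws c]]
      by (simp add: D_def)
  qed
next
  case False
  show ?thesis by (rule dof_lin_nonvertex[OF i]) (use False in blast)
qed

lemma dof_null:
  assumes v: "v \<in> V" and z: "\<And>i. i \<in> dof_set d K \<Longrightarrow> dof K i v = 0"
  shows "AE x in lebesgue_on D. v x = 0"
  by (rule dof_inj[OF v lin_space_zero[OF V_lin]]) (simp add: z lin_on_zero[OF dof_lin V_lin])

end

section \<open>Projections\<close>

text \<open>Common form of the projections defined by \<open>THE\<close>. The functionals
  \<open>\<Phi>\<close> separate the elements of \<open>P\<close> as functions, not just as classes,
  so uniqueness and linearity hold as equations of functions. \<open>R\<close> is tied to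
  \<open>\<Phi>\<close> by an equivalence so that each definition can keep its own wording.\<close>

lemma projection_linear:
  fixes X P :: "('a \<Rightarrow> real) set" and \<Phi> :: "(('a \<Rightarrow> real) \<Rightarrow> real) set"
  assumes X: "lin_space X" and P: "lin_space P" and PX: "P \<subseteq> X"
    and \<Phi>': "\<forall>\<phi>\<in>\<Phi>. lin_on X \<phi>"
    and ex: "\<forall>v\<in>X. \<exists>p\<in>P. \<forall>\<phi>\<in>\<Phi>. \<phi> (\<lambda>x. v x - p x) = 0"
    and zero: "\<forall>p\<in>P. (\<forall>\<phi>\<in>\<Phi>. \<phi> p = 0) \<longrightarrow> p = (\<lambda>x. 0)"
    and R': "\<forall>v p. R v p \<longleftrightarrow> p \<in> P \<and> (\<forall>\<phi>\<in>\<Phi>. \<phi> (\<lambda>x. v x - p x) = 0)"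
  shows "v \<in> X \<Longrightarrow> R v (THE p. R v p)"
    and "v \<in> X \<Longrightarrow> R v p \<Longrightarrow> (THE p. R v p) = p"
    and "v \<in> X \<Longrightarrow> w \<in> X \<Longrightarrow> (THE p. R (\<lambda>x. a * v x + b * w x) p) = (\<lambda>x. a * (THE p. R v p) x + b * (THE p. R w p) x)"
proof -
  note \<Phi> = \<Phi>'[rule_format] and R = R'[rule_format]
  have unique: "p = p'" if v: "v \<in> X" and p: "R v p" "R v p'" for v p p'
  proof -
    have pp: "p \<in> P" "p' \<in> P" using p R by auto
    then have ppX: "p \<in> X" "p' \<in> X" using PX by auto
    have "(\<lambda>x. p x - p' x) = (\<lambda>x. 0)"
    proof (rule zero[rule_format, OF lin_spaceD(3)[OF P pp]])
      fix \<phi> assume \<phi>: "\<phi> \<in> \<Phi>"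
      have "\<phi> v - \<phi> p = 0" "\<phi> v - \<phi> p' = 0"
        using p R \<phi> lin_onD(3)[OF \<Phi>[OF \<phi>] v ppX(1)] lin_onD(3)[OF \<Phi>[OF \<phi>] v ppX(2)] by auto
      then show "\<phi> (\<lambda>x. p x - p' x) = 0" using lin_onD(3)[OF \<Phi>[OF \<phi>] ppX] by simp
    qed
    then show ?thesis by (auto simp: fun_eq_iff)
  qed
  have ex1: "\<exists>!p. R v p" if v: "v \<in> X" for v
    using ex[rule_format, OF v] unique[OF v] R by blast
  have 1: "R v (THE p. R v p)" if "v \<in> X" for v by (rule theI'[OF ex1[OF that]])
  have 2: "(THE p. R v p) = p" if "v \<in> X" "R v p" for v p by (rule unique[OF that(1) 1[OF that(1)] that(2)])
  show "R v (THE p. R v p)" if "v \<in> X" by (rule 1[OF that])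
  show "(THE p. R v p) = p" if "v \<in> X" "R v p" by (rule 2[OF that])
  show "(THE p. R (\<lambda>x. a * v x + b * w x) p) = (\<lambda>x. a * (THE p. R v p) x + b * (THE p. R w p) x)"
    if vw: "v \<in> X" "w \<in> X"
  proof -
    let ?p = "THE p. R v p" and ?q = "THE p. R w p"
    have p: "R v ?p" and q: "R w ?q" using 1 vw by auto
    have pP: "?p \<in> P" "?q \<in> P" using p q R by auto
    have "R (\<lambda>x. a * v x + b * w x) (\<lambda>x. a * ?p x + b * ?q x)"
    proof (rule R[THEN iffD2], intro conjI ballI)
      show "(\<lambda>x. a * ?p x + b * ?q x) \<in> P" by (rule lin_spaceD(1)[OF P pP])
      fix \<phi> assume \<phi>: "\<phi> \<in> \<Phi>"
      have d: "(\<lambda>x. v x - ?p x) \<in> X" "(\<lambda>x. w x - ?q x) \<in> X"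
        using lin_spaceD(3)[OF X] vw pP PX by auto
      have "(\<lambda>x. a * v x + b * w x - (a * ?p x + b * ?q x)) = (\<lambda>x. a * (v x - ?p x) + b * (w x - ?q x))"
        by (intro ext) (simp add: algebra_simps)
      then have "\<phi> (\<lambda>x. a * v x + b * w x - (a * ?p x + b * ?q x)) = a * \<phi> (\<lambda>x. v x - ?p x) + b * \<phi> (\<lambda>x. w x - ?q x)"
        using lin_onD(1)[OF \<Phi>[OF \<phi>] d, of a b] by simp
      then show "\<phi> (\<lambda>x. a * v x + b * w x - (a * ?p x + b * ?q x)) = 0" using p q R \<phi> by auto
    qed
    then show ?thesis by (rule 2[OF lin_spaceD(1)[OF X vw]])
  qed
qed

section \<open>Affine functions, the kernels of the energy forms\<close>

text \<open>Constants and affine functions are the polynomials of zero gradient and zero Hessian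
  energy; \<open>affine_fun 0 0 \<gamma>\<close> stands for the constants.\<close>

definition affine_fun :: "real \<Rightarrow> real \<Rightarrow> real \<Rightarrow> fld" where
  "affine_fun \<alpha> \<beta> \<gamma> x = \<alpha> * x $ 1 + \<beta> * x $ 2 + \<gamma>"

definition affine_jet :: "real \<Rightarrow> real \<Rightarrow> real \<Rightarrow> nat \<Rightarrow> nat \<Rightarrow> fld" where
  "affine_jet \<alpha> \<beta> \<gamma> i j x = (if i = 0 \<and> j = 0 then affine_fun \<alpha> \<beta> \<gamma> x
     else if i = 1 \<and> j = 0 then \<alpha> else if i = 0 \<and> j = 1 then \<beta> else 0)"

lemma smooth_affine_jet: "smooth_jet (affine_jet \<alpha> \<beta> \<gamma>)"
  unfolding smooth_jet_def
proof (intro allI)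
  fix i j and x :: pt
  show "(affine_jet \<alpha> \<beta> \<gamma> i j has_derivative
    (\<lambda>d. affine_jet \<alpha> \<beta> \<gamma> (Suc i) j x * d $ 1 + affine_jet \<alpha> \<beta> \<gamma> i (Suc j) x * d $ 2)) (at x)"
  proof (cases "i = 0 \<and> j = 0")
    case True
    have "((\<lambda>x :: pt. \<alpha> * x $ 1 + \<beta> * x $ 2 + \<gamma>) has_derivative (\<lambda>d. \<alpha> * d $ 1 + \<beta> * d $ 2 + 0)) (at x)"
      by (intro has_derivative_add has_derivative_mult_right has_derivative_const
          bounded_linear_imp_has_derivative bounded_linear_vec_nth)
    then show ?thesis using True by (simp add: affine_jet_def[abs_def] affine_fun_def)
  next
    case False
    then have "affine_jet \<alpha> \<beta> \<gamma> i j = (\<lambda>x. affine_jet \<alpha> \<beta> \<gamma> i j 0)" unfolding affine_jet_def by auto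
    moreover have "((\<lambda>x::pt. affine_jet \<alpha> \<beta> \<gamma> i j 0) has_derivative (\<lambda>d. 0)) (at x)" by simp
    ultimately have "(affine_jet \<alpha> \<beta> \<gamma> i j has_derivative (\<lambda>d. 0)) (at x)" by simp
    then show ?thesis using False unfolding affine_jet_def[of _ _ _ "Suc i"] affine_jet_def[of _ _ _ _ "Suc j"]
      by (auto split: if_splits)
  qed
qed

lemma affine_jet_0: "affine_jet \<alpha> \<beta> \<gamma> 0 0 = affine_fun \<alpha> \<beta> \<gamma>"
  unfolding affine_jet_def by auto

lemma affine_in_polys:
  assumes "1 \<le> l" shows "affine_fun \<alpha> \<beta> \<gamma> \<in> polys l"
proof -
  have m: "(\<lambda>x. x $ 1) \<in> polys l" "(\<lambda>x. x $ 2) \<in> polys l" "(\<lambda>x. 1) \<in> polys l"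
    using monomial_in_polys[of 1 0 l] monomial_in_polys[of 0 1 l] monomial_in_polys[of 0 0 l] assms by simp_all
  from lin_spaceD(1)[OF lin_space_polys lin_spaceD(1)[OF lin_space_polys m(1,2), of \<alpha> \<beta>] m(3), of 1 \<gamma>]
  show ?thesis unfolding affine_fun_def[abs_def] by simp
qed

lemma const_in_polys: "0 \<le> l \<Longrightarrow> affine_fun 0 0 \<gamma> \<in> polys l"
  using lin_spaceD(4)[OF lin_space_polys monomial_in_polys[of 0 0 l] monomial_in_polys[of 0 0 l], of \<gamma>]
  unfolding affine_fun_def[abs_def] by simp

context vem_cell
begin

lemma sobolev1: "sobolev 2 D \<subseteq> sobolev 1 D" by (rule sobolev_mono) simp

lemma polys_sobolev: "polys (int k) \<subseteq> sobolev 2 D" using polys_V V_sobolev by blast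

lemma smooth_jet_L2: "smooth_jet J \<Longrightarrow> J i j \<in> L2 D"
  by (rule continuous_bounded_L2[OF smooth_jet_continuous D_bounded D_open])

lemma smooth_jet_derivs: "smooth_jet J \<Longrightarrow> has_sob_derivs m D (J 0 0) J"
  by (rule smooth_jet_sobolev) (auto intro: smooth_jet_L2)

lemma smooth_jet_pd: "smooth_jet J \<Longrightarrow> AE x in lebesgue_on D. pd D i j (J 0 0) x = J i j x"
  by (rule pd_AE[OF D_open smooth_jet_derivs]) (auto)

text \<open>The separating functionals are the degrees of freedom instead of coefficients: for
  \<open>l \<le> k\<close> the polynomials lie in \<open>V\<close>, where vanishing degrees of
  freedom force vanishing almost everywhere.\<close>

lemma riesz_polys:
  assumes l: "l \<le> k" and a: "psd_on V a" and null: "\<And>v. v \<in> V \<Longrightarrow> AE x in lebesgue_on D. v x = 0 \<Longrightarrow> a v v = 0"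
    and L: "lin_on (polys (int l)) L" and Lnull: "\<And>q. q \<in> polys (int l) \<Longrightarrow> a q q = 0 \<Longrightarrow> L q = 0"
  shows "\<exists>p\<in>polys (int l). \<forall>q\<in>polys (int l). a p q = L q"
proof (rule riesz_finite[OF finite_dof_set[of d K] lin_space_polys _ L, where D = "dof K"])
  have sub: "polys (int l) \<subseteq> V" using polys_mono[of "int l" "int k"] l polys_V by auto
  show "psd_on (polys (int l)) a" by (rule psd_on_subset[OF a sub])
  show "L q = 0" if "q \<in> polys (int l)" "a q q = 0" for q using Lnull that by blast
  show "lin_on (polys (int l)) (dof K i)" if "i \<in> dof_set d K" for i
    by (rule lin_on_subset[OF dof_lin[OF that] sub])
  show "a v v = 0" if v: "v \<in> polys (int l)" and z: "\<And>i. i \<in> dof_set d K \<Longrightarrow> dof K i v = 0" for v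
  proof -
    have "v \<in> V" using v sub by blast
    then show ?thesis using null dof_null z by blast
  qed
qed

lemma V_L2: "V \<subseteq> L2 D" using V_sobolev sobolev_L2 by blast

lemma polys_L2: "polys l \<subseteq> L2 D"
  using continuous_bounded_L2[OF polys_continuous D_bounded D_open] by blast

lemma ip_null_AE:
  fixes v :: fld
  shows "v \<in> L2 D \<Longrightarrow> AE x in lebesgue_on D. v x = 0 \<Longrightarrow> ip D v v = 0"
  using AE_null_L2norm[of v D] unfolding L2norm_def by simp

section \<open>The mean square projections\<close>

text \<open>The degree \<open>l\<close> is kept general because the gradient is projected
  componentwise to degree \<open>k - 1\<close>.\<close>

lemma Pi0_projection:
  assumes l: "l \<le> k"
  shows "g \<in> L2 D \<Longrightarrow> Pi0 K l g \<in> polys (int l)"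
    and "g \<in> L2 D \<Longrightarrow> q \<in> polys (int l) \<Longrightarrow> ip D (\<lambda>x. g x - Pi0 K l g x) q = 0"
    and "g \<in> L2 D \<Longrightarrow> p \<in> polys (int l) \<Longrightarrow> (\<And>q. q \<in> polys (int l) \<Longrightarrow> ip D (\<lambda>x. g x - p x) q = 0) \<Longrightarrow> Pi0 K l g = p"
    and "g \<in> L2 D \<Longrightarrow> h \<in> L2 D \<Longrightarrow> Pi0 K l (\<lambda>x. a * g x + b * h x) = (\<lambda>x. a * Pi0 K l g x + b * Pi0 K l h x)"
proof -
  let ?P = "polys (int l)"
  let ?\<Phi> = "(\<lambda>q f. ip D f q) ` ?P"
  let ?R = "\<lambda>v p. p \<in> ?P \<and> (\<forall>q\<in>?P. ip D (\<lambda>x. v x - p x) q = 0)"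
  have \<Phi>: "\<forall>\<phi>\<in>?\<Phi>. lin_on (L2 D) \<phi>"
    using psd_onD(1)[OF psd_ip] polys_L2 by blast
  have ex: "\<forall>v\<in>L2 D. \<exists>p\<in>?P. \<forall>\<phi>\<in>?\<Phi>. \<phi> (\<lambda>x. v x - p x) = 0"
  proof
    fix v assume v: "v \<in> L2 D"
    have "\<exists>p\<in>?P. \<forall>q\<in>?P. ip D p q = ip D v q"
    proof (rule riesz_polys[OF l psd_on_subset[OF psd_ip V_L2]])
      show "ip D w w = 0" if "w \<in> V" "AE x in lebesgue_on D. w x = 0" for w
        using ip_null_AE that V_L2 by blast
      show "lin_on ?P (ip D v)" by (rule lin_on_subset[OF psd_on_linR[OF psd_ip lin_space_L2 v] polys_L2])
      show "ip D v q = 0" if q: "q \<in> ?P" "ip D q q = 0" for q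
      proof -
        have "q \<in> L2 D" using polys_L2 q(1) by blast
        then show ?thesis using psd_null(2)[OF psd_ip lin_space_L2 _ v] q(2) by blast
      qed
    qed
    then obtain p where p: "p \<in> ?P" "\<And>q. q \<in> ?P \<Longrightarrow> ip D p q = ip D v q" by blast
    have pL: "p \<in> L2 D" using polys_L2 p(1) by blast
    have "ip D (\<lambda>x. v x - p x) q = 0" if q: "q \<in> ?P" for q
    proof -
      have "q \<in> L2 D" using polys_L2 q by blast
      from lin_onD(3)[OF psd_onD(1)[OF psd_ip this] v pL] show ?thesis using p(2)[OF q] by simp
    qed
    then show "\<exists>p\<in>?P. \<forall>\<phi>\<in>?\<Phi>. \<phi> (\<lambda>x. v x - p x) = 0" using p(1) by blast
  qed
  have zero: "\<forall>p\<in>?P. (\<forall>\<phi>\<in>?\<Phi>. \<phi> p = 0) \<longrightarrow> p = (\<lambda>x. 0)"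
  proof (intro ballI impI)
    fix p assume p: "p \<in> ?P" and z: "\<forall>\<phi>\<in>?\<Phi>. \<phi> p = 0"
    have "(\<lambda>f. ip D f p) \<in> ?\<Phi>" by (rule imageI[OF p])
    from bspec[OF z this] have "ip D p p = 0" .
    then have "L2norm D p = 0" unfolding L2norm_def by simp
    moreover have "p \<in> L2 D" using polys_L2 p by blast
    ultimately show "p = (\<lambda>x. 0)" using polys_zero_AE[OF p D_open D_nonempty] L2norm_null by blast
  qed
  have eq: "Pi0 K l v = (THE p. ?R v p)" for v unfolding Pi0_def D_def ..
  have R: "\<forall>v p. ?R v p \<longleftrightarrow> p \<in> ?P \<and> (\<forall>\<phi>\<in>?\<Phi>. \<phi> (\<lambda>x. v x - p x) = 0)" by simp
  note proj = projection_linear[where X = "L2 D" and P = ?P and \<Phi> = ?\<Phi> and R = ?R,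
      OF lin_space_L2 lin_space_polys polys_L2 \<Phi> ex zero R]
  show "Pi0 K l g \<in> ?P" if g: "g \<in> L2 D"
    using proj(1)[OF g] unfolding eq by (rule conjunct1)
  show "ip D (\<lambda>x. g x - Pi0 K l g x) q = 0" if g: "g \<in> L2 D" and q: "q \<in> ?P"
    using proj(1)[OF g, THEN conjunct2, THEN bspec, OF q] unfolding eq .
  show "Pi0 K l g = p" if g: "g \<in> L2 D" and p: "p \<in> ?P" "\<And>q. q \<in> ?P \<Longrightarrow> ip D (\<lambda>x. g x - p x) q = 0"
    unfolding eq using proj(2)[OF g, of p] p by blast
  show "Pi0 K l (\<lambda>x. a * g x + b * h x) = (\<lambda>x. a * Pi0 K l g x + b * Pi0 K l h x)" if g: "g \<in> L2 D" "h \<in> L2 D"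
    unfolding eq by (rule proj(3)[OF g])
qed

lemma Pi0_L2: "l \<le> k \<Longrightarrow> g \<in> L2 D \<Longrightarrow> Pi0 K l g \<in> L2 D"
  using Pi0_projection(1) polys_L2 by blast

text \<open>The value is one polynomial per class. Projecting thus turns equations that hold almost
  everywhere into equations of functions.\<close>

lemma Pi0_AE:
  assumes l: "l \<le> k" and g: "g \<in> L2 D" and h: "h \<in> L2 D" and gh: "AE x in lebesgue_on D. g x = h x"
  shows "Pi0 K l g = Pi0 K l h"
proof (rule Pi0_projection(3)[OF l g Pi0_projection(1)[OF l h]])
  fix q assume q: "q \<in> polys (int l)"
  have qL: "q \<in> L2 D" using q polys_L2 by blast
  have "ip D (\<lambda>x. g x - Pi0 K l h x) q = ip D (\<lambda>x. h x - Pi0 K l h x) q"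
    by (rule ip_cong_AE[OF lin_spaceD(3)[OF lin_space_L2 g Pi0_L2[OF l h]] qL lin_spaceD(3)[OF lin_space_L2 h Pi0_L2[OF l h]] qL])
      (use gh in \<open>auto elim: eventually_mono\<close>)
  also have "\<dots> = 0" by (rule Pi0_projection(2)[OF l h q])
  finally show "ip D (\<lambda>x. g x - Pi0 K l h x) q = 0" .
qed

lemma Pi0_ip:
  assumes l: "l \<le> k" and g: "g \<in> L2 D" and q: "q \<in> polys (int l)"
  shows "ip D (Pi0 K l g) q = ip D g q"
proof -
  have qL: "q \<in> L2 D" using q polys_L2 by blast
  show ?thesis using Pi0_projection(2)[OF l g q] lin_onD(3)[OF psd_onD(1)[OF psd_ip qL] g Pi0_L2[OF l g]] by simp
qed

lemma Pi0_norm: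
  assumes l: "l \<le> k" and g: "g \<in> L2 D" shows "L2norm D (Pi0 K l g) \<le> L2norm D g"
proof -
  let ?p = "Pi0 K l g"
  have p: "?p \<in> L2 D" by (rule Pi0_L2[OF l g])
  have n: "ip D ?p ?p = L2norm D ?p * L2norm D ?p" "0 \<le> L2norm D ?p"
    using psd_onD(3)[OF psd_ip p] unfolding L2norm_def by simp_all
  have "ip D ?p ?p \<le> L2norm D g * L2norm D ?p"
    using psd_abs_le[OF psd_ip lin_space_L2 g p] Pi0_ip[OF l g Pi0_projection(1)[OF l g]] unfolding L2norm_def by simp
  then show ?thesis using n by (cases "L2norm D ?p = 0") (auto simp: L2norm_nonneg)
qed

lemma psd_grad2: "psd_on (sobolev 2 D) (\<lambda>v w. ip D (grad D v) (grad D w))"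
  by (rule psd_on_subset[OF psd_grad[OF D_open] sobolev1])

lemma psd_hess2: "psd_on (sobolev 2 D) (\<lambda>v w. ip D (hess D v) (hess D w))"
  by (rule psd_hess[OF D_open])

lemma grad_null:
  assumes "v \<in> sobolev 2 D" "AE x in lebesgue_on D. v x = 0" shows "ip D (grad D v) (grad D v) = 0"
proof -
  have v1: "v \<in> sobolev 1 D" using assms(1) sobolev1 by blast
  show ?thesis unfolding ip_grad[OF v1 v1] using psd_pd_null[OF D_open v1 assms(2), of 1 0] psd_pd_null[OF D_open v1 assms(2), of 0 1] by simp
qed

lemma hess_null:
  assumes "v \<in> sobolev 2 D" "AE x in lebesgue_on D. v x = 0" shows "ip D (hess D v) (hess D v) = 0"
  unfolding ip_hess[OF assms(1,1)]
  using psd_pd_null[OF D_open assms, of 2 0] psd_pd_null[OF D_open assms, of 1 1] psd_pd_null[OF D_open assms, of 0 2] by simp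

lemma pd_null_jet:
  assumes J: "smooth_jet J" and z: "ip D (pd D i j (J 0 0)) (pd D i j (J 0 0)) = 0" and x: "x \<in> D"
  shows "J i j x = 0"
proof -
  have "J 0 0 \<in> sobolev (i + j) D" unfolding sobolev_def using smooth_jet_derivs[OF J] by blast
  from pd_L2[OF this order_refl] have "pd D i j (J 0 0) \<in> L2 D" .
  moreover have "L2norm D (pd D i j (J 0 0)) = 0" unfolding L2norm_def z by simp
  ultimately have "AE x in lebesgue_on D. pd D i j (J 0 0) x = 0" by (rule L2norm_null)
  then have "AE x in lebesgue_on D. J i j x = 0" using smooth_jet_pd[OF J, of i j] by eventually_elim simp
  then show ?thesis by (rule continuous_AE_zero[OF D_open smooth_jet_continuous[OF J] _ x])
qed

text \<open>First derivatives that vanish almost everywhere vanish at every point of the cell by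
  continuity. A ball in the cell provides a convex set on which \<open>p\<close> is constant, and
  the identity theorem for polynomials extends this to the plane.\<close>

lemma grad_kernel:
  assumes p: "p \<in> polys (int k)" and z: "ip D (grad D p) (grad D p) = 0"
  obtains \<gamma> where "p = affine_fun 0 0 \<gamma>"
proof -
  obtain J where J: "smooth_jet J" "J 0 0 = p" using polys_smooth_jet[OF p] .
  have p1: "p \<in> sobolev 1 D" using p polys_sobolev sobolev1 by blast
  have nn: "0 \<le> ip D (pd D 1 0 p) (pd D 1 0 p)" "0 \<le> ip D (pd D 0 1 p) (pd D 0 1 p)"
    by (simp_all add: ip_real)
  have zz: "ip D (pd D 1 0 p) (pd D 1 0 p) = 0" "ip D (pd D 0 1 p) (pd D 0 1 p) = 0"
    using z nn unfolding ip_grad[OF p1 p1] by linarith+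
  obtain y r where r: "0 < r" "ball y r \<subseteq> D" using D_open D_nonempty open_contains_ball by blast
  obtain c where c: "\<And>x. x \<in> ball y r \<Longrightarrow> J 0 0 x = c"
    by (rule jet_constant_on_ball[OF J(1), of y r 0 0])
      (use r pd_null_jet[OF J(1), of 1 0] pd_null_jet[OF J(1), of 0 1] zz J(2) in auto)
  have "(\<lambda>x. p x - affine_fun 0 0 c x) = (\<lambda>x. 0)"
    by (rule polys_zero_on_open[OF lin_spaceD(3)[OF lin_space_polys p const_in_polys], of "ball y r"])
      (use r c J(2) in \<open>auto simp: affine_fun_def\<close>)
  then have "p = affine_fun 0 0 c" by (auto simp: fun_eq_iff)
  then show ?thesis by (rule that)
qed

text \<open>Vanishing second derivatives make the first ones constant on a ball; once the affine jet
  with these slopes is subtracted, the remainder is constant there.\<close>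

lemma hess_kernel:
  assumes p: "p \<in> polys (int k)" and z: "ip D (hess D p) (hess D p) = 0"
  obtains \<alpha> \<beta> \<gamma> where "p = affine_fun \<alpha> \<beta> \<gamma>"
proof -
  obtain J where J: "smooth_jet J" "J 0 0 = p" using polys_smooth_jet[OF p] .
  have p2: "p \<in> sobolev 2 D" using p polys_sobolev by blast
  have nn: "0 \<le> ip D (pd D i j p) (pd D i j p)" for i j by (simp add: ip_real)
  have zz: "ip D (pd D 2 0 p) (pd D 2 0 p) = 0" "ip D (pd D 1 1 p) (pd D 1 1 p) = 0" "ip D (pd D 0 2 p) (pd D 0 2 p) = 0"
  proof -
    have gen: "x = 0" "y = 0" "w = 0" if "1 * (1 * x + 2 * y) + 1 * w = 0" "0 \<le> x" "0 \<le> y" "0 \<le> w" for x y w :: real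
    proof -
      have "x + 2 * y + w = 0" using that(1) by simp
      then show "x = 0" "y = 0" "w = 0" using that(2-4) by linarith+
    qed
    show "ip D (pd D 2 0 p) (pd D 2 0 p) = 0" "ip D (pd D 1 1 p) (pd D 1 1 p) = 0" "ip D (pd D 0 2 p) (pd D 0 2 p) = 0"
      by (rule gen[OF z[unfolded ip_hess[OF p2 p2]] nn nn nn])+
  qed
  obtain y r where r: "0 < r" "ball y r \<subseteq> D" using D_open D_nonempty open_contains_ball by blast
  have J2: "J 2 0 x = 0" "J 1 1 x = 0" "J 0 2 x = 0" if "x \<in> ball y r" for x
    using pd_null_jet[OF J(1), of 2 0 x] pd_null_jet[OF J(1), of 1 1 x] pd_null_jet[OF J(1), of 0 2 x] zz J(2) r that by auto
  obtain \<alpha> where \<alpha>: "\<And>x. x \<in> ball y r \<Longrightarrow> J 1 0 x = \<alpha>"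
    by (rule jet_constant_on_ball[OF J(1), of y r 1 0]) (use J2 in \<open>auto simp: numeral_2_eq_2\<close>)
  obtain \<beta> where \<beta>: "\<And>x. x \<in> ball y r \<Longrightarrow> J 0 1 x = \<beta>"
    by (rule jet_constant_on_ball[OF J(1), of y r 0 1]) (use J2 in \<open>auto simp: numeral_2_eq_2\<close>)
  let ?J' = "\<lambda>i j x. 1 * J i j x + (-1) * affine_jet \<alpha> \<beta> 0 i j x"
  have J': "smooth_jet ?J'" by (rule smooth_jet_comb[OF J(1) smooth_affine_jet])
  obtain \<gamma> where \<gamma>: "\<And>x. x \<in> ball y r \<Longrightarrow> ?J' 0 0 x = \<gamma>"
    by (rule jet_constant_on_ball[OF J', of y r 0 0]) (use \<alpha> \<beta> in \<open>auto simp: affine_jet_def\<close>)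
  have pa: "p x - affine_fun \<alpha> \<beta> \<gamma> x = 0" if "x \<in> ball y r" for x
    using \<gamma>[OF that] unfolding J(2)[symmetric] affine_jet_def affine_fun_def by simp
  have "(\<lambda>x. p x - affine_fun \<alpha> \<beta> \<gamma> x) = (\<lambda>x. 0)"
    by (rule polys_zero_on_open[OF lin_spaceD(3)[OF lin_space_polys p affine_in_polys] open_ball _ pa])
      (use r k in auto)
  then have "p = affine_fun \<alpha> \<beta> \<gamma>" by (auto simp: fun_eq_iff)
  then show ?thesis by (rule that)
qed


section \<open>Boundary means and the elliptic projections\<close>

definition perimeter :: real where "perimeter = (\<Sum>e\<in>cell_edges K. edge_len e)"

lemma perimeter_pos: "0 < perimeter"
proof -
  obtain e where e: "e \<in> cell_edges K" "0 < edge_len e" using exists_proper_edge[OF simple] by blast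
  have "finite (cell_edges K)" unfolding cell_edges_def by simp
  then show ?thesis unfolding perimeter_def
    by (rule sum_pos2[OF _ e(1), where f = edge_len]) (use e(2) edge_len_nonneg in auto)
qed

lemma one_L2_edge: "(\<lambda>x. 1) \<in> L2_edge e"
  by (rule continuous_L2_edge) simp

lemma bdry_eq: "bdry_int_trace K v = (\<Sum>e\<in>cell_edges K. edge_int e (\<lambda>x. edge_trace D e v x * 1))"
  unfolding bdry_int_trace_def D_def by simp

lemma bdry_lin: "lin_on (sobolev 2 D) (bdry_int_trace K)"
proof -
  have "lin_on (sobolev 2 D) (\<lambda>v. \<Sum>e\<in>cell_edges K. edge_int e (\<lambda>x. edge_trace D e v x * 1))"
    by (rule lin_on_sum) (rule trace_lin[OF good_cell_edge D_open one_L2_edge])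
  moreover have "bdry_int_trace K = (\<lambda>v. \<Sum>e\<in>cell_edges K. edge_int e (\<lambda>x. edge_trace D e v x * 1))"
    by (intro ext bdry_eq)
  ultimately show ?thesis by simp
qed

lemma bdry_pd_lin:
  assumes "i + j \<le> 1" shows "lin_on (sobolev 2 D) (\<lambda>v. bdry_int_trace K (pd D i j v))"
  unfolding bdry_eq
  by (rule lin_on_sum) (rule edge_trace_pd_lin[OF good_cell_edge D_open one_L2_edge assms])

lemma bdry_const:
  assumes v: "v \<in> sobolev 1 D" and c: "AE x in lebesgue_on D. v x = \<gamma>"
  shows "bdry_int_trace K v = \<gamma> * perimeter"
proof -
  let ?c = "affine_jet 0 0 \<gamma>"
  have c0: "?c 0 0 = (\<lambda>x. \<gamma>)" unfolding affine_jet_0 affine_fun_def by auto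
  have cs: "?c 0 0 \<in> sobolev 1 D" unfolding sobolev_def using smooth_jet_derivs[OF smooth_affine_jet] by blast
  have "edge_int e (\<lambda>x. edge_trace D e v x * 1) = \<gamma> * edge_len e" if e: "e \<in> cell_edges K" for e
  proof -
    have "edge_int e (\<lambda>x. edge_trace D e v x * 1) = edge_int e (\<lambda>x. edge_trace D e (?c 0 0) x * 1)"
      by (rule edge_trace_null[OF good_cell_edge[OF e] D_open v cs _ one_L2_edge]) (use c c0 in simp)
    also have "\<dots> = edge_int e (\<lambda>x. ?c 0 0 x * 1)"
      by (rule edge_trace_smooth[OF good_cell_edge[OF e] D_open smooth_affine_jet smooth_jet_L2[OF smooth_affine_jet] one_L2_edge])
    also have "\<dots> = \<gamma> * edge_len e"
      unfolding edge_int_def c0 by (simp add: measure_restrict_space)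
    finally show ?thesis .
  qed
  then show ?thesis unfolding bdry_eq perimeter_def sum_distrib_left by (rule sum.cong[OF refl])
qed

lemma affine_sobolev: "affine_fun \<alpha> \<beta> \<gamma> \<in> sobolev 2 D"
  using smooth_jet_derivs[OF smooth_affine_jet, of 2 \<alpha> \<beta> \<gamma>] unfolding sobolev_def affine_jet_0 by blast

lemma affine_pd: "AE x in lebesgue_on D. pd D i j (affine_fun \<alpha> \<beta> \<gamma>) x = affine_jet \<alpha> \<beta> \<gamma> i j x"
  using smooth_jet_pd[OF smooth_affine_jet, of i j \<alpha> \<beta> \<gamma>] unfolding affine_jet_0 .

lemma bdry_affine_pd:
  "bdry_int_trace K (pd D 1 0 (affine_fun \<alpha> \<beta> \<gamma>)) = \<alpha> * perimeter"
  "bdry_int_trace K (pd D 0 1 (affine_fun \<alpha> \<beta> \<gamma>)) = \<beta> * perimeter"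
proof -
  have s: "pd D 1 0 (affine_fun \<alpha> \<beta> \<gamma>) \<in> sobolev 1 D" "pd D 0 1 (affine_fun \<alpha> \<beta> \<gamma>) \<in> sobolev 1 D"
    using pd_sobolev[OF D_open affine_sobolev, of 1 1 0] pd_sobolev[OF D_open affine_sobolev, of 1 0 1] by simp_all
  show "bdry_int_trace K (pd D 1 0 (affine_fun \<alpha> \<beta> \<gamma>)) = \<alpha> * perimeter"
    by (rule bdry_const[OF s(1)]) (use affine_pd[of 1 0] in \<open>simp add: affine_jet_def\<close>)
  show "bdry_int_trace K (pd D 0 1 (affine_fun \<alpha> \<beta> \<gamma>)) = \<beta> * perimeter"
    by (rule bdry_const[OF s(2)]) (use affine_pd[of 0 1] in \<open>simp add: affine_jet_def\<close>)
qed

lemma bdry_affine_const: "bdry_int_trace K (affine_fun 0 0 \<gamma>) = \<gamma> * perimeter"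
proof (rule bdry_const)
  show "affine_fun 0 0 \<gamma> \<in> sobolev 1 D" using affine_sobolev sobolev1 by blast
qed (simp add: affine_fun_def)

lemma affine_pd_null:
  assumes "\<And>x. affine_jet \<alpha> \<beta> \<gamma> i j x = 0" "i + j \<le> 2"
  shows "ip D (pd D i j (affine_fun \<alpha> \<beta> \<gamma>)) (pd D i j (affine_fun \<alpha> \<beta> \<gamma>)) = 0"
proof (rule ip_null_AE)
  show "pd D i j (affine_fun \<alpha> \<beta> \<gamma>) \<in> L2 D" by (rule pd_L2[OF affine_sobolev assms(2)])
  show "AE x in lebesgue_on D. pd D i j (affine_fun \<alpha> \<beta> \<gamma>) x = 0" using affine_pd[of i j \<alpha> \<beta> \<gamma>] assms(1) by simp
qed

lemma grad_const: "ip D (grad D (affine_fun 0 0 \<gamma>)) (grad D (affine_fun 0 0 \<gamma>)) = 0"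
proof -
  have s: "affine_fun 0 0 \<gamma> \<in> sobolev 1 D" using affine_sobolev sobolev1 by blast
  have "ip D (pd D 1 0 (affine_fun 0 0 \<gamma>)) (pd D 1 0 (affine_fun 0 0 \<gamma>)) = 0"
    "ip D (pd D 0 1 (affine_fun 0 0 \<gamma>)) (pd D 0 1 (affine_fun 0 0 \<gamma>)) = 0"
    by (rule affine_pd_null; simp add: affine_jet_def)+
  then show ?thesis unfolding ip_grad[OF s s] by simp
qed

lemma hess_affine: "ip D (hess D (affine_fun \<alpha> \<beta> \<gamma>)) (hess D (affine_fun \<alpha> \<beta> \<gamma>)) = 0"
proof -
  have "ip D (pd D 2 0 (affine_fun \<alpha> \<beta> \<gamma>)) (pd D 2 0 (affine_fun \<alpha> \<beta> \<gamma>)) = 0"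
    "ip D (pd D 1 1 (affine_fun \<alpha> \<beta> \<gamma>)) (pd D 1 1 (affine_fun \<alpha> \<beta> \<gamma>)) = 0"
    "ip D (pd D 0 2 (affine_fun \<alpha> \<beta> \<gamma>)) (pd D 0 2 (affine_fun \<alpha> \<beta> \<gamma>)) = 0"
    by (rule affine_pd_null; simp add: affine_jet_def)+
  then show ?thesis unfolding ip_hess[OF affine_sobolev affine_sobolev] by simp
qed

text \<open>Settles the orthogonality conditions alone. They determine \<open>p\<close> up to the
  kernel of the energy, and this freedom is used to adjust the boundary means.\<close>

lemma energy_projection:
  assumes a: "psd_on (sobolev 2 D) a"
    and null: "\<And>v. v \<in> sobolev 2 D \<Longrightarrow> AE x in lebesgue_on D. v x = 0 \<Longrightarrow> a v v = 0"
    and v: "v \<in> sobolev 2 D"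
  shows "\<exists>p\<in>polys (int k). \<forall>q\<in>polys (int k). a (\<lambda>x. v x - p x) q = 0"
proof -
  have "\<exists>p\<in>polys (int k). \<forall>q\<in>polys (int k). a p q = a v q"
  proof (rule riesz_polys[OF order_refl psd_on_subset[OF a V_sobolev]])
    show "a w w = 0" if "w \<in> V" "AE x in lebesgue_on D. w x = 0" for w using null that V_sobolev by blast
    show "lin_on (polys (int k)) (a v)"
      by (rule lin_on_subset[OF psd_on_linR[OF a lin_space_sobolev v] polys_sobolev])
    show "a v q = 0" if q: "q \<in> polys (int k)" "a q q = 0" for q
    proof -
      have "q \<in> sobolev 2 D" using q(1) polys_sobolev by blast
      from psd_null(2)[OF a lin_space_sobolev this v] q(2) show ?thesis by blast
    qed
  qed
  then obtain p where p: "p \<in> polys (int k)" "\<And>q. q \<in> polys (int k) \<Longrightarrow> a p q = a v q" by blast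
  have ps: "p \<in> sobolev 2 D" using p(1) polys_sobolev by blast
  have "a (\<lambda>x. v x - p x) q = 0" if q: "q \<in> polys (int k)" for q
  proof -
    have qs: "q \<in> sobolev 2 D" using q polys_sobolev by blast
    show ?thesis using lin_onD(3)[OF psd_onD(1)[OF a qs] v ps] p(2)[OF q] by simp
  qed
  then show ?thesis using p(1) by blast
qed

text \<open>A correction \<open>r\<close> from the kernel of the energy is orthogonal to everything,
  so it does not disturb the conditions already met.\<close>

lemma energy_shift:
  assumes a: "psd_on (sobolev 2 D) a" and z: "a r r = 0"
    and v: "v \<in> sobolev 2 D" and p: "p \<in> polys (int k)" and r: "r \<in> polys (int k)" and q: "q \<in> polys (int k)"
    and vp: "a (\<lambda>x. v x - p x) q = 0"
  shows "a (\<lambda>x. v x - (p x + r x)) q = 0"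
proof -
  have s: "p \<in> sobolev 2 D" "r \<in> sobolev 2 D" "q \<in> sobolev 2 D" using p r q polys_sobolev by auto
  have "a r q = 0" using psd_null(1)[OF a lin_space_sobolev s(2,3)] z by blast
  moreover have "a (\<lambda>x. (v x - p x) - r x) q = a (\<lambda>x. v x - p x) q - a r q"
    by (rule lin_onD(3)[OF psd_onD(1)[OF a s(3)] lin_spaceD(3)[OF lin_space_sobolev v s(1)] s(2)])
  ultimately show ?thesis using vp by (simp add: algebra_simps)
qed

lemma Pi1_projection:
  shows "v \<in> sobolev 2 D \<Longrightarrow> Pi1 K k v \<in> polys (int k)"
    and "v \<in> sobolev 2 D \<Longrightarrow> w \<in> sobolev 2 D \<Longrightarrow>
      Pi1 K k (\<lambda>x. a * v x + b * w x) = (\<lambda>x. a * Pi1 K k v x + b * Pi1 K k w x)"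
proof -
  let ?P = "polys (int k)"
  let ?G = "\<lambda>f q. ip D (grad D f) (grad D q)"
  let ?\<Phi> = "insert (bdry_int_trace K) ((\<lambda>q f. ?G f q) ` ?P)"
  let ?R = "\<lambda>v p. p \<in> ?P \<and> (\<forall>q\<in>?P. ?G (\<lambda>x. v x - p x) q = 0) \<and> bdry_int_trace K (\<lambda>x. v x - p x) = 0"
  have \<Phi>: "\<forall>\<phi>\<in>?\<Phi>. lin_on (sobolev 2 D) \<phi>"
    using psd_onD(1)[OF psd_grad2] polys_sobolev bdry_lin by blast
  have ex: "\<forall>v\<in>sobolev 2 D. \<exists>p\<in>?P. \<forall>\<phi>\<in>?\<Phi>. \<phi> (\<lambda>x. v x - p x) = 0"
  proof
    fix v assume v: "v \<in> sobolev 2 D"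
    obtain p where p: "p \<in> ?P" "\<forall>q\<in>?P. ?G (\<lambda>x. v x - p x) q = 0"
      using energy_projection[OF psd_grad2 grad_null v] by blast
    \<comment> \<open>The constant with the same boundary integral as \<open>v - p\<close>; the
      gradient energy does not see it.\<close>
    define r where "r = affine_fun 0 0 (bdry_int_trace K (\<lambda>x. v x - p x) / perimeter)"
    have r: "r \<in> ?P" "?G r r = 0" unfolding r_def by (auto intro: const_in_polys grad_const)
    have s: "p \<in> sobolev 2 D" "r \<in> sobolev 2 D" using p(1) r(1) polys_sobolev by auto
    have "bdry_int_trace K (\<lambda>x. (v x - p x) - r x) = bdry_int_trace K (\<lambda>x. v x - p x) - bdry_int_trace K r"
      by (rule lin_onD(3)[OF bdry_lin lin_spaceD(3)[OF lin_space_sobolev v s(1)] s(2)])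
    also have "bdry_int_trace K r = bdry_int_trace K (\<lambda>x. v x - p x)"
      unfolding r_def bdry_affine_const using perimeter_pos by simp
    finally have "bdry_int_trace K (\<lambda>x. v x - (p x + r x)) = 0" by (simp add: algebra_simps)
    moreover have "?G (\<lambda>x. v x - (p x + r x)) q = 0" if "q \<in> ?P" for q
      using energy_shift[OF psd_grad2 r(2) v p(1) r(1) that] p(2) that by blast
    ultimately show "\<exists>p\<in>?P. \<forall>\<phi>\<in>?\<Phi>. \<phi> (\<lambda>x. v x - p x) = 0"
      by (intro bexI[OF _ lin_spaceD(2)[OF lin_space_polys p(1) r(1)]]) simp
  qed
  have zero: "\<forall>p\<in>?P. (\<forall>\<phi>\<in>?\<Phi>. \<phi> p = 0) \<longrightarrow> p = (\<lambda>x. 0)"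
  proof (intro ballI impI)
    fix p assume p: "p \<in> ?P" and z: "\<forall>\<phi>\<in>?\<Phi>. \<phi> p = 0"
    have "(\<lambda>f. ?G f p) \<in> ?\<Phi>" by (rule insertI2[OF imageI[OF p]])
    from bspec[OF z this] have G: "?G p p = 0" .
    obtain \<gamma> where \<gamma>: "p = affine_fun 0 0 \<gamma>" by (rule grad_kernel[OF p G])
    have "bdry_int_trace K p = 0" using z by simp
    then have "\<gamma> = 0" unfolding \<gamma> bdry_affine_const using perimeter_pos by simp
    then show "p = (\<lambda>x. 0)" unfolding \<gamma> by (simp add: affine_fun_def[abs_def])
  qed
  have eq: "Pi1 K k v = (THE p. ?R v p)" for v unfolding Pi1_def D_def ..
  have R: "\<forall>v p. ?R v p \<longleftrightarrow> p \<in> ?P \<and> (\<forall>\<phi>\<in>?\<Phi>. \<phi> (\<lambda>x. v x - p x) = 0)" by auto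
  note proj = projection_linear[where X = "sobolev 2 D" and P = ?P and \<Phi> = ?\<Phi> and R = ?R,
      OF lin_space_sobolev lin_space_polys polys_sobolev \<Phi> ex zero R]
  show "Pi1 K k v \<in> ?P" if v: "v \<in> sobolev 2 D"
    using proj(1)[OF v] unfolding eq by (rule conjunct1)
  show "Pi1 K k (\<lambda>x. a * v x + b * w x) = (\<lambda>x. a * Pi1 K k v x + b * Pi1 K k w x)"
    if v: "v \<in> sobolev 2 D" "w \<in> sobolev 2 D"
    unfolding eq by (rule proj(3)[OF v])
qed

lemma Pi2_projection:
  shows "v \<in> sobolev 2 D \<Longrightarrow> Pi2 K k v \<in> polys (int k)"
    and "v \<in> sobolev 2 D \<Longrightarrow> w \<in> sobolev 2 D \<Longrightarrow>
      Pi2 K k (\<lambda>x. a * v x + b * w x) = (\<lambda>x. a * Pi2 K k v x + b * Pi2 K k w x)"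
proof -
  let ?P = "polys (int k)"
  let ?H = "\<lambda>f q. ip D (hess D f) (hess D q)"
  let ?b = "bdry_int_trace K"
  let ?b1 = "\<lambda>f. ?b (pd D 1 0 f)" and ?b2 = "\<lambda>f. ?b (pd D 0 1 f)"
  let ?\<Phi> = "insert ?b (insert ?b1 (insert ?b2 ((\<lambda>q f. ?H f q) ` ?P)))"
  let ?R = "\<lambda>v p. p \<in> ?P \<and> (\<forall>q\<in>?P. ?H (\<lambda>x. v x - p x) q = 0) \<and> ?b (\<lambda>x. v x - p x) = 0 \<and>
    ?b1 (\<lambda>x. v x - p x) = 0 \<and> ?b2 (\<lambda>x. v x - p x) = 0"
  have b1: "lin_on (sobolev 2 D) ?b1" and b2: "lin_on (sobolev 2 D) ?b2" by (rule bdry_pd_lin, simp)+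
  have \<Phi>: "\<forall>\<phi>\<in>?\<Phi>. lin_on (sobolev 2 D) \<phi>"
    using psd_onD(1)[OF psd_hess2] polys_sobolev bdry_lin b1 b2 by blast
  have ex: "\<forall>v\<in>sobolev 2 D. \<exists>p\<in>?P. \<forall>\<phi>\<in>?\<Phi>. \<phi> (\<lambda>x. v x - p x) = 0"
  proof
    fix v assume v: "v \<in> sobolev 2 D"
    obtain p where p: "p \<in> ?P" "\<forall>q\<in>?P. ?H (\<lambda>x. v x - p x) q = 0"
      using energy_projection[OF psd_hess2 hess_null v] by blast
    have ps: "p \<in> sobolev 2 D" using p(1) polys_sobolev by auto
    define f where "f = (\<lambda>x. v x - p x)"
    have f: "f \<in> sobolev 2 D" unfolding f_def by (rule lin_spaceD(3)[OF lin_space_sobolev v ps])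
    \<comment> \<open>The slopes match the boundary means of the first derivatives. The constant
      term then corrects the boundary mean, reduced by what the linear part already
      contributes.\<close>
    define \<alpha> where "\<alpha> = ?b1 f / perimeter"
    define \<beta> where "\<beta> = ?b2 f / perimeter"
    define \<gamma> where "\<gamma> = (?b f - ?b (affine_fun \<alpha> \<beta> 0)) / perimeter"
    define r where "r = affine_fun \<alpha> \<beta> \<gamma>"
    have r: "r \<in> ?P" "?H r r = 0" unfolding r_def using k by (auto intro: affine_in_polys hess_affine)
    have rs: "r \<in> sobolev 2 D" using r(1) polys_sobolev by auto
    have br: "?b r = ?b f"
    proof -
      have "r = (\<lambda>x. affine_fun \<alpha> \<beta> 0 x + affine_fun 0 0 \<gamma> x)" unfolding r_def affine_fun_def[abs_def] by simp
      then have "?b r = ?b (affine_fun \<alpha> \<beta> 0) + ?b (affine_fun 0 0 \<gamma>)"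
        using lin_onD(2)[OF bdry_lin affine_sobolev affine_sobolev] by simp
      then show ?thesis unfolding bdry_affine_const \<gamma>_def using perimeter_pos by simp
    qed
    have b1r: "?b1 r = ?b1 f" and b2r: "?b2 r = ?b2 f"
      unfolding r_def bdry_affine_pd \<alpha>_def \<beta>_def using perimeter_pos by simp_all
    have e: "(\<lambda>x. v x - (p x + r x)) = (\<lambda>x. f x - r x)" unfolding f_def by (simp add: algebra_simps)
    have "?b (\<lambda>x. v x - (p x + r x)) = 0" unfolding e lin_onD(3)[OF bdry_lin f rs] br by simp
    moreover have "?b1 (\<lambda>x. v x - (p x + r x)) = 0" unfolding e lin_onD(3)[OF b1 f rs] b1r by simp
    moreover have "?b2 (\<lambda>x. v x - (p x + r x)) = 0" unfolding e lin_onD(3)[OF b2 f rs] b2r by simp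
    moreover have "?H (\<lambda>x. v x - (p x + r x)) q = 0" if "q \<in> ?P" for q
      using energy_shift[OF psd_hess2 r(2) v p(1) r(1) that] p(2) that by blast
    ultimately show "\<exists>p\<in>?P. \<forall>\<phi>\<in>?\<Phi>. \<phi> (\<lambda>x. v x - p x) = 0"
      by (intro bexI[OF _ lin_spaceD(2)[OF lin_space_polys p(1) r(1)]]) simp
  qed
  have zero: "\<forall>p\<in>?P. (\<forall>\<phi>\<in>?\<Phi>. \<phi> p = 0) \<longrightarrow> p = (\<lambda>x. 0)"
  proof (intro ballI impI)
    fix p assume p: "p \<in> ?P" and z: "\<forall>\<phi>\<in>?\<Phi>. \<phi> p = 0"
    have "(\<lambda>f. ?H f p) \<in> ?\<Phi>" by (intro insertI2 imageI[OF p])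
    from bspec[OF z this] have H: "?H p p = 0" .
    obtain \<alpha> \<beta> \<gamma> where \<gamma>: "p = affine_fun \<alpha> \<beta> \<gamma>" by (rule hess_kernel[OF p H])
    have "?b1 p = 0" "?b2 p = 0" using z by simp_all
    then have ab: "\<alpha> = 0" "\<beta> = 0" unfolding \<gamma> bdry_affine_pd using perimeter_pos by simp_all
    have "?b p = 0" using z by simp
    then have "\<gamma> = 0" unfolding \<gamma> ab bdry_affine_const using perimeter_pos by simp
    then show "p = (\<lambda>x. 0)" unfolding \<gamma> ab by (simp add: affine_fun_def[abs_def])
  qed
  have eq: "Pi2 K k v = (THE p. ?R v p)" for v unfolding Pi2_def D_def ..
  have R: "\<forall>v p. ?R v p \<longleftrightarrow> p \<in> ?P \<and> (\<forall>\<phi>\<in>?\<Phi>. \<phi> (\<lambda>x. v x - p x) = 0)" by auto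
  note proj = projection_linear[where X = "sobolev 2 D" and P = ?P and \<Phi> = ?\<Phi> and R = ?R,
      OF lin_space_sobolev lin_space_polys polys_sobolev \<Phi> ex zero R]
  show "Pi2 K k v \<in> ?P" if v: "v \<in> sobolev 2 D"
    using proj(1)[OF v] unfolding eq by (rule conjunct1)
  show "Pi2 K k (\<lambda>x. a * v x + b * w x) = (\<lambda>x. a * Pi2 K k v x + b * Pi2 K k w x)"
    if v: "v \<in> sobolev 2 D" "w \<in> sobolev 2 D"
    unfolding eq by (rule proj(3)[OF v])
qed

end

lemma Lipschitz_continuous:
  fixes f :: "real \<Rightarrow> real"
  assumes "\<And>x y. \<bar>f x - f y\<bar> \<le> L * \<bar>x - y\<bar>" "0 \<le> L"
  shows "continuous_on A f"
  using assms by (intro lipschitz_on_continuous_on[of L] lipschitz_onI) (simp_all add: dist_real_def)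

context vem_cell
begin

section \<open>Forms and load on a cell\<close>

lemma V_minus_poly: "v \<in> V \<Longrightarrow> p \<in> polys (int k) \<Longrightarrow> (\<lambda>x. v x - p x) \<in> V"
  using lin_spaceD(3)[OF V_lin] polys_V by blast

lemma psd_SK: "psd_on V (SK d K)"
proof -
  have "psd_on V (\<lambda>v w. \<Sum>i\<in>dof_set d K. dof K i v * dof K i w)"
    by (rule psd_on_sum) (rule psd_on_prod[OF dof_lin])
  moreover have "SK d K = (\<lambda>v w. \<Sum>i\<in>dof_set d K. dof K i v * dof K i w)"
    by (intro ext) (rule SK_def)
  ultimately show ?thesis by simp
qed

lemma psd_SK_remainder:
  assumes P: "\<And>v. v \<in> V \<Longrightarrow> P v \<in> polys (int k)"
    and lin: "\<And>v w a b. v \<in> V \<Longrightarrow> w \<in> V \<Longrightarrow> P (\<lambda>x. a * v x + b * w x) = (\<lambda>x. a * P v x + b * P w x)"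
  shows "psd_on V (\<lambda>v w. SK d K (\<lambda>x. v x - P v x) (\<lambda>x. w x - P w x))"
proof (rule psd_on_pullback[OF psd_SK, where P = "\<lambda>v x. v x - P v x"])
  show "(\<lambda>x. v x - P v x) \<in> V" if "v \<in> V" for v by (rule V_minus_poly[OF that P[OF that]])
  show "(\<lambda>x. a * v x + b * w x - P (\<lambda>x. a * v x + b * w x) x) = (\<lambda>x. a * (v x - P v x) + b * (w x - P w x))"
    if "v \<in> V" "w \<in> V" for v w a b
    unfolding lin[OF that] by (intro ext) (simp add: algebra_simps)
qed

lemma psd_MK: "psd_on V (MK k d K)"
proof -
  have L: "v \<in> L2 D" if "v \<in> V" for v using V_L2 that by blast
  have 1: "psd_on V (\<lambda>v w. ip D (Pi0 K k v) (Pi0 K k w))"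
    by (rule psd_on_pullback[OF psd_ip, where P = "Pi0 K k"]) (use L Pi0_L2 Pi0_projection(4) in auto)
  have 2: "psd_on V (\<lambda>v w. SK d K (\<lambda>x. v x - Pi0 K k v x) (\<lambda>x. w x - Pi0 K k w x))"
    by (rule psd_SK_remainder) (use L Pi0_projection(1,4) in auto)
  have "psd_on V (\<lambda>v w. 1 * ip D (Pi0 K k v) (Pi0 K k w)
     + (diameter (cell K))\<^sup>2 * SK d K (\<lambda>x. v x - Pi0 K k v x) (\<lambda>x. w x - Pi0 K k w x))"
    by (rule psd_on_comb[OF 1 2]) simp_all
  moreover have "MK k d K = (\<lambda>v w. 1 * ip D (Pi0 K k v) (Pi0 K k w)
     + (diameter (cell K))\<^sup>2 * SK d K (\<lambda>x. v x - Pi0 K k v x) (\<lambda>x. w x - Pi0 K k w x))"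
    by (intro ext) (simp add: MK_def S0_def D_def)
  ultimately show ?thesis by simp
qed

lemma psd_AK: "psd_on V (AK k d K)"
proof -
  have S: "v \<in> sobolev 2 D" if "v \<in> V" for v using V_sobolev that by blast
  have 1: "psd_on V (\<lambda>v w. ip D (hess D (Pi2 K k v)) (hess D (Pi2 K k w)))"
    by (rule psd_on_pullback[OF psd_hess2, where P = "Pi2 K k"])
      (use S Pi2_projection polys_sobolev in auto)
  have 2: "psd_on V (\<lambda>v w. SK d K (\<lambda>x. v x - Pi2 K k v x) (\<lambda>x. w x - Pi2 K k w x))"
    by (rule psd_SK_remainder) (use S Pi2_projection in auto)
  have "psd_on V (\<lambda>v w. 1 * ip D (hess D (Pi2 K k v)) (hess D (Pi2 K k w))
     + diameter (cell K) powi (-2) * SK d K (\<lambda>x. v x - Pi2 K k v x) (\<lambda>x. w x - Pi2 K k w x))"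
    by (rule psd_on_comb[OF 1 2]) (simp_all add: power_int_minus)
  moreover have "AK k d K = (\<lambda>v w. 1 * ip D (hess D (Pi2 K k v)) (hess D (Pi2 K k w))
     + diameter (cell K) powi (-2) * SK d K (\<lambda>x. v x - Pi2 K k v x) (\<lambda>x. w x - Pi2 K k w x))"
    by (intro ext) (simp add: AK_def S2_def D_def)
  ultimately show ?thesis by simp
qed

lemma ip_vector:
  fixes F G :: "pt \<Rightarrow> real^2"
  assumes "\<And>i. (\<lambda>x. F x $ i) \<in> L2 D" "\<And>i. (\<lambda>x. G x $ i) \<in> L2 D"
  shows "ip D F G = 1 * ip D (\<lambda>x. F x $ 1) (\<lambda>x. G x $ 1) + 1 * ip D (\<lambda>x. F x $ 2) (\<lambda>x. G x $ 2)"
proof -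
  have "integrable (lebesgue_on D) (\<lambda>x. F x $ i * G x $ i)" for i
    using assms by (auto intro!: sqint_mult_integrable simp: L2_eq_sqint)
  then show ?thesis unfolding ip_def by (simp add: inner_vec_def sum_2)
qed

text \<open>The vector projection decouples: testing with fields that have one zero component
  isolates each component.\<close>

lemma Pi0vec_eq:
  assumes F: "\<And>i. (\<lambda>x. F x $ i) \<in> L2 D"
  shows "Pi0vec K k F = (\<lambda>x. vector [Pi0 K (k - 1) (\<lambda>x. F x $ 1) x, Pi0 K (k - 1) (\<lambda>x. F x $ 2) x])"
proof -
  have l: "k - 1 \<le> k" by simp
  \<comment> \<open>The truncated difference of natural numbers agrees with the integer one because
    \<open>k\<close> is at least two.\<close>
  have ik: "int k - 1 = int (k - 1)" using k by simp
  let ?P = "polys (int (k - 1))"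
  let ?p = "\<lambda>x. vector [Pi0 K (k - 1) (\<lambda>x. F x $ 1) x, Pi0 K (k - 1) (\<lambda>x. F x $ 2) x] :: real^2"
  have vp: "P \<in> vpolys (int (k - 1)) \<longleftrightarrow> (\<lambda>x. P x $ 1) \<in> ?P \<and> (\<lambda>x. P x $ 2) \<in> ?P" for P
    unfolding vpolys_def by (simp add: forall_2)
  have pp: "?p \<in> vpolys (int (k - 1))"
    unfolding vp using Pi0_projection(1)[OF l F] by simp
  have vL: "(\<lambda>x. P x $ i) \<in> L2 D" if "P \<in> vpolys (int (k - 1))" for P i
    using that polys_L2 unfolding vpolys_def by blast
  have split: "ip D (\<lambda>x. F x - P x) Q = ip D (\<lambda>x. F x $ 1 - P x $ 1) (\<lambda>x. Q x $ 1) + ip D (\<lambda>x. F x $ 2 - P x $ 2) (\<lambda>x. Q x $ 2)"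
    if P: "P \<in> vpolys (int (k - 1))" and Q: "Q \<in> vpolys (int (k - 1))" for P Q
  proof -
    have "(\<lambda>x. (F x - P x) $ i) \<in> L2 D" for i
      using lin_spaceD(3)[OF lin_space_L2 F vL[OF P]] by simp
    from ip_vector[OF this vL[OF Q]] show ?thesis by simp
  qed
  show ?thesis
    unfolding Pi0vec_def D_def[symmetric] ik
  proof (rule the_equality)
    have "ip D (\<lambda>x. F x - ?p x) Q = 0" if Q: "Q \<in> vpolys (int (k - 1))" for Q
      unfolding split[OF pp Q] using Q Pi0_projection(2)[OF l F] unfolding vp by simp
    then show "?p \<in> vpolys (int (k - 1)) \<and> (\<forall>Q\<in>vpolys (int (k - 1)). ip D (\<lambda>x. F x - ?p x) Q = 0)"
      using pp by blast
  next
    fix P assume "P \<in> vpolys (int (k - 1)) \<and> (\<forall>Q\<in>vpolys (int (k - 1)). ip D (\<lambda>x. F x - P x) Q = 0)"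
    then have P: "P \<in> vpolys (int (k - 1))" and orth: "\<And>Q. Q \<in> vpolys (int (k - 1)) \<Longrightarrow> ip D (\<lambda>x. F x - P x) Q = 0"
      by auto
    have z: "(\<lambda>x. 0) \<in> ?P" by (rule lin_space_zero[OF lin_space_polys])
    have "Pi0 K (k - 1) (\<lambda>x. F x $ 1) = (\<lambda>x. P x $ 1)"
    proof (rule Pi0_projection(3)[OF l F])
      show "(\<lambda>x. P x $ 1) \<in> ?P" using P unfolding vp by simp
      fix q assume q: "q \<in> ?P"
      have Q: "(\<lambda>x. vector [q x, 0]) \<in> vpolys (int (k - 1))" unfolding vp using q z by simp
      show "ip D (\<lambda>x. F x $ 1 - P x $ 1) q = 0"
        using orth[OF Q] unfolding split[OF P Q] by (simp add: ip_real)
    qed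
    moreover have "Pi0 K (k - 1) (\<lambda>x. F x $ 2) = (\<lambda>x. P x $ 2)"
    proof (rule Pi0_projection(3)[OF l F])
      show "(\<lambda>x. P x $ 2) \<in> ?P" using P unfolding vp by simp
      fix q assume q: "q \<in> ?P"
      have Q: "(\<lambda>x. vector [0, q x]) \<in> vpolys (int (k - 1))" unfolding vp using q z by simp
      show "ip D (\<lambda>x. F x $ 2 - P x $ 2) q = 0"
        using orth[OF Q] unfolding split[OF P Q] by (simp add: ip_real)
    qed
    ultimately show "P = ?p" by (intro ext) (simp add: vec_eq_iff forall_2)
  qed
qed

text \<open>Differentiation followed by projection is linear as a map into functions, so the
  pullback applies although \<open>pd\<close> alone is linear only almost everywhere.\<close>

lemma psd_Pi0_pd:
  assumes ij: "i + j \<le> 2" and l: "l \<le> k"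
  shows "psd_on V (\<lambda>v w. ip D (Pi0 K l (pd D i j v)) (Pi0 K l (pd D i j w)))"
proof (rule psd_on_pullback[OF psd_ip, where P = "\<lambda>v. Pi0 K l (pd D i j v)"])
  have S: "v \<in> sobolev 2 D" if "v \<in> V" for v using V_sobolev that by blast
  have L: "pd D i j v \<in> L2 D" if "v \<in> V" for v by (rule pd_L2[OF S[OF that] ij])
  show "Pi0 K l (pd D i j v) \<in> L2 D" if "v \<in> V" for v by (rule Pi0_L2[OF l L[OF that]])
  show "Pi0 K l (pd D i j (\<lambda>x. a * v x + b * w x)) = (\<lambda>x. a * Pi0 K l (pd D i j v) x + b * Pi0 K l (pd D i j w) x)"
    if vw: "v \<in> V" "w \<in> V" for v w a b
  proof -
    have "Pi0 K l (pd D i j (\<lambda>x. a * v x + b * w x)) = Pi0 K l (\<lambda>x. a * pd D i j v x + b * pd D i j w x)"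
      by (rule Pi0_AE[OF l L[OF lin_spaceD(1)[OF V_lin vw]] lin_spaceD(1)[OF lin_space_L2 L[OF vw(1)] L[OF vw(2)]]
            pd_comb[OF D_open S[OF vw(1)] S[OF vw(2)] ij]])
    also have "\<dots> = (\<lambda>x. a * Pi0 K l (pd D i j v) x + b * Pi0 K l (pd D i j w) x)"
      by (rule Pi0_projection(4)[OF l L[OF vw(1)] L[OF vw(2)]])
    finally show ?thesis .
  qed
qed

lemma psd_BK: "psd_on V (BK k d K)"
proof -
  let ?p = "\<lambda>i j v. Pi0 K (k - 1) (pd D i j v)"
  have S: "v \<in> sobolev 2 D" if "v \<in> V" for v using V_sobolev that by blast
  have l: "k - 1 \<le> k" by simp
  have 1: "psd_on V (\<lambda>v w. ip D (Pi0vec K k (grad D v)) (Pi0vec K k (grad D w)))"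
  proof (rule psd_on_cong[OF V_lin, where b = "\<lambda>v w. 1 * ip D (?p 1 0 v) (?p 1 0 w) + 1 * ip D (?p 0 1 v) (?p 0 1 w)"])
    show "psd_on V (\<lambda>v w. 1 * ip D (?p 1 0 v) (?p 1 0 w) + 1 * ip D (?p 0 1 v) (?p 0 1 w))"
      by (intro psd_on_comb psd_Pi0_pd l) simp_all
    fix v w assume vw: "v \<in> V" "w \<in> V"
    have L: "pd D 1 0 z \<in> L2 D" "pd D 0 1 z \<in> L2 D" if "z \<in> V" for z
      using pd_L2[OF S[OF that], of 1 0] pd_L2[OF S[OF that], of 0 1] by simp_all
    have g: "(\<lambda>x. grad D z x $ 1) = pd D 1 0 z" "(\<lambda>x. grad D z x $ 2) = pd D 0 1 z" for z
      unfolding grad_def by simp_all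
    have gL: "(\<lambda>x. grad D z x $ i) \<in> L2 D" if "z \<in> V" for z and i :: 2
    proof -
      have "\<forall>i. (\<lambda>x. grad D z x $ i) \<in> L2 D" unfolding forall_2 g using L[OF that] by simp
      then show ?thesis by blast
    qed
    have e: "Pi0vec K k (grad D z) = (\<lambda>x. vector [?p 1 0 z x, ?p 0 1 z x])" if "z \<in> V" for z
      using Pi0vec_eq[OF gL[OF that]] unfolding g .
    have PL: "(\<lambda>x. (vector [?p 1 0 z x, ?p 0 1 z x] :: real^2) $ i) \<in> L2 D" if "z \<in> V" for z and i :: 2
    proof -
      have "\<forall>i. (\<lambda>x. (vector [?p 1 0 z x, ?p 0 1 z x] :: real^2) $ i) \<in> L2 D"
        unfolding forall_2 using Pi0_L2[OF l L(1)[OF that]] Pi0_L2[OF l L(2)[OF that]] by simp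
      then show ?thesis by blast
    qed
    show "ip D (Pi0vec K k (grad D v)) (Pi0vec K k (grad D w)) = 1 * ip D (?p 1 0 v) (?p 1 0 w) + 1 * ip D (?p 0 1 v) (?p 0 1 w)"
      unfolding e[OF vw(1)] e[OF vw(2)] ip_vector[OF PL[OF vw(1)] PL[OF vw(2)]] by simp
  qed
  have 2: "psd_on V (\<lambda>v w. SK d K (\<lambda>x. v x - Pi1 K k v x) (\<lambda>x. w x - Pi1 K k w x))"
    by (rule psd_SK_remainder) (use S Pi1_projection in auto)
  have "psd_on V (\<lambda>v w. 1 * ip D (Pi0vec K k (grad D v)) (Pi0vec K k (grad D w))
     + 1 * SK d K (\<lambda>x. v x - Pi1 K k v x) (\<lambda>x. w x - Pi1 K k w x))"
    by (rule psd_on_comb[OF 1 2]) simp_all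
  moreover have "BK k d K = (\<lambda>v w. 1 * ip D (Pi0vec K k (grad D v)) (Pi0vec K k (grad D w))
     + 1 * SK d K (\<lambda>x. v x - Pi1 K k v x) (\<lambda>x. w x - Pi1 K k w x))"
    by (intro ext) (simp add: BK_def S1_def D_def)
  ultimately show ?thesis by simp
qed

text \<open>The projection is a contraction in mean square both outside and inside \<open>f\<close>,
  so the composite keeps the Lipschitz constant of \<open>f\<close>.\<close>

lemma Lipschitz_load:
  fixes f :: "real \<Rightarrow> real"
  assumes f: "\<And>x y. \<bar>f x - f y\<bar> \<le> L * \<bar>x - y\<bar>" and L: "0 \<le> L"
    and v: "v \<in> V" and v': "v' \<in> V" and w: "w \<in> L2 D"
  shows "\<bar>ip D (Pi0 K k (\<lambda>x. f (Pi0 K k v x))) w - ip D (Pi0 K k (\<lambda>x. f (Pi0 K k v' x))) w\<bar>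
      \<le> L * L2norm D (\<lambda>x. v x - v' x) * L2norm D w"
proof -
  have vL: "v \<in> L2 D" "v' \<in> L2 D" using v v' V_L2 by auto
  let ?p = "Pi0 K k v" and ?p' = "Pi0 K k v'"
  let ?g = "\<lambda>x. f (?p x)" and ?g' = "\<lambda>x. f (?p' x)"
  have fc: "continuous_on UNIV f" by (rule Lipschitz_continuous[OF f L])
  have P: "?p \<in> polys (int k)" "?p' \<in> polys (int k)" using Pi0_projection(1)[OF order_refl] vL by auto
  have gL: "?g \<in> L2 D" "?g' \<in> L2 D"
    by (rule continuous_bounded_L2[OF continuous_on_compose2[OF fc polys_continuous[OF P(1)]] D_bounded D_open], simp)
      (rule continuous_bounded_L2[OF continuous_on_compose2[OF fc polys_continuous[OF P(2)]] D_bounded D_open], simp)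
  have pL: "?p \<in> L2 D" "?p' \<in> L2 D" using P polys_L2 by auto
  let ?d = "\<lambda>x. ?g x - ?g' x"
  have dL: "?d \<in> L2 D" by (rule lin_spaceD(3)[OF lin_space_L2 gL])
  have "Pi0 K k ?d = (\<lambda>x. Pi0 K k ?g x - Pi0 K k ?g' x)"
    using Pi0_projection(4)[OF order_refl gL, of 1 "-1"] by simp
  then have eq: "ip D (Pi0 K k ?g) w - ip D (Pi0 K k ?g') w = ip D (Pi0 K k ?d) w"
    using lin_onD(3)[OF psd_onD(1)[OF psd_ip w] Pi0_L2[OF order_refl gL(1)] Pi0_L2[OF order_refl gL(2)]] by simp
  have "\<bar>ip D (Pi0 K k ?d) w\<bar> \<le> L2norm D (Pi0 K k ?d) * L2norm D w"
    unfolding L2norm_def by (rule psd_abs_le[OF psd_ip lin_space_L2 Pi0_L2[OF order_refl dL] w])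
  also have "\<dots> \<le> (L * L2norm D (\<lambda>x. v x - v' x)) * L2norm D w"
  proof (rule mult_right_mono[OF _ L2norm_nonneg])
    have "L2norm D (Pi0 K k ?d) \<le> L2norm D ?d" by (rule Pi0_norm[OF order_refl dL])
    also have "\<dots> \<le> L * L2norm D (\<lambda>x. ?p x - ?p' x)"
    proof -
      have ppL: "(\<lambda>x. ?p x - ?p' x) \<in> L2 D" by (rule lin_spaceD(3)[OF lin_space_L2 pL])
      have "ip D ?d ?d \<le> L\<^sup>2 * ip D (\<lambda>x. ?p x - ?p' x) (\<lambda>x. ?p x - ?p' x)"
      proof -
        have "(LINT x|lebesgue_on D. ?d x * ?d x) \<le> (LINT x|lebesgue_on D. L\<^sup>2 * ((?p x - ?p' x) * (?p x - ?p' x)))"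
        proof (rule integral_mono)
        show "integrable (lebesgue_on D) (\<lambda>x. ?d x * ?d x)"
          using sqint_mult_integrable dL unfolding L2_eq_sqint by blast
        show "integrable (lebesgue_on D) (\<lambda>x. L\<^sup>2 * ((?p x - ?p' x) * (?p x - ?p' x)))"
          using sqint_mult_integrable[of "\<lambda>x. ?p x - ?p' x" _ "\<lambda>x. ?p x - ?p' x"] ppL unfolding L2_eq_sqint
          by (intro integrable_mult_right) blast
        fix x
        have "(\<bar>?g x - ?g' x\<bar>)\<^sup>2 \<le> (L * \<bar>?p x - ?p' x\<bar>)\<^sup>2" by (rule power_mono[OF f]) simp
        then have "(?g x - ?g' x)\<^sup>2 \<le> L\<^sup>2 * (?p x - ?p' x)\<^sup>2" by (simp add: power_mult_distrib)
        then show "?d x * ?d x \<le> L\<^sup>2 * ((?p x - ?p' x) * (?p x - ?p' x))"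
          by (simp only: power2_eq_square)
        qed
        then show ?thesis unfolding ip_real by simp
      qed
      then have "sqrt (ip D ?d ?d) \<le> sqrt (L\<^sup>2 * ip D (\<lambda>x. ?p x - ?p' x) (\<lambda>x. ?p x - ?p' x))" by simp
      then show ?thesis unfolding L2norm_def using L by (simp add: real_sqrt_mult)
    qed
    also have "\<dots> \<le> L * L2norm D (\<lambda>x. v x - v' x)"
    proof (rule mult_left_mono[OF _ L])
      have "Pi0 K k (\<lambda>x. v x - v' x) = (\<lambda>x. ?p x - ?p' x)"
        using Pi0_projection(4)[OF order_refl vL, of 1 "-1"] by simp
      then show "L2norm D (\<lambda>x. ?p x - ?p' x) \<le> L2norm D (\<lambda>x. v x - v' x)"
        using Pi0_norm[OF order_refl lin_spaceD(3)[OF lin_space_L2 vL]] by simp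
    qed
    finally show "L2norm D (Pi0 K k ?d) \<le> L * L2norm D (\<lambda>x. v x - v' x)" .
  qed
  finally show ?thesis unfolding eq .
qed

lemma load_L2:
  assumes f: "\<And>x y. \<bar>f x - f y\<bar> \<le> L * \<bar>x - y\<bar>" and L: "0 \<le> L" and v: "v \<in> V"
  shows "Pi0 K k (\<lambda>x. f (Pi0 K k v x)) \<in> L2 D"
proof (rule Pi0_L2[OF order_refl])
  have fc: "continuous_on UNIV f" by (rule Lipschitz_continuous[OF f L])
  have "v \<in> L2 D" using v V_L2 by blast
  from continuous_on_compose2[OF fc polys_continuous[OF Pi0_projection(1)[OF order_refl this]]]
  show "(\<lambda>x. f (Pi0 K k v x)) \<in> L2 D" by (intro continuous_bounded_L2 D_bounded D_open) simp
qed

end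

section \<open>The discrete problem\<close>

text \<open>Banach's fixed point theorem for a seminorm. One step is determined only up to null
  vectors, hence a selection \<open>S\<close> is fixed; by the Lipschitz condition \<open>G\<close>
  does not distinguish arguments that differ by a null vector, and uniqueness is likewise modulo
  these.\<close>

lemma contraction_solvable:
  fixes X :: "('a \<Rightarrow> real) set"
  assumes I: "finite I" and X: "lin_space X" and a: "psd_on X a"
    and Dl: "\<And>i. i \<in> I \<Longrightarrow> lin_on X (D i)"
    and Dn: "\<And>v. v \<in> X \<Longrightarrow> (\<And>i. i \<in> I \<Longrightarrow> D i v = 0) \<Longrightarrow> a v v = 0"
    and G: "\<And>u. u \<in> X \<Longrightarrow> lin_on X (G u)"
    and G0: "\<And>u v. u \<in> X \<Longrightarrow> v \<in> X \<Longrightarrow> a v v = 0 \<Longrightarrow> G u v = 0"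
    and q: "0 \<le> q" "q < 1"
    and Lip: "\<And>u w v. u \<in> X \<Longrightarrow> w \<in> X \<Longrightarrow> v \<in> X \<Longrightarrow>
      \<bar>G u v - G w v\<bar> \<le> q * sqrt (a (\<lambda>x. u x - w x) (\<lambda>x. u x - w x)) * sqrt (a v v)"
  shows "\<exists>u\<in>X. (\<forall>v\<in>X. a u v = G u v) \<and>
    (\<forall>w\<in>X. (\<forall>v\<in>X. a w v = G w v) \<longrightarrow> a (\<lambda>x. w x - u x) (\<lambda>x. w x - u x) = 0)"
proof -
  define N where "N v = sqrt (a v v)" for v
  have Np: "0 \<le> N v" "a v v = N v * N v" if "v \<in> X" for v
    using psd_onD(3)[OF a that] unfolding N_def by simp_all
  have dX: "(\<lambda>x. v x - w x) \<in> X" if "v \<in> X" "w \<in> X" for v w by (rule lin_spaceD(3)[OF X that])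
  have "\<exists>s\<in>X. \<forall>v\<in>X. a s v = G u v" if u: "u \<in> X" for u
  proof (rule riesz_finite[OF I X a G[OF u], where D = D])
    show "G u v = 0" if "v \<in> X" "a v v = 0" for v using G0[OF u that] .
    show "lin_on X (D i)" if "i \<in> I" for i using Dl[OF that] .
    show "a v v = 0" if "v \<in> X" "\<And>i. i \<in> I \<Longrightarrow> D i v = 0" for v using that by (rule Dn)
  qed
  then have "\<forall>u\<in>X. \<exists>s. s \<in> X \<and> (\<forall>v\<in>X. a s v = G u v)" by blast
  from bchoice[OF this] obtain S where S: "\<And>u. u \<in> X \<Longrightarrow> S u \<in> X"
    and Sa: "\<And>u v. u \<in> X \<Longrightarrow> v \<in> X \<Longrightarrow> a (S u) v = G u v" by blast
  have contr: "N (\<lambda>x. S u x - S w x) \<le> q * N (\<lambda>x. u x - w x)" if u: "u \<in> X" and w: "w \<in> X" for u w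
  proof -
    let ?v = "\<lambda>x. S u x - S w x"
    have v: "?v \<in> X" by (rule dX[OF S[OF u] S[OF w]])
    have "a ?v ?v = a (S u) ?v - a (S w) ?v" by (rule lin_onD(3)[OF psd_onD(1)[OF a v] S[OF u] S[OF w]])
    also have "\<dots> = G u ?v - G w ?v" by (simp only: Sa[OF u v] Sa[OF w v])
    also have "\<dots> \<le> q * N (\<lambda>x. u x - w x) * N ?v" using Lip[OF u w v] unfolding N_def by linarith
    finally have "N ?v * N ?v \<le> q * N (\<lambda>x. u x - w x) * N ?v" unfolding Np(2)[OF v] .
    then show ?thesis using Np(1)[OF v] Np(1)[OF dX[OF u w]] q(1) by (cases "N ?v = 0") auto
  qed
  define U where "U m = (S ^^ m) (\<lambda>x. 0)" for m
  have U: "U m \<in> X" for m unfolding U_def by (induction m) (use S lin_space_zero[OF X] in auto)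
  have USuc: "U (Suc m) = S (U m)" for m unfolding U_def by simp
  define N1 where "N1 = N (\<lambda>x. U 1 x - U 0 x)"
  have N1: "0 \<le> N1" unfolding N1_def by (rule Np(1)[OF dX[OF U U]])
  have step: "N (\<lambda>x. U (Suc m) x - U m x) \<le> q ^ m * N1" for m
  proof (induction m)
    case (Suc m)
    have "N (\<lambda>x. U (Suc (Suc m)) x - U (Suc m) x) \<le> q * N (\<lambda>x. U (Suc m) x - U m x)"
      unfolding USuc[of "Suc m"] using contr[OF U[of "Suc m"] U[of m]] unfolding USuc[of m, symmetric] .
    also have "\<dots> \<le> q * (q ^ m * N1)" using Suc q(1) by (rule mult_left_mono)
    finally show ?case by simp
  qed (simp add: N1_def)
  have tri: "N (\<lambda>x. u x - w x) \<le> N (\<lambda>x. u x - v x) + N (\<lambda>x. v x - w x)" if "u \<in> X" "v \<in> X" "w \<in> X" for u v w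
    using psd_triangle[OF a X dX[OF that(1,2)] dX[OF that(2,3)]] unfolding N_def by simp
  have far: "N (\<lambda>x. U (m + n) x - U m x) \<le> q ^ m * N1 / (1 - q)" for m n
  proof -
    \<comment> \<open>The geometric sum is multiplied by \<open>1 - q\<close>, so that the induction
      step telescopes; the factor \<open>1 - q ^ n\<close> is what makes it close.\<close>
    have "N (\<lambda>x. U (m + n) x - U m x) * (1 - q) \<le> q ^ m * N1 * (1 - q ^ n)"
    proof (induction n)
      case 0
      have "a (\<lambda>x. 0) (\<lambda>x. 0) = 0" using lin_on_zero[OF psd_onD(1)[OF a lin_space_zero[OF X]] X] .
      then show ?case unfolding N_def by simp
    next
      case (Suc n)
      have "N (\<lambda>x. U (m + Suc n) x - U m x) \<le> q ^ (m + n) * N1 + N (\<lambda>x. U (m + n) x - U m x)"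
        using tri[OF U[of "m + Suc n"] U[of "m + n"] U[of m]] step[of "m + n"] by simp
      then have "N (\<lambda>x. U (m + Suc n) x - U m x) * (1 - q) \<le> (q ^ (m + n) * N1 + N (\<lambda>x. U (m + n) x - U m x)) * (1 - q)"
        using q(2) by (intro mult_right_mono) auto
      also have "\<dots> \<le> q ^ (m + n) * N1 * (1 - q) + q ^ m * N1 * (1 - q ^ n)"
        using Suc by (simp add: distrib_right)
      also have "\<dots> = q ^ m * N1 * (1 - q ^ Suc n)" by (simp add: power_add algebra_simps)
      finally show ?case .
    qed
    also have "\<dots> \<le> q ^ m * N1" using N1 q by (simp add: mult_left_le)
    finally show ?thesis using q(2) by (simp add: pos_le_divide_eq)
  qed
  have sym: "N (\<lambda>x. u x - w x) = N (\<lambda>x. w x - u x)" if "u \<in> X" "w \<in> X" for u w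
    using psd_expand[OF a X dX[OF that] dX[OF that], of "-1" 0] unfolding N_def by simp
  have small: "(\<lambda>m. q ^ m * N1 / (1 - q)) \<longlonglongrightarrow> 0"
    using LIMSEQ_power_zero[of q] q by (intro tendsto_divide_zero tendsto_mult_left_zero) simp
  have "\<exists>u\<in>X. (\<lambda>m. sqrt (a (\<lambda>x. U m x - u x) (\<lambda>x. U m x - u x))) \<longlonglongrightarrow> 0"
  proof (rule psd_complete[OF I X a, where D = D])
    show "lin_on X (D i)" if "i \<in> I" for i using Dl[OF that] .
    show "a v v = 0" if "v \<in> X" "\<And>i. i \<in> I \<Longrightarrow> D i v = 0" for v using that by (rule Dn)
    show "U m \<in> X" for m by (rule U)
    fix e :: real assume e: "0 < e"
    obtain M where M: "\<And>m. m \<ge> M \<Longrightarrow> q ^ m * N1 / (1 - q) < e"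
      using order_tendstoD(2)[OF small e] unfolding eventually_sequentially by blast
    have "N (\<lambda>x. U m x - U p x) < e" if "m \<ge> M" "p \<ge> M" for m p
    proof (cases "m \<le> p")
      case True
      then show ?thesis using far[of m "p - m"] M[OF that(1)] sym[OF U U, of m p] by simp
    next
      case False
      then show ?thesis using far[of p "m - p"] M[OF that(2)] by simp
    qed
    then show "\<exists>M. \<forall>m\<ge>M. \<forall>p\<ge>M. sqrt (a (\<lambda>x. U m x - U p x) (\<lambda>x. U m x - U p x)) < e"
      unfolding N_def by blast
  qed
  then obtain u where u: "u \<in> X" and lim: "(\<lambda>m. N (\<lambda>x. U m x - u x)) \<longlonglongrightarrow> 0" unfolding N_def by blast
  \<comment> \<open>The sequence \<open>a (U (Suc m)) v = G (U m) v\<close> has two limits: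
    \<open>a u v\<close> by continuity of the form, \<open>G u v\<close> by the Lipschitz
    condition.\<close>
  have sol: "a u v = G u v" if v: "v \<in> X" for v
  proof -
    have le1: "\<bar>a (U (Suc m)) v - a u v\<bar> \<le> N (\<lambda>x. U (Suc m) x - u x) * N v" for m
      using psd_abs_le[OF a X dX[OF U[of "Suc m"] u] v] lin_onD(3)[OF psd_onD(1)[OF a v] U[of "Suc m"] u] unfolding N_def by simp
    have le2: "\<bar>a (U (Suc m)) v - G u v\<bar> \<le> q * N (\<lambda>x. U m x - u x) * N v" for m
      using Lip[OF U[of m] u v] unfolding USuc Sa[OF U v] N_def .
    have "(\<lambda>m. N (\<lambda>x. U (Suc m) x - u x) * N v) \<longlonglongrightarrow> 0"
      by (rule tendsto_mult_left_zero[OF LIMSEQ_Suc[OF lim]])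
    from Lim_null_comparison[OF _ this, of "\<lambda>m. a (U (Suc m)) v - a u v"] le1
    have "(\<lambda>m. a (U (Suc m)) v - a u v) \<longlonglongrightarrow> 0" by simp
    then have 1: "(\<lambda>m. a (U (Suc m)) v) \<longlonglongrightarrow> a u v" by (simp add: LIM_zero_iff)
    have "(\<lambda>m. q * N (\<lambda>x. U m x - u x) * N v) \<longlonglongrightarrow> 0"
      by (rule tendsto_mult_left_zero[OF tendsto_mult_right_zero[OF lim]])
    from Lim_null_comparison[OF _ this, of "\<lambda>m. a (U (Suc m)) v - G u v"] le2
    have "(\<lambda>m. a (U (Suc m)) v - G u v) \<longlonglongrightarrow> 0" by simp
    then have 2: "(\<lambda>m. a (U (Suc m)) v) \<longlonglongrightarrow> G u v" by (simp add: LIM_zero_iff)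
    show ?thesis by (rule LIMSEQ_unique[OF 1 2])
  qed
  have uniq: "a (\<lambda>x. w x - u x) (\<lambda>x. w x - u x) = 0" if w: "w \<in> X" and wsol: "\<forall>v\<in>X. a w v = G w v" for w
  proof -
    let ?v = "\<lambda>x. w x - u x"
    have v: "?v \<in> X" by (rule dX[OF w u])
    have "a ?v ?v = a w ?v - a u ?v" by (rule lin_onD(3)[OF psd_onD(1)[OF a v] w u])
    also have "\<dots> = G w ?v - G u ?v" by (simp only: wsol[rule_format, OF v] sol[OF v])
    also have "\<dots> \<le> q * N ?v * N ?v" using Lip[OF w u v] unfolding N_def by linarith
    finally have "a ?v ?v \<le> q * a ?v ?v" unfolding Np(2)[OF v] by (simp only: mult.assoc)
    then have "(1 - q) * a ?v ?v \<le> 0" by (simp add: algebra_simps)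
    then have "a ?v ?v \<le> 0" using q(2) by (simp add: mult_le_0_iff)
    then show ?thesis using psd_onD(3)[OF a v] by simp
  qed
  show ?thesis using u sol uniq by blast
qed

section \<open>The global space and forms on a mesh\<close>

locale vem_mesh =
  fixes \<Omega> :: "pt set" and T :: "polygon set" and b :: bc and k :: nat and d :: dof_degrees and V :: "polygon \<Rightarrow> fld set"
  assumes Om: "polygonal_domain \<Omega>" and T: "decomposition \<Omega> T" and k2: "2 \<le> k"
    and loc: "\<And>K. K \<in> T \<Longrightarrow> local_space k d K (V K)"
begin

abbreviation Vh where "Vh \<equiv> vem_space \<Omega> T b k V"

lemma cell: "K \<in> T \<Longrightarrow> vem_cell k d K (V K) (cell K)"
  by unfold_locales (use decompositionD(2)[OF T] good_edge_cell[OF T] loc k2 in auto)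

lemma Omega_sets: "\<Omega> \<in> sets lebesgue"
  using Om unfolding polygonal_domain_def by simp

lemma cell_sets: "cell K \<in> sets lebesgue"
  using cell_open by simp

text \<open>The closed cells cover \<open>closure \<Omega>\<close> only. An open cell lies in its
  interior, which is \<Omega> again because the domain has no slits.\<close>

lemma cell_subset: assumes "K \<in> T" shows "cell K \<subseteq> \<Omega>"
proof -
  have "closure (cell K) \<subseteq> closure \<Omega>" using decompositionD(4)[OF T] assms by blast
  then have "cell K \<subseteq> interior (closure \<Omega>)"
    using closure_subset[of "cell K"] by (intro interior_maximal[OF _ cell_open]) auto
  then show ?thesis using Om unfolding polygonal_domain_def by simp
qed

lemma ip_indicator:
  fixes v w :: fld
  assumes "D \<in> sets lebesgue" shows "ip D v w = (LINT x|lebesgue. indicator D x * (v x * w x))"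
  unfolding ip_real using assms by (simp add: integral_restrict_space)

lemma L2_indicator:
  fixes v :: fld
  assumes "v \<in> L2 D" "D \<in> sets lebesgue" shows "integrable lebesgue (\<lambda>x. indicator D x * (v x * v x))"
proof -
  have "integrable (lebesgue_on D) (\<lambda>x. v x * v x)" using sqint_mult_integrable assms(1) unfolding L2_eq_sqint by blast
  then show ?thesis using assms(2) by (simp add: integrable_restrict_space)
qed

lemma L2_cell:
  assumes K: "K \<in> T" and v: "v \<in> L2 \<Omega>" shows "v \<in> L2 (cell K)"
proof -
  have m: "v \<in> borel_measurable (lebesgue_on (cell K))"
    by (rule measurable_restrict_mono[OF L2_measurable[OF v] cell_subset[OF K]])
  have "integrable lebesgue (\<lambda>x. indicator (cell K) x *\<^sub>R (indicator \<Omega> x * (v x * v x)))"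
    by (rule integrable_mult_indicator[OF cell_sets L2_indicator[OF v Omega_sets]])
  moreover have "(\<lambda>x. indicator (cell K) x *\<^sub>R (indicator \<Omega> x * (v x * v x))) = (\<lambda>x. indicator (cell K) x *\<^sub>R (v x)\<^sup>2)"
    using cell_subset[OF K] by (intro ext) (auto simp: indicator_def power2_eq_square)
  ultimately have "integrable (lebesgue_on (cell K)) (\<lambda>x. (v x)\<^sup>2)"
    using cell_sets by (simp add: integrable_restrict_space)
  then show ?thesis using m unfolding L2_def by simp
qed

text \<open>The indicators of the disjoint cells add up to at most that of \<Omega>; this is the
  direction in which cellwise estimates become global ones.\<close>

lemma sum_cells_le:
  assumes v: "v \<in> L2 \<Omega>" shows "(\<Sum>K\<in>T. ip (cell K) v v) \<le> ip \<Omega> v v"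
proof -
  have fin: "finite T" by (rule decompositionD(1)[OF T])
  have int: "integrable lebesgue (\<lambda>x. indicator (cell K) x * (v x * v x))" if "K \<in> T" for K
    by (rule L2_indicator[OF L2_cell[OF that v] cell_sets])
  have "(\<Sum>K\<in>T. ip (cell K) v v) = (LINT x|lebesgue. (\<Sum>K\<in>T. indicator (cell K) x * (v x * v x)))"
    unfolding ip_indicator[OF cell_sets] by (rule Bochner_Integration.integral_sum[symmetric]) (rule int)
  also have "\<dots> \<le> (LINT x|lebesgue. indicator \<Omega> x * (v x * v x))"
  proof (rule integral_mono)
    show "integrable lebesgue (\<lambda>x. \<Sum>K\<in>T. indicator (cell K) x * (v x * v x))" using int by simp
    show "integrable lebesgue (\<lambda>x. indicator \<Omega> x * (v x * v x))" by (rule L2_indicator[OF v Omega_sets])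
    fix x
    show "(\<Sum>K\<in>T. indicator (cell K) x * (v x * v x)) \<le> indicator \<Omega> x * (v x * v x)"
    proof (cases "\<exists>K\<in>T. x \<in> cell K")
      case True
      then obtain K0 where K0: "K0 \<in> T" "x \<in> cell K0" by blast
      have "indicator (cell K) x = (if K = K0 then 1 else 0 :: real)" if "K \<in> T" for K
        using decompositionD(3)[OF T that K0(1)] K0(2) by (auto simp: indicator_def)
      then have "(\<Sum>K\<in>T. indicator (cell K) x * (v x * v x)) = (\<Sum>K\<in>T. if K = K0 then v x * v x else 0)"
        by (intro sum.cong) auto
      also have "\<dots> = v x * v x" using fin K0(1) by simp
      finally show ?thesis using cell_subset[OF K0(1)] K0(2) by (auto simp: indicator_def)
    next
      case False
      then have "(\<Sum>K\<in>T. indicator (cell K) x * (v x * v x)) = 0" by (intro sum.neutral) (auto simp: indicator_def)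
      then show ?thesis by simp
    qed
  qed
  finally show ?thesis unfolding ip_indicator[OF Omega_sets] .
qed

lemma Vh_V: "v \<in> Vh \<Longrightarrow> K \<in> T \<Longrightarrow> v \<in> V K"
  unfolding vem_space_def by simp

lemma Vh_L2: "v \<in> Vh \<Longrightarrow> v \<in> L2 \<Omega>"
  unfolding vem_space_def H2nc_def H0_space_def by simp

text \<open>The broken space, without conditions between cells or at the boundary. Its linearity is
  immediate, and it is the common domain on which those conditions become linear
  functionals.\<close>

definition VT :: "fld set" where "VT = {v \<in> L2 \<Omega>. \<forall>K\<in>T. v \<in> V K}"

lemma lin_space_VT: "lin_space VT"
  unfolding lin_space_def
proof (intro conjI ballI allI)
  have "(\<lambda>x. 0) \<in> VT"
    unfolding VT_def using lin_space_zero[OF lin_space_L2] lin_space_zero[OF vem_cell.V_lin[OF cell]] by simp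
  then show "VT \<noteq> {}" by blast
  fix v w a c assume "v \<in> VT" "w \<in> VT"
  then show "(\<lambda>x. a * v x + c * w x) \<in> VT"
    unfolding VT_def using lin_spaceD(1)[OF lin_space_L2] lin_spaceD(1)[OF vem_cell.V_lin[OF cell]] by simp
qed

lemma VT_sobolev: "v \<in> VT \<Longrightarrow> K \<in> T \<Longrightarrow> v \<in> sobolev 2 (cell K)"
  using vem_cell.V_sobolev[OF cell] unfolding VT_def by blast

lemma pval_lin:
  assumes "K \<in> T" "z \<in> set K" shows "lin_on VT (pval (cell K) z)"
proof -
  have "Vertex z \<in> dof_set d K" unfolding dof_set_def using assms(2) by blast
  from vem_cell.dof_lin[OF cell[OF assms(1)] this] have "lin_on (V K) (dof K (Vertex z))" .
  moreover have "dof K (Vertex z) = pval (cell K) z" by (intro ext) simp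
  moreover have "VT \<subseteq> V K" using assms(1) unfolding VT_def by blast
  ultimately show ?thesis using lin_on_subset by metis
qed

text \<open>The cells chosen in \<open>jump\<close> depend on the edge and not on \<open>v\<close>,
  so the jump is a fixed difference of two one-sided traces. \<open>tr\<close> is kept abstract to
  cover traces and normal derivatives alike.\<close>

lemma jump_lin:
  assumes e: "e \<in> all_edges T" and \<phi>: "\<phi> \<in> L2_edge e"
    and L2: "\<And>K v. K \<in> T \<Longrightarrow> v \<in> VT \<Longrightarrow> accessible (cell K) e \<Longrightarrow> tr v K e \<in> L2_edge e"
    and lin: "\<And>K. K \<in> T \<Longrightarrow> good_edge (cell K) e \<Longrightarrow> lin_on VT (\<lambda>v. edge_int e (\<lambda>x. tr v K e x * \<phi> x))"
  shows "lin_on VT (\<lambda>v. edge_int e (\<lambda>x. jump T (tr v) e x * \<phi> x))"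
proof -
  define K where "K = (SOME K. K \<in> T \<and> has_edge K e)"
  have "\<exists>K. K \<in> T \<and> has_edge K e" using e unfolding all_edges_def has_edge_def by blast
  from someI_ex[OF this] have K: "K \<in> T" "has_edge K e" unfolding K_def by auto
  have gK: "good_edge (cell K) e" by (rule good_edge_cell[OF T K])
  show ?thesis
  proof (cases "\<exists>K'\<in>T. K' \<noteq> K \<and> has_edge K' e")
    case False
    have "jump T (tr v) e = tr v K e" for v
      unfolding jump_def Let_def K_def[symmetric] by (rule if_not_P[OF False])
    then show ?thesis using lin[OF K(1) gK] by simp
  next
    case True
    define K' where "K' = (SOME K'. K' \<in> T \<and> K' \<noteq> K \<and> has_edge K' e)"
    have "\<exists>K'. K' \<in> T \<and> K' \<noteq> K \<and> has_edge K' e" using True by blast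
    from someI_ex[OF this] have K': "K' \<in> T" "has_edge K' e" unfolding K'_def by auto
    have gK': "good_edge (cell K') e" by (rule good_edge_cell[OF T K'])
    have j: "jump T (tr v) e = (\<lambda>x. tr v K e x - tr v K' e x)" for v
      unfolding jump_def Let_def K_def[symmetric] K'_def[symmetric] using True by simp
    have "edge_int e (\<lambda>x. (tr v K e x - tr v K' e x) * \<phi> x)
        = 1 * edge_int e (\<lambda>x. tr v K e x * \<phi> x) + (-1) * edge_int e (\<lambda>x. tr v K' e x * \<phi> x)" if v: "v \<in> VT" for v
    proof (cases "edge_len e = 0")
      case True then show ?thesis by (simp add: edge_int_degenerate)
    next
      case False
      then have "accessible (cell K) e" "accessible (cell K') e" using gK gK' unfolding good_edge_def by auto
      then have "tr v K e \<in> L2_edge e" "tr v K' e \<in> L2_edge e" using L2 v K K' by auto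
      from lin_onD(3)[OF psd_onD(1)[OF psd_edge \<phi>] this] show ?thesis by simp
    qed
    then show ?thesis unfolding j
      by (intro lin_on_cong[OF lin_space_VT lin_on_comb[OF lin[OF K(1) gK] lin[OF K'(1) gK']]])
  qed
qed

lemma trace_jump_lin:
  assumes e: "e \<in> all_edges T" and \<phi>: "\<phi> \<in> polys l"
  shows "lin_on VT (\<lambda>v. edge_int e (\<lambda>x. jump T (\<lambda>K e. edge_trace (cell K) e v) e x * \<phi> x))"
proof (rule jump_lin[OF e, where tr = "\<lambda>v K e. edge_trace (cell K) e v"])
  show \<phi>L: "\<phi> \<in> L2_edge e" by (rule continuous_L2_edge[OF polys_continuous[OF \<phi>]])
  show "edge_trace (cell K) e v \<in> L2_edge e" if "K \<in> T" "v \<in> VT" "accessible (cell K) e" for K v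
    by (rule edge_trace_L2_edge[OF that(3) cell_open subsetD[OF sobolev_mono VT_sobolev[OF that(2,1)]]]) simp
  show "lin_on VT (\<lambda>v. edge_int e (\<lambda>x. edge_trace (cell K) e v x * \<phi> x))" if "K \<in> T" "good_edge (cell K) e" for K
    by (rule lin_on_subset[OF trace_lin[OF that(2) cell_open \<phi>L]]) (use VT_sobolev that in blast)
qed

lemma ntrace_jump_lin:
  assumes e: "e \<in> all_edges T" and \<phi>: "\<phi> \<in> polys l"
  shows "lin_on VT (\<lambda>v. edge_int e (\<lambda>x. jump T (\<lambda>K e. ntrace (cell K) e v) e x * \<phi> x))"
proof (rule jump_lin[OF e, where tr = "\<lambda>v K e. ntrace (cell K) e v"])
  show \<phi>L: "\<phi> \<in> L2_edge e" by (rule continuous_L2_edge[OF polys_continuous[OF \<phi>]])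
  show "ntrace (cell K) e v \<in> L2_edge e" if K: "K \<in> T" "v \<in> VT" "accessible (cell K) e" for K v
  proof -
    have s: "pd (cell K) 1 0 v \<in> sobolev 1 (cell K)" "pd (cell K) 0 1 v \<in> sobolev 1 (cell K)"
      using pd_sobolev[OF cell_open VT_sobolev[OF K(2,1)], of 1 1 0] pd_sobolev[OF cell_open VT_sobolev[OF K(2,1)], of 1 0 1]
      by simp_all
    show ?thesis unfolding ntrace_def[abs_def]
      by (rule lin_spaceD(1)[OF lin_space_L2_edge edge_trace_L2_edge[OF K(3) cell_open s(1)] edge_trace_L2_edge[OF K(3) cell_open s(2)]])
  qed
  show "lin_on VT (\<lambda>v. edge_int e (\<lambda>x. ntrace (cell K) e v x * \<phi> x))" if "K \<in> T" "good_edge (cell K) e" for K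
    by (rule lin_on_subset[OF ntrace_lin[OF that(2) cell_open \<phi>L]]) (use VT_sobolev that in blast)
qed

lemma int_edges_all: "int_edges \<Omega> T \<subseteq> all_edges T" unfolding int_edges_def by blast

text \<open>The conditions that cut the discrete space out of \<open>VT\<close>, collected as
  functionals; the boundary condition only decides over which vertices and edges they range.
  Linearity of the space reduces to linearity of each member.\<close>

definition constraints :: "(fld \<Rightarrow> real) set" where
  "constraints =
     {\<lambda>v. pval (cell K) z v - pval (cell K') z v | z K K'.
        z \<in> (if b = CH then mesh_verts T else mesh_verts T \<inter> \<Omega>) \<and> K \<in> T \<and> K' \<in> T \<and> z \<in> set K \<and> z \<in> set K'} \<union>
     {pval (cell K) z | z K. b \<noteq> CH \<and> z \<in> mesh_verts T \<inter> frontier \<Omega> \<and> K \<in> T \<and> z \<in> set K} \<union>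
     {\<lambda>v. edge_int e (\<lambda>x. jump T (\<lambda>K e. edge_trace (cell K) e v) e x * p x) | e p.
        e \<in> (if b = CH then int_edges \<Omega> T else all_edges T) \<and> p \<in> polys (int k - 3)} \<union>
     {\<lambda>v. edge_int e (\<lambda>x. jump T (\<lambda>K e. ntrace (cell K) e v) e x * q x) | e q.
        e \<in> (if b = NC then int_edges \<Omega> T else all_edges T) \<and> q \<in> polys (int k - 2)}"

lemma constraints_lin: assumes "\<phi> \<in> constraints" shows "lin_on VT \<phi>"
proof -
  have d: "lin_on VT (\<lambda>v. pval (cell K) z v - pval (cell K') z v)"
    if "K \<in> T" "K' \<in> T" "z \<in> set K" "z \<in> set K'" for z K K'
    using lin_on_comb[OF pval_lin[OF that(1,3)] pval_lin[OF that(2,4)], of 1 "-1"] by simp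
  from assms consider
    (1) z K K' where "\<phi> = (\<lambda>v. pval (cell K) z v - pval (cell K') z v)" "K \<in> T" "K' \<in> T" "z \<in> set K" "z \<in> set K'"
    | (2) z K where "\<phi> = pval (cell K) z" "K \<in> T" "z \<in> set K"
    | (3) e p where "\<phi> = (\<lambda>v. edge_int e (\<lambda>x. jump T (\<lambda>K e. edge_trace (cell K) e v) e x * p x))"
        "e \<in> (if b = CH then int_edges \<Omega> T else all_edges T)" "p \<in> polys (int k - 3)"
    | (4) e p where "\<phi> = (\<lambda>v. edge_int e (\<lambda>x. jump T (\<lambda>K e. ntrace (cell K) e v) e x * p x))"
        "e \<in> (if b = NC then int_edges \<Omega> T else all_edges T)" "p \<in> polys (int k - 2)"
    unfolding constraints_def by blast
  then show ?thesis
  proof cases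
    case 1 then show ?thesis using d by simp
  next
    case 2 then show ?thesis using pval_lin by simp
  next
    case 3
    then have "e \<in> all_edges T" using int_edges_all by (auto split: if_splits)
    then show ?thesis unfolding 3(1) by (rule trace_jump_lin[OF _ 3(3)])
  next
    case 4
    then have "e \<in> all_edges T" using int_edges_all by (auto split: if_splits)
    then show ?thesis unfolding 4(1) by (rule ntrace_jump_lin[OF _ 4(3)])
  qed
qed

lemma Vh_eq: "Vh = {v \<in> VT. \<forall>\<phi>\<in>constraints. \<phi> v = 0}"
proof (intro set_eqI iffI)
  fix v assume v: "v \<in> Vh"
  then have "v \<in> VT" using Vh_L2 Vh_V unfolding VT_def by blast
  moreover have "\<phi> v = 0" if "\<phi> \<in> constraints" for \<phi>
  proof -
    have H2: "v \<in> H2nc \<Omega> T b k" using v unfolding vem_space_def by blast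
    have H0: "v \<in> H0_space \<Omega> T b" using H2 unfolding H2nc_def by blast
    note h2 = H2[unfolded H2nc_def mem_Collect_eq] and h0 = H0[unfolded H0_space_def mem_Collect_eq]
    note p1 = h0[THEN conjunct2, THEN conjunct2, THEN conjunct1]
      and p2 = h0[THEN conjunct2, THEN conjunct2, THEN conjunct2, THEN mp]
      and p3 = h2[THEN conjunct2, THEN conjunct1] and p4 = h2[THEN conjunct2, THEN conjunct2]
    from that consider
      (1) z K K' where "\<phi> = (\<lambda>v. pval (cell K) z v - pval (cell K') z v)"
          "z \<in> (if b = CH then mesh_verts T else mesh_verts T \<inter> \<Omega>)" "K \<in> T" "K' \<in> T" "z \<in> set K" "z \<in> set K'"
      | (2) z K where "\<phi> = pval (cell K) z" "b \<noteq> CH" "z \<in> mesh_verts T \<inter> frontier \<Omega>" "K \<in> T" "z \<in> set K"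
      | (3) e p where "\<phi> = (\<lambda>v. edge_int e (\<lambda>x. jump T (\<lambda>K e. edge_trace (cell K) e v) e x * p x))"
          "e \<in> (if b = CH then int_edges \<Omega> T else all_edges T)" "p \<in> polys (int k - 3)"
      | (4) e p where "\<phi> = (\<lambda>v. edge_int e (\<lambda>x. jump T (\<lambda>K e. ntrace (cell K) e v) e x * p x))"
          "e \<in> (if b = NC then int_edges \<Omega> T else all_edges T)" "p \<in> polys (int k - 2)"
      unfolding constraints_def by blast
    then show ?thesis
    proof cases
      case 1
      from p1[THEN bspec, OF 1(2), THEN bspec, OF 1(3), THEN bspec, OF 1(4)] 1(5,6) show ?thesis unfolding 1(1) by simp
    next
      case 2
      from p2[OF 2(2), THEN bspec, OF 2(3), THEN bspec, OF 2(4)] 2(5) show ?thesis unfolding 2(1) by simp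
    next
      case 3
      from p3[THEN bspec, OF 3(2), THEN bspec, OF 3(3)] show ?thesis unfolding 3(1) .
    next
      case 4
      from p4[THEN bspec, OF 4(2), THEN bspec, OF 4(3)] show ?thesis unfolding 4(1) .
    qed
  qed
  ultimately show "v \<in> {v \<in> VT. \<forall>\<phi>\<in>constraints. \<phi> v = 0}" by blast
next
  fix v assume "v \<in> {v \<in> VT. \<forall>\<phi>\<in>constraints. \<phi> v = 0}"
  then have v: "v \<in> VT" and c: "\<And>\<phi>. \<phi> \<in> constraints \<Longrightarrow> \<phi> v = 0" by auto
  have "pval (cell K) z v = pval (cell K') z v"
    if "z \<in> (if b = CH then mesh_verts T else mesh_verts T \<inter> \<Omega>)" "K \<in> T" "K' \<in> T" "z \<in> set K" "z \<in> set K'" for z K K'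
  proof -
    have "(\<lambda>v. pval (cell K) z v - pval (cell K') z v) \<in> constraints" unfolding constraints_def using that by blast
    from c[OF this] show ?thesis by simp
  qed
  moreover have "pval (cell K) z v = 0" if "b \<noteq> CH" "z \<in> mesh_verts T \<inter> frontier \<Omega>" "K \<in> T" "z \<in> set K" for z K
  proof -
    have "pval (cell K) z \<in> constraints" unfolding constraints_def using that by blast
    from c[OF this] show ?thesis .
  qed
  moreover have "edge_int e (\<lambda>x. jump T (\<lambda>K e. edge_trace (cell K) e v) e x * p x) = 0"
    if "e \<in> (if b = CH then int_edges \<Omega> T else all_edges T)" "p \<in> polys (int k - 3)" for e p
  proof -
    have "(\<lambda>v. edge_int e (\<lambda>x. jump T (\<lambda>K e. edge_trace (cell K) e v) e x * p x)) \<in> constraints"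
      unfolding constraints_def using that by blast
    from c[OF this] show ?thesis .
  qed
  moreover have "edge_int e (\<lambda>x. jump T (\<lambda>K e. ntrace (cell K) e v) e x * p x) = 0"
    if "e \<in> (if b = NC then int_edges \<Omega> T else all_edges T)" "p \<in> polys (int k - 2)" for e p
  proof -
    have "(\<lambda>v. edge_int e (\<lambda>x. jump T (\<lambda>K e. ntrace (cell K) e v) e x * p x)) \<in> constraints"
      unfolding constraints_def using that by blast
    from c[OF this] show ?thesis .
  qed
  ultimately show "v \<in> Vh"
    using v VT_sobolev[OF v] unfolding VT_def vem_space_def H2nc_def H0_space_def by blast
qed

lemma Vh_lin: "lin_space Vh"
  unfolding lin_space_def
proof (intro conjI ballI allI)
  have "(\<lambda>x. 0) \<in> Vh"
    unfolding Vh_eq using lin_space_zero[OF lin_space_VT] lin_on_zero[OF constraints_lin lin_space_VT] by blast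
  then show "Vh \<noteq> {}" by blast
  fix v w a c assume "v \<in> Vh" "w \<in> Vh"
  then have v: "v \<in> VT" "\<forall>\<phi>\<in>constraints. \<phi> v = 0" and w: "w \<in> VT" "\<forall>\<phi>\<in>constraints. \<phi> w = 0"
    unfolding Vh_eq by auto
  have "\<phi> (\<lambda>x. a * v x + c * w x) = 0" if "\<phi> \<in> constraints" for \<phi>
    using lin_onD(1)[OF constraints_lin[OF that] v(1) w(1), of a c] bspec[OF v(2) that] bspec[OF w(2) that] by simp
  then show "(\<lambda>x. a * v x + c * w x) \<in> Vh" unfolding Vh_eq using lin_spaceD(1)[OF lin_space_VT v(1) w(1)] by blast
qed

lemma psd_Mh: "psd_on Vh (Mh k d T)" and psd_Ah: "psd_on Vh (Ah k d T)" and psd_Bh: "psd_on Vh (Bh k d T)"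
proof -
  have s: "Vh \<subseteq> V K" if "K \<in> T" for K using Vh_V that by blast
  have "psd_on Vh (\<lambda>v w. \<Sum>K\<in>T. MK k d K v w)" "psd_on Vh (\<lambda>v w. \<Sum>K\<in>T. AK k d K v w)" "psd_on Vh (\<lambda>v w. \<Sum>K\<in>T. BK k d K v w)"
    using psd_on_sum[of T Vh "MK k d"] psd_on_sum[of T Vh "AK k d"] psd_on_sum[of T Vh "BK k d"]
      psd_on_subset[OF vem_cell.psd_MK[OF cell] s] psd_on_subset[OF vem_cell.psd_AK[OF cell] s]
      psd_on_subset[OF vem_cell.psd_BK[OF cell] s] by blast+
  moreover have "Mh k d T = (\<lambda>v w. \<Sum>K\<in>T. MK k d K v w)" "Ah k d T = (\<lambda>v w. \<Sum>K\<in>T. AK k d K v w)"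
    "Bh k d T = (\<lambda>v w. \<Sum>K\<in>T. BK k d K v w)"
    by (intro ext Mh_def Ah_def Bh_def)+
  ultimately show "psd_on Vh (Mh k d T)" "psd_on Vh (Ah k d T)" "psd_on Vh (Bh k d T)" by simp_all
qed

text \<open>The local estimates are added up by Cauchy-Schwarz for finite sums over the cells, and
  the cellwise norms are bounded by the global ones.\<close>

lemma Fh_Lipschitz:
  fixes f :: "real \<Rightarrow> real"
  assumes f: "\<And>x y. \<bar>f x - f y\<bar> \<le> L * \<bar>x - y\<bar>" and L: "0 \<le> L"
    and v: "v \<in> Vh" and v': "v' \<in> Vh" and w: "w \<in> Vh"
  shows "\<bar>Fh k f T v w - Fh k f T v' w\<bar> \<le> L * L2norm \<Omega> (\<lambda>x. v x - v' x) * L2norm \<Omega> w"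
proof -
  let ?d = "\<lambda>x. v x - v' x"
  have dL: "?d \<in> L2 \<Omega>" and wL: "w \<in> L2 \<Omega>" using Vh_L2 lin_spaceD(3)[OF Vh_lin v v'] w by auto
  have cell_le: "L2_set (\<lambda>K. L2norm (cell K) z) T \<le> L2norm \<Omega> z" if z: "z \<in> L2 \<Omega>" for z
  proof -
    have "(\<Sum>K\<in>T. (L2norm (cell K) z)\<^sup>2) = (\<Sum>K\<in>T. ip (cell K) z z)"
      unfolding L2norm_def by (intro sum.cong) (auto simp: ip_real)
    also have "\<dots> \<le> ip \<Omega> z z" by (rule sum_cells_le[OF z])
    finally show ?thesis unfolding L2_set_def L2norm_def[of \<Omega>] by simp
  qed
  have "\<bar>Fh k f T v w - Fh k f T v' w\<bar> \<le> (\<Sum>K\<in>T. L * (L2norm (cell K) ?d * L2norm (cell K) w))"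
    unfolding Fh_def sum_subtractf[symmetric]
  proof (rule order_trans[OF sum_abs sum_mono])
    fix K assume K: "K \<in> T"
    show "\<bar>ip (cell K) (Pi0 K k (\<lambda>x. f (Pi0 K k v x))) w - ip (cell K) (Pi0 K k (\<lambda>x. f (Pi0 K k v' x))) w\<bar>
        \<le> L * (L2norm (cell K) ?d * L2norm (cell K) w)"
      using vem_cell.Lipschitz_load[OF cell[OF K] f L Vh_V[OF v K] Vh_V[OF v' K] L2_cell[OF K wL]]
      by (simp only: mult.assoc)
  qed
  also have "\<dots> = L * (\<Sum>K\<in>T. \<bar>L2norm (cell K) ?d\<bar> * \<bar>L2norm (cell K) w\<bar>)"
    by (simp add: sum_distrib_left L2norm_nonneg)
  also have "\<dots> \<le> L * (L2norm \<Omega> ?d * L2norm \<Omega> w)"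
  proof (rule mult_left_mono[OF _ L])
    have "(\<Sum>K\<in>T. \<bar>L2norm (cell K) ?d\<bar> * \<bar>L2norm (cell K) w\<bar>)
        \<le> L2_set (\<lambda>K. L2norm (cell K) ?d) T * L2_set (\<lambda>K. L2norm (cell K) w) T" by (rule L2_set_mult_ineq)
    also have "\<dots> \<le> L2norm \<Omega> ?d * L2norm \<Omega> w"
      by (intro mult_mono cell_le dL wL L2norm_nonneg L2_set_nonneg)
    finally show "(\<Sum>K\<in>T. \<bar>L2norm (cell K) ?d\<bar> * \<bar>L2norm (cell K) w\<bar>) \<le> L2norm \<Omega> ?d * L2norm \<Omega> w" .
  qed
  finally show ?thesis by (simp only: mult.assoc)
qed

lemma Fh_lin:
  fixes f :: "real \<Rightarrow> real"
  assumes f: "\<And>x y. \<bar>f x - f y\<bar> \<le> L * \<bar>x - y\<bar>" and L: "0 \<le> L" and u: "u \<in> Vh"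
  shows "lin_on Vh (Fh k f T u)"
proof -
  have "lin_on Vh (ip (cell K) (Pi0 K k (\<lambda>x. f (Pi0 K k u x))))" if K: "K \<in> T" for K
  proof (rule lin_on_subset[OF psd_on_linR[OF psd_ip lin_space_L2]])
    show "Pi0 K k (\<lambda>x. f (Pi0 K k u x)) \<in> L2 (cell K)"
      by (rule vem_cell.load_L2[OF cell[OF K] f L Vh_V[OF u K]])
    show "Vh \<subseteq> L2 (cell K)" using L2_cell[OF K] Vh_L2 by blast
  qed
  from lin_on_sum[of T Vh "\<lambda>K. ip (cell K) (Pi0 K k (\<lambda>x. f (Pi0 K k u x)))", OF this]
  show ?thesis unfolding Fh_def[abs_def] .
qed

text \<open>The right-hand side can be represented by the energy form only if it vanishes on the
  null vectors of that form.\<close>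

lemma Fh_null:
  fixes f :: "real \<Rightarrow> real"
  assumes f: "\<And>x y. \<bar>f x - f y\<bar> \<le> L * \<bar>x - y\<bar>" and L: "0 \<le> L" and u: "u \<in> Vh" and w: "w \<in> Vh"
    and w0: "L2norm \<Omega> w = 0"
  shows "Fh k f T u w = 0"
  unfolding Fh_def
proof (rule sum.neutral, intro ballI)
  fix K assume K: "K \<in> T"
  have wL: "w \<in> L2 \<Omega>" by (rule Vh_L2[OF w])
  have "ip (cell K) w w \<le> (\<Sum>K\<in>T. ip (cell K) w w)"
    by (rule member_le_sum[OF K _ decompositionD(1)[OF T]]) (simp add: ip_real)
  also have "\<dots> \<le> 0" using sum_cells_le[OF wL] w0 unfolding L2norm_def by simp
  finally have "ip (cell K) w w = 0" by (simp add: ip_real antisym)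
  then show "ip (cell K) (Pi0 K k (\<lambda>x. f (Pi0 K k u x))) w = 0"
    using psd_null(2)[OF psd_ip lin_space_L2 L2_cell[OF K wL] vem_cell.load_L2[OF cell[OF K] f L Vh_V[OF u K]]] by blast
qed


section \<open>Solution of one time step\<close>

text \<open>Vanishing degrees of freedom leave a function that is zero almost everywhere, though
  perhaps not everywhere; the upper stability bounds then make all forms vanish on it. This is how
  the degrees of freedom detect the null space of the energy.\<close>

lemma forms_null:
  assumes M: "\<And>K v. K \<in> T \<Longrightarrow> v \<in> V K \<Longrightarrow> MK k d K v v \<le> CM * sqnorm0 K v"
    and A: "\<And>K v. K \<in> T \<Longrightarrow> v \<in> V K \<Longrightarrow> AK k d K v v \<le> CA * sqsemi2 K v"
    and B: "\<And>K v. K \<in> T \<Longrightarrow> v \<in> V K \<Longrightarrow> BK k d K v v \<le> CB * sqsemi1 K v"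
    and v: "v \<in> Vh" and z: "\<And>K i. K \<in> T \<Longrightarrow> i \<in> dof_set d K \<Longrightarrow> dof K i v = 0"
  shows "Mh k d T v v = 0" "Ah k d T v v = 0" "Bh k d T v v = 0"
proof -
  have "MK k d K v v = 0" "AK k d K v v = 0" "BK k d K v v = 0" if K: "K \<in> T" for K
  proof -
    interpret vem_cell k d K "V K" "cell K" by (rule cell[OF K])
    have vK: "v \<in> V K" by (rule Vh_V[OF v K])
    have vs: "v \<in> sobolev 2 (cell K)" using V_sobolev vK by blast
    have ae: "AE x in lebesgue_on (cell K). v x = 0" by (rule dof_null[OF vK z[OF K]])
    have "sqnorm0 K v = 0" unfolding sqnorm0_def using AE_null_L2norm[OF sobolev_L2[OF vs] ae] by simp
    then show "MK k d K v v = 0" using M[OF K vK] psd_onD(3)[OF psd_MK vK] by simp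
    have "sqsemi2 K v = 0" unfolding sqsemi2_def L2norm_def hess_null[OF vs ae] by simp
    then show "AK k d K v v = 0" using A[OF K vK] psd_onD(3)[OF psd_AK vK] by simp
    have "sqsemi1 K v = 0" unfolding sqsemi1_def L2norm_def grad_null[OF vs ae] by simp
    then show "BK k d K v v = 0" using B[OF K vK] psd_onD(3)[OF psd_BK vK] by simp
  qed
  then show "Mh k d T v v = 0" "Ah k d T v v = 0" "Bh k d T v v = 0"
    unfolding Mh_def Ah_def Bh_def by simp_all
qed

text \<open>The two bilinear terms only add to the energy, so coercivity of the mass form alone
  controls the L2 norm, and the condition \<open>L * \<tau> < C\<close> makes the load a
  contraction.\<close>

lemma solve_step:
  fixes f :: "real \<Rightarrow> real"
  assumes al: "0 \<le> \<alpha>1" "0 \<le> \<alpha>2" and L: "0 < L" and f: "\<And>x y. \<bar>f x - f y\<bar> \<le> L * \<bar>x - y\<bar>"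
    and M: "\<And>K v. K \<in> T \<Longrightarrow> v \<in> V K \<Longrightarrow> MK k d K v v \<le> CM * sqnorm0 K v"
    and A: "\<And>K v. K \<in> T \<Longrightarrow> v \<in> V K \<Longrightarrow> AK k d K v v \<le> CA * sqsemi2 K v"
    and B: "\<And>K v. K \<in> T \<Longrightarrow> v \<in> V K \<Longrightarrow> BK k d K v v \<le> CB * sqsemi1 K v"
    and C: "0 < C" and coer: "\<And>v. v \<in> Vh \<Longrightarrow> C * (L2norm \<Omega> v)\<^sup>2 \<le> Mh k d T v v"
    and dt: "0 < \<tau>" "L * \<tau> < C" and up: "up \<in> Vh"
  shows "\<exists>u\<in>Vh. solves_step k d T Vh \<alpha>1 \<alpha>2 \<tau> f up u \<and>
    (\<forall>w\<in>Vh. solves_step k d T Vh \<alpha>1 \<alpha>2 \<tau> f up w \<longrightarrow> (AE x in lebesgue_on \<Omega>. w x = u x))"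
proof -
  define a where "a = (\<lambda>v w. 1 * ((1 / \<tau>) * Mh k d T v w + \<alpha>1 * Ah k d T v w) + \<alpha>2 * Bh k d T v w)"
  have psda: "psd_on Vh a"
    unfolding a_def using dt(1) al by (intro psd_on_comb psd_Mh psd_Ah psd_Bh) simp_all
  have Ma: "(1 / \<tau>) * Mh k d T v v \<le> a v v" if "v \<in> Vh" for v
    unfolding a_def using psd_onD(3)[OF psd_Ah that] psd_onD(3)[OF psd_Bh that] al by simp
  have Na: "(L2norm \<Omega> v)\<^sup>2 \<le> (\<tau> / C) * a v v" if v: "v \<in> Vh" for v
  proof -
    have "C * (L2norm \<Omega> v)\<^sup>2 \<le> \<tau> * a v v"
      using coer[OF v] Ma[OF v] dt(1) by (simp add: field_simps)
    then show ?thesis using C by (simp add: field_simps)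
  qed
  define G where "G = (\<lambda>u v. 1 * Fh k f T u v + (1 / \<tau>) * Mh k d T up v)"
  have step: "solves_step k d T Vh \<alpha>1 \<alpha>2 \<tau> f up u \<longleftrightarrow> (\<forall>v\<in>Vh. a u v = G u v)" if u: "u \<in> Vh" for u
  proof -
    have "Mh k d T (\<lambda>x. (u x - up x) / \<tau>) v = (1 / \<tau>) * Mh k d T u v + (- 1 / \<tau>) * Mh k d T up v" if v: "v \<in> Vh" for v
    proof -
      have "(\<lambda>x. (u x - up x) / \<tau>) = (\<lambda>x. (1 / \<tau>) * u x + (- 1 / \<tau>) * up x)" by (intro ext) (simp add: diff_divide_distrib)
      then show ?thesis using lin_onD(1)[OF psd_onD(1)[OF psd_Mh v] u up, of "1 / \<tau>" "- 1 / \<tau>"] by simp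
    qed
    then show ?thesis unfolding solves_step_def a_def G_def by auto
  qed
  \<comment> \<open>Pairing with the cell keeps apart the one-sided degrees of freedom of
    neighbouring cells at a common vertex or edge.\<close>
  define I where "I = Sigma T (dof_set d)"
  define q where "q = L * \<tau> / C"
  have q: "0 \<le> q" "q < 1" unfolding q_def using L dt C by simp_all
  have null: "Mh k d T v v = 0" "L2norm \<Omega> v = 0" if v: "v \<in> Vh" and z: "a v v = 0" for v
  proof -
    have "(1 / \<tau>) * Mh k d T v v \<le> 0" using Ma[OF v] z by simp
    then show "Mh k d T v v = 0" using psd_onD(3)[OF psd_Mh v] dt(1) by (simp add: field_simps)
    show "L2norm \<Omega> v = 0" using Na[OF v] z by simp
  qed
  have "\<exists>u\<in>Vh. (\<forall>v\<in>Vh. a u v = G u v) \<and>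
    (\<forall>w\<in>Vh. (\<forall>v\<in>Vh. a w v = G w v) \<longrightarrow> a (\<lambda>x. w x - u x) (\<lambda>x. w x - u x) = 0)"
  proof (rule contraction_solvable[where I = I and D = "\<lambda>(K, i). dof K i" and q = q])
    show "finite I" unfolding I_def using decompositionD(1)[OF T] finite_dof_set by (intro finite_SigmaI) auto
    show "lin_space Vh" by (rule Vh_lin)
    show "psd_on Vh a" by (rule psda)
    show "lin_on Vh (case i of (K, i) \<Rightarrow> dof K i)" if "i \<in> I" for i
    proof -
      obtain K j where i: "i = (K, j)" "K \<in> T" "j \<in> dof_set d K" using \<open>i \<in> I\<close> unfolding I_def by blast
      have "Vh \<subseteq> V K" using Vh_V[OF _ i(2)] by blast
      from lin_on_subset[OF vem_cell.dof_lin[OF cell[OF i(2)] i(3)] this] show ?thesis unfolding i(1) by simp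
    qed
    show "a v v = 0" if v: "v \<in> Vh" and z: "\<And>i. i \<in> I \<Longrightarrow> (case i of (K, i) \<Rightarrow> dof K i) v = 0" for v
    proof -
      have "dof K i v = 0" if "K \<in> T" "i \<in> dof_set d K" for K i using z[of "(K, i)"] that unfolding I_def by simp
      from forms_null[OF M A B v this] show ?thesis unfolding a_def by simp
    qed
    show "lin_on Vh (G u)" if u: "u \<in> Vh" for u
      unfolding G_def by (intro lin_on_comb Fh_lin[OF f _ u] psd_on_linR[OF psd_Mh Vh_lin up]) (use L in simp)
    show "G u v = 0" if u: "u \<in> Vh" and v: "v \<in> Vh" and z: "a v v = 0" for u v
    proof -
      have "Fh k f T u v = 0" by (rule Fh_null[OF f _ u v null(2)[OF v z]]) (use L in simp)
      moreover have "Mh k d T up v = 0" using psd_null(2)[OF psd_Mh Vh_lin v up] null(1)[OF v z] by blast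
      ultimately show ?thesis unfolding G_def by simp
    qed
    show "0 \<le> q" "q < 1" by (rule q)+
    fix u w v assume uwv: "u \<in> Vh" "w \<in> Vh" "v \<in> Vh"
    let ?d = "\<lambda>x. u x - w x"
    have d: "?d \<in> Vh" by (rule lin_spaceD(3)[OF Vh_lin uwv(1,2)])
    have n: "L2norm \<Omega> z \<le> sqrt (\<tau> / C) * sqrt (a z z)" if z: "z \<in> Vh" for z
      using real_sqrt_le_mono[OF Na[OF z]] unfolding real_sqrt_mult[of "\<tau> / C"] real_sqrt_abs
      by (simp only: abs_of_nonneg[OF L2norm_nonneg])
    have "\<bar>G u v - G w v\<bar> = \<bar>Fh k f T u v - Fh k f T w v\<bar>" unfolding G_def by simp
    also have "\<dots> \<le> L * (L2norm \<Omega> ?d * L2norm \<Omega> v)"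
      using Fh_Lipschitz[OF f _ uwv] L by (simp add: mult.assoc)
    \<comment> \<open>Each of the two L2 norms costs one factor \<open>sqrt (\<tau> / C)\<close>;
      together with \<open>L\<close> these make up \<open>q\<close>.\<close>
    also have "\<dots> \<le> L * ((sqrt (\<tau> / C) * sqrt (a ?d ?d)) * (sqrt (\<tau> / C) * sqrt (a v v)))"
      using L dt(1) C psd_onD(3)[OF psda d]
      by (intro mult_left_mono mult_mono n d uwv(3) L2norm_nonneg) simp_all
    also have "\<dots> = (L * (sqrt (\<tau> / C) * sqrt (\<tau> / C))) * sqrt (a ?d ?d) * sqrt (a v v)" by (simp only: ac_simps)
    also have "L * (sqrt (\<tau> / C) * sqrt (\<tau> / C)) = q" unfolding q_def using dt(1) C by simp
    finally show "\<bar>G u v - G w v\<bar> \<le> q * sqrt (a ?d ?d) * sqrt (a v v)" .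
  qed
  then obtain u where u: "u \<in> Vh" "\<forall>v\<in>Vh. a u v = G u v"
    and uniq: "\<And>w. w \<in> Vh \<Longrightarrow> \<forall>v\<in>Vh. a w v = G w v \<Longrightarrow> a (\<lambda>x. w x - u x) (\<lambda>x. w x - u x) = 0" by blast
  have "AE x in lebesgue_on \<Omega>. w x = u x" if w: "w \<in> Vh" and s: "solves_step k d T Vh \<alpha>1 \<alpha>2 \<tau> f up w" for w
  proof -
    have d: "(\<lambda>x. w x - u x) \<in> Vh" by (rule lin_spaceD(3)[OF Vh_lin w u(1)])
    have "\<forall>v\<in>Vh. a w v = G w v" using s unfolding step[OF w] .
    from L2norm_null[OF Vh_L2[OF d] null(2)[OF d uniq[OF w this]]]
    have "AE x in lebesgue_on \<Omega>. w x - u x = 0" .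
    then show ?thesis by (rule eventually_mono) simp
  qed
  moreover have "solves_step k d T Vh \<alpha>1 \<alpha>2 \<tau> f up u" unfolding step[OF u(1)] by (rule u(2))
  ultimately show ?thesis using u(1) by blast
qed

end

text \<open>Elements of the space are functions standing for classes, so uniqueness is equality
  almost everywhere.\<close>

theorem theorem3p1:
  fixes \<Omega> :: "pt set" and b :: bc and \<alpha>1 \<alpha>2 L\<^sub>f :: real and f :: "real \<Rightarrow> real"
    and H :: "real set" and \<T> :: "real \<Rightarrow> polygon set"
    and k :: nat and d :: dof_degrees and V :: "real \<Rightarrow> polygon \<Rightarrow> fld set"
    and C_low C_up M_hat :: real
    and T_end \<Delta>t h :: real and N n :: nat and u :: "nat \<Rightarrow> fld"
  assumes "polygonal_domain \<Omega>"
    and "\<alpha>1 > 0" and "\<alpha>2 > 0"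
    and "L\<^sub>f > 0" and "\<And>x y. \<bar>f x - f y\<bar> \<le> L\<^sub>f * \<bar>x - y\<bar>"
    and "\<And>h. h \<in> H \<Longrightarrow> decomposition \<Omega> (\<T> h) \<and> h = mesh_size (\<T> h)"
    and "k \<ge> 2"
    and "deg_edge0 d \<ge> int k - 3" and "deg_edge1 d \<ge> int k - 3" and "deg_cell d \<ge> int k - 4"
    and "\<And>h K. h \<in> H \<Longrightarrow> K \<in> \<T> h \<Longrightarrow> local_space k d K (V h K)"
    and "stabilizations_equivalent H \<T> V k d"
    and "forms_consistent H \<T> V k d"
    and "forms_stable H \<T> V k d"
    and "C_low > 0" and "C_up > 0"
    and "\<And>h v w. h \<in> H \<Longrightarrow> v \<in> vem_space \<Omega> (\<T> h) b k (V h) \<Longrightarrow> w \<in> vem_space \<Omega> (\<T> h) b k (V h) \<Longrightarrow>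
           \<bar>Mh k d (\<T> h) v w\<bar> \<le> C_up * L2norm \<Omega> v * L2norm \<Omega> w"
    and "\<And>h v. h \<in> H \<Longrightarrow> v \<in> vem_space \<Omega> (\<T> h) b k (V h) \<Longrightarrow>
           Mh k d (\<T> h) v v \<ge> C_low * (L2norm \<Omega> v)\<^sup>2"
    and "M_hat = max C_low (C_up\<^sup>2 * inverse C_low)"
    and "T_end > 0" and "N \<ge> 1" and "\<Delta>t = T_end / real N"
    and "\<Delta>t < inverse (2 * L\<^sub>f) * min M_hat C_low"
    and "h \<in> H"
    and "1 \<le> n" and "n \<le> N"
    and "\<And>j. j < n \<Longrightarrow> u j \<in> vem_space \<Omega> (\<T> h) b k (V h)"
  shows "\<exists>u\<^sub>n \<in> vem_space \<Omega> (\<T> h) b k (V h).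
           solves_step k d (\<T> h) (vem_space \<Omega> (\<T> h) b k (V h)) \<alpha>1 \<alpha>2 \<Delta>t f (u (n - 1)) u\<^sub>n \<and>
           (\<forall>w \<in> vem_space \<Omega> (\<T> h) b k (V h).
              solves_step k d (\<T> h) (vem_space \<Omega> (\<T> h) b k (V h)) \<alpha>1 \<alpha>2 \<Delta>t f (u (n - 1)) w \<longrightarrow>
              (AE x in lebesgue_on \<Omega>. w x = u\<^sub>n x))"
proof -
  interpret vem_mesh \<Omega> "\<T> h" b k d "V h"
    using assms(1,6,7,11,24) by unfold_locales auto
  obtain cM CM where M: "\<forall>h\<in>H. \<forall>K\<in>\<T> h. \<forall>v\<in>V h K. cM * sqnorm0 K v \<le> MK k d K v v \<and> MK k d K v v \<le> CM * sqnorm0 K v"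
    using assms(14) unfolding forms_stable_def unif_equiv_def by blast
  obtain cA CA where A: "\<forall>h\<in>H. \<forall>K\<in>\<T> h. \<forall>v\<in>V h K. cA * sqsemi2 K v \<le> AK k d K v v \<and> AK k d K v v \<le> CA * sqsemi2 K v"
    using assms(14) unfolding forms_stable_def unif_equiv_def by blast
  obtain cB CB where B: "\<forall>h\<in>H. \<forall>K\<in>\<T> h. \<forall>v\<in>V h K. cB * sqsemi1 K v \<le> BK k d K v v \<and> BK k d K v v \<le> CB * sqsemi1 K v"
    using assms(14) unfolding forms_stable_def unif_equiv_def by blast
  have dt: "0 < \<Delta>t" using assms(20,21,22) by simp
  \<comment> \<open>The minimum is at most \<open>C_low\<close>, so the restriction on the time step
    yields \<open>2 * (L\<^sub>f * \<Delta>t) < C_low\<close>; by positivity the contraction factor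
    is below one.\<close>
  have "inverse (2 * L\<^sub>f) * min M_hat C_low \<le> inverse (2 * L\<^sub>f) * C_low"
    using assms(4) by (intro mult_left_mono) auto
  then have "\<Delta>t < inverse (2 * L\<^sub>f) * C_low" using assms(23) by linarith
  then have "2 * (L\<^sub>f * \<Delta>t) < C_low" using assms(4) by (simp add: field_simps)
  moreover have "0 < L\<^sub>f * \<Delta>t" using assms(4) dt by simp
  ultimately have Ldt: "L\<^sub>f * \<Delta>t < C_low" by linarith
  show ?thesis
  proof (rule solve_step[where L = L\<^sub>f and C = C_low and CM = CM and CA = CA and CB = CB])
    show "0 \<le> \<alpha>1" "0 \<le> \<alpha>2" "0 < L\<^sub>f" "0 < C_low" using assms(2,3,4,15) by simp_all
    show "\<bar>f x - f y\<bar> \<le> L\<^sub>f * \<bar>x - y\<bar>" for x y by (rule assms(5))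
    show "MK k d K v v \<le> CM * sqnorm0 K v" if "K \<in> \<T> h" "v \<in> V h K" for K v using M assms(24) that by blast
    show "AK k d K v v \<le> CA * sqsemi2 K v" if "K \<in> \<T> h" "v \<in> V h K" for K v using A assms(24) that by blast
    show "BK k d K v v \<le> CB * sqsemi1 K v" if "K \<in> \<T> h" "v \<in> V h K" for K v using B assms(24) that by blast
    show "C_low * (L2norm \<Omega> v)\<^sup>2 \<le> Mh k d (\<T> h) v v" if "v \<in> vem_space \<Omega> (\<T> h) b k (V h)" for v
      by (rule assms(18)[OF assms(24) that])
    show "0 < \<Delta>t" by (rule dt)
    show "L\<^sub>f * \<Delta>t < C_low" by (rule Ldt)
    show "u (n - 1) \<in> vem_space \<Omega> (\<T> h) b k (V h)" using assms(25) by (intro assms(27)) simp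
  qed
qed

end
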